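(* Let $n=3$, $s_0,s_1,s_2,b_0,b_1,b_2\in\mathbb{R}$ with $b_0<0$ and $b_1,b_2>\frac12$, and $S=s_0+s_1+s_2$. Assume (b) $b_0+b_1+b_2\ge\frac12$; (c) $b_0+b_1\ge0$; (d) $b_0+b_2\ge0$; (e) $S\ge2-(b_0+b_1+b_2)$; (f) $S\ge\frac32-(b_0+b_1)$; (g) $S\ge\frac32-(b_0+b_2)$; (h) $S\ge1-b_0$; (i) $s_0+2(s_1+s_2)+b_0\ge\frac32$; (j) $s_1+s_2\ge-b_0$; (k) $s_0+s_2\ge0$; (l) $s_0+s_1\ge0$; together with the exceptions: if $b_1=\frac12$ then (e) and (f) are strict; if $b_2=\frac12$ then (e) and (g) are strict; if $b_1+b_2=1$ then (e) is strict; if (b) is an equality then (c) and (d) are strict; if (h) is an equality then (j) is strict. Then $\begin{pmatrix} s_0 & s_1 & s_2\\ b_0 & b_1 & b_2\end{pmatrix}$ is a product.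
   Context: For $u\in\mathcal S(\mathbb{R}^{1+n})$ let $\widetilde u(\tau,\xi)=\iint e^{-i(t\tau+x\cdot\xi)}u(t,x)\,dt\,dx$, $(\tau,\xi)\in\mathbb{R}\times\mathbb{R}^n$, and $\langle x\rangle=(1+|x|^2)^{1/2}$. For $s,b\in\mathbb{R}$ the wave-Sobolev space $H^{s,b}=H^{s,b}(\mathbb{R}^{1+n})$ is the completion of $\mathcal S(\mathbb{R}^{1+n})$ with respect to the norm $\|u\|_{H^{s,b}}=\|\langle\xi\rangle^s\langle|\tau|-|\xi|\rangle^b\widetilde u(\tau,\xi)\|_{L^2_{\tau,\xi}}$. A real matrix $\begin{pmatrix} s_0 & s_1 & s_2\\ b_0 & b_1 & b_2\end{pmatrix}$ is called a product (in dimension $n$) if there is a constant $C$ such that $\|uv\|_{H^{-s_0,-b_0}}\le C\|u\|_{H^{s_1,b_1}}\|v\|_{H^{s_2,b_2}}$ for all $u,v\in\mathcal S(\mathbb{R}^{1+n})$. "Strict" means the inequality holds with $>$. *)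

theory Defs
  imports "HOL-Analysis.Analysis"
begin

type_synonym spacetime = "real \<times> (real ^ 3)"

fun iter_deriv :: "'a::real_normed_vector list \<Rightarrow> ('a \<Rightarrow> 'b::real_normed_vector) \<Rightarrow> 'a \<Rightarrow> 'b" where
  "iter_deriv [] f = f"
| "iter_deriv (v # vs) f = (\<lambda>x. frechet_derivative (iter_deriv vs f) (at x) v)"

definition schwartz :: "('a::euclidean_space \<Rightarrow> complex) \<Rightarrow> bool" where
  "schwartz f \<longleftrightarrow>
     (\<forall>vs. set vs \<subseteq> Basis \<longrightarrow> (\<forall>x. iter_deriv vs f differentiable (at x))) \<and>
     (\<forall>vs (N::nat). set vs \<subseteq> Basis \<longrightarrow>
        (\<exists>C. \<forall>x. (1 + norm x) ^ N * norm (iter_deriv vs f x) \<le> C))"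

definition fourier_st :: "(spacetime \<Rightarrow> complex) \<Rightarrow> spacetime \<Rightarrow> complex" where
  "fourier_st u = (\<lambda>(\<tau>, \<xi>). integral\<^sup>L lborel
      (\<lambda>(t, x). cis (- (t * \<tau> + x \<bullet> \<xi>)) * u (t, x)))"

definition jbr :: "real \<Rightarrow> real" where
  "jbr r = sqrt (1 + r\<^sup>2)"

definition hsb_norm_sq :: "real \<Rightarrow> real \<Rightarrow> (spacetime \<Rightarrow> complex) \<Rightarrow> ennreal" where
  "hsb_norm_sq s b u = (\<integral>\<^sup>+ z. ennreal
      ((jbr (norm (snd z)) powr s * jbr (\<bar>fst z\<bar> - norm (snd z)) powr b
        * cmod (fourier_st u z))\<^sup>2) \<partial>lborel)"

text \<open>Product estimate in dimension n = 3 (squared form, C replaced by C^2).\<close>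
definition is_product3 :: "real \<Rightarrow> real \<Rightarrow> real \<Rightarrow> real \<Rightarrow> real \<Rightarrow> real \<Rightarrow> bool" where
  "is_product3 s0 s1 s2 b0 b1 b2 \<longleftrightarrow>
     (\<exists>C::real. \<forall>u v. schwartz u \<longrightarrow> schwartz v \<longrightarrow>
        hsb_norm_sq (- s0) (- b0) (\<lambda>z. u z * v z)
          \<le> ennreal C * hsb_norm_sq s1 b1 u * hsb_norm_sq s2 b2 v)"

end

theory Submission
  imports Defs "HOL-Probability.Probability"
begin

text \<open>
Write \<open>\<beta> = - b0\<close>. On the Fourier side the claim is an \<open>L\<^sup>2 \<times> L\<^sup>2 \<rightarrow> L\<^sup>2\<close> bound for a bilinear convolution
with a kernel (\<open>full_kernel\<close>). The output modulation \<open>\<bar>\<bar>\<tau>\<bar> - \<bar>\<xi>\<bar>\<bar>\<close> is at most the sum of the two input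
modulations and of the cone gap \<open>\<bar>\<bar>\<plusminus>\<bar>\<xi>1\<bar> \<plusminus> \<bar>\<xi>2\<bar>\<bar> - \<bar>\<xi>1 + \<xi>2\<bar>\<bar>\<close>. An input modulation is absorbed by its own
weight where it exceeds the smallest of the three frequencies; otherwise it costs slightly less than
\<open>\<beta>\<close> powers of that frequency, and only functions living near the wave cones remain.

If one input has low frequency, Cauchy-Schwarz reduces the bound to integrals over thickened ellipsoids
and hyperboloids, computed in bipolar coordinates. If the output has low frequency, one expands the
square of the convolution and regroups \<open>X1 + X2 = X3 + X4\<close> as \<open>(X1, X4)\<close>, \<open>(X2, X3)\<close> before applying
Cauchy-Schwarz, which leaves integrals over \<open>z = \<xi>1 + \<xi>2\<close> alone. For equal signs of the cones, once the
inputs are restricted to octants, these run over layers of \<open>\<bar>P + z\<bar> - \<bar>Q + z\<bar>\<close> with a gradient bounded below.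
For opposite signs they run over layers of \<open>\<bar>P + z\<bar> + \<bar>Q + z\<bar>\<close>, which are flat when \<open>P\<close> and \<open>-Q\<close> are nearly
parallel; there the vanishing of the cone gap along \<open>P\<close> saves the logarithm that a size estimate loses.
\<close>

text \<open>Since (h), (i) and (j) may hold with equality, no power of a frequency can be given
  away. Slack comes from b1, b2 > 1/2: the cone factors need an exponent b just above 1/2, and what
  is left over gives the modulation terms their gain \<epsilon>. The cone gap term has no such gain;
  where its size alone would lose a logarithm, the loss is recovered from geometry. With one low
  input, a gap B forces the low frequency to be at least B/2. For a low output frequency z the scale
  |z|^2 = |P| is critical: when P and -Q are parallel, |P + z| + |Q + z| varies only by about
  |z|^2/|P|, so below that scale a unit layer can fill the whole ball, and the volume of the ball
  has to suffice. Condition (i) is the balance at that scale, (h) the one at |z| comparable to |P|.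
  The ratio 128 between high and low is 8 * 16: the gradient d of a sum or difference of norms is
  controlled up to radius |d| |P| / 16, and 8\<alpha> \<le> 1 marks nearly antiparallel P and
  Q.\<close>

section \<open>Japanese brackets and their one-dimensional integrals\<close>

lemma jbr_ge_1: "1 \<le> jbr x" and jbr_pos: "0 < jbr x" and jbr_nonneg: "0 \<le> jbr x"
proof -
  show "1 \<le> jbr x" by (simp add: jbr_def)
  then show "0 < jbr x" "0 \<le> jbr x" by linarith+
qed

lemma jbr_ge_abs: "\<bar>x\<bar> \<le> jbr x"
  unfolding jbr_def by (rule real_le_rsqrt) simp

lemma jbr_le: "jbr x \<le> 1 + \<bar>x\<bar>"
  unfolding jbr_def by (rule real_le_lsqrt) (auto simp: power2_eq_square algebra_simps)

lemma jbr_abs [simp]: "jbr \<bar>x\<bar> = jbr x"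
  by (simp add: jbr_def)

lemma jbr_mono: "\<bar>x\<bar> \<le> \<bar>y\<bar> \<Longrightarrow> jbr x \<le> jbr y"
  unfolding jbr_def by (auto simp: abs_le_square_iff)

lemma jbr_mult_le: "1 \<le> c \<Longrightarrow> jbr (c * x) \<le> c * jbr x"
  unfolding jbr_def
  by (rule real_le_lsqrt)
     (auto simp: power_mult_distrib algebra_simps)

lemma jbr_le_mult: "\<bar>x\<bar> \<le> c * \<bar>y\<bar> \<Longrightarrow> 1 \<le> c \<Longrightarrow> jbr x \<le> c * jbr y"
  using jbr_mono[of x "c * y"] jbr_mult_le[of c y] by (simp add: abs_mult)

text \<open>The bracket is the length of a plane vector with first component 1, so this is a
  triangle inequality in which \<open>y\<close> enters through a vector with first component
  0.\<close>

lemma jbr_add_le: "jbr (x + y) \<le> jbr x + jbr y"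
proof -
  have "jbr (x + y) = norm (Complex 1 (x + y))" by (simp add: jbr_def cmod_def)
  also have "\<dots> \<le> norm (Complex 1 x) + norm (Complex 0 y)"
    by (rule order_trans[OF _ norm_triangle_ineq]) (simp add: complex_add)
  also have "\<dots> \<le> jbr x + jbr y"
    using jbr_ge_abs[of y] by (simp add: jbr_def cmod_def)
  finally show ?thesis .
qed

lemma jbr_measurable [measurable]: "jbr \<in> borel_measurable borel"
  unfolding jbr_def[abs_def] by measurable

lemma jbr_powr_neg_le:
  assumes "0 \<le> p" shows "jbr x powr (-p) \<le> 2 powr p * (1 + \<bar>x\<bar>) powr (-p)"
proof -
  have "1 + \<bar>x\<bar> \<le> 2 * jbr x" using jbr_ge_1[of x] jbr_ge_abs[of x] by linarith
  then have "(2 * jbr x) powr (-p) \<le> (1 + \<bar>x\<bar>) powr (-p)"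
    using assms by (intro powr_mono2') auto
  then show ?thesis using jbr_pos[of x]
    by (simp add: powr_mult powr_minus field_simps)
qed

lemma nn_integral_shifted_power:
  fixes k Y a :: real
  assumes "0 < k" "0 < Y + a"
  shows "(\<integral>\<^sup>+t. ennreal ((Y + t) powr (-1-k)) * indicator {a..} t \<partial>lborel)
    = ennreal ((Y + a) powr (-k) / k)"
proof -
  have lim: "((\<lambda>t. - ((Y + t) powr (-k) / k)) \<longlongrightarrow> - (0 / k)) at_top"
    using assms by (intro tendsto_intros tendsto_neg_powr filterlim_tendsto_add_at_top[of _ Y] tendsto_const filterlim_ident) auto
  have "(\<integral>\<^sup>+t. ennreal ((Y + t) powr (-1-k)) * indicator {a..} t \<partial>lborel)
      = ennreal (- (0 / k) - (- ((Y + a) powr (-k) / k)))"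
  proof (rule nn_integral_FTC_atLeast[OF _ _ _ lim])
    fix x assume "a \<le> x"
    then have "0 < Y + x" using assms by linarith
    then show "((\<lambda>t. - ((Y + t) powr - k / k)) has_real_derivative (Y + x) powr (- 1 - k)) (at x)"
      using assms by (auto intro!: derivative_eq_intros simp: powr_diff powr_minus)
        (simp add: divide_simps)
  qed auto
  then show ?thesis by simp
qed

lemma nn_integral_tail:
  fixes k Y :: real
  assumes k: "0 < k" and Y: "0 < Y"
  shows "(\<integral>\<^sup>+t. ennreal ((Y + \<bar>t\<bar>) powr (-1-k)) \<partial>lborel) \<le> ennreal (2 * Y powr (-k) / k)"
proof -
  let ?f = "\<lambda>t. ennreal ((Y + t) powr (-1-k)) * indicator {0..} t"
  have "(\<integral>\<^sup>+t. ennreal ((Y + \<bar>t\<bar>) powr (-1-k)) \<partial>lborel) \<le> (\<integral>\<^sup>+t. ?f t + ?f (0 + (-1) * t) \<partial>lborel)"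
    by (intro nn_integral_mono) (auto simp: indicator_def)
  also have "\<dots> = (\<integral>\<^sup>+t. ?f t \<partial>lborel) + (\<integral>\<^sup>+t. ?f (0 + (-1) * t) \<partial>lborel)"
    by (rule nn_integral_add) auto
  also have "(\<integral>\<^sup>+t. ?f (0 + (-1) * t) \<partial>lborel) = (\<integral>\<^sup>+t. ?f t \<partial>lborel)"
    using nn_integral_real_affine[of ?f "-1" 0] by simp
  also have "(\<integral>\<^sup>+t. ?f t \<partial>lborel) = ennreal (Y powr (-k) / k)"
    using nn_integral_shifted_power[of k Y 0] assms by simp
  also have "ennreal (Y powr (-k) / k) + ennreal (Y powr (-k) / k) = ennreal (2 * Y powr (-k) / k)"
    using k by (subst ennreal_plus[symmetric]) auto
  finally show ?thesis .
qed

lemma nn_integral_translate: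
  fixes f :: "'a::euclidean_space \<Rightarrow> ennreal"
  assumes [measurable]: "f \<in> borel_measurable borel"
  shows "(\<integral>\<^sup>+x. f (x + c) \<partial>lborel) = (\<integral>\<^sup>+x. f x \<partial>lborel)"
proof -
  have "(\<integral>\<^sup>+x. f x \<partial>lborel) = (\<integral>\<^sup>+x. f x \<partial>distr lborel borel ((+) c))"
    by (simp add: lborel_distr_plus)
  also have "\<dots> = (\<integral>\<^sup>+x. f (c + x) \<partial>lborel)"
    by (subst nn_integral_distr) auto
  finally show ?thesis by (simp add: add.commute)
qed

lemma nn_integral_reflect:
  fixes f :: "'a::euclidean_space \<Rightarrow> ennreal"
  assumes [measurable]: "f \<in> borel_measurable borel"
  shows "(\<integral>\<^sup>+x. f (c - x) \<partial>lborel) = (\<integral>\<^sup>+x. f x \<partial>lborel)"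
proof -
  have "(\<integral>\<^sup>+x. f x \<partial>lborel) = (\<integral>\<^sup>+x. f x \<partial>density (distr lborel borel (\<lambda>x. c + (-1) *\<^sub>R x)) (\<lambda>_. \<bar>-1::real\<bar>^DIM('a)))"
    by (subst lborel_affine[of "-1" c]) auto
  also have "\<dots> = (\<integral>\<^sup>+x. f (c - x) \<partial>lborel)"
    by (simp add: nn_integral_density nn_integral_distr)
  finally show ?thesis by simp
qed

definition jconst :: "real \<Rightarrow> real" where
  "jconst p = 2 powr p * (2 / (p - 1))"

lemma jconst_nonneg: "1 < p \<Longrightarrow> 0 \<le> jconst p"
  by (simp add: jconst_def)

lemma nn_integral_jbr0:
  assumes "1 < p"
  shows "(\<integral>\<^sup>+t. ennreal (jbr t powr (-p)) \<partial>lborel) \<le> ennreal (jconst p)"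
proof -
  have "(\<integral>\<^sup>+t. ennreal (jbr t powr (-p)) \<partial>lborel)
     \<le> (\<integral>\<^sup>+t. ennreal (2 powr p) * ennreal ((1 + \<bar>t\<bar>) powr (-1-(p-1))) \<partial>lborel)"
    using jbr_powr_neg_le[of p] assms
    by (intro nn_integral_mono) (auto simp: ennreal_mult[symmetric])
  also have "\<dots> \<le> ennreal (2 powr p) * ennreal (2 * 1 powr (-(p-1)) / (p-1))"
    using nn_integral_tail[of "p-1" 1] assms by (subst nn_integral_cmult) (auto intro!: mult_left_mono)
  also have "\<dots> = ennreal (jconst p)" using assms by (simp add: jconst_def ennreal_mult[symmetric])
  finally show ?thesis .
qed

lemma nn_integral_jbr:
  assumes "1 < p"
  shows "(\<integral>\<^sup>+t. ennreal (jbr (t - a) powr (-p)) \<partial>lborel) \<le> ennreal (jconst p)"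
    and "(\<integral>\<^sup>+t. ennreal (jbr (a - t) powr (-p)) \<partial>lborel) \<le> ennreal (jconst p)"
  using nn_integral_jbr0[OF assms] nn_integral_translate[of "\<lambda>t. ennreal (jbr t powr (-p))" "-a"]
    nn_integral_reflect[of "\<lambda>t. ennreal (jbr t powr (-p))" "a"] by auto

text \<open>One of the two brackets is at least half of the bracket on the right; it is taken out of
  the integral, and the other one is integrable because p > 1. This carries out the time integral
  whenever two factors near cones are convolved.\<close>

lemma nn_integral_jbr_jbr:
  assumes p: "1 < p"
  shows "(\<integral>\<^sup>+t. ennreal (jbr (t - a) powr (-p)) * ennreal (jbr (c - t - b) powr (-p)) \<partial>lborel)
     \<le> ennreal (2 powr p * (2 * jconst p)) * ennreal (jbr (c - a - b) powr (-p))"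
proof -
  have pt: "jbr (t - a) powr (-p) * jbr (c - t - b) powr (-p)
     \<le> 2 powr p * jbr (c - a - b) powr (-p) * (jbr (t - a) powr (-p) + jbr (c - t - b) powr (-p))"
    (is "?x * ?y \<le> ?z * _") for t
  proof -
    have *: "u powr (-p) * v powr (-p) \<le> 2 powr p * w powr (-p) * v powr (-p)"
      if "w \<le> 2 * u" "0 < w" "0 < u" for u v w
    proof -
      have "(2 * u) powr (-p) \<le> w powr (-p)" using that p by (intro powr_mono2') auto
      then have "u powr (-p) \<le> 2 powr p * w powr (-p)" using that
        by (simp add: powr_mult powr_minus field_simps)
      then show ?thesis by (rule mult_right_mono) simp
    qed
    have "jbr (c - a - b) \<le> jbr (t - a) + jbr (c - t - b)"
      using jbr_add_le[of "t - a" "c - t - b"] by (simp add: algebra_simps)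
    then consider "jbr (c - a - b) \<le> 2 * jbr (t - a)" | "jbr (c - a - b) \<le> 2 * jbr (c - t - b)" by linarith
    then show ?thesis
    proof cases
      case 1
      then have "?x * ?y \<le> ?z * ?y" by (rule *) (auto simp: jbr_pos)
      also have "\<dots> \<le> ?z * (?x + ?y)" by (rule mult_left_mono) auto
      finally show ?thesis .
    next
      case 2
      then have "?y * ?x \<le> ?z * ?x" by (rule *) (auto simp: jbr_pos)
      also have "\<dots> \<le> ?z * (?x + ?y)" by (rule mult_left_mono) auto
      finally show ?thesis by (simp add: mult.commute)
    qed
  qed
  have "(\<integral>\<^sup>+t. ennreal (jbr (t - a) powr (-p)) * ennreal (jbr (c - t - b) powr (-p)) \<partial>lborel)
     \<le> (\<integral>\<^sup>+t. ennreal (2 powr p * jbr (c - a - b) powr (-p)) *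
          (ennreal (jbr (t - a) powr (-p)) + ennreal (jbr ((c - b) - t) powr (-p))) \<partial>lborel)"
    using pt by (intro nn_integral_mono)
      (auto simp: ennreal_mult[symmetric] ennreal_plus[symmetric] algebra_simps simp del: ennreal_plus intro!: ennreal_leI)
  also have "\<dots> = ennreal (2 powr p * jbr (c - a - b) powr (-p)) *
          ((\<integral>\<^sup>+t. ennreal (jbr (t - a) powr (-p)) \<partial>lborel) + (\<integral>\<^sup>+t. ennreal (jbr ((c - b) - t) powr (-p)) \<partial>lborel))"
    by (simp add: nn_integral_cmult nn_integral_add)
  also have "\<dots> \<le> ennreal (2 powr p * jbr (c - a - b) powr (-p)) * (ennreal (jconst p) + ennreal (jconst p))"
    by (intro mult_left_mono add_mono nn_integral_jbr p) auto
  also have "\<dots> = ennreal (2 powr p * (2 * jconst p)) * ennreal (jbr (c - a - b) powr (-p))"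
    using jconst_nonneg[OF p]
    by (simp add: ennreal_mult[symmetric] ennreal_plus[symmetric] algebra_simps del: ennreal_plus)
  finally show ?thesis .
qed

text \<open>Each value of \<open>\<phi>\<close> lies in [t, t+1] for a set of t of measure one.
  Inserting this average and exchanging the integrals turns a uniform bound on unit layers of the
  phase into a bound for the decaying bracket.\<close>

lemma nn_integral_layers:
  fixes w :: "'a::euclidean_space \<Rightarrow> ennreal"
  assumes [measurable]: "w \<in> borel_measurable borel" "\<phi> \<in> borel_measurable borel" and p: "1 < p"
    and A: "\<And>t. (\<integral>\<^sup>+z. w z * indicator {t..t+1} (\<phi> z) \<partial>lborel) \<le> A"
  shows "(\<integral>\<^sup>+z. w z * ennreal (jbr (\<tau> - \<phi> z) powr (-p)) \<partial>lborel) \<le> ennreal (2 powr p * jconst p) * A"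
proof -
  have 1: "(\<integral>\<^sup>+t. indicator {t..t+1} x * c \<partial>lborel) = c" for x :: real and c :: ennreal
  proof -
    have "(\<integral>\<^sup>+t. indicator {t..t+1} x * c \<partial>lborel) = (\<integral>\<^sup>+t. c * indicator {x-1..x} t \<partial>lborel)"
      by (intro nn_integral_cong) (auto simp: indicator_def)
    also have "\<dots> = c" by (simp add: nn_integral_cmult_indicator)
    finally show ?thesis .
  qed
  \<comment> \<open>Inside a unit layer the bracket changes by a factor of at most 2, being
    1-Lipschitz and at least 1.\<close>
  have pt: "jbr (\<tau> - x) powr (-p) \<le> 2 powr p * jbr (\<tau> - t) powr (-p)" if "x \<in> {t..t+1}" for x t
  proof -
    have "jbr (\<tau> - t) \<le> jbr (\<tau> - x) + \<bar>x - t\<bar>"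
    proof -
      have "jbr (\<tau> - t) = norm (Complex 1 (\<tau> - t))" by (simp add: jbr_def cmod_def)
      also have "\<dots> \<le> norm (Complex 1 (\<tau> - x)) + norm (Complex 0 (x - t))"
        by (rule order_trans[OF _ norm_triangle_ineq]) (simp add: complex_add)
      finally show ?thesis by (simp add: jbr_def cmod_def)
    qed
    also have "\<dots> \<le> 2 * jbr (\<tau> - x)" using that jbr_ge_1[of "\<tau> - x"] by auto
    finally have "(2 * jbr (\<tau> - x)) powr (-p) \<le> jbr (\<tau> - t) powr (-p)"
      using p jbr_pos by (intro powr_mono2') auto
    then show ?thesis using jbr_pos[of "\<tau> - x"] by (simp add: powr_mult powr_minus field_simps)
  qed
  have "(\<integral>\<^sup>+z. w z * ennreal (jbr (\<tau> - \<phi> z) powr (-p)) \<partial>lborel)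
    = (\<integral>\<^sup>+z. \<integral>\<^sup>+t. indicator {t..t+1} (\<phi> z) * (w z * ennreal (jbr (\<tau> - \<phi> z) powr (-p))) \<partial>lborel \<partial>lborel)"
    by (simp add: 1)
  also have "\<dots> \<le> (\<integral>\<^sup>+z. \<integral>\<^sup>+t. ennreal (2 powr p * jbr (\<tau> - t) powr (-p)) * (w z * indicator {t..t+1} (\<phi> z)) \<partial>lborel \<partial>lborel)"
    using pt by (intro nn_integral_mono) (auto simp: indicator_def mult.commute intro!: mult_left_mono ennreal_leI)
  also have "\<dots> = (\<integral>\<^sup>+t. \<integral>\<^sup>+z. ennreal (2 powr p * jbr (\<tau> - t) powr (-p)) * (w z * indicator {t..t+1} (\<phi> z)) \<partial>lborel \<partial>lborel)"
    unfolding indicator_def by (rule lborel_pair.Fubini') (simp, measurable)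
  also have "\<dots> = (\<integral>\<^sup>+t. ennreal (2 powr p * jbr (\<tau> - t) powr (-p)) * (\<integral>\<^sup>+z. w z * indicator {t..t+1} (\<phi> z) \<partial>lborel) \<partial>lborel)"
    by (intro nn_integral_cong nn_integral_cmult) (simp add: indicator_def, measurable)
  also have "\<dots> \<le> (\<integral>\<^sup>+t. (ennreal (2 powr p) * A) * ennreal (jbr (\<tau> - t) powr (-p)) \<partial>lborel)"
    using mult_left_mono[OF A, of "ennreal (2 powr p * jbr (\<tau> - t) powr (-p))" for t]
    by (intro nn_integral_mono) (simp add: ennreal_mult mult_ac)
  also have "\<dots> \<le> (ennreal (2 powr p) * A) * ennreal (jconst p)"
    by (subst nn_integral_cmult) (auto intro!: mult_left_mono nn_integral_jbr p)
  also have "\<dots> = ennreal (2 powr p * jconst p) * A"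
    using jconst_nonneg[OF p] by (simp add: ennreal_mult mult_ac)
  finally show ?thesis .
qed

subsection \<open>Radial and bipolar integration\<close>

text \<open>It is enough to test boxes, since they determine \<open>lborel\<close>: the preimage of
  a box is its image under the inverse map, which is again orthogonal.\<close>

lemma orthogonal_transformation_distr_lborel:
  fixes f :: "real^'n::{finite,wellorder} \<Rightarrow> real^'n::_"
  assumes f: "orthogonal_transformation f"
  shows "distr lborel borel f = lborel"
proof (rule lborel_eqI[symmetric])
  have lin: "linear f" using f by (rule orthogonal_transformation_linear)
  then have [measurable]: "f \<in> borel_measurable borel"
    by (intro borel_measurable_continuous_onI linear_continuous_on linear_linear[THEN iffD2])
  obtain g where g: "orthogonal_transformation g" "g \<circ> f = id" "f \<circ> g = id"
    using orthogonal_transformation_inv[OF f] orthogonal_transformation_bij[OF f]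
    by (metis bij_is_inj bij_is_surj inv_o_cancel surj_iff)

  fix l u :: "real^'n::{finite,wellorder}" assume le: "\<And>b. b \<in> Basis \<Longrightarrow> l \<bullet> b \<le> u \<bullet> b"
  have vim: "f -` box l u = g ` box l u"
  proof -
    have "g (f x) = x" "f (g x) = x" for x using g(2,3) by (metis comp_apply id_apply)+
    then show ?thesis by (auto simp: image_iff) metis
  qed
  have m: "f -` box l u \<in> sets borel"
    using measurable_sets[of f borel borel "box l u"] by simp
  have bl: "box l u \<in> lmeasurable" by simp
  have "emeasure (distr lborel borel f) (box l u) = emeasure lborel (f -` box l u)"
    by (subst emeasure_distr) auto
  also have "\<dots> = emeasure lebesgue (f -` box l u)" using m by simp
  also have "\<dots> = ennreal (measure lebesgue (g ` box l u))"
    unfolding vim using measurable_orthogonal_image[OF g(1) bl]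
    by (intro emeasure_eq_measure2 fmeasurableD2 emeasure_eq_ennreal_measure) auto
  also have "measure lebesgue (g ` box l u) = measure lebesgue (box l u)"
    by (rule measure_orthogonal_image[OF g(1) bl])
  also have "ennreal \<dots> = emeasure lebesgue (box l u)"
    using fmeasurableD2[OF bl] by (intro emeasure_eq_ennreal_measure[symmetric]) auto
  also have "\<dots> = (\<Prod>b\<in>Basis. (u - l) \<bullet> b)"
    using le by simp
  finally show "emeasure (distr lborel borel f) (box l u) = (\<Prod>b\<in>Basis. (u - l) \<bullet> b)" .
qed simp

definition vec3 :: "real \<times> (real \<times> real) \<Rightarrow> real^3" where
  "vec3 p = vector [fst p, fst (snd p), snd (snd p)]"

lemma vec3_nth [simp]:
  "vec3 p $ 1 = fst p" "vec3 p $ 2 = fst (snd p)" "vec3 p $ 3 = snd (snd p)"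
  by (simp_all add: vec3_def)

lemma linear_vec3: "linear vec3"
  by (rule linearI) (simp_all add: vec_eq_iff forall_3)

lemma vec3_measurable [measurable]: "vec3 \<in> borel_measurable borel"
  by (intro borel_measurable_continuous_onI linear_continuous_on linear_linear[THEN iffD2] linear_vec3)

lemma inner_vec3: "vec3 p \<bullet> vec3 q = p \<bullet> q"
  by (simp add: inner_vec_def sum_3 inner_prod_def)

lemma distr_vec3: "distr lborel borel vec3 = lborel"
proof (rule lborel_eqI[symmetric])
  fix l u :: "real^3" assume le: "\<And>b. b \<in> Basis \<Longrightarrow> l \<bullet> b \<le> u \<bullet> b"
  have le': "l $ i \<le> u $ i" for i
    using le[of "axis i 1"] by (auto simp: inner_axis Basis_vec_def)
  have vim: "vec3 -` box l u = {l$1<..<u$1} \<times> ({l$2<..<u$2} \<times> {l$3<..<u$3})"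
    by (auto simp: mem_box_cart forall_3)
  have "emeasure (distr lborel borel vec3) (box l u) = emeasure lborel (vec3 -` box l u)"
    by (subst emeasure_distr) auto
  also have "\<dots> = emeasure (lborel \<Otimes>\<^sub>M lborel) ({l$1<..<u$1} \<times> ({l$2<..<u$2} \<times> {l$3<..<u$3}))"
    by (simp add: vim lborel_prod)
  also have "\<dots> = emeasure lborel {l$1<..<u$1} * emeasure (lborel \<Otimes>\<^sub>M lborel) ({l$2<..<u$2} \<times> {l$3<..<u$3})"
    by (subst lborel.emeasure_pair_measure_Times) (auto simp: lborel_prod borel_Times)
  also have "\<dots> = ennreal ((u$1 - l$1) * ((u$2 - l$2) * (u$3 - l$3)))"
    using le' by (subst lborel.emeasure_pair_measure_Times) (auto simp: ennreal_mult)
  also have "(u$1 - l$1) * ((u$2 - l$2) * (u$3 - l$3)) = (\<Prod>b\<in>Basis. (u - l) \<bullet> b)"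
  proof -
    have B: "Basis = range (\<lambda>i::3. axis i (1::real))" by (auto simp: Basis_vec_def)
    have "(\<Prod>b\<in>Basis. (u - l) \<bullet> b) = (\<Prod>i\<in>UNIV. (u - l) \<bullet> axis i 1)"
      unfolding B by (subst prod.reindex) (auto intro!: injI simp: axis_eq_axis)
    also have "\<dots> = (\<Prod>i\<in>{1,2,3::3}. (u - l) $ i)"
      by (simp only: UNIV_3 inner_axis) simp
    also have "\<dots> = (u$1 - l$1) * ((u$2 - l$2) * (u$3 - l$3))"
      by simp
    finally show ?thesis by simp
  qed
  finally show "emeasure (distr lborel borel vec3) (box l u) = (\<Prod>b\<in>Basis. (u - l) \<bullet> b)" .
qed simp

text \<open>\<open>J\<close> embeds the plane isometrically as the orthogonal complement of
  \<open>e\<close>, so that volume splits into an axis and a plane. The axis will be the gradient of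
  a phase or the direction of a frequency.\<close>

lemma slice:
  fixes e :: "real^3"
  assumes "norm e = 1"
  obtains J :: "real \<times> real \<Rightarrow> real^3" where
    "linear J" "\<And>y. e \<bullet> J y = 0" "\<And>y y'. J y \<bullet> J y' = y \<bullet> y'"
    "\<And>z. \<exists>y. z = (z \<bullet> e) *\<^sub>R e + J y"
    "\<And>F. F \<in> borel_measurable borel \<Longrightarrow>
       (\<integral>\<^sup>+z. F z \<partial>lborel) = (\<integral>\<^sup>+x. \<integral>\<^sup>+y. F (x *\<^sub>R e + J y) \<partial>lborel \<partial>lborel)"
proof -
  have "norm (axis 1 1 :: real^3) = norm e" using assms by simp
  then obtain f where f: "orthogonal_transformation f" "f (axis 1 1 :: real^3) = e"
    by (rule orthogonal_transformation_exists)
  have lf: "linear f" using f(1) by (rule orthogonal_transformation_linear)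
  then have [measurable]: "f \<in> borel_measurable borel"
    by (intro borel_measurable_continuous_onI linear_continuous_on linear_linear[THEN iffD2])
  define J where "J y = f (vec3 (0, y))" for y
  have e: "x *\<^sub>R e = f (vec3 (x, 0))" for x
  proof -
    have "vec3 (x, 0) = x *\<^sub>R axis 1 1" by (simp add: vec_eq_iff forall_3 axis_def)
    then show ?thesis by (simp add: linear_cmul[OF lf] f(2))
  qed
  have eJ: "x *\<^sub>R e + J y = f (vec3 (x, y))" for x y
    by (simp add: e J_def linear_add[OF lf, symmetric] linear_add[OF linear_vec3, symmetric])
  have ip: "f a \<bullet> f b = a \<bullet> b" for a b
    using f(1) by (simp add: orthogonal_transformation_def)
  show ?thesis
  proof
    show "linear J"
      by (rule linearI) (simp_all add: J_def linear_add[OF lf, symmetric] linear_add[OF linear_vec3, symmetric]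
          linear_cmul[OF lf, symmetric] linear_cmul[OF linear_vec3, symmetric])
    show eJ0: "e \<bullet> J y = 0" for y
      using e[of 1] by (simp add: J_def ip inner_vec3)
    show "J y \<bullet> J y' = y \<bullet> y'" for y y'
      by (simp add: J_def ip inner_vec3)
    show "\<exists>y. z = (z \<bullet> e) *\<^sub>R e + J y" for z
    proof -
      obtain a where "z = f a" using f(1) orthogonal_transformation_surj by blast
      moreover have "a = vec3 (a $ 1, (a $ 2, a $ 3))" by (simp add: vec_eq_iff forall_3)
      ultimately have z: "z = (a $ 1) *\<^sub>R e + J (a $ 2, a $ 3)" using eJ by metis
      have "e \<bullet> e = 1" using assms by (simp add: norm_eq_1)
      then have "z \<bullet> e = a $ 1"
        using eJ0[of "(a $ 2, a $ 3)"] arg_cong[OF z, of "\<lambda>z. e \<bullet> z"]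
        by (simp add: inner_add_right inner_commute[of z])
      then show ?thesis using z by auto
    qed
    fix F :: "real^3 \<Rightarrow> ennreal" assume [measurable]: "F \<in> borel_measurable borel"
    have "(\<integral>\<^sup>+z. F z \<partial>lborel) = (\<integral>\<^sup>+z. F z \<partial>distr lborel borel f)"
      by (simp add: orthogonal_transformation_distr_lborel[OF f(1)])
    also have "\<dots> = (\<integral>\<^sup>+z. F (f z) \<partial>distr lborel borel vec3)"
      by (subst nn_integral_distr) (auto simp: distr_vec3)
    also have "\<dots> = (\<integral>\<^sup>+p. F (f (vec3 p)) \<partial>(lborel \<Otimes>\<^sub>M lborel))"
      by (subst nn_integral_distr) (auto simp: lborel_prod)
    also have "\<dots> = (\<integral>\<^sup>+x. \<integral>\<^sup>+y. F (f (vec3 (x, y))) \<partial>lborel \<partial>lborel)"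
      by (subst lborel.nn_integral_fst[symmetric]) (auto simp: lborel_prod)
    finally show "(\<integral>\<^sup>+z. F z \<partial>lborel) = (\<integral>\<^sup>+x. \<integral>\<^sup>+y. F (x *\<^sub>R e + J y) \<partial>lborel \<partial>lborel)"
      by (simp add: eJ)
  qed
qed

text \<open>A measure on the line that is finite on half-lines is fixed by its distribution
  function. Hence the density of a radial variable can be read off from the volumes of its sublevel
  sets.\<close>

lemma nn_integral_pushforward:
  fixes T :: "'a \<Rightarrow> real"
  assumes [measurable]: "T \<in> borel_measurable M" "g \<in> borel_measurable borel" "F \<in> borel_measurable borel"
    and eq: "\<And>t. emeasure M {z \<in> space M. T z \<le> t} = (\<integral>\<^sup>+x. g x * indicator {..t} x \<partial>lborel)"
    and fin: "\<And>t. emeasure M {z \<in> space M. T z \<le> t} \<noteq> \<infinity>"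
  shows "(\<integral>\<^sup>+z. F (T z) \<partial>M) = (\<integral>\<^sup>+x. F x * g x \<partial>lborel)"
proof -
  have em: "emeasure (distr M borel T) {..t} = emeasure M {z \<in> space M. T z \<le> t}" for t
    by (subst emeasure_distr) (auto intro!: arg_cong[where f="emeasure M"])
  have "distr M borel T = density lborel g"
  proof (rule measure_eqI_generator_eq[where E="range (\<lambda>t::real. {..t})" and \<Omega>=UNIV and A="\<lambda>i. {..real i}"])
    show "Int_stable (range (\<lambda>t::real. {..t}))"
      by (auto simp: Int_stable_def)
    show "\<And>X. X \<in> range (\<lambda>t::real. {..t}) \<Longrightarrow> emeasure (distr M borel T) X = emeasure (density lborel g) X"
      by (auto simp: em eq emeasure_density)
    show "sets (distr M borel T) = sigma_sets UNIV (range (\<lambda>t::real. {..t}))"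
      "sets (density lborel g) = sigma_sets UNIV (range (\<lambda>t::real. {..t}))"
      by (simp_all add: borel_eq_atMost)
    show "(\<Union>i. {..real i}) = UNIV" by (auto intro: real_arch_simple)
    show "emeasure (distr M borel T) {..real i} \<noteq> \<infinity>" for i using fin em by simp
  qed auto
  then have "(\<integral>\<^sup>+z. F z \<partial>distr M borel T) = (\<integral>\<^sup>+z. F z \<partial>density lborel g)" by simp
  then show ?thesis
    by (simp add: nn_integral_distr nn_integral_density mult.commute)
qed

text \<open>The squared radius is the natural variable: a disc of squared radius t has area \<pi> t,
  so the density is constant.\<close>

lemma nn_integral_radial2:
  assumes "F \<in> borel_measurable borel"
  shows "(\<integral>\<^sup>+y. F ((norm (y::real\<times>real))\<^sup>2) \<partial>lborel) = (\<integral>\<^sup>+w. F w * (ennreal pi * indicator {0..} w) \<partial>lborel)"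
proof (rule nn_integral_pushforward)
  have eq: "{z \<in> space lborel. (norm (z::real\<times>real))\<^sup>2 \<le> t} = (if t < 0 then {} else cball 0 (sqrt t))" for t
  proof (cases "t < 0")
    case True
    then have "\<not> (norm z)\<^sup>2 \<le> t" for z :: "real \<times> real" using zero_le_power2[of "norm z"] by linarith
    then show ?thesis using True by simp
  next
    case False
    have "(norm z)\<^sup>2 \<le> t \<longleftrightarrow> norm z \<le> sqrt t" for z :: "real \<times> real"
      using False abs_le_square_iff[of "norm z" "sqrt t"] by simp
    then show ?thesis using False by auto
  qed
  have em: "emeasure lborel {z \<in> space lborel. (norm (z::real\<times>real))\<^sup>2 \<le> t} = ennreal (pi * max 0 t)" for t
    unfolding eq by (auto simp: emeasure_cball unit_ball_vol_2)
  show "emeasure lborel {z \<in> space lborel. (norm (z::real\<times>real))\<^sup>2 \<le> t} \<noteq> \<infinity>" for t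
    by (simp only: em) simp
  fix t :: real
  have "(\<integral>\<^sup>+x. ennreal pi * indicator {0..} x * indicator {..t} x \<partial>lborel) = (\<integral>\<^sup>+x. ennreal pi * indicator {0..t} x \<partial>lborel)"
    by (intro nn_integral_cong) (auto simp: indicator_def)
  also have "\<dots> = ennreal pi * emeasure lborel {0..t}" by (simp add: nn_integral_cmult_indicator)
  also have "\<dots> = ennreal (pi * max 0 t)" by (auto simp: ennreal_mult max_def)
  finally show "emeasure lborel {z \<in> space lborel. (norm (z::real\<times>real))\<^sup>2 \<le> t} = (\<integral>\<^sup>+x. ennreal pi * indicator {0..} x * indicator {..t} x \<partial>lborel)"
    using em by simp
qed (use assms in auto)

lemma nn_integral_sqrt_subst:
  assumes "F \<in> borel_measurable borel"
  shows "(\<integral>\<^sup>+v. F (sqrt v) * indicator {0..} v \<partial>lborel) = (\<integral>\<^sup>+a. F a * (ennreal (2 * a) * indicator {0..} a) \<partial>lborel)"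
proof -
  let ?M = "density lborel (\<lambda>v::real. indicator {0..} v)"
  have "(\<integral>\<^sup>+v. F (sqrt v) \<partial>?M) = (\<integral>\<^sup>+a. F a * (ennreal (2 * a) * indicator {0..} a) \<partial>lborel)"
  proof (rule nn_integral_pushforward)
    have em: "emeasure ?M {z \<in> space ?M. sqrt z \<le> t} = ennreal ((max 0 t)\<^sup>2)" for t
    proof -
      have "emeasure ?M {z \<in> space ?M. sqrt z \<le> t} = (\<integral>\<^sup>+v. indicator {0..} v * indicator {z. sqrt z \<le> t} v \<partial>lborel)"
        by (subst emeasure_density) auto
      also have "\<dots> = (\<integral>\<^sup>+v. indicator (if t < 0 then {} else {0..t\<^sup>2}) v \<partial>lborel)"
      proof (intro nn_integral_cong)
        fix v :: real
        show "indicator {0..} v * indicator {z. sqrt z \<le> t} v = (indicator (if t < 0 then {} else {0..t\<^sup>2}) v :: ennreal)"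
        proof (cases "0 \<le> v \<and> 0 \<le> t")
          case True
          then have "sqrt v \<le> t \<longleftrightarrow> v \<le> t\<^sup>2" using abs_le_square_iff[of "sqrt v" t] by simp
          then show ?thesis using True by (auto simp: indicator_def)
        next
          case False
          then show ?thesis by (auto simp: indicator_def dest: order_trans[OF real_sqrt_ge_zero])
        qed
      qed
      also have "\<dots> = ennreal ((max 0 t)\<^sup>2)" by (auto simp: max_def)
      finally show ?thesis .
    qed
    show "emeasure ?M {z \<in> space ?M. sqrt z \<le> t} \<noteq> \<infinity>" for t by (simp only: em) simp
    fix t :: real
    have "(\<integral>\<^sup>+x. ennreal (2 * x) * indicator {0..} x * indicator {..t} x \<partial>lborel)
        = (\<integral>\<^sup>+x. ennreal (2 * x) * indicator {0..t} x \<partial>lborel)"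
      by (intro nn_integral_cong) (auto simp: indicator_def)
    also have "\<dots> = ennreal ((max 0 t)\<^sup>2)"
    proof (cases "0 \<le> t")
      case True
      have "(\<integral>\<^sup>+x. ennreal (2 * x) * indicator {0..t} x \<partial>lborel) = ennreal (t^2 - 0^2)"
        using True by (intro nn_integral_FTC_Icc) (auto intro!: derivative_eq_intros)
      then show ?thesis using True by simp
    qed auto
    finally show "emeasure ?M {z \<in> space ?M. sqrt z \<le> t} = (\<integral>\<^sup>+x. ennreal (2 * x) * indicator {0..} x * indicator {..t} x \<partial>lborel)"
      using em by simp
  qed (use assms in auto)
  then show ?thesis using assms by (simp add: nn_integral_density mult.commute)
qed

text \<open>At a fixed height x on the axis, the squared distance to the axis has constant density
  \<pi>, and adding x^2 to it gives \<rho>. So in the variables (x, \<rho>) volume is \<pi> times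
  Lebesgue measure on the set x^2 \<le> \<rho>. The radial and the bipolar formula both follow from
  this.\<close>

lemma nn_integral_slice_radial:
  fixes e :: "real^3" and F :: "real \<Rightarrow> real \<Rightarrow> ennreal"
  assumes e: "norm e = 1" and F[measurable]: "case_prod F \<in> borel_measurable borel"
  shows "(\<integral>\<^sup>+z. F (z \<bullet> e) ((norm z)\<^sup>2) \<partial>lborel)
    = ennreal pi * (\<integral>\<^sup>+\<rho>. \<integral>\<^sup>+x. F x \<rho> * indicator {x. x\<^sup>2 \<le> \<rho>} x \<partial>lborel \<partial>lborel)"
proof -
  have [measurable]: "(\<lambda>x. F (f x) (g x)) \<in> borel_measurable M"
    if [measurable]: "f \<in> borel_measurable M" "g \<in> borel_measurable M" for M :: "'z measure" and f g
  proof -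
    have "(\<lambda>x. case_prod F (f x, g x)) \<in> borel_measurable M" by measurable
    then show ?thesis by simp
  qed
  obtain J :: "real \<times> real \<Rightarrow> real^3" where J: "\<And>y. e \<bullet> J y = 0" "\<And>y y'. J y \<bullet> J y' = y \<bullet> y'"
    "\<And>F. F \<in> borel_measurable borel \<Longrightarrow>
       (\<integral>\<^sup>+z. F z \<partial>lborel) = (\<integral>\<^sup>+x. \<integral>\<^sup>+y. F (x *\<^sub>R e + J y) \<partial>lborel \<partial>lborel)"
    using slice[OF e] by metis
  have ee: "e \<bullet> e = 1" using e by (simp add: norm_eq_1)
  have c: "(x *\<^sub>R e + J y) \<bullet> e = x" "(norm (x *\<^sub>R e + J y))\<^sup>2 = (norm y)\<^sup>2 + x\<^sup>2" for x y
    using J(1)[of y] ee inner_commute[of "J y" e] power2_norm_eq_inner[of y]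
    unfolding power2_norm_eq_inner[of "x *\<^sub>R e + J y"]
    by (simp_all add: inner_add_left inner_add_right J(2) power2_eq_square)
  have "(\<integral>\<^sup>+z. F (z \<bullet> e) ((norm z)\<^sup>2) \<partial>lborel) = (\<integral>\<^sup>+x. \<integral>\<^sup>+y. F x ((norm (y::real\<times>real))\<^sup>2 + x\<^sup>2) \<partial>lborel \<partial>lborel)"
    by (subst J(3)) (auto simp: c)
  also have "\<dots> = (\<integral>\<^sup>+x. \<integral>\<^sup>+w. F x (w + x\<^sup>2) * (ennreal pi * indicator {0..} w) \<partial>lborel \<partial>lborel)"
    by (intro nn_integral_cong nn_integral_radial2[where F="\<lambda>w. F x (w + x\<^sup>2)" for x]) simp
  also have "\<dots> = (\<integral>\<^sup>+x. \<integral>\<^sup>+w. (\<lambda>\<rho>. ennreal pi * (F x \<rho> * indicator {x. x\<^sup>2 \<le> \<rho>} x)) (w + x\<^sup>2) \<partial>lborel \<partial>lborel)"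
    by (intro nn_integral_cong) (auto simp: indicator_def mult_ac)
  also have "\<dots> = (\<integral>\<^sup>+x. \<integral>\<^sup>+\<rho>. ennreal pi * (F x \<rho> * indicator {x. x\<^sup>2 \<le> \<rho>} x) \<partial>lborel \<partial>lborel)"
    unfolding indicator_def by (intro nn_integral_cong nn_integral_translate) simp
  also have "\<dots> = (\<integral>\<^sup>+\<rho>. \<integral>\<^sup>+x. ennreal pi * (F x \<rho> * indicator {x. x\<^sup>2 \<le> \<rho>} x) \<partial>lborel \<partial>lborel)"
    unfolding indicator_def by (rule lborel_pair.Fubini') simp
  also have "\<dots> = ennreal pi * (\<integral>\<^sup>+\<rho>. \<integral>\<^sup>+x. F x \<rho> * indicator {x. x\<^sup>2 \<le> \<rho>} x \<partial>lborel \<partial>lborel)"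
    unfolding indicator_def by (simp add: nn_integral_cmult)
  finally show ?thesis .
qed

lemma nn_integral_radial3:
  assumes [measurable]: "F \<in> borel_measurable borel"
  shows "(\<integral>\<^sup>+z. F ((norm (z::real^3))\<^sup>2) \<partial>lborel)
    = (\<integral>\<^sup>+\<rho>. F \<rho> * (ennreal (2 * pi * sqrt \<rho>) * indicator {0..} \<rho>) \<partial>lborel)"
proof -
  have "(\<integral>\<^sup>+z. F ((norm (z::real^3))\<^sup>2) \<partial>lborel)
    = ennreal pi * (\<integral>\<^sup>+\<rho>. \<integral>\<^sup>+x. F \<rho> * indicator {x. x\<^sup>2 \<le> \<rho>} x \<partial>lborel \<partial>lborel)"
    by (rule nn_integral_slice_radial[of "axis 1 1" "\<lambda>x. F"]) (auto simp: norm_axis_1 case_prod_beta' borel_prod[symmetric])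
  also have "\<dots> = (\<integral>\<^sup>+\<rho>. ennreal pi * (F \<rho> * (ennreal (2 * sqrt \<rho>) * indicator {0..} \<rho>)) \<partial>lborel)"
  proof -
    have "(\<integral>\<^sup>+x. F \<rho> * indicator {x. x\<^sup>2 \<le> \<rho>} x \<partial>lborel) = F \<rho> * (ennreal (2 * sqrt \<rho>) * indicator {0..} \<rho>)" for \<rho>
    proof -
      have "{x. x\<^sup>2 \<le> \<rho>} = (if \<rho> < 0 then {} else {- sqrt \<rho>..sqrt \<rho>})"
      proof (cases "\<rho> < 0")
        case True
        then have "\<not> x\<^sup>2 \<le> \<rho>" for x :: real using zero_le_power2[of x] by linarith
        then show ?thesis using True by simp
      next
        case False
        then have "x\<^sup>2 \<le> \<rho> \<longleftrightarrow> x \<in> {- sqrt \<rho>..sqrt \<rho>}" for x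
          using abs_le_square_iff[of x "sqrt \<rho>"] by (simp add: abs_le_iff) linarith
        then show ?thesis using False by (simp only: Collect_mem_eq) simp
      qed
      then show ?thesis by (cases "\<rho> < 0") (simp_all add: nn_integral_cmult_indicator)
    qed
    then show ?thesis by (simp add: nn_integral_cmult)
  qed
  also have "\<dots> = (\<integral>\<^sup>+\<rho>. F \<rho> * (ennreal (2 * pi * sqrt \<rho>) * indicator {0..} \<rho>) \<partial>lborel)"
  proof (rule nn_integral_cong)
    fix \<rho> :: real
    have "ennreal pi * ennreal (2 * sqrt \<rho>) = ennreal (2 * pi * sqrt \<rho>)"
      by (cases "\<rho> \<ge> 0") (auto simp: ennreal_mult'[symmetric] mult_ac ennreal_neg mult_nonneg_nonpos)
    then show "ennreal pi * (F \<rho> * (ennreal (2 * sqrt \<rho>) * indicator {0..} \<rho>)) = F \<rho> * (ennreal (2 * pi * sqrt \<rho>) * indicator {0..} \<rho>)"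
      by (metis (no_types, lifting) mult.assoc mult.left_commute)
  qed
  finally show ?thesis .
qed

text \<open>For fixed \<rho> = |z|^2 the square of |\<xi> - z| is affine in the component of z along
  \<xi>, with slope -2|\<xi>|; the Jacobian is therefore constant and produces the factor 1/|\<xi>|.
  There is only an inequality because the triangle condition between |z|, |\<xi> - z| and |\<xi>| is
  dropped on the right.\<close>

lemma nn_integral_bipolar:
  fixes \<xi> :: "real^3" and F :: "real \<Rightarrow> real \<Rightarrow> ennreal"
  assumes R: "0 < norm \<xi>" and F[measurable]: "case_prod F \<in> borel_measurable borel"
  shows "(\<integral>\<^sup>+z. F (norm z) (norm (\<xi> - z)) \<partial>lborel)
    \<le> ennreal (pi / norm \<xi>) * (\<integral>\<^sup>+\<rho>. \<integral>\<^sup>+a. F (sqrt \<rho>) a * (ennreal a * indicator {0..} a * indicator {0..} \<rho>) \<partial>lborel \<partial>lborel)"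
proof -
  have [measurable]: "(\<lambda>x. F (f x) (g x)) \<in> borel_measurable M"
    if [measurable]: "f \<in> borel_measurable M" "g \<in> borel_measurable M" for M :: "'z measure" and f g
  proof -
    have "(\<lambda>x. case_prod F (f x, g x)) \<in> borel_measurable M" by measurable
    then show ?thesis by simp
  qed
  define R where "R = norm \<xi>"
  define e where "e = \<xi> /\<^sub>R R"
  have R0: "R > 0" using R by (simp add: R_def)
  have e: "norm e = 1" "\<xi> = R *\<^sub>R e" using R0 by (auto simp: e_def R_def)
  have n: "norm (\<xi> - z) = sqrt (R\<^sup>2 + (norm z)\<^sup>2 + (- 2 * R) * (z \<bullet> e))" for z
  proof -
    have "(norm (\<xi> - z))\<^sup>2 = R\<^sup>2 + (norm z)\<^sup>2 + (- 2 * R) * (z \<bullet> e)"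
      using e(1) unfolding power2_norm_eq_inner e(2)
      by (simp add: inner_diff_left inner_diff_right norm_eq_1 power2_eq_square inner_commute)
    then show ?thesis by (metis norm_ge_zero real_sqrt_unique)
  qed
  define G where "G x \<rho> = F (sqrt \<rho>) (sqrt (R\<^sup>2 + \<rho> + (- 2 * R) * x))" for x \<rho>
  define H where "H \<rho> v = F (sqrt \<rho>) (sqrt v) * indicator {0..} v" for \<rho> v
  have [measurable]: "case_prod G \<in> borel_measurable borel" "H \<rho> \<in> borel_measurable borel" for \<rho>
    unfolding G_def H_def case_prod_beta' by (simp_all add: borel_prod[symmetric])
  have "(\<integral>\<^sup>+z. F (norm z) (norm (\<xi> - z)) \<partial>lborel) = (\<integral>\<^sup>+z. G (z \<bullet> e) ((norm z)\<^sup>2) \<partial>lborel)"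
    by (simp add: G_def n)
  also have "\<dots> = ennreal pi * (\<integral>\<^sup>+\<rho>. \<integral>\<^sup>+x. G x \<rho> * indicator {x. x\<^sup>2 \<le> \<rho>} x \<partial>lborel \<partial>lborel)"
    by (rule nn_integral_slice_radial[OF e(1)]) simp
  also have "\<dots> \<le> ennreal pi * (\<integral>\<^sup>+\<rho>. \<integral>\<^sup>+x. indicator {0..} \<rho> * H \<rho> ((R\<^sup>2 + \<rho>) + (- 2 * R) * x) \<partial>lborel \<partial>lborel)"
  proof (intro mult_left_mono nn_integral_mono)
    fix \<rho> x :: real
    have "0 \<le> R\<^sup>2 + \<rho> + (- 2 * R) * x" if "x\<^sup>2 \<le> \<rho>"
      using that zero_le_power2[of "R - x"] by (simp add: power2_diff)
    then show "G x \<rho> * indicator {x. x\<^sup>2 \<le> \<rho>} x \<le> indicator {0..} \<rho> * H \<rho> ((R\<^sup>2 + \<rho>) + (- 2 * R) * x)"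
      using order_trans[OF zero_le_power2[of x]] by (auto simp: G_def H_def indicator_def)
  qed simp
  also have "\<dots> = ennreal pi * (\<integral>\<^sup>+\<rho>. indicator {0..} \<rho> * (ennreal (1 / (2 * R)) * (\<integral>\<^sup>+v. H \<rho> v \<partial>lborel)) \<partial>lborel)"
  proof -
    have "(\<integral>\<^sup>+v. H \<rho> v \<partial>lborel) = ennreal (2 * R) * (\<integral>\<^sup>+x. H \<rho> ((R\<^sup>2 + \<rho>) + (- 2 * R) * x) \<partial>lborel)" for \<rho>
      using nn_integral_real_affine[of "H \<rho>" "- 2 * R" "R\<^sup>2 + \<rho>"] R0 by simp
    then have "ennreal (1 / (2 * R)) * (\<integral>\<^sup>+v. H \<rho> v \<partial>lborel) = (\<integral>\<^sup>+x. H \<rho> ((R\<^sup>2 + \<rho>) + (- 2 * R) * x) \<partial>lborel)" for \<rho>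
      using R0 by (simp add: mult.assoc[symmetric] ennreal_mult[symmetric])
    then show ?thesis by (simp add: nn_integral_cmult)
  qed
  also have "\<dots> = ennreal pi * (\<integral>\<^sup>+\<rho>. ennreal (1 / R) * (\<integral>\<^sup>+a. F (sqrt \<rho>) a * (ennreal a * indicator {0..} a * indicator {0..} \<rho>) \<partial>lborel) \<partial>lborel)"
  proof -
    have "indicator {0..} \<rho> * (ennreal (1 / (2 * R)) * (\<integral>\<^sup>+v. H \<rho> v \<partial>lborel))
       = ennreal (1 / R) * (\<integral>\<^sup>+a. F (sqrt \<rho>) a * (ennreal a * indicator {0..} a * indicator {0..} \<rho>) \<partial>lborel)" for \<rho>
    proof -
      have "(\<integral>\<^sup>+v. H \<rho> v \<partial>lborel) = (\<integral>\<^sup>+a. F (sqrt \<rho>) a * (ennreal (2 * a) * indicator {0..} a) \<partial>lborel)"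
        unfolding H_def by (rule nn_integral_sqrt_subst) simp
      also have "\<dots> = (\<integral>\<^sup>+a. ennreal 2 * (F (sqrt \<rho>) a * (ennreal a * indicator {0..} a)) \<partial>lborel)"
        by (intro nn_integral_cong) (auto simp: indicator_def ennreal_mult mult_ac)
      also have "\<dots> = ennreal 2 * (\<integral>\<^sup>+a. F (sqrt \<rho>) a * (ennreal a * indicator {0..} a) \<partial>lborel)"
        by (rule nn_integral_cmult) simp
      finally have "ennreal (1 / (2 * R)) * (\<integral>\<^sup>+v. H \<rho> v \<partial>lborel) = ennreal (1 / R) * (\<integral>\<^sup>+a. F (sqrt \<rho>) a * (ennreal a * indicator {0..} a) \<partial>lborel)"
        using R0 by (simp add: mult.assoc[symmetric] ennreal_mult[symmetric] ennreal_numeral[symmetric] del: ennreal_numeral)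
      then show ?thesis by (auto simp: indicator_def)
    qed
    then show ?thesis by simp
  qed
  also have "\<dots> = (ennreal pi * ennreal (1 / R)) * (\<integral>\<^sup>+\<rho>. \<integral>\<^sup>+a. F (sqrt \<rho>) a * (ennreal a * indicator {0..} a * indicator {0..} \<rho>) \<partial>lborel \<partial>lborel)"
    unfolding indicator_def by (subst nn_integral_cmult) (auto simp: mult.assoc)
  also have "ennreal pi * ennreal (1 / R) = ennreal (pi / R)"
    using R0 by (simp add: ennreal_mult[symmetric])
  finally show ?thesis by (simp add: R_def)
qed

section \<open>Phases with a gradient bounded below\<close>

text \<open>\<open>tr\<close> is a lower bound \<alpha> for the derivative of the phase along
  \<open>n\<close>, in the form of a difference quotient between points where \<open>w\<close> does
  not vanish. On each line parallel to \<open>n\<close> the layer therefore stays within 1/\<alpha>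
  of any one of its points, and \<open>w\<close> is controlled there by the distance of the line
  from the origin, which leaves an integral over the orthogonal plane.\<close>

lemma nn_integral_transversal_layer:
  fixes n :: "real^3" and w :: "real^3 \<Rightarrow> ennreal"
  assumes n: "norm n = 1" and [measurable]: "w \<in> borel_measurable borel" "\<phi> \<in> borel_measurable borel" "g \<in> borel_measurable borel"
    and \<alpha>: "0 < \<alpha>"
    and w: "\<And>z. w z \<le> g (norm (z - (z \<bullet> n) *\<^sub>R n))"
    and tr: "\<And>z s. w z \<noteq> 0 \<Longrightarrow> w (z + s *\<^sub>R n) \<noteq> 0 \<Longrightarrow> \<alpha> * \<bar>s\<bar> \<le> \<bar>\<phi> (z + s *\<^sub>R n) - \<phi> z\<bar>"
  shows "(\<integral>\<^sup>+z. w z * indicator {t..t+1} (\<phi> z) \<partial>lborel) \<le> ennreal (2 / \<alpha>) * (\<integral>\<^sup>+y. g (norm (y::real\<times>real)) \<partial>lborel)"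
proof -
  obtain J :: "real \<times> real \<Rightarrow> real^3" where J: "linear J" "\<And>y. n \<bullet> J y = 0" "\<And>y y'. J y \<bullet> J y' = y \<bullet> y'"
    "\<And>F. F \<in> borel_measurable borel \<Longrightarrow>
       (\<integral>\<^sup>+z. F z \<partial>lborel) = (\<integral>\<^sup>+x. \<integral>\<^sup>+y. F (x *\<^sub>R n + J y) \<partial>lborel \<partial>lborel)"
    using slice[OF n] by metis
  have [measurable]: "J \<in> borel_measurable borel"
    by (intro borel_measurable_continuous_onI linear_continuous_on linear_linear[THEN iffD2] J(1))
  have nn: "n \<bullet> n = 1" using n by (simp add: norm_eq_1)
  have c: "norm (x *\<^sub>R n + J y - ((x *\<^sub>R n + J y) \<bullet> n) *\<^sub>R n) = norm y" for x y
  proof -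
    have "(x *\<^sub>R n + J y) \<bullet> n = x" using J(2)[of y] nn inner_commute[of "J y" n] by (simp add: inner_add_left)
    then show ?thesis by (simp add: norm_eq_sqrt_inner J(3))
  qed
  have one: "(\<integral>\<^sup>+x. w (x *\<^sub>R n + J y) * indicator {t..t+1} (\<phi> (x *\<^sub>R n + J y)) \<partial>lborel) \<le> ennreal (2 / \<alpha>) * g (norm y)" for y
  proof (cases "\<exists>x. w (x *\<^sub>R n + J y) \<noteq> 0 \<and> \<phi> (x *\<^sub>R n + J y) \<in> {t..t+1}")
    case True
    then obtain x0 where x0: "w (x0 *\<^sub>R n + J y) \<noteq> 0" "\<phi> (x0 *\<^sub>R n + J y) \<in> {t..t+1}" by blast
    have "w (x *\<^sub>R n + J y) * indicator {t..t+1} (\<phi> (x *\<^sub>R n + J y)) \<le> g (norm y) * indicator {x0 - 1/\<alpha>..x0 + 1/\<alpha>} x" for x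
    proof (cases "w (x *\<^sub>R n + J y) \<noteq> 0 \<and> \<phi> (x *\<^sub>R n + J y) \<in> {t..t+1}")
      case True
      have eq: "x0 *\<^sub>R n + J y + (x - x0) *\<^sub>R n = x *\<^sub>R n + J y" by (simp add: algebra_simps)
      have "\<alpha> * \<bar>x - x0\<bar> \<le> \<bar>\<phi> (x *\<^sub>R n + J y) - \<phi> (x0 *\<^sub>R n + J y)\<bar>"
        using tr[of "x0 *\<^sub>R n + J y" "x - x0"] True x0 unfolding eq by blast
      also have "\<dots> \<le> 1" using True x0 by auto
      finally have "\<bar>x - x0\<bar> \<le> 1 / \<alpha>" using \<alpha> by (simp add: field_simps)
      then have "x \<in> {x0 - 1/\<alpha>..x0 + 1/\<alpha>}" by auto
      then show ?thesis using w[of "x *\<^sub>R n + J y"] True by (simp only: c) simp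
    qed auto
    then have "(\<integral>\<^sup>+x. w (x *\<^sub>R n + J y) * indicator {t..t+1} (\<phi> (x *\<^sub>R n + J y)) \<partial>lborel)
       \<le> (\<integral>\<^sup>+x. g (norm y) * indicator {x0 - 1/\<alpha>..x0 + 1/\<alpha>} x \<partial>lborel)"
      by (intro nn_integral_mono) 
    also have "\<dots> = ennreal (2 / \<alpha>) * g (norm y)"
      using \<alpha> by (simp add: nn_integral_cmult_indicator mult.commute)
    finally show ?thesis .
  next
    case False
    then have "w (x *\<^sub>R n + J y) * indicator {t..t+1} (\<phi> (x *\<^sub>R n + J y)) = 0" for x
      by (auto simp: indicator_def)
    then show ?thesis by (simp only: nn_integral_const) simp
  qed
  have "(\<integral>\<^sup>+z. w z * indicator {t..t+1} (\<phi> z) \<partial>lborel)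
     = (\<integral>\<^sup>+x. \<integral>\<^sup>+y. w (x *\<^sub>R n + J y) * indicator {t..t+1} (\<phi> (x *\<^sub>R n + J y)) \<partial>lborel \<partial>lborel)"
    by (rule J(4)) simp
  also have "\<dots> = (\<integral>\<^sup>+y. \<integral>\<^sup>+x. w (x *\<^sub>R n + J y) * indicator {t..t+1} (\<phi> (x *\<^sub>R n + J y)) \<partial>lborel \<partial>lborel)"
    by (rule lborel_pair.Fubini') simp
  also have "\<dots> \<le> (\<integral>\<^sup>+y. ennreal (2 / \<alpha>) * g (norm (y::real\<times>real)) \<partial>lborel)"
    by (intro nn_integral_mono one)
  also have "\<dots> = ennreal (2 / \<alpha>) * (\<integral>\<^sup>+y. g (norm (y::real\<times>real)) \<partial>lborel)"
    by (rule nn_integral_cmult) simp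
  finally show ?thesis .
qed

text \<open>The difference of the squared norms is exactly the inner product of x - y with 2p + x +
  y. Division by the sum of the norms, which is at least 3/2 |p|, leaves the linear part and an
  error of relative size r/|p|.\<close>

lemma norm_diff_quotient:
  fixes p :: "'a::real_inner"
  assumes "norm x \<le> r" "norm y \<le> r" "4 * r \<le> norm p" "p \<noteq> 0"
  shows "\<bar>(norm (p + x) - norm (p + y)) - (x - y) \<bullet> (p /\<^sub>R norm p)\<bar> \<le> 3 * r / norm p * norm (x - y)"
proof -
  define P a b where "P = norm p" and "a = norm (p + x)" and "b = norm (p + y)"
  have P: "P > 0" using assms by (simp add: P_def)
  have r0: "0 \<le> r" using assms(1) norm_ge_zero[of x] by linarith
  have ab: "\<bar>a - P\<bar> \<le> r" "\<bar>b - P\<bar> \<le> r"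
    using assms norm_triangle_ineq3[of "p + x" p] norm_triangle_ineq3[of "p + y" p] by (auto simp: a_def b_def P_def)
  have pos: "3/2 * P \<le> a + b" using ab assms(3) by (auto simp: P_def[symmetric])
  have "(a - b) * (a + b) = (x - y) \<bullet> ((p + x) + (p + y))"
    by (simp add: a_def b_def algebra_simps power2_norm_eq_inner[unfolded power2_eq_square] inner_add_left inner_add_right inner_diff_left inner_commute)
  then have "((a - b) - (x - y) \<bullet> (p /\<^sub>R P)) * (a + b) = (x - y) \<bullet> ((p + x) + (p + y) - (a + b) *\<^sub>R (p /\<^sub>R P))"
    by (simp add: algebra_simps inner_diff_right inner_add_right)
  also have "(p + x) + (p + y) - (a + b) *\<^sub>R (p /\<^sub>R P) = (x + y) - ((a - P) + (b - P)) *\<^sub>R (p /\<^sub>R P)"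
  proof -
    define v where "v = p /\<^sub>R P"
    have "p = P *\<^sub>R v" using P by (simp add: v_def)
    moreover have "P *\<^sub>R v + P *\<^sub>R v = (P * 2) *\<^sub>R v" by (metis scaleR_left_distrib mult_2_right)
    ultimately show ?thesis unfolding v_def[symmetric] by (simp add: algebra_simps)
  qed
  finally have eqn: "((a - b) - (x - y) \<bullet> (p /\<^sub>R P)) * (a + b) = (x - y) \<bullet> ((x + y) - ((a - P) + (b - P)) *\<^sub>R (p /\<^sub>R P))" .
  have "\<bar>(a - b) - (x - y) \<bullet> (p /\<^sub>R P)\<bar> * (a + b) = \<bar>(x - y) \<bullet> ((x + y) - ((a - P) + (b - P)) *\<^sub>R (p /\<^sub>R P))\<bar>"
  proof -
    have "0 \<le> a + b" by (simp add: a_def b_def)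
    then have "\<bar>a + b\<bar> = a + b" by simp
    then show ?thesis using eqn by (metis abs_mult)
  qed
  also have "\<dots> \<le> norm (x - y) * norm ((x + y) - ((a - P) + (b - P)) *\<^sub>R (p /\<^sub>R P))"
    by (rule Cauchy_Schwarz_ineq2)
  also have "\<dots> \<le> norm (x - y) * (4 * r)"
  proof (intro mult_left_mono)
    have "norm ((x + y) - ((a - P) + (b - P)) *\<^sub>R (p /\<^sub>R P)) \<le> norm (x + y) + norm (((a - P) + (b - P)) *\<^sub>R (p /\<^sub>R P))"
      by (rule norm_triangle_ineq4)
    also have "norm (((a - P) + (b - P)) *\<^sub>R (p /\<^sub>R P)) = \<bar>(a - P) + (b - P)\<bar>"
    proof -
      have "norm (p /\<^sub>R P) = 1" using P by (simp add: P_def)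
      then show ?thesis by (simp only: norm_scaleR) simp
    qed
    also have "norm (x + y) \<le> norm x + norm y" by (rule norm_triangle_ineq)
    finally show "norm ((x + y) - ((a - P) + (b - P)) *\<^sub>R (p /\<^sub>R P)) \<le> 4 * r" using ab assms by linarith
  qed simp
  finally have "\<bar>(a - b) - (x - y) \<bullet> (p /\<^sub>R P)\<bar> \<le> norm (x - y) * (4 * r) / (a + b)"
    using pos P by (simp add: pos_le_divide_eq)
  also have "\<dots> \<le> norm (x - y) * (4 * r) / (3/2 * P)"
    using pos P r0 by (intro divide_left_mono mult_nonneg_nonneg) auto
  also have "\<dots> \<le> 3 * r / P * norm (x - y)"
    using P r0 by (simp add: field_simps mult_right_mono)
  finally show ?thesis by (simp add: P_def a_def b_def)
qed

text \<open>\<open>d\<close> is the gradient at the origin of a sum (\<sigma> = 1, ellipsoids) or a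
  difference (\<sigma> = -1, hyperboloids) of two distances. In a ball of radius r each of the two
  linearisations errs by at most 3/16 |d| |s|, so more than half of the derivative along d
  survives.\<close>

lemma norm_sum_transversal:
  fixes p q :: "'a::real_inner"
  assumes sg: "\<sigma> = 1 \<or> \<sigma> = (-1::real)" and pq: "p \<noteq> 0" "q \<noteq> 0"
  defines "d \<equiv> p /\<^sub>R norm p + \<sigma> *\<^sub>R (q /\<^sub>R norm q)"
  assumes d: "d \<noteq> 0"
    and r: "16 * r \<le> norm d * norm p" "16 * r \<le> norm d * norm q"
    and z: "norm z \<le> r" "norm (z + s *\<^sub>R (d /\<^sub>R norm d)) \<le> r"
  shows "norm d / 2 * \<bar>s\<bar> \<le> \<bar>(norm (p + (z + s *\<^sub>R (d /\<^sub>R norm d))) + \<sigma> * norm (q + (z + s *\<^sub>R (d /\<^sub>R norm d))))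
      - (norm (p + z) + \<sigma> * norm (q + z))\<bar>"
proof -
  define D z' n where "D = norm d" and "z' = z + s *\<^sub>R (d /\<^sub>R norm d)" and "n = d /\<^sub>R norm d"
  have D: "D > 0" using d by (simp add: D_def)
  have D2: "D \<le> 2"
  proof -
    have "D \<le> norm (p /\<^sub>R norm p) + norm (\<sigma> *\<^sub>R (q /\<^sub>R norm q))" unfolding D_def d_def by (rule norm_triangle_ineq)
    also have "\<dots> = 2" using pq sg by auto
    finally show ?thesis .
  qed
  have n: "norm n = 1" using d by (simp add: n_def)
  have zz: "z' - z = s *\<^sub>R n" by (simp add: z'_def n_def)
  have r4: "4 * r \<le> norm p" "4 * r \<le> norm q"
    using r mult_right_mono[OF D2, of "norm p"] mult_right_mono[OF D2, of "norm q"] norm_ge_zero[of p] norm_ge_zero[of q]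
    unfolding D_def by linarith+
  have e: "\<bar>(norm (v + z') - norm (v + z)) - (s *\<^sub>R n) \<bullet> (v /\<^sub>R norm v)\<bar> \<le> 3/16 * D * \<bar>s\<bar>"
    if "v \<noteq> 0" "4 * r \<le> norm v" "16 * r \<le> norm d * norm v" for v
  proof -
    have "\<bar>(norm (v + z') - norm (v + z)) - (z' - z) \<bullet> (v /\<^sub>R norm v)\<bar> \<le> 3 * r / norm v * norm (z' - z)"
      using z that by (intro norm_diff_quotient) (auto simp: z'_def)
    also have "3 * r / norm v \<le> 3/16 * D" using that by (simp add: D_def field_simps)
    then have "3 * r / norm v * norm (z' - z) \<le> 3/16 * D * norm (z' - z)" by (rule mult_right_mono) simp
    finally show ?thesis by (simp add: zz n)
  qed
  have "(s *\<^sub>R n) \<bullet> (p /\<^sub>R norm p) + \<sigma> * ((s *\<^sub>R n) \<bullet> (q /\<^sub>R norm q)) = s * (n \<bullet> d)"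
    by (simp add: d_def inner_add_right algebra_simps)
  also have "n \<bullet> d = D" using D by (simp add: n_def D_def power2_norm_eq_inner[symmetric] power2_eq_square)
  finally have main: "(s *\<^sub>R n) \<bullet> (p /\<^sub>R norm p) + \<sigma> * ((s *\<^sub>R n) \<bullet> (q /\<^sub>R norm q)) = s * D" .
  have e1: "\<bar>(norm (p + z') - norm (p + z)) - (s *\<^sub>R n) \<bullet> (p /\<^sub>R norm p)\<bar> \<le> 3/16 * D * \<bar>s\<bar>"
    using e[of p] pq r4 r by blast
  have "\<bar>(norm (q + z') - norm (q + z)) - (s *\<^sub>R n) \<bullet> (q /\<^sub>R norm q)\<bar> \<le> 3/16 * D * \<bar>s\<bar>"
    using e[of q] pq r4 r by blast
  then have e2: "\<bar>\<sigma> * (norm (q + z') - norm (q + z)) - \<sigma> * ((s *\<^sub>R n) \<bullet> (q /\<^sub>R norm q))\<bar> \<le> 3/16 * D * \<bar>s\<bar>"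
    using sg by (elim disjE) (simp_all only: abs_le_iff, auto)
  have "\<bar>((norm (p + z') + \<sigma> * norm (q + z')) - (norm (p + z) + \<sigma> * norm (q + z))) - s * D\<bar> \<le> 3/8 * D * \<bar>s\<bar>"
  proof -
    have *: "\<bar>((P' + \<sigma> * Q') - (P + \<sigma> * Q)) - (A + B)\<bar> \<le> 3/8 * D * \<bar>s\<bar>"
      if "\<bar>(P' - P) - A\<bar> \<le> 3/16 * D * \<bar>s\<bar>" "\<bar>\<sigma> * (Q' - Q) - B\<bar> \<le> 3/16 * D * \<bar>s\<bar>" for P P' Q Q' A B
      using abs_triangle_ineq[of "(P' - P) - A" "\<sigma> * (Q' - Q) - B"] that
      by (simp add: algebra_simps)
    show ?thesis unfolding main[symmetric] by (rule *[OF e1 e2])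
  qed
  moreover have "\<bar>s * D\<bar> = D * \<bar>s\<bar>" using D by (simp add: abs_mult)
  ultimately have "D * \<bar>s\<bar> - 3/8 * D * \<bar>s\<bar> \<le> \<bar>(norm (p + z') + \<sigma> * norm (q + z')) - (norm (p + z) + \<sigma> * norm (q + z))\<bar>"
    by linarith
  moreover have "D / 2 * \<bar>s\<bar> \<le> D * \<bar>s\<bar> - 3/8 * D * \<bar>s\<bar>"
    using mult_nonneg_nonneg[of D "\<bar>s\<bar>"] D by simp
  ultimately have "D / 2 * \<bar>s\<bar> \<le> \<bar>(norm (p + z') + \<sigma> * norm (q + z')) - (norm (p + z) + \<sigma> * norm (q + z))\<bar>" by linarith
  then show ?thesis unfolding D_def z'_def .
qed

subsection \<open>Layers between ellipsoids\<close>

text \<open>Quadratic growth puts the sublevel set at height s above \<open>f m\<close> into a disc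
  of area \<pi> s/c, and convexity makes these sets shrink well when contracted towards m. The layer
  is what such a contraction misses, and in the plane this part of the area stays bounded as the
  height grows.\<close>

lemma emeasure_convex_layer:
  fixes f :: "real \<times> real \<Rightarrow> real"
  assumes cv: "convex_on UNIV f" and [measurable]: "f \<in> borel_measurable borel"
    and c: "0 < c"
    and gr: "\<And>y. norm (y - m) \<le> \<rho> \<Longrightarrow> f m + c * (norm (y - m))\<^sup>2 \<le> f y"
  shows "emeasure lborel {y. norm (y - m) \<le> \<rho> \<and> t \<le> f y \<and> f y \<le> t + 1} \<le> ennreal (4 * pi / c)"
proof -
  define S where "S s = {y. norm (y - m) \<le> \<rho> \<and> f y - f m \<le> s}" for s
  define L where "L = {y. norm (y - m) \<le> \<rho> \<and> t \<le> f y \<and> f y \<le> t + 1}"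
  define k where "k = t - f m"
  have [measurable]: "S s \<in> sets borel" "L \<in> sets borel" for s
    unfolding S_def L_def by measurable
  have ball: "emeasure lborel (S s) \<le> ennreal (pi * (s / c))" if s: "0 \<le> s" for s
  proof -
    have "S s \<subseteq> cball m (sqrt (s / c))"
    proof
      fix y assume y: "y \<in> S s"
      then have "c * (norm (y - m))\<^sup>2 \<le> s" using gr[of y] by (auto simp: S_def)
      then have "(norm (y - m))\<^sup>2 \<le> s / c" using c by (simp add: field_simps)
      then have "norm (y - m) \<le> sqrt (s / c)" by (rule real_le_rsqrt)
      then show "y \<in> cball m (sqrt (s / c))" by (simp add: dist_norm norm_minus_commute)
    qed
    then have "emeasure lborel (S s) \<le> emeasure lborel (cball m (sqrt (s / c)))"
      by (rule emeasure_mono) simp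
    also have "\<dots> = ennreal (pi * (s / c))"
      using s c by (simp add: emeasure_cball unit_ball_vol_2)
    finally show ?thesis .
  qed
  have LS: "L \<subseteq> S (k + 1)" by (auto simp: L_def S_def k_def)
  have "emeasure lborel L \<le> ennreal (4 * pi / c)"
  proof (cases "k \<le> 1")
    case True
    show ?thesis
    proof (cases "0 \<le> k + 1")
      case True
      have "emeasure lborel L \<le> emeasure lborel (S (k + 1))" using LS by (rule emeasure_mono) simp
      also have "\<dots> \<le> ennreal (pi * ((k + 1) / c))" using True by (rule ball)
      also have "\<dots> \<le> ennreal (4 * pi / c)"
        using \<open>k \<le> 1\<close> c by (intro ennreal_leI) (auto simp: field_simps)
      finally show ?thesis .
    next
      case False
      have "y \<notin> L" for y
      proof
        assume y: "y \<in> L"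
        then have "f m + c * (norm (y - m))\<^sup>2 \<le> f y" using gr[of y] by (simp add: L_def)
        moreover have "0 \<le> c * (norm (y - m))\<^sup>2" using c by simp
        moreover have "f y \<le> t + 1" using y by (simp add: L_def)
        ultimately show False using False by (simp add: k_def)
      qed
      then have "L = {}" by auto
      then show ?thesis by simp
    qed
  next
    case False
    \<comment> \<open>Contraction by this ratio carries the sublevel set of height k + 1 into that
      of height k - 1, which is disjoint from the layer because f exceeds \<open>f m\<close> by at
      least k there. The measure scales by l^2, and (1 - l^2) (k + 1) = 4k/(k + 1) is less than
      4.\<close>
    define l where "l = (k - 1) / (k + 1)"
    have l: "0 < l" "l < 1" "l * (k + 1) = k - 1" using False by (auto simp: l_def)
    define A where "A = {y. m + (1/l) *\<^sub>R (y - m) \<in> S (k + 1)}"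
    have [measurable]: "A \<in> sets borel" unfolding A_def by measurable
    have emA: "emeasure lborel A = ennreal (l\<^sup>2) * emeasure lborel (S (k + 1))"
    proof -
      have "emeasure lborel A = emeasure (density (distr lborel borel (\<lambda>x. (m - l *\<^sub>R m) + l *\<^sub>R x)) (\<lambda>_. \<bar>l\<bar>^DIM(real\<times>real))) A"
        by (subst lborel_affine[of l "m - l *\<^sub>R m"]) (use l in auto)
      also have "\<dots> = ennreal (l\<^sup>2) * emeasure lborel ((\<lambda>x. (m - l *\<^sub>R m) + l *\<^sub>R x) -` A)"
        using l by (simp add: emeasure_density nn_integral_cmult_indicator emeasure_distr power2_eq_square)
      also have "(\<lambda>x. (m - l *\<^sub>R m) + l *\<^sub>R x) -` A = S (k + 1)"
      proof -
        have "m + (1/l) *\<^sub>R ((m - l *\<^sub>R m) + l *\<^sub>R x - m) = x" for x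
          using l by (simp add: algebra_simps)
        then show ?thesis by (auto simp: A_def)
      qed
      finally show ?thesis .
    qed
    have AS: "A \<subseteq> S (k + 1) \<and> A \<inter> L = {}"
    proof -
      have "y \<in> S (k - 1)" if "y \<in> A" for y
      proof -
        define x where "x = m + (1/l) *\<^sub>R (y - m)"
        have x: "x \<in> S (k + 1)" using that by (simp add: A_def x_def)
        have y: "y = (1 - l) *\<^sub>R m + l *\<^sub>R x" using l by (simp add: x_def algebra_simps)
        have "f y \<le> (1 - l) * f m + l * f x"
          unfolding y using l by (intro convex_onD[OF cv]) auto
        then have "f y - f m \<le> l * (f x - f m)" by (simp add: algebra_simps)
        also have "\<dots> \<le> l * (k + 1)" using x l by (intro mult_left_mono) (auto simp: S_def)
        finally have 1: "f y - f m \<le> k - 1" using l by simp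
        have "y - m = l *\<^sub>R (x - m)" unfolding y by (simp add: algebra_simps)
        then have "norm (y - m) = l * norm (x - m)" using l by simp
        also have "\<dots> \<le> 1 * norm (x - m)" using l by (intro mult_right_mono) auto
        also have "\<dots> \<le> \<rho>" using x by (simp add: S_def)
        finally show ?thesis using 1 by (simp add: S_def)
      qed
      then show ?thesis by (force simp: S_def L_def k_def)
    qed
    have "emeasure lborel L + emeasure lborel A = emeasure lborel (L \<union> A)"
      using AS by (intro plus_emeasure) auto
    also have "\<dots> \<le> emeasure lborel (S (k + 1))" using AS LS by (intro emeasure_mono) auto
    finally have *: "emeasure lborel L + ennreal (l\<^sup>2) * emeasure lborel (S (k + 1)) \<le> emeasure lborel (S (k + 1))"
      by (simp add: emA)
    have fin: "emeasure lborel (S (k + 1)) < \<infinity>"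
      using ball[of "k + 1"] False by (auto simp: le_less_trans[OF _ ennreal_less_top])
    obtain a where a: "emeasure lborel (S (k + 1)) = ennreal a" "0 \<le> a"
      using fin by (metis ennreal_cases less_irrefl infinity_ennreal_def)
    have a1: "a \<le> pi * ((k + 1) / c)" using ball[of "k + 1"] False a c by simp
    have finL: "emeasure lborel L < \<infinity>" using emeasure_mono[OF LS, of lborel] fin by (auto intro: le_less_trans)
    obtain b where b: "emeasure lborel L = ennreal b" "0 \<le> b"
      using finL by (metis ennreal_cases less_irrefl infinity_ennreal_def)
    have "b + l\<^sup>2 * a \<le> a"
      using * a b by (simp add: ennreal_mult[symmetric] ennreal_plus[symmetric] del: ennreal_plus)
    then have "b \<le> (1 - l\<^sup>2) * a" by (simp add: algebra_simps)
    also have "1 - l\<^sup>2 = 4 * k / (k + 1)\<^sup>2" using False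
      by (simp add: l_def field_simps) (simp add: power2_eq_square algebra_simps)
    also have "4 * k / (k + 1)\<^sup>2 * a \<le> 4 * k / (k + 1)\<^sup>2 * (pi * ((k + 1) / c))"
      using False a1 by (intro mult_left_mono) auto
    also have "\<dots> = (4 * pi / c) * (k / (k + 1))"
    proof -
      have "4 * k / K\<^sup>2 * (pi * (K / c)) = (4 * pi / c) * (k / K)" if "K > 0" for K
        using that c by (simp add: field_simps power2_eq_square)
      then show ?thesis using False by simp
    qed
    also have "\<dots> \<le> (4 * pi / c) * 1" using False c by (intro mult_left_mono) auto
    finally show ?thesis by (simp add: b ennreal_leI)
  qed
  then show ?thesis by (simp add: L_def)
qed

text \<open>A planar slice of a layer between confocal ellipsoids, with the foci at distances A and
  B from the plane. The first norm alone gives a quadratic growth with constant 1/(8A); of the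
  second one only the supporting hyperplane is used.\<close>

lemma emeasure_ellipse_layer:
  fixes w :: "real \<times> real"
  assumes A: "0 < A" and B: "0 \<le> B" and w: "4 * norm w \<le> A + B" and r: "2 * r \<le> A"
  shows "emeasure lborel {y. norm y \<le> r \<and> t \<le> norm (A, y) + norm (B, y + w) \<and> norm (A, y) + norm (B, y + w) \<le> t + 1}
     \<le> ennreal (32 * pi * A)" (is "emeasure lborel ?L \<le> _")
proof -
  define f where "f y = norm (A, y) + norm (B, y + w)" for y
  define s where "s = A / (A + B)"
  \<comment> \<open>The minimiser is given by the reflection principle: the segment between the feet
    of the two foci is divided in the ratio A to B.\<close>
  define m where "m = - (s *\<^sub>R w)"
  have s: "0 < s" "s \<le> 1" "s * (A + B) = A" using A B by (auto simp: s_def field_simps)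
  have nm: "4 * norm m \<le> A"
  proof -
    have "4 * norm m = s * (4 * norm w)" using s by (simp add: m_def)
    also have "\<dots> \<le> s * (A + B)" using s w by (intro mult_left_mono) auto
    finally show ?thesis using s by simp
  qed
  define a where "a = (A, m)"
  have a0: "norm a > 0" using A by (simp add: a_def norm_Pair) (metis add_pos_nonneg zero_less_power2 less_irrefl zero_le_power2)
  have cont: "continuous_on UNIV f" unfolding f_def by (intro continuous_intros)
  have fm: "f \<in> borel_measurable borel" by (rule borel_measurable_continuous_onI[OF cont])
  have cv: "convex_on UNIV f"
  proof (rule convex_onI)
    fix u and x y :: "real \<times> real" assume u: "0 < u" "u < (1::real)"
    have 1: "(A, (1 - u) *\<^sub>R x + u *\<^sub>R y) = (1 - u) *\<^sub>R (A, x) + u *\<^sub>R (A, y)"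
      by (simp add: algebra_simps)
    have 2: "(B, (1 - u) *\<^sub>R x + u *\<^sub>R y + w) = (1 - u) *\<^sub>R (B, x + w) + u *\<^sub>R (B, y + w)"
      by (simp add: algebra_simps)
    have "norm ((1 - u) *\<^sub>R v + u *\<^sub>R v') \<le> (1 - u) * norm v + u * norm v'" for v v' :: "real \<times> real \<times> real"
      using norm_triangle_ineq[of "(1 - u) *\<^sub>R v" "u *\<^sub>R v'"] u by simp
    from this[of "(A, x)" "(A, y)"] this[of "(B, x + w)" "(B, y + w)"]
    show "f ((1 - u) *\<^sub>R x + u *\<^sub>R y) \<le> (1 - u) * f x + u * f y"
      unfolding f_def 1 2 by (simp add: algebra_simps)
  qed simp
  have gr: "f m + 1 / (8 * A) * (norm (y - m))\<^sup>2 \<le> f y" if y: "norm (y - m) \<le> norm m + r" for y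
  proof -
    define b where "b = (A, y)"
    have ny: "norm y \<le> A" using norm_triangle_ineq[of "y - m" m] y nm r by simp
    have b0: "norm b > 0" using A by (simp add: b_def norm_Pair) (metis add_pos_nonneg zero_less_power2 less_irrefl zero_le_power2)
    have na: "(norm a)\<^sup>2 \<le> 2 * A\<^sup>2"
      using power_mono[of "norm m" A 2] nm A by (simp add: a_def norm_Pair)
    have nb: "norm b \<le> 2 * A"
      unfolding b_def norm_Pair using power_mono[OF ny, of 2] A
      by (intro real_le_lsqrt) (auto simp: power2_eq_square intro: order_trans[OF _ mult_right_mono[of 1 3 "A * A"]])
    have ab: "a \<bullet> b = A\<^sup>2 + m \<bullet> y" by (simp add: a_def b_def power2_eq_square)
    \<comment> \<open>Lagrange's identity: the defect in the Cauchy-Schwarz inequality for a and b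
      contains A^2 |y - m|^2. It is the source of the strict convexity.\<close>
    have "A\<^sup>2 * (norm (y - m))\<^sup>2 \<le> (norm a * norm b)\<^sup>2 - (a \<bullet> b)\<^sup>2"
    proof -
      have n: "(norm a)\<^sup>2 = A\<^sup>2 + (norm m)\<^sup>2" "(norm b)\<^sup>2 = A\<^sup>2 + (norm y)\<^sup>2"
        by (simp_all add: a_def b_def norm_Pair)
      have "(norm (y - m))\<^sup>2 = (norm y)\<^sup>2 + (norm m)\<^sup>2 - 2 * (m \<bullet> y)"
        by (simp add: power2_norm_eq_inner inner_diff_left inner_diff_right inner_commute)
      moreover have "(m \<bullet> y)\<^sup>2 \<le> (norm m)\<^sup>2 * (norm y)\<^sup>2"
        using Cauchy_Schwarz_ineq[of m y] by (simp add: power2_norm_eq_inner)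
      moreover have "A\<^sup>2 * (Y + M - 2 * k) \<le> (A\<^sup>2 + M) * (A\<^sup>2 + Y) - (A\<^sup>2 + k)\<^sup>2" if "k\<^sup>2 \<le> M * Y" for Y M k
        using that by (simp add: algebra_simps power2_eq_square)
      ultimately show ?thesis unfolding ab power_mult_distrib n by simp
    qed
    also have "\<dots> = (norm a * norm b - a \<bullet> b) * (norm a * norm b + a \<bullet> b)"
      by (simp add: algebra_simps power2_eq_square)
    also have "\<dots> \<le> (norm a * norm b - a \<bullet> b) * (2 * (norm a * norm b))"
      using norm_cauchy_schwarz[of a b] by (intro mult_left_mono) auto
    finally have 1: "A\<^sup>2 * (norm (y - m))\<^sup>2 \<le> (norm a * norm b - a \<bullet> b) * (2 * (norm a * norm b))" .
    have "(norm (y - m))\<^sup>2 / (8 * A) \<le> (norm a * norm b - a \<bullet> b) / norm a"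
    proof -
      have "(norm a)\<^sup>2 * norm b \<le> (2 * A\<^sup>2) * (2 * A)" using na nb a0 A by (intro mult_mono) auto
      then have "(norm a * norm b - a \<bullet> b) * ((norm a)\<^sup>2 * norm b) \<le> (norm a * norm b - a \<bullet> b) * (4 * A * A\<^sup>2)"
        using norm_cauchy_schwarz[of a b] by (intro mult_left_mono) (auto simp: algebra_simps)
      moreover have "norm a * (A\<^sup>2 * (norm (y - m))\<^sup>2) \<le> 2 * ((norm a * norm b - a \<bullet> b) * ((norm a)\<^sup>2 * norm b))"
        using mult_left_mono[OF 1, of "norm a"] a0 by (simp add: power2_eq_square algebra_simps)
      ultimately have "A\<^sup>2 * (norm a * (norm (y - m))\<^sup>2) \<le> A\<^sup>2 * (8 * A * (norm a * norm b - a \<bullet> b))"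
        by (simp add: algebra_simps)
      then have "norm a * (norm (y - m))\<^sup>2 \<le> 8 * A * (norm a * norm b - a \<bullet> b)"
        using A by simp
      then show ?thesis using A a0 by (simp add: field_simps)
    qed
    also have "(norm a * norm b - a \<bullet> b) / norm a = norm b - norm a - (m \<bullet> (y - m)) / norm a"
    proof -
      have "m \<bullet> (y - m) = a \<bullet> b - (norm a)\<^sup>2"
      proof -
        have "(norm a)\<^sup>2 = A\<^sup>2 + m \<bullet> m" by (simp add: a_def norm_Pair power2_norm_eq_inner)
        then show ?thesis by (simp add: ab inner_diff_right)
      qed
      then show ?thesis using a0 by (simp add: field_simps power2_eq_square)
    qed
    finally have first: "norm (A, m) + (m \<bullet> (y - m)) / norm a + (norm (y - m))\<^sup>2 / (8 * A) \<le> norm (A, y)"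
      by (simp add: a_def b_def)
    have second: "norm (B, m + w) - (m \<bullet> (y - m)) / norm a \<le> norm (B, y + w)"
    proof -
      \<comment> \<open>at the minimiser the gradients of the two terms cancel: \<open>(B, m + w)\<close> is parallel to \<open>(A, - m)\<close>\<close>
      define l where "l = B / A"
      have mw: "m + w = - (l *\<^sub>R m)"
      proof -
        have "(1 - s) = l * s" using A B by (simp add: l_def s_def field_simps)
        then have "w - s *\<^sub>R w = (l * s) *\<^sub>R w" by (metis scaleR_left_diff_distrib scaleR_one)
        then show ?thesis by (simp add: m_def algebra_simps)
      qed
      have l0: "0 \<le> l" "l * A = B" using A B by (auto simp: l_def)
      define a' where "a' = (A, - m)"
      have na': "norm a' = norm a" by (simp add: a'_def a_def norm_Pair)
      have eq: "(B, m + w) = l *\<^sub>R a'" using l0 by (simp add: a'_def mw)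
      have "a' \<bullet> (B, y + w) \<le> norm a * norm (B, y + w)"
        using norm_cauchy_schwarz[of a' "(B, y + w)"] by (simp add: na')
      moreover have "(B, y + w) = l *\<^sub>R a' + (0, y - m)" unfolding eq[symmetric] by simp
      then have "a' \<bullet> (B, y + w) = l * (norm a)\<^sup>2 - m \<bullet> (y - m)"
        by (simp add: inner_add_right power2_norm_eq_inner[symmetric] na') (simp add: a'_def)
      ultimately have "l * (norm a)\<^sup>2 - m \<bullet> (y - m) \<le> norm a * norm (B, y + w)" by simp
      moreover have "norm (B, m + w) = l * norm a" unfolding eq using l0 by (simp add: na')
      ultimately show ?thesis using a0 by (simp add: field_simps power2_eq_square)
    qed
    show ?thesis using first second by (simp add: f_def)
  qed
  have "emeasure lborel ?L \<le> emeasure lborel {y. norm (y - m) \<le> norm m + r \<and> t \<le> f y \<and> f y \<le> t + 1}"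
    using fm by (intro emeasure_mono) (auto simp: f_def intro: order_trans[OF norm_triangle_ineq4])
  also have "\<dots> \<le> ennreal (4 * pi / (1 / (8 * A)))"
    using A by (intro emeasure_convex_layer[OF cv fm _ gr]) auto
  also have "4 * pi / (1 / (8 * A)) = 32 * pi * A" by simp
  finally show ?thesis .
qed

section \<open>The relative cone gap on ellipsoidal layers\<close>

text \<open>The quotient under the first power is the relative cone gap of two inputs on opposite
  cones with a low output z; the term |z|^(-\<kappa>) stands for the gain of the modulation term.
  The common factor 1/|z| is the power at which an estimate by size alone diverges logarithmically.
  The condition |P| \<le> |z|^2 restricts to the scales on which the curvature of the ellipsoids is
  visible.\<close>

definition gap_weight :: "real \<Rightarrow> real^3 \<Rightarrow> real^3 \<Rightarrow> real" where
  "gap_weight \<kappa> P z = (if 1 \<le> norm z \<and> norm P \<le> (norm z)\<^sup>2 \<and> 128 * norm z \<le> norm P then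
     inverse (norm z) * (((norm z - \<bar>norm (P + z) - norm P\<bar>) / norm z) powr \<kappa> + norm z powr (-\<kappa>)) else 0)"

lemma gap_weight_measurable [measurable]: "gap_weight \<kappa> P \<in> borel_measurable borel"
  unfolding gap_weight_def[abs_def] by measurable

lemma gap_weight_nonneg: "0 \<le> gap_weight \<kappa> P z"
  by (auto simp: gap_weight_def)

lemma gap_weight_le:
  assumes "0 < \<kappa>" shows "gap_weight \<kappa> P z \<le> 2 / norm z"
proof (cases "1 \<le> norm z \<and> norm P \<le> (norm z)\<^sup>2 \<and> 128 * norm z \<le> norm P")
  case True
  have a: "\<bar>norm (P + z) - norm P\<bar> \<le> norm z" using norm_triangle_ineq3[of "P + z" P] by simp
  have nz: "0 < norm z" using True by linarith
  have "((norm z - \<bar>norm (P + z) - norm P\<bar>) / norm z) powr \<kappa> \<le> 1 powr \<kappa>"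
    using nz a assms by (intro powr_mono2) (auto simp: pos_divide_le_eq)
  moreover have "norm z powr (-\<kappa>) \<le> 1 powr (-\<kappa>)"
    using True assms by (intro powr_mono2') auto
  ultimately have "inverse (norm z) * (((norm z - \<bar>norm (P + z) - norm P\<bar>) / norm z) powr \<kappa> + norm z powr (-\<kappa>)) \<le> inverse (norm z) * 2"
    by (intro mult_left_mono) auto
  then show ?thesis using True by (simp add: gap_weight_def field_simps)
qed (auto simp: gap_weight_def)

lemma nn_integral_inverse_disc:
  assumes "0 \<le> T"
  shows "(\<integral>\<^sup>+y. ennreal (if norm (y::real\<times>real) \<le> T then 2 / norm y else 0) \<partial>lborel) \<le> ennreal (4 * pi * T)"
proof -
  have "(\<integral>\<^sup>+y. ennreal (if norm (y::real\<times>real) \<le> T then 2 / norm y else 0) \<partial>lborel)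
      = (\<integral>\<^sup>+y. ennreal (if sqrt ((norm (y::real\<times>real))\<^sup>2) \<le> T then 2 / sqrt ((norm y)\<^sup>2) else 0) \<partial>lborel)"
    by (simp only: real_sqrt_abs abs_norm_cancel)
  also have "\<dots> = (\<integral>\<^sup>+w. ennreal (if sqrt w \<le> T then 2 / sqrt w else 0) * (ennreal pi * indicator {0..} w) \<partial>lborel)"
    by (rule nn_integral_radial2[where F="\<lambda>w. ennreal (if sqrt w \<le> T then 2 / sqrt w else 0)"]) simp
  also have "\<dots> = (\<integral>\<^sup>+w. (\<lambda>a. ennreal pi * ennreal (if a \<le> T then 2 / a else 0)) (sqrt w) * indicator {0..} w \<partial>lborel)"
    by (simp add: mult_ac)
  also have "\<dots> = (\<integral>\<^sup>+a. ennreal pi * ennreal (if a \<le> T then 2 / a else 0) * (ennreal (2 * a) * indicator {0..} a) \<partial>lborel)"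
    by (rule nn_integral_sqrt_subst) simp
  also have "\<dots> \<le> (\<integral>\<^sup>+a. ennreal (4 * pi) * indicator {0..T} a \<partial>lborel)"
  proof (rule nn_integral_mono)
    fix a :: real
    have "ennreal pi * ennreal (2 / a) * ennreal (2 * a) \<le> ennreal (4 * pi)" if "0 \<le> a"
      using that by (cases "a = 0") (auto simp: ennreal_mult[symmetric])
    then show "ennreal pi * ennreal (if a \<le> T then 2 / a else 0) * (ennreal (2 * a) * indicator {0..} a) \<le> ennreal (4 * pi) * indicator {0..T} a"
      by (auto simp: indicator_def mult.assoc)
  qed
  also have "\<dots> = ennreal (4 * pi * T)"
    using assms by (simp add: nn_integral_cmult_indicator ennreal_mult)
  finally show ?thesis .
qed

context
  fixes P Q :: "real^3"
  assumes P0: "P \<noteq> 0" and PQ: "norm P \<le> norm Q"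
begin

private definition "N = norm P"
private definition "e = P /\<^sub>R N"
text \<open>The length of the gradient of \<open>\<phi>\<close> at the origin; it vanishes exactly
  when P and Q are antiparallel.\<close>

private definition "\<alpha> = norm (e + Q /\<^sub>R norm Q)"
private definition "\<phi> z = norm (P + z) + norm (Q + z)"

private lemma basic: "0 < N" "Q \<noteq> 0" "norm e = 1" "P = N *\<^sub>R e" "norm (Q /\<^sub>R norm Q) = 1" "N \<le> norm Q"
proof -
  show N: "0 < N" "N \<le> norm Q" using P0 PQ by (auto simp: N_def)
  show Q: "Q \<noteq> 0" using PQ P0 by auto
  show "norm e = 1" "P = N *\<^sub>R e" using N by (auto simp: e_def N_def)
  show "norm (Q /\<^sub>R norm Q) = 1" using Q by simp
qed

private lemma phi_measurable [measurable]: "\<phi> \<in> borel_measurable borel"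
  unfolding \<phi>_def[abs_def] by measurable

text \<open>Here z is too small to turn the gradient, so the layer has thickness of order
  1/\<alpha>, while 2/|z| integrates over a disc of radius \<alpha> N / 16 to a multiple of \<alpha>
  N. The factor \<alpha> cancels.\<close>

private lemma near:
  assumes \<kappa>: "0 < \<kappa>"
  shows "(\<integral>\<^sup>+z. ennreal (if 16 * norm z \<le> \<alpha> * N then gap_weight \<kappa> P z else 0) * indicator {t..t+1} (\<phi> z) \<partial>lborel) \<le> ennreal (pi * N)"
proof (cases "\<alpha> = 0")
  case True
  have "(if 16 * norm z \<le> \<alpha> * N then gap_weight \<kappa> P z else 0) = 0" for z
    using True by (auto simp: gap_weight_def)
  then show ?thesis by simp
next
  case False
  then have \<alpha>: "0 < \<alpha>" by (simp add: \<alpha>_def)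
  define d where "d = e + Q /\<^sub>R norm Q"
  define n where "n = d /\<^sub>R norm d"
  have d: "norm d = \<alpha>" by (simp add: d_def \<alpha>_def)
  have d0: "d \<noteq> 0" using \<alpha> d by auto
  have n: "norm n = 1" using d0 by (simp add: n_def)
  define g where "g s = ennreal (if s \<le> \<alpha> * N / 16 then 2 / s else 0)" for s :: real
  have [measurable]: "g \<in> borel_measurable borel"
    unfolding g_def[abs_def] by measurable
  let ?w = "\<lambda>z. ennreal (if 16 * norm z \<le> \<alpha> * N then gap_weight \<kappa> P z else 0)"
  \<comment> \<open>The majorant 2/s would be 0 at s = 0, by the convention for division, and fail
    on the axis through n. It is set to infinity there, which affects only one point of the
    plane.\<close>
  have "(\<integral>\<^sup>+z. ?w z * indicator {t..t+1} (\<phi> z) \<partial>lborel) \<le> ennreal (2 / (\<alpha> / 2)) * (\<integral>\<^sup>+y. (if norm (y::real\<times>real) = 0 then \<top> else g (norm y)) \<partial>lborel)"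
  proof (rule nn_integral_transversal_layer[OF n, where g="\<lambda>s. if s = 0 then \<top> else g s"])
    fix z :: "real^3"
    let ?y = "z - (z \<bullet> n) *\<^sub>R n"
    have "norm ?y \<le> norm z"
    proof -
      have "(norm ?y)\<^sup>2 = (norm z)\<^sup>2 - (z \<bullet> n)\<^sup>2"
        using n unfolding power2_norm_eq_inner
        by (simp add: inner_diff_left inner_diff_right inner_commute norm_eq_1 power2_eq_square)
      then have "(norm ?y)\<^sup>2 \<le> (norm z)\<^sup>2" by simp
      then show ?thesis by (rule power2_le_imp_le) simp
    qed
    then show "?w z \<le> (if norm ?y = 0 then \<top> else g (norm ?y))"
    proof -
      assume le: "norm ?y \<le> norm z"
      have "2 / norm z \<le> 2 / norm ?y" if "?y \<noteq> 0"
        using that le by (intro divide_left_mono mult_pos_pos) (auto intro: less_le_trans[of 0 "norm ?y"])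
      then show ?thesis using gap_weight_le[OF \<kappa>, of P z] le by (auto simp: g_def intro!: ennreal_leI)
    qed
  next
    fix z :: "real^3" and s assume "?w z \<noteq> 0" "?w (z + s *\<^sub>R n) \<noteq> 0"
    then have z: "norm z \<le> \<alpha> * N / 16" "norm (z + s *\<^sub>R n) \<le> \<alpha> * N / 16" by (auto split: if_splits)
    have dd: "P /\<^sub>R norm P + 1 *\<^sub>R (Q /\<^sub>R norm Q) = d" by (simp add: d_def e_def N_def)
    have "norm d / 2 * \<bar>s\<bar> \<le> \<bar>(norm (P + (z + s *\<^sub>R (d /\<^sub>R norm d))) + 1 * norm (Q + (z + s *\<^sub>R (d /\<^sub>R norm d))))
      - (norm (P + z) + 1 * norm (Q + z))\<bar>"
      using d0 norm_sum_transversal[of 1 P Q "\<alpha> * N / 16" z s, unfolded dd] z \<alpha> d P0 basic(2,6) mult_left_mono[OF basic(6), of \<alpha>]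
      by (auto simp: n_def N_def)
    then show "\<alpha> / 2 * \<bar>s\<bar> \<le> \<bar>\<phi> (z + s *\<^sub>R n) - \<phi> z\<bar>"
      by (simp add: \<phi>_def n_def d)
  qed (use \<alpha> in auto)
  also have "(\<integral>\<^sup>+y. (if norm (y::real\<times>real) = 0 then \<top> else g (norm y)) \<partial>lborel) = (\<integral>\<^sup>+y. g (norm (y::real\<times>real)) \<partial>lborel)"
    by (rule nn_integral_cong_AE, rule AE_mp[OF AE_lborel_singleton[of "0::real\<times>real"]]) simp
  also have "\<dots> \<le> ennreal (4 * pi * (\<alpha> * N / 16))"
    unfolding g_def using \<alpha> basic by (intro nn_integral_inverse_disc) auto
  also have "ennreal (2 / (\<alpha> / 2)) * ennreal (4 * pi * (\<alpha> * N / 16)) = ennreal (pi * N)"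
    using \<alpha> basic by (simp add: ennreal_mult[symmetric])
  finally show ?thesis using mult_left_mono by (metis (no_types, lifting) order_trans zero_le)
qed

text \<open>Up to constants, a point \<open>z\<close> of the layer \<open>t \<le> \<phi> z \<le> t + 1\<close> with \<open>norm z\<close> at least \<open>\<alpha> * N / 16\<close> has
  \<open>Y t \<le> norm z\<close> and relative cone gap at most \<open>Y t / norm z\<close>. The integral of \<open>Y powr \<kappa> * (Y + \<bar>x\<bar>) powr (- 1 - \<kappa>)\<close>
  along the axis of \<open>P\<close> is then bounded, while \<open>\<kappa> = 0\<close> would give a logarithm.\<close>

private definition "Y t = sqrt (1 + \<alpha>\<^sup>2 * N\<^sup>2 + N * max 0 (t - N - norm Q + 1))"

private lemma Y_ge_1: "1 \<le> Y t"
  unfolding Y_def using basic(1) by (intro real_le_rsqrt) auto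

private lemma Y_sq: "(Y t)\<^sup>2 = 1 + \<alpha>\<^sup>2 * N\<^sup>2 + N * max 0 (t - N - norm Q + 1)"
  unfolding Y_def using basic(1) by (intro real_sqrt_pow2) auto

text \<open>The gradient of \<open>\<phi>\<close> at the origin is almost orthogonal to the axis of
  P: its component along \<open>e\<close> is quadratic in \<alpha>. So even an axial displacement of
  size N contributes to N \<open>\<phi>\<close> only (\<alpha> N)^2, which is part of the square of
  \<open>Y\<close>.\<close>

private lemma alpha_dot: "e \<bullet> (e + Q /\<^sub>R norm Q) = \<alpha>\<^sup>2 / 2"
proof -
  have 1: "e \<bullet> e = 1" using basic(3) by (simp add: norm_eq_1)
  have 2: "(Q /\<^sub>R norm Q) \<bullet> (Q /\<^sub>R norm Q) = 1" using basic(5) by (simp only: norm_eq_1)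
  have "\<alpha>\<^sup>2 = e \<bullet> e + 2 * (e \<bullet> (Q /\<^sub>R norm Q)) + (Q /\<^sub>R norm Q) \<bullet> (Q /\<^sub>R norm Q)"
    unfolding \<alpha>_def power2_norm_eq_inner by (simp only: inner_add_left inner_add_right inner_commute)
  then show ?thesis using 1 2 by (simp add: inner_add_right)
qed

private lemma far_pointwise:
  assumes \<kappa>: "0 < \<kappa>" and z: "1 \<le> norm z" "N \<le> (norm z)\<^sup>2" "128 * norm z \<le> N" "\<alpha> * N < 16 * norm z"
    and t: "t \<le> \<phi> z" "\<phi> z \<le> t + 1"
  shows "gap_weight \<kappa> P z \<le> 18 powr (1 + \<kappa>) * (612 powr \<kappa> + 1) * ((Y t + \<bar>z \<bullet> e\<bar>) powr (-1-\<kappa>) * Y t powr \<kappa>)"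
proof -
  note N = basic(1)
  define n x y where "n = norm z" and "x = z \<bullet> e" and "y = z - x *\<^sub>R e"
  define u v where "u = norm (P + z) - N" and "v = norm (Q + z) - norm Q"
  define h where "h = u + v"
  have n: "1 \<le> n" "N \<le> n\<^sup>2" "128 * n \<le> N" "\<alpha> * N \<le> 16 * n" "0 \<le> n" using z by (auto simp: n_def)
  have \<alpha>0: "0 \<le> \<alpha>" by (simp add: \<alpha>_def)
  have ee: "e \<bullet> e = 1" using basic(3) by (simp add: norm_eq_1)
  have ey: "e \<bullet> y = 0" by (simp add: y_def inner_diff_right ee x_def inner_commute)
  have zxy: "z = x *\<^sub>R e + y" by (simp add: y_def)
  have n2: "n\<^sup>2 = x\<^sup>2 + (norm y)\<^sup>2"
    unfolding n_def power2_norm_eq_inner by (subst (1 2) zxy)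
      (simp add: inner_add_left inner_add_right ee ey inner_commute[of y e] power2_eq_square)
  have xn: "\<bar>x\<bar> \<le> n" using Cauchy_Schwarz_ineq2[of z e] basic(3) by (simp add: x_def n_def)
  have h: "t - N - norm Q \<le> h" "h \<le> t - N - norm Q + 1"
    using t by (auto simp: h_def u_def v_def \<phi>_def)
  define A where "A = N + x"
  have A: "127 / 128 * N \<le> A" "A \<le> 129 / 128 * N" using xn n by (auto simp: A_def)
  have Pz: "norm (P + z) = u + N" by (simp add: u_def)
  have Pz2: "(u + N)\<^sup>2 = A\<^sup>2 + (norm y)\<^sup>2"
  proof -
    have "P + z = A *\<^sub>R e + y" by (subst basic(4), subst zxy) (simp add: A_def algebra_simps)
    then show ?thesis unfolding Pz[symmetric] power2_norm_eq_inner
      by (simp add: inner_add_left inner_add_right ee ey inner_commute[of y e] power2_eq_square)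
  qed
  have un: "\<bar>u\<bar> \<le> n" using norm_triangle_ineq3[of "P + z" P] by (simp add: u_def n_def N_def)
  \<comment> \<open>The excess of |P + z| over its linearisation N + x. The identity below makes N
    \<epsilon> comparable to |y|^2, up to a factor 3.\<close>
  define \<epsilon> where "\<epsilon> = u - x"
  have eps: "\<epsilon> * (u + N + A) = (norm y)\<^sup>2"
    using Pz2 by (simp add: \<epsilon>_def A_def power2_eq_square algebra_simps)
  have den: "N \<le> u + N + A" "u + N + A \<le> 3 * N" using A un n by auto
  have eps0: "0 \<le> \<epsilon>" using eps den N by (smt (verit) mult_neg_pos zero_le_power2)
  have eps1: "(norm y)\<^sup>2 \<le> 3 * N * \<epsilon>" using mult_left_mono[OF den(2) eps0] eps by (simp add: algebra_simps)
  have eps2: "N * \<epsilon> \<le> (norm y)\<^sup>2" using mult_left_mono[OF den(1) eps0] eps by (simp add: algebra_simps)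
  define d where "d = e + Q /\<^sub>R norm Q"
  have dn: "norm d = \<alpha>" by (simp add: d_def \<alpha>_def)
  define s where "s = z \<bullet> (Q /\<^sub>R norm Q)"
  have s: "s = z \<bullet> d - x" by (simp add: s_def d_def x_def inner_add_right)
  have sn: "\<bar>s\<bar> \<le> n" unfolding s_def n_def using Cauchy_Schwarz_ineq2[of z "Q /\<^sub>R norm Q"] basic(5) by simp
  have sQ: "z \<bullet> Q = s * norm Q" using basic(2) by (simp add: s_def)
  \<comment> \<open>The norm lies above its tangent plane at Q; the next estimate bounds the excess
    by the second-order term |z|^2/|Q|.\<close>
  have v1: "s \<le> v"
  proof -
    have "(Q + z) \<bullet> (Q /\<^sub>R norm Q) \<le> norm (Q + z) * norm (Q /\<^sub>R norm Q)" by (rule norm_cauchy_schwarz)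
    moreover have "(Q + z) \<bullet> (Q /\<^sub>R norm Q) = norm Q + s"
      using basic(2) by (simp add: inner_add_left s_def power2_norm_eq_inner[symmetric]) (simp add: power2_eq_square field_simps)
    ultimately show ?thesis using basic(5) by (simp add: v_def)
  qed
  have v2: "N * v \<le> N * s + n\<^sup>2"
  proof -
    have "(norm (Q + z))\<^sup>2 = (norm Q)\<^sup>2 + 2 * (s * norm Q) + n\<^sup>2"
      unfolding sQ[symmetric] n_def power2_norm_eq_inner by (simp add: inner_add_left inner_add_right inner_commute)
    also have "\<dots> \<le> (norm Q + s + n\<^sup>2 / norm Q)\<^sup>2"
    proof -
      define K where "K = norm Q"
      define c where "c = n\<^sup>2 / K"
      have K: "0 < K" "n \<le> K" using basic(1,6) n by (auto simp: K_def)
      have c: "c * K = n\<^sup>2" "0 \<le> c" using K by (auto simp: c_def)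
      have "0 \<le> 2 * c * (K + s) - n\<^sup>2 + s\<^sup>2 + c\<^sup>2"
      proof -
        have "0 \<le> n\<^sup>2 + 2 * c * s + s\<^sup>2 + c\<^sup>2" using zero_le_power2[of "c + s"] zero_le_power2[of n]
          unfolding power2_sum by linarith
        also have "\<dots> = 2 * c * (K + s) - n\<^sup>2 + s\<^sup>2 + c\<^sup>2" using c by (simp add: algebra_simps)
        finally show ?thesis .
      qed
      then have "K\<^sup>2 + 2 * (s * K) + n\<^sup>2 \<le> (K + s + c)\<^sup>2" by (simp add: power2_eq_square algebra_simps)
      then show ?thesis by (simp add: K_def c_def)
    qed
    finally have "norm (Q + z) \<le> norm Q + s + n\<^sup>2 / norm Q"
      by (rule power2_le_imp_le) (use sn n basic(1,6) in \<open>auto intro!: add_nonneg_nonneg\<close>)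
    moreover have "n\<^sup>2 / norm Q \<le> n\<^sup>2 / N" using basic by (intro divide_left_mono) auto
    ultimately have "v \<le> s + n\<^sup>2 / N" by (simp add: v_def)
    then have "N * v \<le> N * (s + n\<^sup>2 / N)" using N by (intro mult_left_mono) auto
    then show ?thesis using N by (simp add: algebra_simps)
  qed
  have zd: "\<bar>z \<bullet> d\<bar> \<le> n * \<alpha>" using Cauchy_Schwarz_ineq2[of z d] by (simp add: n_def dn)
  have zd2: "\<bar>z \<bullet> d\<bar> \<le> \<bar>x\<bar> * (\<alpha>\<^sup>2 / 2) + norm y * \<alpha>"
  proof -
    have "z \<bullet> d = x * (\<alpha>\<^sup>2 / 2) + y \<bullet> d" by (subst zxy) (simp add: inner_add_left alpha_dot[folded d_def])
    moreover have "\<bar>y \<bullet> d\<bar> \<le> norm y * \<alpha>" using Cauchy_Schwarz_ineq2[of y d] by (simp add: dn)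
    moreover have "\<bar>x * (\<alpha>\<^sup>2 / 2)\<bar> = \<bar>x\<bar> * (\<alpha>\<^sup>2 / 2)" by (simp add: abs_mult)
    ultimately show ?thesis by linarith
  qed
  have y2n: "(norm y)\<^sup>2 \<le> n\<^sup>2" using n2 by simp
  \<comment> \<open>The axial parts x of u and v cancel up to z . d, because Q is nearly opposite to
    P; what is left is of second order in n.\<close>
  have Nh: "N * h \<le> 18 * n\<^sup>2"
  proof -
    have "N * h = N * x + N * \<epsilon> + N * v" by (simp add: h_def \<epsilon>_def algebra_simps)
    also have "\<dots> \<le> N * x + n\<^sup>2 + (N * s + n\<^sup>2)" using eps2 y2n v2 by linarith
    also have "\<dots> = N * (z \<bullet> d) + 2 * n\<^sup>2" by (simp add: s algebra_simps)
    also have "N * (z \<bullet> d) \<le> N * (n * \<alpha>)" using zd N by (intro mult_left_mono) auto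
    also have "N * (n * \<alpha>) = n * (\<alpha> * N)" by simp
    also have "\<dots> \<le> n * (16 * n)" using n by (intro mult_left_mono) auto
    finally show ?thesis by (simp add: power2_eq_square)
  qed
  define M where "M = N * max 0 (t - N - norm Q + 1)"
  have M: "N * h \<le> M" "0 \<le> M" "M \<le> 18 * n\<^sup>2 + N"
  proof -
    show "N * h \<le> M" unfolding M_def using h N by (intro mult_left_mono) auto
    show "0 \<le> M" using N by (simp add: M_def)
    have "N * (t - N - norm Q + 1) \<le> N * (h + 1)" using h N by (intro mult_left_mono) auto
    then show "M \<le> 18 * n\<^sup>2 + N" using Nh N n by (auto simp: M_def max_def algebra_simps)
  qed
  have Y2: "(Y t)\<^sup>2 = 1 + (\<alpha> * N)\<^sup>2 + M" by (simp add: Y_sq M_def power_mult_distrib)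
  \<comment> \<open>The terms 1, (\<alpha> N)^2 and M of the square of \<open>Y\<close> add up to at
    most (1 + 256 + 18 + 1) n^2, which is less than 17^2 n^2; the last 1 comes from N \<le>
    n^2.\<close>
  have Yn: "Y t \<le> 17 * n"
  proof (rule power2_le_imp_le)
    have "(\<alpha> * N)\<^sup>2 \<le> (16 * n)\<^sup>2" using n N \<alpha>0 by (intro power_mono) auto
    moreover have "1 \<le> n\<^sup>2" using n by simp
    ultimately show "(Y t)\<^sup>2 \<le> (17 * n)\<^sup>2" using M n unfolding Y2 by (simp add: power_mult_distrib)
  qed (use n in simp)
  \<comment> \<open>The layer bounds N \<epsilon> + N (z . d) from above once v is replaced by its
    lower bound s. The mixed term |y| \<alpha> N is then absorbed into |y|^2, at the price of a
    multiple of (\<alpha> N)^2.\<close>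
  have yY: "(norm y)\<^sup>2 \<le> 12 * (Y t)\<^sup>2"
  proof -
    have "N * h = N * x + N * \<epsilon> + N * v" by (simp add: h_def \<epsilon>_def algebra_simps)
    moreover have "N * s \<le> N * v" using v1 N by simp
    ultimately have "N * \<epsilon> + N * (z \<bullet> d) \<le> M" using M(1) by (simp add: s algebra_simps)
    then have 1: "(norm y)\<^sup>2 \<le> 3 * M + 3 * (N * \<bar>z \<bullet> d\<bar>)"
      using eps1 mult_left_mono[OF abs_ge_minus_self[of "z \<bullet> d"], of N] N by simp
    have "N * \<bar>z \<bullet> d\<bar> \<le> N * (\<bar>x\<bar> * (\<alpha>\<^sup>2 / 2) + norm y * \<alpha>)" using zd2 N by (intro mult_left_mono) auto
    also have "\<dots> = \<bar>x\<bar> * (N * (\<alpha>\<^sup>2 / 2)) + norm y * (\<alpha> * N)" by (simp add: algebra_simps)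
    also have "\<bar>x\<bar> * (N * (\<alpha>\<^sup>2 / 2)) \<le> N * (N * (\<alpha>\<^sup>2 / 2))"
      using xn n N by (intro mult_right_mono) auto
    also have "\<dots> = (\<alpha> * N)\<^sup>2 / 2" by (simp add: power2_eq_square)
    also have "norm y * (\<alpha> * N) \<le> (norm y)\<^sup>2 / 6 + 3/2 * (\<alpha> * N)\<^sup>2"
      using zero_le_power2[of "norm y - 3 * (\<alpha> * N)"] by (simp add: power2_eq_square algebra_simps)
    finally have "N * \<bar>z \<bullet> d\<bar> \<le> (norm y)\<^sup>2 / 6 + 2 * (\<alpha> * N)\<^sup>2" by simp
    with 1 have "(norm y)\<^sup>2 \<le> 6 * M + 12 * (\<alpha> * N)\<^sup>2" by simp
    then show ?thesis using M(2) unfolding Y2 by simp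
  qed
  define B where "B = n - \<bar>u\<bar>"
  have B0: "0 \<le> B" using un by (simp add: B_def)
  \<comment> \<open>The gap times n is at most n^2 - u^2, and n^2 - x^2 is |y|^2: the gap vanishes
    quadratically on the axis of P.\<close>
  have B: "B * n \<le> 3 * (norm y)\<^sup>2"
  proof -
    have "B * n \<le> B * (n + \<bar>u\<bar>)" using B0 by (intro mult_left_mono) auto
    also have "\<dots> = n\<^sup>2 - u\<^sup>2" by (simp add: B_def algebra_simps power2_eq_square)
    also have "u = x + \<epsilon>" by (simp add: \<epsilon>_def)
    also have "n\<^sup>2 - (x + \<epsilon>)\<^sup>2 \<le> (norm y)\<^sup>2 - 2 * (x * \<epsilon>)" using n2 by (simp add: power2_sum)
    also have "\<dots> \<le> (norm y)\<^sup>2 + 2 * (N * \<epsilon>)"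
    proof -
      have "(- x) * \<epsilon> \<le> N * \<epsilon>" using eps0 xn n N by (intro mult_right_mono) auto
      then have "- (x * \<epsilon>) \<le> N * \<epsilon>" by simp
      then show ?thesis by linarith
    qed
    also have "\<dots> \<le> 3 * (norm y)\<^sup>2" using eps2 by simp
    finally show ?thesis .
  qed
  have n0: "0 < n" using n by simp
  have Y0: "0 < Y t" using Y_ge_1[of t] by simp
  \<comment> \<open>The gap is quadratic in Y/n with constant 36 = 3 * 12. One factor Y/n is
    replaced by its bound 17, giving 612; the remaining one carries the exponent \<kappa>.\<close>
  have first: "(B / n) powr \<kappa> \<le> 612 powr \<kappa> * (Y t / n) powr \<kappa>"
  proof -
    have "B / n = (B * n) / n\<^sup>2" using n0 by (simp add: power2_eq_square)
    also have "\<dots> \<le> 36 * (Y t)\<^sup>2 / n\<^sup>2" using B yY by (intro divide_right_mono) auto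
    also have "\<dots> = 36 * (Y t / n) * (Y t / n)" by (simp add: power2_eq_square)
    also have "\<dots> \<le> 36 * (Y t / n) * 17" using Yn n0 Y0 by (intro mult_left_mono) (auto simp: field_simps)
    finally have "B / n \<le> 612 * (Y t / n)" by simp
    then have "(B / n) powr \<kappa> \<le> (612 * (Y t / n)) powr \<kappa>" using B0 n0 \<kappa> by (intro powr_mono2) auto
    also have "\<dots> = 612 powr \<kappa> * (Y t / n) powr \<kappa>" using Y0 n0 by (intro powr_mult)
    finally show ?thesis .
  qed
  have second: "n powr (-\<kappa>) \<le> (Y t / n) powr \<kappa>"
  proof -
    have "n powr (-\<kappa>) = (1 / n) powr \<kappa>" using n0 by (simp add: powr_minus powr_divide inverse_eq_divide)
    also have "\<dots> \<le> (Y t / n) powr \<kappa>" using n0 \<kappa> Y_ge_1[of t] by (intro powr_mono2 divide_right_mono) auto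
    finally show ?thesis .
  qed
  have "gap_weight \<kappa> P z = inverse n * ((B / n) powr \<kappa> + n powr (-\<kappa>))"
    using z by (auto simp: gap_weight_def n_def B_def u_def N_def)
  also have "\<dots> \<le> inverse n * (612 powr \<kappa> * (Y t / n) powr \<kappa> + (Y t / n) powr \<kappa>)"
    using first second n0 by (intro mult_left_mono add_mono) auto
  also have "\<dots> = (612 powr \<kappa> + 1) * (n powr (-1-\<kappa>) * Y t powr \<kappa>)"
    using n0 Y0 by (simp add: powr_divide powr_diff powr_minus field_simps)
  \<comment> \<open>Y + |x| is at most 18 n, so the decay in n becomes a decay in x that is
    integrable along the axis.\<close>
  also have "n powr (-1-\<kappa>) \<le> 18 powr (1 + \<kappa>) * (Y t + \<bar>x\<bar>) powr (-1-\<kappa>)"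
  proof -
    have "(18 * n) powr (-(1+\<kappa>)) \<le> (Y t + \<bar>x\<bar>) powr (-(1+\<kappa>))"
      using Yn xn Y0 \<kappa> by (intro powr_mono2') auto
    moreover have "(18 * n) powr (-(1+\<kappa>)) = 18 powr (-(1+\<kappa>)) * n powr (-(1+\<kappa>))"
      using n0 by (simp add: powr_mult)
    ultimately have "18 powr (-(1+\<kappa>)) * n powr (-(1+\<kappa>)) \<le> (Y t + \<bar>x\<bar>) powr (-(1+\<kappa>))" by simp
    then have "18 powr (1+\<kappa>) * (18 powr (-(1+\<kappa>)) * n powr (-(1+\<kappa>))) \<le> 18 powr (1+\<kappa>) * (Y t + \<bar>x\<bar>) powr (-(1+\<kappa>))"
      by (rule mult_left_mono) simp
    then have "n powr (-(1+\<kappa>)) \<le> 18 powr (1+\<kappa>) * (Y t + \<bar>x\<bar>) powr (-(1+\<kappa>))"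
      unfolding mult.assoc[symmetric] powr_add[symmetric] by simp
    then show ?thesis by simp
  qed
  then have "(612 powr \<kappa> + 1) * (n powr (-1-\<kappa>) * Y t powr \<kappa>) \<le> (612 powr \<kappa> + 1) * (18 powr (1 + \<kappa>) * (Y t + \<bar>x\<bar>) powr (-1-\<kappa>) * Y t powr \<kappa>)"
    by (intro mult_left_mono mult_right_mono) auto
  finally show ?thesis by (simp add: x_def mult_ac)
qed

text \<open>For 8\<alpha> \<le> 1 the vector Q points almost along -e: its axial component is at
  most -63/64 |Q| and its orthogonal part at most |Q|/8. A slice orthogonal to e is then covered by
  \<open>emeasure_ellipse_layer\<close>, where only the absolute value of the axial component
  enters.\<close>

private lemma far_slice:
  assumes J: "linear J" "\<And>y. e \<bullet> J y = 0" "\<And>y y'. J y \<bullet> J y' = y \<bullet> (y'::real\<times>real)" "\<And>z. \<exists>y. z = (z \<bullet> e) *\<^sub>R e + J y"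
    and \<alpha>: "8 * \<alpha> \<le> 1" and x: "128 * \<bar>x\<bar> \<le> N"
  shows "emeasure lborel {y. 128 * norm y \<le> N \<and> t \<le> \<phi> (x *\<^sub>R e + J y) \<and> \<phi> (x *\<^sub>R e + J y) \<le> t + 1} \<le> ennreal (64 * pi * N)"
proof -
  note N = basic(1)
  have ee: "e \<bullet> e = 1" using basic(3) by (simp add: norm_eq_1)
  have nJ: "norm (a *\<^sub>R e + J y) = norm (\<bar>a\<bar>, y)" for a y
    using J(2)[of y] ee inner_commute[of "J y" e]
    by (simp add: norm_eq_sqrt_inner inner_add_left inner_add_right J(3) inner_Pair)
  obtain w where w: "Q = (Q \<bullet> e) *\<^sub>R e + J w" using J(4) by blast
  define a where "a = Q \<bullet> e"
  define K where "K = norm Q"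
  have Qa: "K\<^sup>2 = a\<^sup>2 + (norm w)\<^sup>2"
    using nJ[of a w] w by (simp add: a_def[symmetric] K_def norm_Pair)
  have aK: "a = K * (\<alpha>\<^sup>2 / 2 - 1)"
    using alpha_dot ee basic(2) by (simp add: inner_add_right a_def K_def inner_commute field_simps)
  have K: "0 < K" "N \<le> K" using basic by (auto simp: K_def)
  have \<alpha>0: "0 \<le> \<alpha>" by (simp add: \<alpha>_def)
  have \<alpha>2: "64 * \<alpha>\<^sup>2 \<le> 1" using power_mono[OF \<alpha>, of 2] \<alpha>0 by (simp add: power_mult_distrib)
  have wK: "8 * norm w \<le> K"
  proof (rule power2_le_imp_le)
    have "(norm w)\<^sup>2 = K\<^sup>2 - a\<^sup>2" using Qa by simp
    also have "\<dots> = K\<^sup>2 * (\<alpha>\<^sup>2 - \<alpha>\<^sup>2 * \<alpha>\<^sup>2 / 4)" by (simp add: aK power2_eq_square field_simps)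
    also have "\<dots> \<le> K\<^sup>2 * \<alpha>\<^sup>2" by (intro mult_left_mono) auto
    finally have "64 * (norm w)\<^sup>2 \<le> K\<^sup>2 * (64 * \<alpha>\<^sup>2)" by simp
    also have "\<dots> \<le> K\<^sup>2 * 1" using \<alpha>2 by (intro mult_left_mono) auto
    finally show "(8 * norm w)\<^sup>2 \<le> K\<^sup>2" by (simp add: power_mult_distrib)
  qed (use K in simp)
  define A B where "A = N + x" and "B = \<bar>a + x\<bar>"
  have A: "127/128 * N \<le> A" "A \<le> 2 * N" "0 < A" using x N by (auto simp: A_def)
  have "K * (63/64) \<le> K * (1 - \<alpha>\<^sup>2/2)" using \<alpha>2 K by (intro mult_left_mono) auto
  then have "a \<le> - (K * (63/64))" using aK by (simp add: algebra_simps)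
  then have B: "K / 2 \<le> B" using x K by (simp add: B_def)
  have "\<phi> (x *\<^sub>R e + J y) = norm (A, y) + norm (B, y + w)" for y
  proof -
    have 1: "P + (x *\<^sub>R e + J y) = A *\<^sub>R e + J y" by (subst basic(4)) (simp add: A_def algebra_simps)
    have 2: "Q + (x *\<^sub>R e + J y) = (a + x) *\<^sub>R e + J (y + w)"
      by (subst w) (simp add: a_def linear_add[OF J(1)] algebra_simps)
    show ?thesis unfolding \<phi>_def 1 2 nJ using A by (simp add: B_def)
  qed
  then have "emeasure lborel {y. 128 * norm y \<le> N \<and> t \<le> \<phi> (x *\<^sub>R e + J y) \<and> \<phi> (x *\<^sub>R e + J y) \<le> t + 1}
    = emeasure lborel {y. norm y \<le> N / 128 \<and> t \<le> norm (A, y) + norm (B, y + w) \<and> norm (A, y) + norm (B, y + w) \<le> t + 1}"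
    by (simp add: mult.commute field_simps)
  also have "\<dots> \<le> ennreal (32 * pi * A)"
    using A B K wK N by (intro emeasure_ellipse_layer) auto
  also have "\<dots> \<le> ennreal (64 * pi * N)" using A by (intro ennreal_leI) auto
  finally show ?thesis .
qed

text \<open>On a slice orthogonal to P the weight is bounded by a function of the axial coordinate
  alone and the layer has area O(N). The axial integral yields Y^(-\<kappa>), which cancels the
  power of \<open>Y\<close> in the pointwise bound; the result is thus uniform in t and in the
  angle.\<close>

private lemma far:
  assumes \<kappa>: "0 < \<kappa>"
  shows "(\<integral>\<^sup>+z. ennreal (if 16 * norm z \<le> \<alpha> * N then 0 else gap_weight \<kappa> P z) * indicator {t..t+1} (\<phi> z) \<partial>lborel)
    \<le> ennreal (18 powr (1 + \<kappa>) * (612 powr \<kappa> + 1) * (128 * pi / \<kappa>) * N)"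
\<comment> \<open>Since 128 |z| \<le> N on the support of the weight, 16 |z| > \<alpha> N is
  possible only for 8\<alpha> < 1.\<close>
proof (cases "8 * \<alpha> \<le> 1")
  case False
  have "(if 16 * norm z \<le> \<alpha> * N then 0 else gap_weight \<kappa> P z) = 0" for z
  proof (rule ccontr)
    assume "\<not> ?thesis"
    then have "128 * norm z \<le> N" "\<alpha> * N < 16 * norm z" by (auto simp: gap_weight_def N_def split: if_splits)
    then have "(8 * \<alpha>) * N < 1 * N" by simp
    then show False using False basic(1) by simp
  qed
  then show ?thesis by simp
next
  case True
  obtain J :: "real \<times> real \<Rightarrow> real^3" where J: "linear J" "\<And>y. e \<bullet> J y = 0" "\<And>y y'. J y \<bullet> J y' = y \<bullet> y'"
    "\<And>z. \<exists>y. z = (z \<bullet> e) *\<^sub>R e + J y"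
    "\<And>F. F \<in> borel_measurable borel \<Longrightarrow>
       (\<integral>\<^sup>+z. F z \<partial>lborel) = (\<integral>\<^sup>+x. \<integral>\<^sup>+y. F (x *\<^sub>R e + J y) \<partial>lborel \<partial>lborel)"
    using slice[OF basic(3)] by metis
  have [measurable]: "J \<in> borel_measurable borel"
    by (intro borel_measurable_continuous_onI linear_continuous_on linear_linear[THEN iffD2] J(1))
  have ee: "e \<bullet> e = 1" using basic(3) by (simp add: norm_eq_1)
  have xe: "(x *\<^sub>R e + J y) \<bullet> e = x" for x y
    using J(2)[of y] ee inner_commute[of "J y" e] by (simp add: inner_add_left)
  have ny: "norm y \<le> norm (x *\<^sub>R e + J y)" "\<bar>x\<bar> \<le> norm (x *\<^sub>R e + J y)" for x y
  proof -
    have "(norm (x *\<^sub>R e + J y))\<^sup>2 = x\<^sup>2 + (norm y)\<^sup>2"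
      using J(2)[of y] ee inner_commute[of "J y" e] unfolding power2_norm_eq_inner
      by (simp add: inner_add_left inner_add_right J(3) power2_eq_square)
    then have "(norm y)\<^sup>2 \<le> (norm (x *\<^sub>R e + J y))\<^sup>2" "\<bar>x\<bar>\<^sup>2 \<le> (norm (x *\<^sub>R e + J y))\<^sup>2" by simp_all
    then show "norm y \<le> norm (x *\<^sub>R e + J y)" "\<bar>x\<bar> \<le> norm (x *\<^sub>R e + J y)"
      using power2_le_imp_le[of "\<bar>x\<bar>" "norm (x *\<^sub>R e + J y)"] by (auto dest: power2_le_imp_le)
  qed
  define C where "C = 18 powr (1 + \<kappa>) * (612 powr \<kappa> + 1)"
  have C: "0 \<le> C" by (simp add: C_def)
  define W where "W x = C * ((Y t + \<bar>x\<bar>) powr (-1-\<kappa>) * Y t powr \<kappa>)" for x :: real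
  define L where "L x = {y. 128 * norm y \<le> N \<and> t \<le> \<phi> (x *\<^sub>R e + J y) \<and> \<phi> (x *\<^sub>R e + J y) \<le> t + 1}" for x
  have [measurable]: "L x \<in> sets borel" for x unfolding L_def by measurable
  let ?w = "\<lambda>z. ennreal (if 16 * norm z \<le> \<alpha> * N then 0 else gap_weight \<kappa> P z)"
  have pt: "?w (x *\<^sub>R e + J y) * indicator {t..t+1} (\<phi> (x *\<^sub>R e + J y))
     \<le> (if 128 * \<bar>x\<bar> \<le> N then ennreal (W x) * indicator (L x) y else 0)" for x y
  proof (cases "?w (x *\<^sub>R e + J y) \<noteq> 0 \<and> \<phi> (x *\<^sub>R e + J y) \<in> {t..t+1}")
    case True
    let ?z = "x *\<^sub>R e + J y"
    have z: "1 \<le> norm ?z" "N \<le> (norm ?z)\<^sup>2" "128 * norm ?z \<le> N" "\<alpha> * N < 16 * norm ?z"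
      using True by (auto simp: gap_weight_def N_def split: if_splits)
    have t: "t \<le> \<phi> ?z" "\<phi> ?z \<le> t + 1" using True by auto
    have "gap_weight \<kappa> P ?z \<le> W x" using far_pointwise[OF \<kappa> z t] by (simp add: xe W_def C_def)
    then have "?w ?z \<le> ennreal (W x)" by (auto intro: ennreal_leI order_trans[OF _ gap_weight_nonneg])
    moreover have "128 * \<bar>x\<bar> \<le> N" "128 * norm y \<le> N" using ny[where x=x and y=y] z by linarith+
    ultimately show ?thesis using t by (simp add: L_def)
  qed (auto simp: indicator_def)
  have "(\<integral>\<^sup>+z. ?w z * indicator {t..t+1} (\<phi> z) \<partial>lborel)
    = (\<integral>\<^sup>+x. \<integral>\<^sup>+y. ?w (x *\<^sub>R e + J y) * indicator {t..t+1} (\<phi> (x *\<^sub>R e + J y)) \<partial>lborel \<partial>lborel)"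
    by (rule J(5)) simp
  also have "\<dots> \<le> (\<integral>\<^sup>+x. ennreal (64 * pi * N) * ennreal (W x) \<partial>lborel)"
  proof (rule nn_integral_mono)
    fix x
    have "(\<integral>\<^sup>+y. ?w (x *\<^sub>R e + J y) * indicator {t..t+1} (\<phi> (x *\<^sub>R e + J y)) \<partial>lborel)
       \<le> (\<integral>\<^sup>+y. (if 128 * \<bar>x\<bar> \<le> N then ennreal (W x) * indicator (L x) y else 0) \<partial>lborel)"
      by (intro nn_integral_mono pt)
    also have "\<dots> \<le> ennreal (64 * pi * N) * ennreal (W x)"
    proof (cases "128 * \<bar>x\<bar> \<le> N")
      case x: True
      have "emeasure lborel (L x) \<le> ennreal (64 * pi * N)"
        unfolding L_def by (rule far_slice[OF J(1-4) True x])
      then show ?thesis using x by (simp add: nn_integral_cmult_indicator mult.commute mult_left_mono)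
    qed auto
    finally show "(\<integral>\<^sup>+y. ?w (x *\<^sub>R e + J y) * indicator {t..t+1} (\<phi> (x *\<^sub>R e + J y)) \<partial>lborel) \<le> ennreal (64 * pi * N) * ennreal (W x)" .
  qed
  also have "\<dots> = ennreal (64 * pi * N * (C * Y t powr \<kappa>)) * (\<integral>\<^sup>+x. ennreal ((Y t + \<bar>x\<bar>) powr (-1-\<kappa>)) \<partial>lborel)"
  proof -
    have "ennreal (64 * pi * N) * ennreal (W x) = ennreal (64 * pi * N * (C * Y t powr \<kappa>)) * ennreal ((Y t + \<bar>x\<bar>) powr (-1-\<kappa>))" for x
      using C basic(1) by (simp add: ennreal_mult[symmetric] W_def mult_ac)
    then show ?thesis by (simp add: nn_integral_cmult)
  qed
  also have "\<dots> \<le> ennreal (64 * pi * N * (C * Y t powr \<kappa>)) * ennreal (2 * Y t powr (-\<kappa>) / \<kappa>)"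
    using Y_ge_1[of t] \<kappa> by (intro mult_left_mono nn_integral_tail) auto
  also have "\<dots> = ennreal (C * (128 * pi / \<kappa>) * N)"
  proof -
    have "Y t powr \<kappa> * Y t powr (-\<kappa>) = 1" using Y_ge_1[of t] by (simp add: powr_add[symmetric])
    then have "64 * pi * N * (C * Y t powr \<kappa>) * (2 * Y t powr (-\<kappa>) / \<kappa>) = C * (128 * pi / \<kappa>) * N"
      by (simp add: field_simps)
    then show ?thesis using C basic(1) \<kappa> by (simp add: ennreal_mult[symmetric])
  qed
  finally show ?thesis by (simp add: C_def)
qed

text \<open>The split at |z| = \<alpha> N / 16 is made where the control of the gradient by
  \<open>norm_sum_transversal\<close> ends. Both sides cost a multiple of N, whatever the direction
  and the length of Q.\<close>

lemma gap_weight_layers: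
  assumes p: "1 < p" and \<kappa>: "0 < \<kappa>"
  shows "(\<integral>\<^sup>+z. ennreal (gap_weight \<kappa> P z) * ennreal (jbr (\<tau> - (norm (P + z) + norm (Q + z))) powr (-p)) \<partial>lborel)
    \<le> ennreal (2 powr p * jconst p * (pi + 18 powr (1 + \<kappa>) * (612 powr \<kappa> + 1) * (128 * pi / \<kappa>)) * norm P)"
proof -
  define C where "C = 18 powr (1 + \<kappa>) * (612 powr \<kappa> + 1) * (128 * pi / \<kappa>)"
  have C: "0 \<le> C" using \<kappa> by (simp add: C_def)
  have "(\<integral>\<^sup>+z. ennreal (gap_weight \<kappa> P z) * indicator {t..t+1} (\<phi> z) \<partial>lborel) \<le> ennreal ((pi + C) * N)" for t
  proof -
    have "(\<integral>\<^sup>+z. ennreal (gap_weight \<kappa> P z) * indicator {t..t+1} (\<phi> z) \<partial>lborel)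
      = (\<integral>\<^sup>+z. ennreal (if 16 * norm z \<le> \<alpha> * N then gap_weight \<kappa> P z else 0) * indicator {t..t+1} (\<phi> z)
          + ennreal (if 16 * norm z \<le> \<alpha> * N then 0 else gap_weight \<kappa> P z) * indicator {t..t+1} (\<phi> z) \<partial>lborel)"
      by (intro nn_integral_cong) auto
    also have "\<dots> = (\<integral>\<^sup>+z. ennreal (if 16 * norm z \<le> \<alpha> * N then gap_weight \<kappa> P z else 0) * indicator {t..t+1} (\<phi> z) \<partial>lborel)
          + (\<integral>\<^sup>+z. ennreal (if 16 * norm z \<le> \<alpha> * N then 0 else gap_weight \<kappa> P z) * indicator {t..t+1} (\<phi> z) \<partial>lborel)"
      by (rule nn_integral_add) auto
    also have "\<dots> \<le> ennreal (pi * N) + ennreal (C * N)"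
      unfolding C_def by (intro add_mono near far \<kappa>)
    also have "\<dots> = ennreal ((pi + C) * N)" using basic(1) C by (simp add: ennreal_plus[symmetric] algebra_simps del: ennreal_plus)
    finally show ?thesis .
  qed
  then have "(\<integral>\<^sup>+z. ennreal (gap_weight \<kappa> P z) * ennreal (jbr (\<tau> - \<phi> z) powr (-p)) \<partial>lborel) \<le> ennreal (2 powr p * jconst p) * ennreal ((pi + C) * N)"
    by (intro nn_integral_layers p) auto
  also have "\<dots> = ennreal (2 powr p * jconst p * (pi + C) * N)"
    using jconst_nonneg[OF p] C basic(1) by (simp add: ennreal_mult[symmetric] mult_ac)
  finally show ?thesis by (simp add: C_def N_def \<phi>_def)
qed

end

subsection \<open>Bilinear convolutions with a kernel\<close>

definition bilin :: "('a::euclidean_space \<Rightarrow> 'a \<Rightarrow> real) \<Rightarrow> ('a \<Rightarrow> ennreal) \<Rightarrow> ('a \<Rightarrow> ennreal) \<Rightarrow> 'a \<Rightarrow> ennreal" where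
  "bilin K f g X = (\<integral>\<^sup>+Y. f Y * g (X - Y) * ennreal (K Y (X - Y)) \<partial>lborel)"

text \<open>Stated for squares of norms and for all non-negative measurable functions, so that
  neither roots nor integrability conditions enter; the kernel is a function of the two inputs, and
  the output is their sum.\<close>

definition l2_bounded :: "('a::euclidean_space \<Rightarrow> 'a \<Rightarrow> real) \<Rightarrow> bool" where
  "l2_bounded K \<longleftrightarrow> (\<exists>C\<ge>0. \<forall>f\<in>borel_measurable borel. \<forall>g\<in>borel_measurable borel.
     (\<integral>\<^sup>+X. (bilin K f g X)\<^sup>2 \<partial>lborel) \<le> ennreal C * ((\<integral>\<^sup>+X. (f X)\<^sup>2 \<partial>lborel) * (\<integral>\<^sup>+X. (g X)\<^sup>2 \<partial>lborel)))"

lemma measurable_curried: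
  assumes "case_prod K \<in> borel_measurable (borel :: ('a::second_countable_topology \<times> 'b::second_countable_topology) measure)"
    and [measurable]: "p \<in> borel_measurable M" "q \<in> borel_measurable M"
  shows "(\<lambda>x. K (p x) (q x)) \<in> borel_measurable M"
proof -
  have "(\<lambda>x. (p x, q x)) \<in> measurable M borel" by measurable
  from measurable_compose[OF this assms(1)] show ?thesis by simp
qed

lemma bilin_measurable:
  fixes f g :: "'a::euclidean_space \<Rightarrow> ennreal"
  assumes [measurable]: "f \<in> borel_measurable borel" "g \<in> borel_measurable borel"
    and K: "case_prod K \<in> borel_measurable borel"
  shows "bilin K f g \<in> borel_measurable borel"
proof -
  note [measurable] = measurable_curried[OF K]
  have "(\<lambda>X. \<integral>\<^sup>+Y. f Y * g (X - Y) * ennreal (K Y (X - Y)) \<partial>lborel) \<in> borel_measurable borel"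
    by measurable
  then show ?thesis by (simp add: bilin_def[abs_def])
qed

lemma l2_bounded_mono:
  assumes K: "l2_bounded K'" and c: "0 \<le> c"
    and le: "\<And>X Y. K X Y \<le> c * K' X Y" and nn: "\<And>X Y. 0 \<le> K' X Y" and m: "case_prod K' \<in> borel_measurable borel"
  shows "l2_bounded K"
proof -
  note [measurable] = measurable_curried[OF m]
  obtain C where C: "0 \<le> C" "\<And>f g. f \<in> borel_measurable borel \<Longrightarrow> g \<in> borel_measurable borel \<Longrightarrow>
     (\<integral>\<^sup>+X. (bilin K' f g X)\<^sup>2 \<partial>lborel) \<le> ennreal C * ((\<integral>\<^sup>+X. (f X)\<^sup>2 \<partial>lborel) * (\<integral>\<^sup>+X. (g X)\<^sup>2 \<partial>lborel))"
    using K unfolding l2_bounded_def by blast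
  have "(\<integral>\<^sup>+X. (bilin K f g X)\<^sup>2 \<partial>lborel) \<le> ennreal (c\<^sup>2 * C) * ((\<integral>\<^sup>+X. (f X)\<^sup>2 \<partial>lborel) * (\<integral>\<^sup>+X. (g X)\<^sup>2 \<partial>lborel))"
    if fg[measurable]: "f \<in> borel_measurable borel" "g \<in> borel_measurable borel" for f g
  proof -
    note [measurable] = bilin_measurable[OF fg m]
    have "bilin K f g X \<le> ennreal c * bilin K' f g X" for X
    proof -
      have "bilin K f g X \<le> (\<integral>\<^sup>+Y. ennreal c * (f Y * g (X - Y) * ennreal (K' Y (X - Y))) \<partial>lborel)"
        unfolding bilin_def
      proof (rule nn_integral_mono)
        fix Y
        have "ennreal (K Y (X - Y)) \<le> ennreal c * ennreal (K' Y (X - Y))"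
          using le[of Y "X - Y"] c nn by (simp add: ennreal_mult[symmetric] ennreal_leI)
        then have "f Y * g (X - Y) * ennreal (K Y (X - Y)) \<le> f Y * g (X - Y) * (ennreal c * ennreal (K' Y (X - Y)))"
          by (rule mult_left_mono) simp
        then show "f Y * g (X - Y) * ennreal (K Y (X - Y)) \<le> ennreal c * (f Y * g (X - Y) * ennreal (K' Y (X - Y)))"
          by (simp add: mult_ac)
      qed
      also have "\<dots> = ennreal c * bilin K' f g X"
        unfolding bilin_def by (rule nn_integral_cmult) measurable
      finally show ?thesis .
    qed
    then have "(\<integral>\<^sup>+X. (bilin K f g X)\<^sup>2 \<partial>lborel) \<le> (\<integral>\<^sup>+X. (ennreal c * bilin K' f g X)\<^sup>2 \<partial>lborel)"
      by (intro nn_integral_mono power_mono) auto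
    also have "\<dots> = ennreal (c\<^sup>2) * (\<integral>\<^sup>+X. (bilin K' f g X)\<^sup>2 \<partial>lborel)"
      using c by (simp add: power_mult_distrib ennreal_power nn_integral_cmult)
    also have "\<dots> \<le> ennreal (c\<^sup>2) * (ennreal C * ((\<integral>\<^sup>+X. (f X)\<^sup>2 \<partial>lborel) * (\<integral>\<^sup>+X. (g X)\<^sup>2 \<partial>lborel)))"
      by (intro mult_left_mono C) auto
    also have "\<dots> = ennreal (c\<^sup>2 * C) * ((\<integral>\<^sup>+X. (f X)\<^sup>2 \<partial>lborel) * (\<integral>\<^sup>+X. (g X)\<^sup>2 \<partial>lborel))"
      using C(1) by (simp add: ennreal_mult mult.assoc)
    finally show ?thesis .
  qed
  moreover have "0 \<le> c\<^sup>2 * C" using C(1) by simp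
  ultimately show ?thesis unfolding l2_bounded_def by blast
qed

lemma ennreal_power2_add_le:
  fixes a b :: ennreal shows "(a + b)\<^sup>2 \<le> 2 * a\<^sup>2 + 2 * b\<^sup>2"
proof (cases "a = \<top> \<or> b = \<top>")
  case True
  then show ?thesis by (auto simp: power2_eq_square ennreal_mult_top ennreal_top_mult)
next
  case False
  then obtain r s where "a = ennreal r" "0 \<le> r" "b = ennreal s" "0 \<le> s"
    by (metis ennreal_cases)
  moreover have "(r + s)\<^sup>2 \<le> 2 * r\<^sup>2 + 2 * s\<^sup>2"
    using zero_le_power2[of "r - s"] by (simp add: power2_diff power2_sum)
  ultimately show ?thesis
    by (simp add: ennreal_power ennreal_plus[symmetric] ennreal_mult[symmetric] ennreal_numeral[symmetric] del: ennreal_plus ennreal_numeral)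
qed

lemma ennreal_mult_le_squares:
  fixes a b :: ennreal shows "2 * (a * b) \<le> a\<^sup>2 + b\<^sup>2"
proof (cases "a = \<top> \<or> b = \<top>")
  case True
  then show ?thesis by (auto simp: power2_eq_square ennreal_mult_top ennreal_top_mult)
next
  case False
  then obtain r s where "a = ennreal r" "0 \<le> r" "b = ennreal s" "0 \<le> s"
    by (metis ennreal_cases)
  moreover have "2 * (r * s) \<le> r\<^sup>2 + s\<^sup>2"
    using zero_le_power2[of "r - s"] by (simp add: power2_diff)
  ultimately show ?thesis
    by (simp add: ennreal_power ennreal_plus[symmetric] ennreal_mult[symmetric] ennreal_numeral[symmetric] del: ennreal_plus ennreal_numeral)
qed

lemma l2_bounded_add:
  fixes K1 K2 :: "'a::euclidean_space \<Rightarrow> 'a \<Rightarrow> real"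
  assumes 1: "l2_bounded K1" and 2: "l2_bounded K2"
    and nn: "\<And>X Y. 0 \<le> K1 X Y" "\<And>X Y. 0 \<le> K2 X Y"
    and m: "case_prod K1 \<in> borel_measurable borel" "case_prod K2 \<in> borel_measurable borel"
  shows "l2_bounded (\<lambda>X Y. K1 X Y + K2 X Y)"
proof -
  note [measurable] = measurable_curried[OF m(1)] measurable_curried[OF m(2)]
  obtain C1 where C1: "0 \<le> C1" "\<And>f g. f \<in> borel_measurable borel \<Longrightarrow> g \<in> borel_measurable borel \<Longrightarrow>
     (\<integral>\<^sup>+X. (bilin K1 f g X)\<^sup>2 \<partial>lborel) \<le> ennreal C1 * ((\<integral>\<^sup>+X. (f X)\<^sup>2 \<partial>lborel) * (\<integral>\<^sup>+X. (g X)\<^sup>2 \<partial>lborel))"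
    using 1 unfolding l2_bounded_def by blast
  obtain C2 where C2: "0 \<le> C2" "\<And>f g. f \<in> borel_measurable borel \<Longrightarrow> g \<in> borel_measurable borel \<Longrightarrow>
     (\<integral>\<^sup>+X. (bilin K2 f g X)\<^sup>2 \<partial>lborel) \<le> ennreal C2 * ((\<integral>\<^sup>+X. (f X)\<^sup>2 \<partial>lborel) * (\<integral>\<^sup>+X. (g X)\<^sup>2 \<partial>lborel))"
    using 2 unfolding l2_bounded_def by blast
  have "(\<integral>\<^sup>+X. (bilin (\<lambda>X Y. K1 X Y + K2 X Y) f g X)\<^sup>2 \<partial>lborel) \<le> ennreal (2 * C1 + 2 * C2) * ((\<integral>\<^sup>+X. (f X)\<^sup>2 \<partial>lborel) * (\<integral>\<^sup>+X. (g X)\<^sup>2 \<partial>lborel))"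
    if fg[measurable]: "f \<in> borel_measurable borel" "g \<in> borel_measurable borel" for f g
  proof -
    note [measurable] = bilin_measurable[OF fg m(1)] bilin_measurable[OF fg m(2)]
    let ?P = "(\<integral>\<^sup>+X. (f X)\<^sup>2 \<partial>lborel) * (\<integral>\<^sup>+X. (g X)\<^sup>2 \<partial>lborel)"
    have "bilin (\<lambda>X Y. K1 X Y + K2 X Y) f g X = bilin K1 f g X + bilin K2 f g X" for X
      unfolding bilin_def using nn by (simp add: distrib_left nn_integral_add)
    then have "(\<integral>\<^sup>+X. (bilin (\<lambda>X Y. K1 X Y + K2 X Y) f g X)\<^sup>2 \<partial>lborel)
        \<le> (\<integral>\<^sup>+X. 2 * (bilin K1 f g X)\<^sup>2 + 2 * (bilin K2 f g X)\<^sup>2 \<partial>lborel)"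
      by (intro nn_integral_mono) (simp add: ennreal_power2_add_le)
    also have "\<dots> = 2 * (\<integral>\<^sup>+X. (bilin K1 f g X)\<^sup>2 \<partial>lborel) + 2 * (\<integral>\<^sup>+X. (bilin K2 f g X)\<^sup>2 \<partial>lborel)"
      by (simp add: nn_integral_add nn_integral_cmult)
    also have "\<dots> \<le> 2 * (ennreal C1 * ?P) + 2 * (ennreal C2 * ?P)"
      by (intro add_mono mult_left_mono C1 C2 fg) auto
    also have "\<dots> = ennreal (2 * C1 + 2 * C2) * ?P"
      using C1(1) C2(1) by (simp add: ennreal_mult distrib_right mult.assoc)
    finally show ?thesis .
  qed
  moreover have "0 \<le> 2 * C1 + 2 * C2" using C1 C2 by simp
  ultimately show ?thesis unfolding l2_bounded_def by blast
qed

lemma l2_bounded_sum: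
  fixes K :: "'i \<Rightarrow> 'a::euclidean_space \<Rightarrow> 'a \<Rightarrow> real"
  assumes "finite I" and "\<And>i. i \<in> I \<Longrightarrow> l2_bounded (K i)"
    and "\<And>i X Y. i \<in> I \<Longrightarrow> 0 \<le> K i X Y" and "\<And>i. i \<in> I \<Longrightarrow> case_prod (K i) \<in> borel_measurable borel"
  shows "l2_bounded (\<lambda>X Y. \<Sum>i\<in>I. K i X Y)"
  using assms
proof (induction rule: finite_induct)
  case empty
  show ?case unfolding l2_bounded_def by (auto simp: bilin_def intro!: exI[of _ 0])
next
  case (insert i I)
  have "(\<lambda>z. \<Sum>j\<in>I. case_prod (K j) z) \<in> borel_measurable borel"
    using insert.prems by (intro borel_measurable_sum) auto
  moreover have "(\<lambda>z. \<Sum>j\<in>I. case_prod (K j) z) = (\<lambda>(X, Y). \<Sum>j\<in>I. K j X Y)" by auto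
  ultimately have "l2_bounded (\<lambda>X Y. K i X Y + (\<Sum>j\<in>I. K j X Y))"
    using insert.prems by (intro l2_bounded_add insert.IH) (auto intro: sum_nonneg)
  then show ?case using insert.hyps by simp
qed

lemma l2_bounded_swap:
  fixes K :: "'a::euclidean_space \<Rightarrow> 'a \<Rightarrow> real"
  assumes K: "l2_bounded K" and m: "case_prod K \<in> borel_measurable borel"
  shows "l2_bounded (\<lambda>X Y. K Y X)"
proof -
  note [measurable] = measurable_curried[OF m]
  have "bilin (\<lambda>X Y. K Y X) f g X = bilin K g f X"
    if [measurable]: "f \<in> borel_measurable borel" "g \<in> borel_measurable borel" for f g X
  proof -
    have "bilin K g f X = (\<integral>\<^sup>+Y. g Y * f (X - Y) * ennreal (K Y (X - Y)) \<partial>lborel)" by (simp add: bilin_def)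
    also have "\<dots> = (\<integral>\<^sup>+Y. g (X - Y) * f (X - (X - Y)) * ennreal (K (X - Y) (X - (X - Y))) \<partial>lborel)"
      by (rule nn_integral_reflect[symmetric]) measurable
    finally show ?thesis by (simp add: bilin_def mult_ac)
  qed
  note eq = this
  obtain C where C: "0 \<le> C" "\<And>f g. f \<in> borel_measurable borel \<Longrightarrow> g \<in> borel_measurable borel \<Longrightarrow>
     (\<integral>\<^sup>+X. (bilin K f g X)\<^sup>2 \<partial>lborel) \<le> ennreal C * ((\<integral>\<^sup>+X. (f X)\<^sup>2 \<partial>lborel) * (\<integral>\<^sup>+X. (g X)\<^sup>2 \<partial>lborel))"
    using K unfolding l2_bounded_def by blast
  show ?thesis unfolding l2_bounded_def
  proof (intro exI[of _ C] conjI ballI C(1))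
    fix f g :: "'a \<Rightarrow> ennreal" assume fg: "f \<in> borel_measurable borel" "g \<in> borel_measurable borel"
    show "(\<integral>\<^sup>+X. (bilin (\<lambda>X Y. K Y X) f g X)\<^sup>2 \<partial>lborel) \<le> ennreal C * ((\<integral>\<^sup>+X. (f X)\<^sup>2 \<partial>lborel) * (\<integral>\<^sup>+X. (g X)\<^sup>2 \<partial>lborel))"
      using C(2)[OF fg(2,1)] by (simp add: eq[OF fg] mult.commute)
  qed
qed

lemma nn_integral_translate_diff:
  fixes f :: "'a::euclidean_space \<Rightarrow> ennreal"
  assumes "f \<in> borel_measurable borel"
  shows "(\<integral>\<^sup>+x. f (x - c) \<partial>lborel) = (\<integral>\<^sup>+x. f x \<partial>lborel)"
  using nn_integral_translate[OF assms, of "- c"] by simp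

lemma nn_integral_convolution:
  fixes f g :: "'a::euclidean_space \<Rightarrow> ennreal"
  assumes [measurable]: "f \<in> borel_measurable borel" "g \<in> borel_measurable borel"
  shows "(\<integral>\<^sup>+X. \<integral>\<^sup>+Y. f Y * g (X - Y) \<partial>lborel \<partial>lborel) = (\<integral>\<^sup>+X. f X \<partial>lborel) * (\<integral>\<^sup>+X. g X \<partial>lborel)"
proof -
  have "(\<integral>\<^sup>+X. \<integral>\<^sup>+Y. f Y * g (X - Y) \<partial>lborel \<partial>lborel) = (\<integral>\<^sup>+Y. \<integral>\<^sup>+X. f Y * g (X - Y) \<partial>lborel \<partial>lborel)"
    by (subst lborel_pair.Fubini') auto
  also have "\<dots> = (\<integral>\<^sup>+Y. f Y * (\<integral>\<^sup>+X. g X \<partial>lborel) \<partial>lborel)"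
    by (intro nn_integral_cong) (subst nn_integral_cmult, auto simp: nn_integral_translate_diff[of g])
  also have "\<dots> = (\<integral>\<^sup>+X. f X \<partial>lborel) * (\<integral>\<^sup>+X. g X \<partial>lborel)"
    by (simp add: nn_integral_multc)
  finally show ?thesis .
qed

text \<open>Cauchy-Schwarz at a fixed output, with the product of f and g against the kernel. What
  remains is the convolution of the squares of f and g, whose integral factorises.\<close>

lemma l2_bounded_output:
  fixes K :: "'a::euclidean_space \<Rightarrow> 'a \<Rightarrow> real"
  assumes m: "case_prod K \<in> borel_measurable borel" and C: "0 \<le> C"
    and b: "\<And>X. (\<integral>\<^sup>+Y. (ennreal (K Y (X - Y)))\<^sup>2 \<partial>lborel) \<le> ennreal C"
  shows "l2_bounded K"
proof -
  note [measurable] = measurable_curried[OF m]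
  have "(\<integral>\<^sup>+X. (bilin K f g X)\<^sup>2 \<partial>lborel) \<le> ennreal C * ((\<integral>\<^sup>+X. (f X)\<^sup>2 \<partial>lborel) * (\<integral>\<^sup>+X. (g X)\<^sup>2 \<partial>lborel))"
    if [measurable]: "f \<in> borel_measurable borel" "g \<in> borel_measurable borel" for f g
  proof -
    have "(bilin K f g X)\<^sup>2 \<le> ennreal C * (\<integral>\<^sup>+Y. (f Y)\<^sup>2 * (g (X - Y))\<^sup>2 \<partial>lborel)" for X
    proof -
      have "(bilin K f g X)\<^sup>2 \<le> (\<integral>\<^sup>+Y. (f Y * g (X - Y))\<^sup>2 \<partial>lborel) * (\<integral>\<^sup>+Y. (ennreal (K Y (X - Y)))\<^sup>2 \<partial>lborel)"
        unfolding bilin_def by (rule Cauchy_Schwarz_nn_integral) measurable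
      also have "\<dots> \<le> (\<integral>\<^sup>+Y. (f Y * g (X - Y))\<^sup>2 \<partial>lborel) * ennreal C"
        by (intro mult_left_mono b) simp
      finally show ?thesis by (simp add: power_mult_distrib mult.commute)
    qed
    then have "(\<integral>\<^sup>+X. (bilin K f g X)\<^sup>2 \<partial>lborel) \<le> (\<integral>\<^sup>+X. ennreal C * (\<integral>\<^sup>+Y. (f Y)\<^sup>2 * (g (X - Y))\<^sup>2 \<partial>lborel) \<partial>lborel)"
      by (rule nn_integral_mono)
    also have "\<dots> = ennreal C * (\<integral>\<^sup>+X. (\<integral>\<^sup>+Y. (f Y)\<^sup>2 * (g (X - Y))\<^sup>2 \<partial>lborel) \<partial>lborel)"
      by (rule nn_integral_cmult) measurable
    also have "\<dots> = ennreal C * ((\<integral>\<^sup>+X. (f X)\<^sup>2 \<partial>lborel) * (\<integral>\<^sup>+X. (g X)\<^sup>2 \<partial>lborel))"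
      by (subst nn_integral_convolution) auto
    finally show ?thesis .
  qed
  then show ?thesis using C unfolding l2_bounded_def by blast
qed

text \<open>Cauchy-Schwarz with g alone against f K: the norm of g leaves the integral, and after
  Fubini the kernel is integrated over the second input at a fixed first input.\<close>

lemma l2_bounded_input:
  fixes K :: "'a::euclidean_space \<Rightarrow> 'a \<Rightarrow> real"
  assumes m: "case_prod K \<in> borel_measurable borel" and C: "0 \<le> C"
    and b: "\<And>Y. (\<integral>\<^sup>+X. (ennreal (K Y X))\<^sup>2 \<partial>lborel) \<le> ennreal C"
  shows "l2_bounded K"
proof -
  note [measurable] = measurable_curried[OF m]
  have "(\<integral>\<^sup>+X. (bilin K f g X)\<^sup>2 \<partial>lborel) \<le> ennreal C * ((\<integral>\<^sup>+X. (f X)\<^sup>2 \<partial>lborel) * (\<integral>\<^sup>+X. (g X)\<^sup>2 \<partial>lborel))"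
    if [measurable]: "f \<in> borel_measurable borel" "g \<in> borel_measurable borel" for f g
  proof -
    let ?G = "\<integral>\<^sup>+X. (g X)\<^sup>2 \<partial>lborel"
    have "(bilin K f g X)\<^sup>2 \<le> ?G * (\<integral>\<^sup>+Y. (f Y)\<^sup>2 * (ennreal (K Y (X - Y)))\<^sup>2 \<partial>lborel)" for X
    proof -
      have "(bilin K f g X)\<^sup>2 = (\<integral>\<^sup>+Y. g (X - Y) * (f Y * ennreal (K Y (X - Y))) \<partial>lborel)\<^sup>2"
        unfolding bilin_def by (simp add: mult_ac)
      also have "\<dots> \<le> (\<integral>\<^sup>+Y. (g (X - Y))\<^sup>2 \<partial>lborel) * (\<integral>\<^sup>+Y. (f Y * ennreal (K Y (X - Y)))\<^sup>2 \<partial>lborel)"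
        by (rule Cauchy_Schwarz_nn_integral) measurable
      also have "(\<integral>\<^sup>+Y. (g (X - Y))\<^sup>2 \<partial>lborel) = ?G"
        by (rule nn_integral_reflect[of "\<lambda>Y. (g Y)\<^sup>2"]) measurable
      finally show ?thesis by (simp add: power_mult_distrib)
    qed
    then have "(\<integral>\<^sup>+X. (bilin K f g X)\<^sup>2 \<partial>lborel) \<le> (\<integral>\<^sup>+X. ?G * (\<integral>\<^sup>+Y. (f Y)\<^sup>2 * (ennreal (K Y (X - Y)))\<^sup>2 \<partial>lborel) \<partial>lborel)"
      by (rule nn_integral_mono)
    also have "\<dots> = ?G * (\<integral>\<^sup>+X. (\<integral>\<^sup>+Y. (f Y)\<^sup>2 * (ennreal (K Y (X - Y)))\<^sup>2 \<partial>lborel) \<partial>lborel)"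
      by (rule nn_integral_cmult) measurable
    finally have 1: "(\<integral>\<^sup>+X. (bilin K f g X)\<^sup>2 \<partial>lborel)
      \<le> ?G * (\<integral>\<^sup>+X. (\<integral>\<^sup>+Y. (f Y)\<^sup>2 * (ennreal (K Y (X - Y)))\<^sup>2 \<partial>lborel) \<partial>lborel)" .
    have "(\<integral>\<^sup>+X. (\<integral>\<^sup>+Y. (f Y)\<^sup>2 * (ennreal (K Y (X - Y)))\<^sup>2 \<partial>lborel) \<partial>lborel)
       = (\<integral>\<^sup>+Y. (\<integral>\<^sup>+X. (f Y)\<^sup>2 * (ennreal (K Y (X - Y)))\<^sup>2 \<partial>lborel) \<partial>lborel)"
      by (subst lborel_pair.Fubini') auto
    also have "\<dots> = (\<integral>\<^sup>+Y. (f Y)\<^sup>2 * (\<integral>\<^sup>+X. (ennreal (K Y X))\<^sup>2 \<partial>lborel) \<partial>lborel)"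
      by (intro nn_integral_cong) (subst nn_integral_cmult, auto simp: nn_integral_translate_diff[of "\<lambda>X. (ennreal (K Y X))\<^sup>2" for Y])
    also have "\<dots> \<le> (\<integral>\<^sup>+Y. (f Y)\<^sup>2 * ennreal C \<partial>lborel)"
      by (intro nn_integral_mono mult_left_mono b) simp
    also have "\<dots> = (\<integral>\<^sup>+X. (f X)\<^sup>2 \<partial>lborel) * ennreal C"
      by (rule nn_integral_multc) measurable
    finally have "?G * (\<integral>\<^sup>+X. (\<integral>\<^sup>+Y. (f Y)\<^sup>2 * (ennreal (K Y (X - Y)))\<^sup>2 \<partial>lborel) \<partial>lborel)
      \<le> ?G * ((\<integral>\<^sup>+X. (f X)\<^sup>2 \<partial>lborel) * ennreal C)"
      by (rule mult_left_mono) simp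
    with 1 show ?thesis by (simp add: mult_ac)
  qed
  then show ?thesis using C unfolding l2_bounded_def by blast
qed

text \<open>Expanding the square of \<open>bilin\<close> gives an integral over \<open>X1 + X2 = X3 + X4\<close>; here the four
  factors are regrouped as \<open>(X1, X4)\<close> and \<open>(X2, X3)\<close>, which exchanges the cases of equal and of
  opposite signs of the two wave cones.\<close>

lemma l2_bounded_regroup:
  fixes W :: "'a::euclidean_space \<Rightarrow> 'a \<Rightarrow> real"
  assumes W: "case_prod W \<in> borel_measurable borel" "\<And>X Y. 0 \<le> W X Y"
    and m[measurable]: "m1 \<in> borel_measurable borel" "m2 \<in> borel_measurable borel" "\<And>X. 0 \<le> m1 X" "\<And>X. 0 \<le> m2 X"
    and C: "0 \<le> C"
    and b: "\<And>Y Z. (\<integral>\<^sup>+X. ennreal (W Y (X - Y) * W (X - Z) Z) * ennreal ((m2 (X - Y))\<^sup>2 * (m1 (X - Z))\<^sup>2) \<partial>lborel) \<le> ennreal C"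
  shows "l2_bounded (\<lambda>X Y. W X Y * (m1 X * m2 Y))"
proof -
  note [measurable] = measurable_curried[OF W(1)]
  have "(\<integral>\<^sup>+X. (bilin (\<lambda>X Y. W X Y * (m1 X * m2 Y)) f g X)\<^sup>2 \<partial>lborel) \<le> ennreal C * ((\<integral>\<^sup>+X. (f X)\<^sup>2 \<partial>lborel) * (\<integral>\<^sup>+X. (g X)\<^sup>2 \<partial>lborel))"
    if [measurable]: "f \<in> borel_measurable borel" "g \<in> borel_measurable borel" for f g
  proof -
    define T where "T X = bilin (\<lambda>X Y. W X Y * (m1 X * m2 Y)) f g X" for X
    define A where "A X Y Z = (f Y)\<^sup>2 * (g (X - Z))\<^sup>2 * (ennreal (W Y (X - Y) * W Z (X - Z)) * ennreal ((m2 (X - Y))\<^sup>2 * (m1 Z)\<^sup>2))" for X Y Z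
    define u where "u X Y = f Y * g (X - Y) * ennreal (W Y (X - Y) * (m1 Y * m2 (X - Y)))" for X Y
    have [measurable]: "(\<lambda>x. u (p x) (q x)) \<in> borel_measurable M" if [measurable]: "p \<in> borel_measurable M" "q \<in> borel_measurable M" for p q and M :: "'z measure"
      unfolding u_def by measurable
    have [measurable]: "(\<lambda>x. A (p x) (q x) (r x)) \<in> borel_measurable M" if [measurable]: "p \<in> borel_measurable M" "q \<in> borel_measurable M" "r \<in> borel_measurable M" for p q r and M :: "'z measure"
      unfolding A_def by measurable
    have T: "T X = (\<integral>\<^sup>+Y. u X Y \<partial>lborel)" for X by (simp add: T_def bilin_def u_def)
    have pt: "2 * (u X Y * u X Z) \<le> A X Y Z + A X Z Y" for X Y Z
    proof -
      \<comment> \<open>The kernel is shared evenly by the two regrouped factors through its square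
        root. Their squares then contain both values of W, so the localisation of both original
        pairs survives the regrouping.\<close>
      define w where "w = ennreal (sqrt (W Y (X - Y) * W Z (X - Z)))"
      have w2: "w\<^sup>2 = ennreal (W Y (X - Y)) * ennreal (W Z (X - Z))"
        using W(2) by (simp add: w_def ennreal_power ennreal_mult[symmetric])
      define a where "a = f Y * g (X - Z) * (w * (ennreal (m2 (X - Y)) * ennreal (m1 Z)))"
      define b where "b = f Z * g (X - Y) * (w * (ennreal (m2 (X - Z)) * ennreal (m1 Y)))"
      have "u X Y * u X Z = a * b"
      proof -
        have "a * b = w\<^sup>2 * (f Y * g (X - Z) * (f Z * g (X - Y)) * (ennreal (m2 (X - Y)) * ennreal (m1 Z) * (ennreal (m2 (X - Z)) * ennreal (m1 Y))))"
          by (simp add: a_def b_def power2_eq_square mult_ac)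
        then show ?thesis using W(2) m by (simp add: u_def w2 ennreal_mult mult_ac)
      qed
      moreover have "A X Y Z = a\<^sup>2" "A X Z Y = b\<^sup>2"
        using W(2) m by (simp_all add: A_def a_def b_def power_mult_distrib w2 ennreal_mult ennreal_power[symmetric] mult_ac)
      ultimately show ?thesis using ennreal_mult_le_squares[of a b] by simp
    qed
    have sq: "2 * (T X)\<^sup>2 \<le> 2 * (\<integral>\<^sup>+Y. \<integral>\<^sup>+Z. A X Y Z \<partial>lborel \<partial>lborel)" for X
    proof -
      have "2 * (T X)\<^sup>2 = (\<integral>\<^sup>+Y. \<integral>\<^sup>+Z. 2 * (u X Y * u X Z) \<partial>lborel \<partial>lborel)"
        unfolding T by (simp add: power2_eq_square nn_integral_cmult nn_integral_multc mult.assoc)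
      also have "\<dots> \<le> (\<integral>\<^sup>+Y. \<integral>\<^sup>+Z. A X Y Z + A X Z Y \<partial>lborel \<partial>lborel)"
        by (intro nn_integral_mono pt)
      also have "\<dots> = (\<integral>\<^sup>+Y. \<integral>\<^sup>+Z. A X Y Z \<partial>lborel \<partial>lborel) + (\<integral>\<^sup>+Y. \<integral>\<^sup>+Z. A X Z Y \<partial>lborel \<partial>lborel)"
        by (simp add: nn_integral_add)
      also have "(\<integral>\<^sup>+Y. \<integral>\<^sup>+Z. A X Z Y \<partial>lborel \<partial>lborel) = (\<integral>\<^sup>+Z. \<integral>\<^sup>+Y. A X Z Y \<partial>lborel \<partial>lborel)"
        by (rule lborel_pair.Fubini') simp
      finally show ?thesis by (simp add: mult_2)
    qed
    have "(T X)\<^sup>2 \<le> (\<integral>\<^sup>+Y. \<integral>\<^sup>+Z. A X Y Z \<partial>lborel \<partial>lborel)" for X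
      using sq[of X] by (subst (asm) ennreal_mult_le_mult_iff) auto
    then have "(\<integral>\<^sup>+X. (T X)\<^sup>2 \<partial>lborel) \<le> (\<integral>\<^sup>+X. \<integral>\<^sup>+Y. \<integral>\<^sup>+Z. A X Y Z \<partial>lborel \<partial>lborel \<partial>lborel)"
      by (rule nn_integral_mono)
    \<comment> \<open>The substitution Z to X - Z frees the argument of g from X. The functions f
      and g then leave the innermost integral, in which X is the output.\<close>
    also have "\<dots> = (\<integral>\<^sup>+X. \<integral>\<^sup>+Y. \<integral>\<^sup>+Z. A X Y (X - Z) \<partial>lborel \<partial>lborel \<partial>lborel)"
      by (intro nn_integral_cong nn_integral_reflect[of "\<lambda>Z. A X Y Z" for X Y, symmetric]) simp
    also have "\<dots> = (\<integral>\<^sup>+Y. \<integral>\<^sup>+X. \<integral>\<^sup>+Z. A X Y (X - Z) \<partial>lborel \<partial>lborel \<partial>lborel)"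
      by (rule lborel_pair.Fubini') simp
    also have "\<dots> = (\<integral>\<^sup>+Y. \<integral>\<^sup>+Z. \<integral>\<^sup>+X. A X Y (X - Z) \<partial>lborel \<partial>lborel \<partial>lborel)"
      by (intro nn_integral_cong lborel_pair.Fubini') simp
    also have "\<dots> = (\<integral>\<^sup>+Y. \<integral>\<^sup>+Z. (f Y)\<^sup>2 * (g Z)\<^sup>2 * (\<integral>\<^sup>+X. ennreal (W Y (X - Y) * W (X - Z) Z) * ennreal ((m2 (X - Y))\<^sup>2 * (m1 (X - Z))\<^sup>2) \<partial>lborel) \<partial>lborel \<partial>lborel)"
      by (intro nn_integral_cong) (simp add: A_def nn_integral_cmult)
    also have "\<dots> \<le> (\<integral>\<^sup>+Y. \<integral>\<^sup>+Z. (f Y)\<^sup>2 * (g Z)\<^sup>2 * ennreal C \<partial>lborel \<partial>lborel)"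
      by (intro nn_integral_mono mult_left_mono b) simp
    also have "\<dots> = ennreal C * ((\<integral>\<^sup>+X. (f X)\<^sup>2 \<partial>lborel) * (\<integral>\<^sup>+X. (g X)\<^sup>2 \<partial>lborel))"
      by (simp add: nn_integral_cmult nn_integral_multc mult_ac)
    finally show ?thesis by (simp add: T_def)
  qed
  then show ?thesis using C unfolding l2_bounded_def by blast
qed

section \<open>Kernels concentrated near the cones\<close>

lemma nn_integral_spacetime:
  fixes F :: "real \<times> (real^3) \<Rightarrow> ennreal"
  assumes [measurable]: "F \<in> borel_measurable borel"
  shows "(\<integral>\<^sup>+X. F X \<partial>lborel) = (\<integral>\<^sup>+\<xi>. \<integral>\<^sup>+\<tau>. F (\<tau>, \<xi>) \<partial>lborel \<partial>lborel)"
proof -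
  have "(\<integral>\<^sup>+X. F X \<partial>lborel) = (\<integral>\<^sup>+X. F X \<partial>(lborel \<Otimes>\<^sub>M lborel))" by (simp add: lborel_prod)
  also have "\<dots> = (\<integral>\<^sup>+\<xi>. \<integral>\<^sup>+\<tau>. F (\<tau>, \<xi>) \<partial>lborel \<partial>lborel)"
    by (subst lborel_pair.nn_integral_snd[symmetric]) (auto simp: lborel_prod)
  finally show ?thesis .
qed

text \<open>The weight for a single sheet \<tau> = e |\<xi>| of the cone, with e = 1 or e = -1. For
  one sheet the time integrals are plain convolutions of brackets.\<close>

definition cone_factor :: "real \<Rightarrow> real \<Rightarrow> spacetime \<Rightarrow> real" where
  "cone_factor b e X = jbr (fst X - e * norm (snd X)) powr (-b)"

lemma cone_factor_measurable [measurable]: "cone_factor b e \<in> borel_measurable borel"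
  unfolding cone_factor_def[abs_def] by (simp add: borel_prod[symmetric])

lemma cone_factor_nonneg: "0 \<le> cone_factor b e X"
  by (simp add: cone_factor_def)

lemma cone_factor_sq: "(cone_factor b e X)\<^sup>2 = jbr (fst X - e * norm (snd X)) powr (-(2*b))"
  unfolding cone_factor_def by (simp add: power2_eq_square powr_add[symmetric])

text \<open>Integrating the squared kernel over time merges the two cone factors into one bracket of
  the output time minus the sum of the signed frequencies. Only an integral over the spatial
  frequency z is left.\<close>

lemma l2_bounded_cone_output:
  fixes w :: "real^3 \<Rightarrow> real^3 \<Rightarrow> real"
  assumes w: "case_prod w \<in> borel_measurable borel" "\<And>x y. 0 \<le> w x y" and b: "1 < 2 * b" and C: "0 \<le> C"
    and bd: "\<And>\<tau> \<xi>. (\<integral>\<^sup>+z. ennreal ((w z (\<xi> - z))\<^sup>2) * ennreal (jbr (\<tau> - e1 * norm z - e2 * norm (\<xi> - z)) powr (-(2*b))) \<partial>lborel) \<le> ennreal C"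
  shows "l2_bounded (\<lambda>X Y. w (snd X) (snd Y) * (cone_factor b e1 X * cone_factor b e2 Y))"
proof (rule l2_bounded_output)
  note [measurable] = measurable_curried[OF w(1)]
  show "(\<lambda>(X, Y). w (snd X) (snd Y) * (cone_factor b e1 X * cone_factor b e2 Y)) \<in> borel_measurable borel"
    unfolding case_prod_beta'
    by (intro borel_measurable_times measurable_curried[OF w(1)] measurable_compose[OF _ cone_factor_measurable])
       (auto intro!: borel_measurable_continuous_onI continuous_intros)
  let ?D = "2 powr (2*b) * (2 * jconst (2*b))"
  show "0 \<le> ?D * C" using C jconst_nonneg[OF b] by simp
  fix X :: spacetime
  obtain \<tau> \<xi> where X: "X = (\<tau>, \<xi>)" by (cases X)
  have "(\<integral>\<^sup>+Y. (ennreal (w (snd Y) (snd (X - Y)) * (cone_factor b e1 Y * cone_factor b e2 (X - Y))))\<^sup>2 \<partial>lborel)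
    = (\<integral>\<^sup>+Y. ennreal ((w (snd Y) (\<xi> - snd Y))\<^sup>2) * (ennreal (jbr (fst Y - e1 * norm (snd Y)) powr (-(2*b))) *
        ennreal (jbr (\<tau> - fst Y - e2 * norm (\<xi> - snd Y)) powr (-(2*b)))) \<partial>lborel)"
    using w(2) cone_factor_nonneg[of b]
    by (intro nn_integral_cong) (simp add: X ennreal_power power_mult_distrib cone_factor_sq ennreal_mult)
  also have "\<dots> = (\<integral>\<^sup>+z. \<integral>\<^sup>+t. ennreal ((w z (\<xi> - z))\<^sup>2) * (ennreal (jbr (t - e1 * norm z) powr (-(2*b))) *
        ennreal (jbr (\<tau> - t - e2 * norm (\<xi> - z)) powr (-(2*b)))) \<partial>lborel \<partial>lborel)"
    by (subst nn_integral_spacetime) (simp_all add: borel_prod[symmetric])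
  also have "\<dots> = (\<integral>\<^sup>+z. ennreal ((w z (\<xi> - z))\<^sup>2) * (\<integral>\<^sup>+t. ennreal (jbr (t - e1 * norm z) powr (-(2*b))) *
        ennreal (jbr (\<tau> - t - e2 * norm (\<xi> - z)) powr (-(2*b))) \<partial>lborel) \<partial>lborel)"
    by (intro nn_integral_cong nn_integral_cmult) simp
  also have "\<dots> \<le> (\<integral>\<^sup>+z. ennreal ((w z (\<xi> - z))\<^sup>2) * (ennreal ?D * ennreal (jbr (\<tau> - e1 * norm z - e2 * norm (\<xi> - z)) powr (-(2*b)))) \<partial>lborel)"
    by (intro nn_integral_mono mult_left_mono nn_integral_jbr_jbr b) simp
  also have "\<dots> = ennreal ?D * (\<integral>\<^sup>+z. ennreal ((w z (\<xi> - z))\<^sup>2) * ennreal (jbr (\<tau> - e1 * norm z - e2 * norm (\<xi> - z)) powr (-(2*b))) \<partial>lborel)"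
    by (subst nn_integral_cmult[symmetric]) (auto simp: mult_ac)
  also have "\<dots> \<le> ennreal ?D * ennreal C" by (intro mult_left_mono bd) simp
  also have "\<dots> = ennreal (?D * C)" using C jconst_nonneg[OF b] by (simp add: ennreal_mult)
  finally show "(\<integral>\<^sup>+Y. (ennreal (w (snd Y) (snd (X - Y)) * (cone_factor b e1 Y * cone_factor b e2 (X - Y))))\<^sup>2 \<partial>lborel) \<le> ennreal (?D * C)" .
qed

text \<open>Regrouping integrates the cone factors at X - Y and X - Z over their common time, which
  subtracts the two phases. Equal signs thus lead to a difference of distances and opposite signs to
  a sum.\<close>

lemma l2_bounded_cone_regroup:
  fixes w :: "real^3 \<Rightarrow> real^3 \<Rightarrow> real"
  assumes w: "case_prod w \<in> borel_measurable borel" "\<And>x y. 0 \<le> w x y" and b: "1 < 2 * b" and C: "0 \<le> C"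
    and bd: "\<And>\<tau> \<eta> \<zeta>. (\<integral>\<^sup>+z. ennreal (w \<eta> (z - \<eta>) * w (z - \<zeta>) \<zeta>) *
        ennreal (jbr (\<tau> - (e2 * norm (z - \<eta>) - e1 * norm (z - \<zeta>))) powr (-(2*b))) \<partial>lborel) \<le> ennreal C"
  shows "l2_bounded (\<lambda>X Y. w (snd X) (snd Y) * (cone_factor b e1 X * cone_factor b e2 Y))"
proof (rule l2_bounded_regroup[where W="\<lambda>X Y. w (snd X) (snd Y)"])
  note [measurable] = measurable_curried[OF w(1)]
  show "(\<lambda>(X::spacetime, Y::spacetime). w (snd X) (snd Y)) \<in> borel_measurable borel"
    unfolding case_prod_beta'
    by (intro measurable_curried[OF w(1)]) (auto intro!: borel_measurable_continuous_onI continuous_intros)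
  let ?D = "2 powr (2*b) * (2 * jconst (2*b))"
  show "0 \<le> ?D * C" using C jconst_nonneg[OF b] by simp
  fix Y Z :: spacetime
  obtain s \<eta> t \<zeta> where YZ: "Y = (s, \<eta>)" "Z = (t, \<zeta>)" by (cases Y, cases Z)
  \<comment> \<open>The bracket is even; this brings the second factor into the form expected by
    \<open>nn_integral_jbr_jbr\<close>, with the sign of \<open>e1\<close> reversed.\<close>
  have j: "jbr (r - (t + e1 * x)) = jbr (t - r + e1 * x)" for r x
    unfolding jbr_def by (simp add: power2_eq_square algebra_simps)
  have "(\<integral>\<^sup>+X. ennreal (w (snd Y) (snd (X - Y)) * w (snd (X - Z)) (snd Z)) * ennreal ((cone_factor b e2 (X - Y))\<^sup>2 * (cone_factor b e1 (X - Z))\<^sup>2) \<partial>lborel)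
    = (\<integral>\<^sup>+X. ennreal (w \<eta> (snd X - \<eta>) * w (snd X - \<zeta>) \<zeta>) * (ennreal (jbr (fst X - (s + e2 * norm (snd X - \<eta>))) powr (-(2*b))) *
        ennreal (jbr (t - fst X - (- e1 * norm (snd X - \<zeta>))) powr (-(2*b)))) \<partial>lborel)"
    by (intro nn_integral_cong) (simp add: YZ cone_factor_sq ennreal_mult j diff_diff_add)
  also have "\<dots> = (\<integral>\<^sup>+z. \<integral>\<^sup>+r. ennreal (w \<eta> (z - \<eta>) * w (z - \<zeta>) \<zeta>) * (ennreal (jbr (r - (s + e2 * norm (z - \<eta>))) powr (-(2*b))) *
        ennreal (jbr (t - r - (- e1 * norm (z - \<zeta>))) powr (-(2*b)))) \<partial>lborel \<partial>lborel)"
    by (subst nn_integral_spacetime) (simp_all add: borel_prod[symmetric])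
  also have "\<dots> = (\<integral>\<^sup>+z. ennreal (w \<eta> (z - \<eta>) * w (z - \<zeta>) \<zeta>) * (\<integral>\<^sup>+r. ennreal (jbr (r - (s + e2 * norm (z - \<eta>))) powr (-(2*b))) *
        ennreal (jbr (t - r - (- e1 * norm (z - \<zeta>))) powr (-(2*b))) \<partial>lborel) \<partial>lborel)"
    by (intro nn_integral_cong nn_integral_cmult) simp
  also have "\<dots> \<le> (\<integral>\<^sup>+z. ennreal (w \<eta> (z - \<eta>) * w (z - \<zeta>) \<zeta>) * (ennreal ?D * ennreal (jbr (t - (s + e2 * norm (z - \<eta>)) - (- e1 * norm (z - \<zeta>))) powr (-(2*b)))) \<partial>lborel)"
    by (intro nn_integral_mono mult_left_mono nn_integral_jbr_jbr b) simp
  also have "\<dots> = ennreal ?D * (\<integral>\<^sup>+z. ennreal (w \<eta> (z - \<eta>) * w (z - \<zeta>) \<zeta>) *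
        ennreal (jbr ((t - s) - (e2 * norm (z - \<eta>) - e1 * norm (z - \<zeta>))) powr (-(2*b))) \<partial>lborel)"
    by (subst nn_integral_cmult[symmetric]) (auto simp: mult_ac algebra_simps)
  also have "\<dots> \<le> ennreal ?D * ennreal C" by (intro mult_left_mono bd) simp
  also have "\<dots> = ennreal (?D * C)" using C jconst_nonneg[OF b] by (simp add: ennreal_mult)
  finally show "(\<integral>\<^sup>+X. ennreal (w (snd Y) (snd (X - Y)) * w (snd (X - Z)) (snd Z)) * ennreal ((cone_factor b e2 (X - Y))\<^sup>2 * (cone_factor b e1 (X - Z))\<^sup>2) \<partial>lborel) \<le> ennreal (?D * C)" .
qed (use w cone_factor_nonneg in auto)

subsection \<open>Fourier transforms of products\<close>

text \<open>The norm dominates every coordinate, so the integrand is at most a product of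
  one-dimensional integrable functions. The exponent gives each coordinate a square.\<close>

lemma nn_integral_decay_finite:
  "(\<integral>\<^sup>+z. ennreal (1 / (1 + norm (z::'a::euclidean_space)) ^ (2 * DIM('a))) \<partial>lborel) < \<infinity>"
proof -
  have 1: "(\<integral>\<^sup>+t. ennreal (1 / (1 + \<bar>t::real\<bar>)\<^sup>2) \<partial>lborel) < \<infinity>"
  proof -
    have "(\<integral>\<^sup>+t. ennreal (1 / (1 + \<bar>t::real\<bar>)\<^sup>2) \<partial>lborel) = (\<integral>\<^sup>+t. ennreal ((1 + \<bar>t\<bar>) powr (-1-1)) \<partial>lborel)"
      by (intro nn_integral_cong) (simp add: powr_minus inverse_eq_divide add_pos_nonneg)
    also have "\<dots> \<le> ennreal (2 * 1 powr (-1) / 1)" by (rule nn_integral_tail) auto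
    also have "\<dots> < \<infinity>" by simp
    finally show ?thesis .
  qed
  have "(\<integral>\<^sup>+z. ennreal (1 / (1 + norm (z::'a)) ^ (2 * DIM('a))) \<partial>lborel)
     \<le> (\<integral>\<^sup>+z. (\<Prod>b\<in>Basis. ennreal (1 / (1 + \<bar>(z::'a) \<bullet> b\<bar>)\<^sup>2)) \<partial>lborel)"
  proof (rule nn_integral_mono)
    fix z :: 'a
    have "1 / (1 + norm z) ^ (2 * DIM('a)) = (\<Prod>b\<in>(Basis::'a set). 1 / (1 + norm z)\<^sup>2)"
      by (simp add: power_mult power_one_over)
    also have "\<dots> \<le> (\<Prod>b\<in>Basis. 1 / (1 + \<bar>z \<bullet> b\<bar>)\<^sup>2)"
    proof (rule prod_mono)
      fix b :: 'a assume b: "b \<in> Basis"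
      have "(1 + \<bar>z \<bullet> b\<bar>)\<^sup>2 \<le> (1 + norm z)\<^sup>2" using Basis_le_norm[OF b, of z] by (intro power_mono) auto
      moreover have "0 < (1 + \<bar>z \<bullet> b\<bar>)\<^sup>2" by (simp add: add_pos_nonneg)
      ultimately show "0 \<le> 1 / (1 + norm z)\<^sup>2 \<and> 1 / (1 + norm z)\<^sup>2 \<le> 1 / (1 + \<bar>z \<bullet> b\<bar>)\<^sup>2"
        by (auto intro!: divide_left_mono mult_pos_pos simp: add_pos_nonneg)
    qed
    finally show "ennreal (1 / (1 + norm z) ^ (2 * DIM('a))) \<le> (\<Prod>b\<in>Basis. ennreal (1 / (1 + \<bar>z \<bullet> b\<bar>)\<^sup>2))"
      by (subst prod_ennreal) (auto intro!: ennreal_leI)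
  qed
  also have "\<dots> = (\<Prod>b\<in>(Basis::'a set). \<integral>\<^sup>+t. ennreal (1 / (1 + \<bar>t\<bar>)\<^sup>2) \<partial>lborel)"
    by (subst nn_integral_lborel_prod) auto
  also have "\<dots> < \<infinity>" using 1 by (simp add: power_less_top_ennreal)
  finally show ?thesis .
qed

text \<open>The properties of Schwartz functions that the transform estimate rests on; all come from
  the decay of u itself, that is, from the empty list of derivatives.\<close>

lemma schwartz_imp:
  fixes u :: "'a::euclidean_space \<Rightarrow> complex"
  assumes "schwartz u"
  shows "continuous_on UNIV u" "\<exists>M. \<forall>z. norm (u z) \<le> M" "integrable lborel u"
proof -
  have "\<forall>x. iter_deriv [] u differentiable (at x)"
    using assms unfolding schwartz_def by (metis empty_subsetI list.set(1))
  then show cont: "continuous_on UNIV u"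
    by (auto intro!: continuous_at_imp_continuous_on differentiable_imp_continuous_within)
  have dec: "\<exists>C. \<forall>x. (1 + norm x) ^ N * norm (u x) \<le> C" for N
  proof -
    have "\<exists>C. \<forall>x. (1 + norm x) ^ N * norm (iter_deriv [] u x) \<le> C"
      using assms unfolding schwartz_def by (metis empty_subsetI list.set(1))
    then show ?thesis by simp
  qed
  show "\<exists>M. \<forall>z. norm (u z) \<le> M" using dec[of 0] by simp
  obtain C where C: "\<And>x. (1 + norm x) ^ (2 * DIM('a)) * norm (u x) \<le> C" using dec by blast
  show "integrable lborel u"
  proof (rule integrableI_bounded)
    show "u \<in> borel_measurable lborel" using borel_measurable_continuous_onI[OF cont] by simp
    have "norm (u 0) \<le> C" using C[of 0] by simp
    then have "0 \<le> C" using norm_ge_zero[of "u 0"] by linarith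
    have "(\<integral>\<^sup>+x. ennreal (norm (u x)) \<partial>lborel) \<le> (\<integral>\<^sup>+x. ennreal C * ennreal (1 / (1 + norm (x::'a)) ^ (2 * DIM('a))) \<partial>lborel)"
    proof (rule nn_integral_mono)
      fix x :: 'a
      have "norm (u x) \<le> C * (1 / (1 + norm x) ^ (2 * DIM('a)))"
        using C[of x] by (simp add: pos_le_divide_eq add_pos_nonneg mult.commute)
      then show "ennreal (norm (u x)) \<le> ennreal C * ennreal (1 / (1 + norm x) ^ (2 * DIM('a)))"
        using \<open>0 \<le> C\<close> by (subst ennreal_mult[symmetric]) (auto intro: ennreal_leI)
    qed
    also have "\<dots> = ennreal C * (\<integral>\<^sup>+x. ennreal (1 / (1 + norm (x::'a)) ^ (2 * DIM('a))) \<partial>lborel)"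
      by (rule nn_integral_cmult) measurable
    also have "\<dots> < \<infinity>" using nn_integral_decay_finite[where 'a='a] by (simp add: ennreal_mult_less_top)
    finally show "(\<integral>\<^sup>+x. ennreal (norm (u x)) \<partial>lborel) < \<infinity>" .
  qed
qed

section \<open>The Gaussian as its own Fourier transform\<close>

definition gauss :: "'a::euclidean_space \<Rightarrow> real" where
  "gauss z = exp (- (z \<bullet> z) / 2)"

lemma gauss_measurable [measurable]: "gauss \<in> borel_measurable borel"
  unfolding gauss_def[abs_def] by measurable

lemma gauss_nonneg: "0 \<le> gauss z" by (simp add: gauss_def)

lemma gauss_eq_prod: "gauss z = (\<Prod>b\<in>Basis. exp (- (z \<bullet> b)\<^sup>2 / 2))"
  unfolding gauss_def by (subst euclidean_inner) (simp add: exp_sum[symmetric] sum_negf sum_divide_distrib power2_eq_square)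

lemma integrable_gauss1: "integrable lborel (\<lambda>x::real. exp (- x\<^sup>2 / 2))"
proof -
  have "integrable lborel (\<lambda>x. sqrt (2 * pi) * std_normal_density x)"
    by (intro integrable_mult_right integrable_normal_density) simp
  then show ?thesis by (simp add: std_normal_density_def)
qed

text \<open>Read off from the characteristic function of the standard normal distribution.\<close>

lemma integral_gauss1:
  "(\<integral>x. cis (- (s * x)) * complex_of_real (exp (- x\<^sup>2 / 2)) \<partial>lborel) = complex_of_real (sqrt (2 * pi) * exp (- s\<^sup>2 / 2))"
proof -
  have "char std_normal_distribution (- s) = (\<integral>x. cis (- (s * x)) * complex_of_real (std_normal_density x) \<partial>lborel)"
    unfolding char_def
    by (subst integral_density) (auto simp: cis_conv_exp scaleR_conv_of_real mult_ac)
  also have "\<dots> = (\<integral>x. complex_of_real (1 / sqrt (2 * pi)) * (cis (- (s * x)) * complex_of_real (exp (- x\<^sup>2 / 2))) \<partial>lborel)"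
    by (intro Bochner_Integration.integral_cong) (auto simp: std_normal_density_def)
  also have "\<dots> = complex_of_real (1 / sqrt (2 * pi)) * (\<integral>x. cis (- (s * x)) * complex_of_real (exp (- x\<^sup>2 / 2)) \<partial>lborel)"
    by (rule integral_mult_right_zero)
  finally have "complex_of_real (exp (- s\<^sup>2 / 2)) = complex_of_real (1 / sqrt (2 * pi)) * (\<integral>x. cis (- (s * x)) * complex_of_real (exp (- x\<^sup>2 / 2)) \<partial>lborel)"
    by (simp add: char_std_normal_distribution)
  then show ?thesis by (simp add: field_simps)
qed

lemma cis_measurable [measurable (raw)]:
  "f \<in> borel_measurable M \<Longrightarrow> (\<lambda>x. cis (f x)) \<in> borel_measurable M"
  by (rule measurable_compose[of f M borel cis]) (auto intro!: borel_measurable_continuous_onI continuous_intros)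

lemma cis_sum: "finite A \<Longrightarrow> cis (\<Sum>i\<in>A. f i) = (\<Prod>i\<in>A. cis (f i))"
  by (induction A rule: finite_induct) (auto simp: cis_mult[symmetric])

lemma
  fixes s :: "'a::euclidean_space"
  shows integrable_gauss: "integrable lborel (\<lambda>z::'a. complex_of_real (gauss z))"
    and integral_gauss: "(\<integral>z. cis (- (s \<bullet> z)) * complex_of_real (gauss z) \<partial>lborel)
       = complex_of_real (sqrt (2 * pi) ^ DIM('a) * gauss s)"
proof -
  interpret product_sigma_finite "\<lambda>b::'a. lborel :: real measure" ..
  have int: "integrable lborel (\<lambda>x. cis (- (r * x)) * complex_of_real (exp (- x\<^sup>2 / 2)))" for r :: real
  proof (rule Bochner_Integration.integrable_bound[OF integrable_gauss1])
    show "(\<lambda>x. cis (- (r * x)) * complex_of_real (exp (- x\<^sup>2 / 2))) \<in> borel_measurable lborel"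
      by measurable
  qed (simp add: norm_mult)
  have eq: "cis (- (s \<bullet> z)) * complex_of_real (gauss z) = (\<Prod>b\<in>Basis. cis (- ((s \<bullet> b) * (z \<bullet> b))) * complex_of_real (exp (- (z \<bullet> b)\<^sup>2 / 2)))" for s z :: 'a
  proof -
    have "cis (- (s \<bullet> z)) = (\<Prod>b\<in>Basis. cis (- ((s \<bullet> b) * (z \<bullet> b))))"
      by (subst euclidean_inner) (simp add: cis_sum[symmetric] sum_negf)
    then show ?thesis by (simp add: gauss_eq_prod prod.distrib)
  qed
  let ?f = "\<lambda>s z::'a. \<Prod>b\<in>Basis. cis (- ((s \<bullet> b) * (z \<bullet> b))) * complex_of_real (exp (- (z \<bullet> b)\<^sup>2 / 2))"
  let ?h = "\<lambda>s f. \<Prod>b\<in>(Basis::'a set). cis (- ((s \<bullet> b) * f b)) * complex_of_real (exp (- (f b)\<^sup>2 / 2))"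
  let ?T = "\<lambda>f. \<Sum>b\<in>Basis. f b *\<^sub>R (b::'a)"
  have Tm: "?T \<in> measurable (\<Pi>\<^sub>M b\<in>Basis. lborel) borel" by measurable
  have fm: "?f s \<in> borel_measurable borel" for s :: 'a
    by measurable
  have comp: "?f s (?T f) = ?h s f" for s f by (intro prod.cong) auto
  have hint: "integrable (\<Pi>\<^sub>M b\<in>(Basis::'a set). lborel) (?h s)" for s :: 'a
    by (intro product_integrable_prod int) auto
  have "integrable lborel (?f 0)"
    unfolding lborel_eq[where 'a='a] using hint[of 0] by (subst integrable_distr_eq[OF Tm fm]) (simp only: comp)
  then have "integrable lborel (\<lambda>z. cis (- (0 \<bullet> z)) * complex_of_real (gauss (z::'a)))" by (simp only: eq)
  then show "integrable lborel (\<lambda>z::'a. complex_of_real (gauss z))" by simp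
  have "(\<integral>z. cis (- (s \<bullet> z)) * complex_of_real (gauss z) \<partial>lborel) = (\<integral>z. ?f s z \<partial>lborel)"
    by (simp only: eq)
  also have "\<dots> = (\<integral>f. ?h s f \<partial>(\<Pi>\<^sub>M b\<in>(Basis::'a set). lborel))"
    unfolding lborel_eq[where 'a='a] by (subst integral_distr[OF Tm fm]) (simp only: comp)
  also have "\<dots> = (\<Prod>b\<in>(Basis::'a set). complex_of_real (sqrt (2 * pi) * exp (- (s \<bullet> b)\<^sup>2 / 2)))"
    by (subst product_integral_prod) (auto intro: int simp only: integral_gauss1 finite_Basis)
  also have "\<dots> = complex_of_real (sqrt (2 * pi) ^ DIM('a) * gauss s)"
    by (simp add: prod.distrib gauss_eq_prod)
  finally show "(\<integral>z. cis (- (s \<bullet> z)) * complex_of_real (gauss z) \<partial>lborel)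
       = complex_of_real (sqrt (2 * pi) ^ DIM('a) * gauss s)" .
qed

definition ft :: "('a::euclidean_space \<Rightarrow> complex) \<Rightarrow> 'a \<Rightarrow> complex" where
  "ft u \<zeta> = (\<integral>z. cis (- (z \<bullet> \<zeta>)) * u z \<partial>lborel)"



lemma integrable_phase:
  fixes f :: "'a::euclidean_space \<Rightarrow> complex"
  assumes "integrable lborel f" and [measurable]: "c \<in> borel_measurable borel"
  shows "integrable lborel (\<lambda>x. cis (c x) * f x)"
proof (rule Bochner_Integration.integrable_bound[OF assms(1)])
  have [measurable]: "f \<in> borel_measurable borel" using assms(1) by auto
  show "(\<lambda>x. cis (c x) * f x) \<in> borel_measurable lborel" by measurable
qed (simp add: norm_mult)

lemma ft_measurable [measurable]:
  assumes "integrable lborel u"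
  shows "ft u \<in> borel_measurable borel"
proof -
  have [measurable]: "u \<in> borel_measurable borel" using assms by auto
  have "(\<lambda>\<zeta>. \<integral>z. cis (- (z \<bullet> \<zeta>)) * u z \<partial>lborel) \<in> borel_measurable borel" by measurable
  then show ?thesis by (simp add: ft_def[abs_def])
qed

lemma norm_ft_le:
  assumes "integrable lborel u"
  shows "norm (ft u \<zeta>) \<le> (\<integral>z. norm (u z) \<partial>lborel)"
proof -
  have "norm (ft u \<zeta>) \<le> (\<integral>z. norm (cis (- (z \<bullet> \<zeta>)) * u z) \<partial>lborel)"
    unfolding ft_def by (rule integral_norm_bound)
  then show ?thesis by (simp add: norm_mult)
qed

text \<open>The phase factor has modulus one, so f and g alone guarantee absolute convergence on the
  product space.\<close>

lemma Fubini_phase: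
  fixes f g :: "'a::euclidean_space \<Rightarrow> complex"
  assumes f: "integrable lborel f" and g: "integrable lborel g"
    and c: "(\<lambda>(x, y). c x y) \<in> borel_measurable (borel :: ('a \<times> 'a) measure)"
  shows "(\<integral>x. f x * (\<integral>y. cis (c x y) * g y \<partial>lborel) \<partial>lborel) = (\<integral>y. g y * (\<integral>x. cis (c x y) * f x \<partial>lborel) \<partial>lborel)"
proof -
  have [measurable]: "f \<in> borel_measurable borel" "g \<in> borel_measurable borel" using f g by auto
  have cm: "(\<lambda>z. c (fst z) (snd z)) \<in> borel_measurable (lborel \<Otimes>\<^sub>M lborel)"
    using c by (simp add: case_prod_beta' lborel_prod)
  have "integrable (lborel \<Otimes>\<^sub>M lborel) (\<lambda>z. f (fst z) * (cis (c (fst z) (snd z)) * g (snd z)))"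
  proof (rule integrableI_bounded)
    note [measurable] = cm
    show "(\<lambda>z. f (fst z) * (cis (c (fst z) (snd z)) * g (snd z))) \<in> borel_measurable (lborel \<Otimes>\<^sub>M lborel)" by measurable
    have "(\<integral>\<^sup>+z. ennreal (norm (f (fst z) * (cis (c (fst z) (snd z)) * g (snd z)))) \<partial>(lborel \<Otimes>\<^sub>M lborel))
      = (\<integral>\<^sup>+x. \<integral>\<^sup>+y. ennreal (norm (f x)) * ennreal (norm (g y)) \<partial>lborel \<partial>lborel)"
      by (subst lborel.nn_integral_fst[symmetric]) (auto simp: norm_mult ennreal_mult)
    also have "\<dots> = (\<integral>\<^sup>+x. ennreal (norm (f x)) \<partial>lborel) * (\<integral>\<^sup>+y. ennreal (norm (g y)) \<partial>lborel)"
      by (simp add: nn_integral_cmult nn_integral_multc)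
    also have "\<dots> < \<infinity>" using f g by (auto simp: integrable_iff_bounded ennreal_mult_less_top)
    finally show "(\<integral>\<^sup>+z. ennreal (norm (f (fst z) * (cis (c (fst z) (snd z)) * g (snd z)))) \<partial>(lborel \<Otimes>\<^sub>M lborel)) < \<infinity>" .
  qed
  then have i: "integrable (lborel \<Otimes>\<^sub>M lborel) (\<lambda>(x, y). f x * (cis (c x y) * g y))" by (simp add: case_prod_beta')
  have "(\<integral>x. f x * (\<integral>y. cis (c x y) * g y \<partial>lborel) \<partial>lborel) = (\<integral>x. \<integral>y. f x * (cis (c x y) * g y) \<partial>lborel \<partial>lborel)"
    by simp
  also have "\<dots> = (\<integral>y. \<integral>x. f x * (cis (c x y) * g y) \<partial>lborel \<partial>lborel)"
    by (rule lborel_pair.Fubini_integral[OF i, symmetric])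
  also have "\<dots> = (\<integral>y. \<integral>x. g y * (cis (c x y) * f x) \<partial>lborel \<partial>lborel)" by (simp add: mult_ac)
  also have "\<dots> = (\<integral>y. g y * (\<integral>x. cis (c x y) * f x \<partial>lborel) \<partial>lborel)" by simp
  finally show ?thesis .
qed

lemma
  fixes f :: "'a::euclidean_space \<Rightarrow> complex"
  assumes d: "0 < \<delta>"
  shows integral_scale: "integrable lborel f \<Longrightarrow> (\<integral>x. f (w + \<delta> *\<^sub>R x) \<partial>lborel) = complex_of_real (1 / \<delta> ^ DIM('a)) * (\<integral>x. f x \<partial>lborel)"
    and integrable_scale: "integrable lborel f \<Longrightarrow> integrable lborel (\<lambda>x. f (w + \<delta> *\<^sub>R x))"
proof -
  assume f: "integrable lborel f"
  then have [measurable]: "f \<in> borel_measurable borel" by auto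
  have eq: "lborel = density (distr lborel borel (\<lambda>x. w + \<delta> *\<^sub>R x)) (\<lambda>_. ennreal (\<delta> ^ DIM('a)))"
    using lborel_affine[of \<delta> w] d by (simp add: ennreal_power)
  have "(\<integral>x. f x \<partial>lborel) = (\<delta> ^ DIM('a)) *\<^sub>R (\<integral>x. f (w + \<delta> *\<^sub>R x) \<partial>lborel)"
    by (subst eq, subst integral_density) (use d in \<open>auto simp: integral_distr\<close>)
  then show "(\<integral>x. f (w + \<delta> *\<^sub>R x) \<partial>lborel) = complex_of_real (1 / \<delta> ^ DIM('a)) * (\<integral>x. f x \<partial>lborel)"
    using d by (simp add: scaleR_conv_of_real)
  have "integrable (density (distr lborel borel (\<lambda>x. w + \<delta> *\<^sub>R x)) (\<lambda>_. ennreal (\<delta> ^ DIM('a)))) f"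
    using f eq by metis
  then have "integrable lborel (\<lambda>x. (\<delta> ^ DIM('a)) *\<^sub>R f (w + \<delta> *\<^sub>R x))"
    by (subst (asm) integrable_density) (use d in \<open>auto simp: integrable_distr_eq\<close>)
  then have "integrable lborel (\<lambda>x. (1 / \<delta> ^ DIM('a)) *\<^sub>R ((\<delta> ^ DIM('a)) *\<^sub>R f (w + \<delta> *\<^sub>R x)))"
    by (rule integrable_scaleR_right)
  then show "integrable lborel (\<lambda>x. f (w + \<delta> *\<^sub>R x))"
    using d by simp
qed

lemma nn_integral_scale:
  fixes f :: "'a::euclidean_space \<Rightarrow> ennreal"
  assumes d: "0 < \<delta>" and [measurable]: "f \<in> borel_measurable borel"
  shows "(\<integral>\<^sup>+x. f (\<delta> *\<^sub>R x) \<partial>lborel) = ennreal (1 / \<delta> ^ DIM('a)) * (\<integral>\<^sup>+x. f x \<partial>lborel)"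
proof -
  have eq: "lborel = density (distr lborel borel (\<lambda>x::'a. 0 + \<delta> *\<^sub>R x)) (\<lambda>_. ennreal (\<delta> ^ DIM('a)))"
    using lborel_affine[of \<delta> 0] d by (simp add: ennreal_power)
  have "(\<integral>\<^sup>+x. f x \<partial>lborel) = ennreal (\<delta> ^ DIM('a)) * (\<integral>\<^sup>+x. f (\<delta> *\<^sub>R x) \<partial>lborel)"
    by (subst eq) (simp add: nn_integral_density nn_integral_distr nn_integral_cmult)
  then show ?thesis using d by (simp add: mult.assoc[symmetric] ennreal_mult[symmetric])
qed

text \<open>Averaging \<open>u\<close> against a Gaussian of width \<open>\<delta>\<close> and letting \<open>\<delta> \<rightarrow> 0\<close> replaces Fourier inversion, so
  no decay of the transforms is needed.\<close>

lemma norm_ft_mult_le: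
  fixes u v :: "'a::euclidean_space \<Rightarrow> complex"
  assumes u: "continuous_on UNIV u" "\<And>z. norm (u z) \<le> M" "integrable lborel u" and v: "integrable lborel v"
  shows "ennreal (norm (ft (\<lambda>z. u z * v z) \<zeta>0)) \<le> (\<integral>\<^sup>+\<zeta>. ennreal (norm (ft u \<zeta>)) * ennreal (norm (ft v (\<zeta>0 - \<zeta>))) \<partial>lborel)"
proof -
  define k where "k = sqrt (2 * pi) ^ DIM('a)"
  \<comment> \<open>The sharp inequality has the factor 1/k^2, a power of 2\<pi>; since k \<ge> 1 it
    may be dropped.\<close>
  have k: "1 \<le> k"
  proof -
    have "1 \<le> sqrt (2 * pi)" using pi_gt3 by (intro real_le_rsqrt) auto
    then show ?thesis by (simp add: k_def one_le_power)
  qed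
  have [measurable]: "u \<in> borel_measurable borel" "v \<in> borel_measurable borel" using u v by auto
  note [measurable] = ft_measurable[OF u(3)] ft_measurable[OF v]
  have M0: "0 \<le> M" using u(2)[of 0] norm_ge_zero[of "u 0"] by linarith
  define I where "I = (\<integral>\<^sup>+\<zeta>. ennreal (norm (ft u \<zeta>)) * ennreal (norm (ft v (\<zeta>0 - \<zeta>))) \<partial>lborel)"
  \<comment> \<open>As \<delta> tends to 0, H tends to k u by continuity, and B to k times the
    transform of the product. For fixed \<delta>, H is a superposition of characters whose amplitude
    is the transform of u times a Gaussian, hence integrable even if the transform of u is not; this
    makes Fubini applicable.\<close>
  define H where "H \<delta> w = (\<integral>s. u (w + \<delta> *\<^sub>R s) * complex_of_real (gauss s) \<partial>lborel)" for \<delta> w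
  define B where "B \<delta> = (\<integral>w. (v w * cis (- (w \<bullet> \<zeta>0))) * H \<delta> w \<partial>lborel)" for \<delta>
  have gauss_ft: "complex_of_real (gauss s) = complex_of_real (1 / k) * (\<integral>\<zeta>. cis (- (s \<bullet> \<zeta>)) * complex_of_real (gauss \<zeta>) \<partial>lborel)" for s :: 'a
    using k by (simp add: integral_gauss k_def)
  have H: "H \<delta> w = complex_of_real (1 / k * (1 / \<delta> ^ DIM('a))) * (\<integral>\<zeta>. complex_of_real (gauss \<zeta>) * (cis ((w \<bullet> \<zeta>) / \<delta>) * ft u ((1/\<delta>) *\<^sub>R \<zeta>)) \<partial>lborel)"
    if d: "0 < \<delta>" for \<delta> w
  proof -
    have "H \<delta> w = (\<integral>s. complex_of_real (1 / k) * (u (w + \<delta> *\<^sub>R s) * (\<integral>\<zeta>. cis (- (s \<bullet> \<zeta>)) * complex_of_real (gauss \<zeta>) \<partial>lborel)) \<partial>lborel)"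
      unfolding H_def by (subst gauss_ft) (simp add: mult_ac)
    also have "\<dots> = complex_of_real (1 / k) * (\<integral>s. u (w + \<delta> *\<^sub>R s) * (\<integral>\<zeta>. cis (- (s \<bullet> \<zeta>)) * complex_of_real (gauss \<zeta>) \<partial>lborel) \<partial>lborel)"
      by (rule integral_mult_right_zero)
    also have "(\<integral>s. u (w + \<delta> *\<^sub>R s) * (\<integral>\<zeta>. cis (- (s \<bullet> \<zeta>)) * complex_of_real (gauss \<zeta>) \<partial>lborel) \<partial>lborel)
      = (\<integral>\<zeta>. complex_of_real (gauss \<zeta>) * (\<integral>s. cis (- (s \<bullet> \<zeta>)) * u (w + \<delta> *\<^sub>R s) \<partial>lborel) \<partial>lborel)"
      by (rule Fubini_phase[OF integrable_scale[OF d u(3)] integrable_gauss])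
         (auto intro!: borel_measurable_continuous_onI continuous_intros simp: case_prod_beta')
    also have "\<dots> = (\<integral>\<zeta>. complex_of_real (1 / \<delta> ^ DIM('a)) * (complex_of_real (gauss \<zeta>) * (cis ((w \<bullet> \<zeta>) / \<delta>) * ft u ((1/\<delta>) *\<^sub>R \<zeta>))) \<partial>lborel)"
    proof (intro Bochner_Integration.integral_cong refl)
      fix \<zeta> :: 'a
      have "(\<integral>s. cis (- (s \<bullet> \<zeta>)) * u (w + \<delta> *\<^sub>R s) \<partial>lborel)
         = (\<integral>s. (\<lambda>y. cis ((w \<bullet> \<zeta>) / \<delta>) * (cis (- (y \<bullet> ((1/\<delta>) *\<^sub>R \<zeta>))) * u y)) (w + \<delta> *\<^sub>R s) \<partial>lborel)"
      proof (intro Bochner_Integration.integral_cong refl)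
        fix s
        have "(w \<bullet> \<zeta>) / \<delta> + - ((w + \<delta> *\<^sub>R s) \<bullet> ((1/\<delta>) *\<^sub>R \<zeta>)) = - (s \<bullet> \<zeta>)"
          using d by (simp add: inner_add_left field_simps)
        then show "cis (- (s \<bullet> \<zeta>)) * u (w + \<delta> *\<^sub>R s) = cis ((w \<bullet> \<zeta>) / \<delta>) * (cis (- ((w + \<delta> *\<^sub>R s) \<bullet> ((1/\<delta>) *\<^sub>R \<zeta>))) * u (w + \<delta> *\<^sub>R s))"
          by (simp only: mult.assoc[symmetric] cis_mult)
      qed
      also have "\<dots> = complex_of_real (1 / \<delta> ^ DIM('a)) * (\<integral>y. cis ((w \<bullet> \<zeta>) / \<delta>) * (cis (- (y \<bullet> ((1/\<delta>) *\<^sub>R \<zeta>))) * u y) \<partial>lborel)"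
        by (rule integral_scale[OF d]) (intro integrable_mult_right integrable_phase u(3), measurable)
      also have "\<dots> = complex_of_real (1 / \<delta> ^ DIM('a)) * (cis ((w \<bullet> \<zeta>) / \<delta>) * ft u ((1/\<delta>) *\<^sub>R \<zeta>))"
        unfolding ft_def by (simp only: integral_mult_right_zero)
      finally show "complex_of_real (gauss \<zeta>) * (\<integral>s. cis (- (s \<bullet> \<zeta>)) * u (w + \<delta> *\<^sub>R s) \<partial>lborel)
         = complex_of_real (1 / \<delta> ^ DIM('a)) * (complex_of_real (gauss \<zeta>) * (cis ((w \<bullet> \<zeta>) / \<delta>) * ft u ((1/\<delta>) *\<^sub>R \<zeta>)))"
        by (simp only: mult_ac)
    qed
    also have "\<dots> = complex_of_real (1 / \<delta> ^ DIM('a)) * (\<integral>\<zeta>. complex_of_real (gauss \<zeta>) * (cis ((w \<bullet> \<zeta>) / \<delta>) * ft u ((1/\<delta>) *\<^sub>R \<zeta>)) \<partial>lborel)"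
      by (rule integral_mult_right_zero)
    finally show ?thesis by (simp only: of_real_mult mult.assoc)
  qed
  \<comment> \<open>The dilation of frequency space by 1/\<delta> gives a power of \<delta> that
    cancels the prefactor of H. The Gaussian is at most 1, so the bound is uniform in
    \<delta>.\<close>
  have bound: "ennreal (norm (B \<delta>)) \<le> I" if d: "0 < \<delta>" for \<delta>
  proof -
    define g where "g \<zeta> = complex_of_real (gauss \<zeta>) * ft u ((1/\<delta>) *\<^sub>R \<zeta>)" for \<zeta>
    have g: "integrable lborel g"
    proof (rule Bochner_Integration.integrable_bound)
      show "integrable lborel (\<lambda>\<zeta>. complex_of_real (gauss \<zeta>) * complex_of_real (\<integral>z. norm (u z) \<partial>lborel))"
        by (intro integrable_mult_left integrable_gauss)
      show "g \<in> borel_measurable lborel" unfolding g_def[abs_def] by measurable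
      have "0 \<le> (\<integral>z. norm (u z) \<partial>lborel)" by simp
      then show "AE \<zeta> in lborel. norm (g \<zeta>) \<le> norm (complex_of_real (gauss \<zeta>) * complex_of_real (\<integral>z. norm (u z) \<partial>lborel))"
        using norm_ft_le[OF u(3)] gauss_nonneg by (auto simp: g_def norm_mult intro!: mult_left_mono)
    qed
    have v': "integrable lborel (\<lambda>w. v w * cis (- (w \<bullet> \<zeta>0)))"
      using integrable_phase[OF v, of "\<lambda>w. - (w \<bullet> \<zeta>0)"] by (simp add: mult.commute)
    let ?c = "complex_of_real (1 / k * (1 / \<delta> ^ DIM('a)))"
    have "B \<delta> = (\<integral>w. ?c * ((v w * cis (- (w \<bullet> \<zeta>0))) * (\<integral>\<zeta>. cis ((w \<bullet> \<zeta>) / \<delta>) * g \<zeta> \<partial>lborel)) \<partial>lborel)"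
      unfolding B_def by (simp only: H[OF d] g_def mult_ac)
    also have "\<dots> = ?c * (\<integral>w. (v w * cis (- (w \<bullet> \<zeta>0))) * (\<integral>\<zeta>. cis ((w \<bullet> \<zeta>) / \<delta>) * g \<zeta> \<partial>lborel) \<partial>lborel)"
      by (rule integral_mult_right_zero)
    also have "(\<integral>w. (v w * cis (- (w \<bullet> \<zeta>0))) * (\<integral>\<zeta>. cis ((w \<bullet> \<zeta>) / \<delta>) * g \<zeta> \<partial>lborel) \<partial>lborel)
        = (\<integral>\<zeta>. g \<zeta> * (\<integral>w. cis ((w \<bullet> \<zeta>) / \<delta>) * (v w * cis (- (w \<bullet> \<zeta>0))) \<partial>lborel) \<partial>lborel)"
      by (rule Fubini_phase[OF v' g])
         (use d in \<open>auto intro!: borel_measurable_continuous_onI continuous_intros simp: case_prod_beta'\<close>)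
    also have "\<dots> = (\<integral>\<zeta>. g \<zeta> * ft v (\<zeta>0 - (1/\<delta>) *\<^sub>R \<zeta>) \<partial>lborel)"
    proof -
      have "cis ((w \<bullet> \<zeta>) / \<delta>) * (v w * cis (- (w \<bullet> \<zeta>0))) = cis (- (w \<bullet> (\<zeta>0 - (1/\<delta>) *\<^sub>R \<zeta>))) * v w" for w \<zeta>
      proof -
        have "(w \<bullet> \<zeta>) / \<delta> + - (w \<bullet> \<zeta>0) = - (w \<bullet> (\<zeta>0 - (1/\<delta>) *\<^sub>R \<zeta>))" by (simp add: inner_diff_right)
        then have "cis (- (w \<bullet> (\<zeta>0 - (1/\<delta>) *\<^sub>R \<zeta>))) = cis ((w \<bullet> \<zeta>) / \<delta>) * cis (- (w \<bullet> \<zeta>0))" by (simp only: cis_mult)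
        then show ?thesis by (simp only: mult_ac)
      qed
      then show ?thesis by (simp only: ft_def)
    qed
    finally have Beq: "B \<delta> = ?c * (\<integral>\<zeta>. g \<zeta> * ft v (\<zeta>0 - (1/\<delta>) *\<^sub>R \<zeta>) \<partial>lborel)" .
    define F where "F \<zeta> = ennreal (norm (ft u \<zeta>)) * ennreal (norm (ft v (\<zeta>0 - \<zeta>)))" for \<zeta>
    have [measurable]: "F \<in> borel_measurable borel" unfolding F_def[abs_def] by measurable
    have "ennreal (norm (\<integral>\<zeta>. g \<zeta> * ft v (\<zeta>0 - (1/\<delta>) *\<^sub>R \<zeta>) \<partial>lborel)) \<le> (\<integral>\<^sup>+\<zeta>. ennreal (norm (g \<zeta> * ft v (\<zeta>0 - (1/\<delta>) *\<^sub>R \<zeta>))) \<partial>lborel)"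
    proof (cases "integrable lborel (\<lambda>\<zeta>. g \<zeta> * ft v (\<zeta>0 - (1/\<delta>) *\<^sub>R \<zeta>))")
      case True then show ?thesis by (rule integral_norm_bound_ennreal)
    next
      \<comment> \<open>A Bochner integral that does not exist has the value 0.\<close>
      case False then show ?thesis by (simp add: not_integrable_integral_eq)
    qed
    also have "\<dots> \<le> (\<integral>\<^sup>+\<zeta>. F ((1/\<delta>) *\<^sub>R \<zeta>) \<partial>lborel)"
    proof (rule nn_integral_mono)
      fix \<zeta> :: 'a
      have "gauss \<zeta> \<le> 1" by (simp add: gauss_def)
      then have "norm (g \<zeta> * ft v (\<zeta>0 - (1/\<delta>) *\<^sub>R \<zeta>)) \<le> norm (ft u ((1/\<delta>) *\<^sub>R \<zeta>)) * norm (ft v (\<zeta>0 - (1/\<delta>) *\<^sub>R \<zeta>))"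
        using gauss_nonneg[of \<zeta>] by (simp add: g_def norm_mult mult_right_mono mult_left_le_one_le)
      then show "ennreal (norm (g \<zeta> * ft v (\<zeta>0 - (1/\<delta>) *\<^sub>R \<zeta>))) \<le> F ((1/\<delta>) *\<^sub>R \<zeta>)"
        unfolding F_def by (subst ennreal_mult[symmetric]) (auto intro: ennreal_leI)
    qed
    also have "\<dots> = ennreal (1 / (1/\<delta>) ^ DIM('a)) * I"
      unfolding I_def F_def[symmetric] using d by (intro nn_integral_scale) auto
    finally have "ennreal (norm (\<integral>\<zeta>. g \<zeta> * ft v (\<zeta>0 - (1/\<delta>) *\<^sub>R \<zeta>) \<partial>lborel)) \<le> ennreal (\<delta> ^ DIM('a)) * I"
      using d by (simp add: power_one_over field_simps)
    then have "ennreal (1 / k * (1 / \<delta> ^ DIM('a))) * ennreal (norm (\<integral>\<zeta>. g \<zeta> * ft v (\<zeta>0 - (1/\<delta>) *\<^sub>R \<zeta>) \<partial>lborel))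
       \<le> ennreal (1 / k * (1 / \<delta> ^ DIM('a))) * (ennreal (\<delta> ^ DIM('a)) * I)"
      by (rule mult_left_mono) simp
    also have "\<dots> = ennreal (1 / k) * I"
      using d k by (simp add: mult.assoc[symmetric] ennreal_mult[symmetric])
    also have "\<dots> \<le> 1 * I" using k by (intro mult_right_mono) auto
    also have "ennreal (1 / k * (1 / \<delta> ^ DIM('a))) * ennreal (norm (\<integral>\<zeta>. g \<zeta> * ft v (\<zeta>0 - (1/\<delta>) *\<^sub>R \<zeta>) \<partial>lborel)) = ennreal (norm (B \<delta>))"
    proof -
      have "norm ?c = 1 / k * (1 / \<delta> ^ DIM('a))" using d k by (simp only: norm_of_real) simp
      then show ?thesis unfolding Beq norm_mult using d k by (subst ennreal_mult[symmetric]) auto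
    qed
    finally show ?thesis by simp
  qed
  define \<delta> where "\<delta> n = 1 / real (Suc n)" for n
  have \<delta>: "0 < \<delta> n" for n by (simp add: \<delta>_def)
  have \<delta>0: "\<delta> \<longlonglongrightarrow> 0" unfolding \<delta>_def[abs_def] using LIMSEQ_inverse_real_of_nat by (simp add: inverse_eq_divide)
  have ig: "integrable lborel (\<lambda>s::'a. M * gauss s)"
  proof -
    have "integrable lborel (\<lambda>s::'a. norm (complex_of_real (gauss s)))" by (rule integrable_norm[OF integrable_gauss])
    then show ?thesis using gauss_nonneg[where 'a='a] by (simp add: abs_of_nonneg)
  qed
  have Hb: "norm (H d w) \<le> (\<integral>s. M * gauss (s::'a) \<partial>lborel)" for d w
  proof -
    have "norm (H d w) \<le> (\<integral>s. norm (u (w + d *\<^sub>R s) * complex_of_real (gauss s)) \<partial>lborel)"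
      unfolding H_def by (rule integral_norm_bound)
    also have "\<dots> \<le> (\<integral>s. M * gauss (s::'a) \<partial>lborel)"
      using u(2) gauss_nonneg M0
      by (intro integral_mono' ig) (auto simp: norm_mult abs_of_nonneg intro!: mult_right_mono mult_nonneg_nonneg)
    finally show ?thesis .
  qed
  have Hlim: "(\<lambda>n. H (\<delta> n) w) \<longlonglongrightarrow> u w * k" for w
  proof -
    have "(\<lambda>n. \<integral>s. u (w + \<delta> n *\<^sub>R s) * complex_of_real (gauss s) \<partial>lborel) \<longlonglongrightarrow> (\<integral>s. u w * complex_of_real (gauss (s::'a)) \<partial>lborel)"
    proof (rule integral_dominated_convergence[where w="\<lambda>s. M * gauss s"])
      show "AE s in lborel. (\<lambda>n. u (w + \<delta> n *\<^sub>R s) * complex_of_real (gauss s)) \<longlonglongrightarrow> u w * complex_of_real (gauss s)"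
      proof (rule AE_I2)
        fix s :: 'a
        have "(\<lambda>n. w + \<delta> n *\<^sub>R s) \<longlonglongrightarrow> w + 0 *\<^sub>R s" by (intro tendsto_intros \<delta>0)
        then have "(\<lambda>n. u (w + \<delta> n *\<^sub>R s)) \<longlonglongrightarrow> u w"
          using continuous_on_tendsto_compose[OF u(1)] by simp
        then show "(\<lambda>n. u (w + \<delta> n *\<^sub>R s) * complex_of_real (gauss s)) \<longlonglongrightarrow> u w * complex_of_real (gauss s)"
          by (intro tendsto_intros)
      qed
      show "AE s in lborel. norm (u (w + \<delta> n *\<^sub>R s) * complex_of_real (gauss s)) \<le> M * gauss s" for n
        using u(2) by (intro AE_I2) (simp add: norm_mult gauss_nonneg mult_right_mono)
    qed (use ig in auto)
    also have "(\<integral>s. u w * complex_of_real (gauss (s::'a)) \<partial>lborel) = u w * k"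
      using integral_gauss[of "0::'a"] by (simp add: k_def gauss_def)
    finally show ?thesis by (simp add: H_def)
  qed
  have [measurable]: "H (\<delta> n) \<in> borel_measurable borel" for n unfolding H_def[abs_def] by measurable
  have "(\<lambda>n. B (\<delta> n)) \<longlonglongrightarrow> (\<integral>w. (v w * cis (- (w \<bullet> \<zeta>0))) * (u w * k) \<partial>lborel)"
    unfolding B_def
  proof (rule integral_dominated_convergence[where w="\<lambda>w. norm (v w) * (\<integral>s. M * gauss (s::'a) \<partial>lborel)"])
    show "AE w in lborel. (\<lambda>n. v w * cis (- (w \<bullet> \<zeta>0)) * H (\<delta> n) w) \<longlonglongrightarrow> v w * cis (- (w \<bullet> \<zeta>0)) * (u w * k)"
      by (intro AE_I2 tendsto_intros Hlim)
    show "AE w in lborel. norm (v w * cis (- (w \<bullet> \<zeta>0)) * H (\<delta> n) w) \<le> norm (v w) * (\<integral>s. M * gauss (s::'a) \<partial>lborel)" for n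
      using Hb by (auto simp: norm_mult intro!: mult_left_mono)
    show "integrable lborel (\<lambda>w. norm (v w) * (\<integral>s. M * gauss (s::'a) \<partial>lborel))"
      using v by (intro integrable_mult_left integrable_norm)
  qed auto
  also have "(\<integral>w. (v w * cis (- (w \<bullet> \<zeta>0))) * (u w * k) \<partial>lborel) = (\<integral>w. complex_of_real k * (cis (- (w \<bullet> \<zeta>0)) * (u w * v w)) \<partial>lborel)"
    by (simp only: mult_ac)
  also have "\<dots> = k * ft (\<lambda>z. u z * v z) \<zeta>0" unfolding ft_def by (rule integral_mult_right_zero)
  finally have lim: "(\<lambda>n. norm (B (\<delta> n))) \<longlonglongrightarrow> norm (k * ft (\<lambda>z. u z * v z) \<zeta>0)"
    by (rule tendsto_norm)
  have "ennreal (norm (k * ft (\<lambda>z. u z * v z) \<zeta>0)) \<le> I"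
    by (rule LIMSEQ_le_const2[OF tendsto_ennrealI[OF lim]]) (use bound \<delta> in auto)
  moreover have "norm (ft (\<lambda>z. u z * v z) \<zeta>0) \<le> norm (k * ft (\<lambda>z. u z * v z) \<zeta>0)"
    using k by (simp add: norm_mult mult_le_cancel_right1)
  ultimately show ?thesis unfolding I_def by (meson ennreal_leI order_trans)
qed

lemma fourier_st_eq_ft: "fourier_st u = ft u"
  by (auto simp: fourier_st_def ft_def fun_eq_iff case_prod_beta' inner_prod_def intro!: Bochner_Integration.integral_cong)

subsection \<open>Low-high interactions\<close>

lemma powr_comparable:
  fixes x y c a :: real
  assumes "0 < x" "0 < y" "x \<le> c * y" "y \<le> c * x" "1 \<le> c"
  shows "x powr a \<le> c powr \<bar>a\<bar> * y powr a"
proof (cases "0 \<le> a")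
  case True
  then have "x powr a \<le> (c * y) powr a" using assms by (intro powr_mono2) auto
  then show ?thesis using True assms by (simp add: powr_mult)
next
  case False
  then have "(c * x) powr a \<le> y powr a" using assms by (intro powr_mono2') auto
  then have "c powr (-a) * (c powr a * x powr a) \<le> c powr (-a) * y powr a"
    using assms by (intro mult_left_mono) (auto simp: powr_mult)
  then show ?thesis using False assms by (simp add: mult.assoc[symmetric] powr_add[symmetric])
qed

lemma powr_le_one_le_neg: "1 \<le> x \<Longrightarrow> a \<le> 0 \<Longrightarrow> x powr a \<le> 1" for x a :: real
  using powr_mono[of a 0 x] by simp

lemma nn_integral_power_Icc:
  assumes \<delta>: "0 < \<delta>" and T: "0 \<le> T"
  shows "(\<integral>\<^sup>+\<rho>. ennreal ((1 + \<rho>) powr (\<delta> - 1)) * indicator {0..T} \<rho> \<partial>lborel) \<le> ennreal ((1 + T) powr \<delta> / \<delta>)"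
proof -
  have "(\<integral>\<^sup>+\<rho>. ennreal ((1 + \<rho>) powr (\<delta> - 1)) * indicator {0..T} \<rho> \<partial>lborel)
    = ennreal ((1 + T) powr \<delta> / \<delta> - (1 + 0) powr \<delta> / \<delta>)"
  proof (rule nn_integral_FTC_Icc[where F="\<lambda>t. (1 + t) powr \<delta> / \<delta>"])
    fix x assume "x \<in> {0..T}"
    then have "0 < 1 + x" by simp
    then show "((\<lambda>t. (1 + t) powr \<delta> / \<delta>) has_real_derivative (1 + x) powr (\<delta> - 1)) (at x)"
      using \<delta> by (auto intro!: derivative_eq_intros)
  qed (use T in auto)
  also have "\<dots> \<le> ennreal ((1 + T) powr \<delta> / \<delta>)" using \<delta> by (intro ennreal_leI) simp
  finally show ?thesis .
qed

lemma jbr_sqrt_powr: "0 \<le> \<rho> \<Longrightarrow> jbr (sqrt \<rho>) powr a = (1 + \<rho>) powr (a / 2)"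
proof -
  assume \<rho>: "0 \<le> \<rho>"
  then have "jbr (sqrt \<rho>) = (1 + \<rho>) powr (1 / 2)" by (simp add: jbr_def powr_half_sqrt)
  then show ?thesis by (simp add: powr_powr)
qed

section \<open>Frequency weights\<close>

definition jn :: "real^3 \<Rightarrow> real" where "jn x = jbr (norm x)"

lemma jn_measurable [measurable]: "jn \<in> borel_measurable borel"
  unfolding jn_def[abs_def] by measurable

lemma jn_ge_1: "1 \<le> jn x" and jn_pos: "0 < jn x"
  by (simp_all add: jn_def jbr_ge_1 jbr_pos)

lemma norm_le_jn: "norm x \<le> jn x"
  using jbr_ge_abs[of "norm x"] by (simp add: jn_def)

lemma jn_minus [simp]: "jn (- x) = jn x"
  by (simp add: jn_def)

lemma jn_le: "norm x \<le> c * norm y \<Longrightarrow> 1 \<le> c \<Longrightarrow> jn x \<le> c * jn y"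
  unfolding jn_def by (rule jbr_le_mult) auto

lemma jn_powr_comparable:
  assumes "norm x \<le> c * norm y" "norm y \<le> c * norm x" "1 \<le> c"
  shows "jn x powr a \<le> c powr \<bar>a\<bar> * jn y powr a"
  by (intro powr_comparable jn_pos jn_le assms)

text \<open>The output modulation of two inputs that lie exactly on the sheets with signs e1 and
  e2.\<close>

definition cone_gap :: "real \<Rightarrow> real \<Rightarrow> real^3 \<Rightarrow> real^3 \<Rightarrow> real" where
  "cone_gap e1 e2 x y = \<bar>\<bar>e1 * norm x + e2 * norm y\<bar> - norm (x + y)\<bar>"

definition sobolev_weight :: "real \<Rightarrow> real \<Rightarrow> real \<Rightarrow> real^3 \<Rightarrow> real^3 \<Rightarrow> real" where
  "sobolev_weight s0 s1 s2 x y = jn (x + y) powr (-s0) * (jn x powr (-s1) * jn y powr (-s2))"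

definition min_freq :: "real^3 \<Rightarrow> real^3 \<Rightarrow> real" where
  "min_freq x y = min (jn (x + y)) (min (jn x) (jn y))"

text \<open>What becomes of the output modulation to the power \<beta>, for inputs near the cones:
  the cone gap, and an input modulation not exceeding the smallest frequency, for which the spare
  decay of the cone factors saves \<epsilon>.\<close>

definition main_weight :: "real \<Rightarrow> real \<Rightarrow> real \<Rightarrow> real \<Rightarrow> real \<Rightarrow> real \<Rightarrow> real \<Rightarrow> real^3 \<Rightarrow> real^3 \<Rightarrow> real" where
  "main_weight s0 s1 s2 \<beta> \<epsilon> e1 e2 x y = (cone_gap e1 e2 x y powr \<beta> + min_freq x y powr (\<beta> - \<epsilon>)) * sobolev_weight s0 s1 s2 x y"

lemma sobolev_weight_nonneg: "0 \<le> sobolev_weight s0 s1 s2 x y"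
  by (simp add: sobolev_weight_def)

lemma main_weight_nonneg: "0 \<le> main_weight s0 s1 s2 \<beta> \<epsilon> e1 e2 x y"
  by (simp add: main_weight_def sobolev_weight_nonneg)

lemma main_weight_measurable: "case_prod (main_weight s0 s1 s2 \<beta> \<epsilon> e1 e2) \<in> borel_measurable borel"
  unfolding main_weight_def[abs_def] cone_gap_def min_freq_def sobolev_weight_def case_prod_beta' by (simp add: borel_prod[symmetric])

lemma main_weight_restrict_measurable:
  assumes "Measurable.pred (borel \<Otimes>\<^sub>M borel) (\<lambda>z. R (fst z) (snd z))"
  shows "(\<lambda>(x, y). if R x y then main_weight s0 s1 s2 \<beta> \<epsilon> e1 e2 x y else 0) \<in> borel_measurable borel"
proof -
  have [measurable]: "(\<lambda>z. main_weight s0 s1 s2 \<beta> \<epsilon> e1 e2 (fst z) (snd z)) \<in> borel_measurable (borel \<Otimes>\<^sub>M borel)"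
    using main_weight_measurable by (simp add: borel_prod case_prod_beta')
  note [measurable] = assms
  have "(\<lambda>z. if R (fst z) (snd z) then main_weight s0 s1 s2 \<beta> \<epsilon> e1 e2 (fst z) (snd z) else 0) \<in> borel_measurable (borel \<Otimes>\<^sub>M borel)"
    by measurable
  then show ?thesis by (simp add: borel_prod case_prod_beta')
qed

lemma main_weight_swap: "main_weight s0 s1 s2 \<beta> \<epsilon> e1 e2 x y = main_weight s0 s2 s1 \<beta> \<epsilon> e2 e1 y x"
  by (simp add: main_weight_def cone_gap_def min_freq_def sobolev_weight_def add.commute mult.commute min.commute)

text \<open>Both compared quantities are within |y| of |x|.\<close>

lemma cone_gap_le:
  assumes "\<bar>e1\<bar> = 1" "\<bar>e2\<bar> = 1"
  shows "cone_gap e1 e2 x y \<le> 2 * norm y"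
proof -
  have "\<bar>\<bar>e1 * norm x + e2 * norm y\<bar> - norm x\<bar> \<le> norm y"
  proof -
    have "e1 = 1 \<or> e1 = -1" "e2 = 1 \<or> e2 = -1" using assms by linarith+
    then have "\<bar>\<bar>e1 * a + e2 * c\<bar> - a\<bar> \<le> c" if "0 \<le> a" "0 \<le> c" for a c :: real
      using that by (elim disjE) (simp_all add: abs_if)
    then show ?thesis by simp
  qed
  moreover have "\<bar>norm x - norm (x + y)\<bar> \<le> norm y"
    using norm_triangle_ineq3[of x "x + y"] by simp
  ultimately show ?thesis unfolding cone_gap_def by linarith
qed

text \<open>In bipolar coordinates around the high frequency \<xi> the radius a = |\<xi> - y| is
  traded for the phase \<psi>; the factor a \<le> c |\<xi>| of the volume cancels the Jacobian
  1/|\<xi>|. Integrating first over \<rho> at fixed \<psi> permits weights that depend on the cone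
  gap, which is a function of \<psi>.\<close>

lemma nn_integral_low_frequency:
  fixes \<xi> :: "real^3" and G :: "real \<Rightarrow> real \<Rightarrow> ennreal"
  assumes R: "0 < norm \<xi>" and G: "case_prod G \<in> borel_measurable borel"
    and e1: "\<bar>e1\<bar> = 1" and p: "1 < p" and c: "0 \<le> c"
    and A: "\<And>\<psi>. (\<integral>\<^sup>+\<rho>. G \<psi> (sqrt \<rho>) * indicator {0..} \<rho> \<partial>lborel) \<le> A"
  shows "(\<integral>\<^sup>+y. G (e1 * norm (\<xi> - y) + e2 * norm y) (norm y) * (if norm (\<xi> - y) \<le> c * norm \<xi> then 1 else 0) *
      ennreal (jbr (\<tau> - (e1 * norm (\<xi> - y) + e2 * norm y)) powr (-p)) \<partial>lborel) \<le> ennreal (c * pi * jconst p) * A"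
proof -
  note [measurable] = measurable_curried[OF G]
  define R where "R = norm \<xi>"
  have R0: "0 < R" using R by (simp add: R_def)
  define F where "F r a = G (e1 * a + e2 * r) r * (if a \<le> c * R then 1 else 0) * ennreal (jbr (\<tau> - (e1 * a + e2 * r)) powr (-p))" for r a
  have Fm: "case_prod F \<in> borel_measurable borel"
    unfolding F_def case_prod_beta' by (simp add: borel_prod[symmetric])
  have "(\<integral>\<^sup>+y. F (norm y) (norm (\<xi> - y)) \<partial>lborel)
    \<le> ennreal (pi / R) * (\<integral>\<^sup>+\<rho>. \<integral>\<^sup>+a. F (sqrt \<rho>) a * (ennreal a * indicator {0..} a * indicator {0..} \<rho>) \<partial>lborel \<partial>lborel)"
    unfolding R_def by (rule nn_integral_bipolar[OF R Fm])
  also have "\<dots> \<le> ennreal (pi / R) * (\<integral>\<^sup>+\<rho>. ennreal (c * R) * (\<integral>\<^sup>+\<psi>. (G \<psi> (sqrt \<rho>) * indicator {0..} \<rho>) * ennreal (jbr (\<tau> - \<psi>) powr (-p)) \<partial>lborel) \<partial>lborel)"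
  proof (intro mult_left_mono nn_integral_mono)
    fix \<rho> :: real
    let ?h = "\<lambda>\<psi>. (G \<psi> (sqrt \<rho>) * indicator {0..} \<rho>) * ennreal (jbr (\<tau> - \<psi>) powr (-p))"
    have "(\<integral>\<^sup>+a. F (sqrt \<rho>) a * (ennreal a * indicator {0..} a * indicator {0..} \<rho>) \<partial>lborel)
       \<le> (\<integral>\<^sup>+a. ennreal (c * R) * ?h (e2 * sqrt \<rho> + e1 * a) \<partial>lborel)"
    proof (rule nn_integral_mono)
      fix a :: real
      show "F (sqrt \<rho>) a * (ennreal a * indicator {0..} a * indicator {0..} \<rho>) \<le> ennreal (c * R) * ?h (e2 * sqrt \<rho> + e1 * a)"
      proof (cases "0 \<le> a \<and> a \<le> c * R")
        case True
        then have "ennreal a \<le> ennreal (c * R)" by (intro ennreal_leI) simp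
        then have "ennreal a * ?h (e2 * sqrt \<rho> + e1 * a) \<le> ennreal (c * R) * ?h (e2 * sqrt \<rho> + e1 * a)" by (rule mult_right_mono) simp
        then show ?thesis using True by (simp add: F_def mult_ac add.commute)
      qed (auto simp: F_def indicator_def)
    qed
    also have "\<dots> = ennreal (c * R) * (\<integral>\<^sup>+a. ?h (e2 * sqrt \<rho> + e1 * a) \<partial>lborel)"
      by (rule nn_integral_cmult) measurable
    also have "(\<integral>\<^sup>+a. ?h (e2 * sqrt \<rho> + e1 * a) \<partial>lborel) = (\<integral>\<^sup>+\<psi>. ?h \<psi> \<partial>lborel)"
      using nn_integral_real_affine[of ?h e1 "e2 * sqrt \<rho>"] e1 by (cases "e1 = 0") auto
    finally show "(\<integral>\<^sup>+a. F (sqrt \<rho>) a * (ennreal a * indicator {0..} a * indicator {0..} \<rho>) \<partial>lborel) \<le> ennreal (c * R) * (\<integral>\<^sup>+\<psi>. ?h \<psi> \<partial>lborel)" .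
  qed simp
  also have "\<dots> = ennreal (pi / R) * (ennreal (c * R) * (\<integral>\<^sup>+\<rho>. (\<integral>\<^sup>+\<psi>. (G \<psi> (sqrt \<rho>) * indicator {0..} \<rho>) * ennreal (jbr (\<tau> - \<psi>) powr (-p)) \<partial>lborel) \<partial>lborel))"
    unfolding indicator_def by (subst nn_integral_cmult) auto
  also have "(\<integral>\<^sup>+\<rho>. (\<integral>\<^sup>+\<psi>. (G \<psi> (sqrt \<rho>) * indicator {0..} \<rho>) * ennreal (jbr (\<tau> - \<psi>) powr (-p)) \<partial>lborel) \<partial>lborel)
     = (\<integral>\<^sup>+\<psi>. (\<integral>\<^sup>+\<rho>. (G \<psi> (sqrt \<rho>) * indicator {0..} \<rho>) * ennreal (jbr (\<tau> - \<psi>) powr (-p)) \<partial>lborel) \<partial>lborel)"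
    unfolding indicator_def by (rule lborel_pair.Fubini') simp
  also have "\<dots> = (\<integral>\<^sup>+\<psi>. (\<integral>\<^sup>+\<rho>. G \<psi> (sqrt \<rho>) * indicator {0..} \<rho> \<partial>lborel) * ennreal (jbr (\<tau> - \<psi>) powr (-p)) \<partial>lborel)"
    unfolding indicator_def by (intro nn_integral_cong nn_integral_multc) simp
  also have "ennreal (pi / R) * (ennreal (c * R) * \<dots>) \<le> ennreal (pi / R) * (ennreal (c * R) * (\<integral>\<^sup>+\<psi>. A * ennreal (jbr (\<tau> - \<psi>) powr (-p)) \<partial>lborel))"
    by (intro mult_left_mono nn_integral_mono mult_right_mono A) auto
  also have "\<dots> \<le> ennreal (pi / R) * (ennreal (c * R) * (A * ennreal (jconst p)))"
    by (subst nn_integral_cmult) (auto intro!: mult_left_mono nn_integral_jbr p)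
  also have "\<dots> = ennreal (c * pi * jconst p) * A"
  proof -
    have "ennreal (c * pi * jconst p) = ennreal (pi / R) * (ennreal (c * R) * ennreal (jconst p))"
      using R0 c jconst_nonneg[OF p] by (simp add: ennreal_mult[symmetric])
    then show ?thesis by (simp add: mult_ac)
  qed
  finally show ?thesis by (simp add: F_def R_def)
qed

text \<open>Here y is the low input, so x and x + y are comparable and s0, s1 act together through h
  = s0 + s1. All constants 128 and 129 come from |y| \<le> 128 |x + y|, which also gives |x| \<le>
  129 |x + y|.\<close>

lemma low_high:
  assumes \<beta>: "0 < \<epsilon>" "\<epsilon> \<le> \<beta>" and s: "0 \<le> s0 + s1" "1 + \<beta> \<le> s0 + s1 + s2"
    and e: "\<bar>e1\<bar> = 1" "\<bar>e2\<bar> = 1" and b: "1 < 2 * b"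
  shows "l2_bounded (\<lambda>X Y. (if norm (snd Y) \<le> norm (snd X) \<and> norm (snd Y) \<le> 128 * norm (snd X + snd Y)
    then main_weight s0 s1 s2 \<beta> \<epsilon> e1 e2 (snd X) (snd Y) else 0) * (cone_factor b e1 X * cone_factor b e2 Y))"
proof -
  define h where "h = s0 + s1"
  define C1 where "C1 = 129 powr \<bar>s1\<bar>"
  define K0 where "K0 = 2 * C1\<^sup>2 * (128 powr (2 * h) + 2 powr (2 * \<beta>))"
  define A where "A = K0 * (1 / \<epsilon> + (if s2 < 1 + \<beta> then 128 powr (2 * (1 + \<beta> - s2)) / (1 + \<beta> - s2) else 4 powr \<beta> / \<beta>))"
  have h: "0 \<le> h" using s by (simp add: h_def)
  have C1: "0 \<le> C1" by (simp add: C1_def)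
  have K0: "0 \<le> K0" by (simp add: K0_def)
  have A0: "0 \<le> A" using \<beta> K0 by (auto simp: A_def)
  let ?R = "\<lambda>x y::real^3. norm y \<le> norm x \<and> norm y \<le> 128 * norm (x + y)"
  define w where "w x y = (if ?R x y then main_weight s0 s1 s2 \<beta> \<epsilon> e1 e2 x y else 0)" for x y
  have "l2_bounded (\<lambda>X Y. w (snd X) (snd Y) * (cone_factor b e1 X * cone_factor b e2 Y))"
  proof (rule l2_bounded_cone_output)
    show wm: "case_prod w \<in> borel_measurable borel"
      unfolding w_def by (rule main_weight_restrict_measurable) measurable
    note [measurable] = measurable_curried[OF wm]
    show "0 \<le> w x y" for x y by (simp add: w_def main_weight_nonneg)
    show "0 \<le> 129 * pi * jconst (2 * b) * A" using A0 jconst_nonneg[OF b] by simp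
    fix \<tau> and \<xi> :: "real^3"
    define R where "R = norm \<xi>"
    \<comment> \<open>Bounds the square of the gap term. For s2 < 1 + \<beta> the size bound B \<le>
      2r is enough, as the integral is dominated by the largest r. For s2 = 1 + \<beta> and h = 0
      that would leave the integral of 1/(1 + \<rho>), a logarithm; so for s2 \<ge> 1 + \<beta> the
      gap is kept and B \<le> 2r is read as a lower bound for r.\<close>
    define bt where "bt \<psi> r = (if s2 < 1 + \<beta> then (if r \<le> 128 * R then jbr R powr (-2 * h) * jbr r powr (2 * \<beta> - 2 * s2) else 0)
       else (if \<bar>\<bar>\<psi>\<bar> - R\<bar> \<le> 2 * r then \<bar>\<bar>\<psi>\<bar> - R\<bar> powr (2 * \<beta>) * jbr r powr (- 2 - 2 * \<beta>) else 0))" for \<psi> r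
    have bt0: "0 \<le> bt \<psi> r" for \<psi> r by (simp add: bt_def)
    define G where "G \<psi> r = ennreal (K0 * (jbr r powr (-2 - 2 * \<epsilon>) + bt \<psi> r))" for \<psi> r
    have Gm: "case_prod G \<in> borel_measurable borel"
      unfolding G_def bt_def case_prod_beta' by (simp add: borel_prod[symmetric])
    \<comment> \<open>Reflection makes the low input the variable of integration.\<close>
    have "(\<integral>\<^sup>+z. ennreal ((w z (\<xi> - z))\<^sup>2) * ennreal (jbr (\<tau> - e1 * norm z - e2 * norm (\<xi> - z)) powr (-(2*b))) \<partial>lborel)
      = (\<integral>\<^sup>+y. ennreal ((w (\<xi> - y) y)\<^sup>2) * ennreal (jbr (\<tau> - e1 * norm (\<xi> - y) - e2 * norm y) powr (-(2*b))) \<partial>lborel)"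
      using nn_integral_reflect[of "\<lambda>z. ennreal ((w z (\<xi> - z))\<^sup>2) * ennreal (jbr (\<tau> - e1 * norm z - e2 * norm (\<xi> - z)) powr (-(2*b)))" \<xi>]
      by simp
    also have "\<dots> \<le> ennreal (129 * pi * jconst (2 * b) * A)"
    \<comment> \<open>For output frequency 0 the region forces y = 0, a null set.\<close>
    proof (cases "R = 0")
      case True
      have "AE y in lborel. ennreal ((w (\<xi> - y) y)\<^sup>2) * ennreal (jbr (\<tau> - e1 * norm (\<xi> - y) - e2 * norm y) powr (-(2*b))) = 0"
        by (rule AE_mp[OF AE_lborel_singleton[of "0::real^3"]]) (use True in \<open>auto simp: w_def R_def\<close>)
      then have "(\<integral>\<^sup>+y. ennreal ((w (\<xi> - y) y)\<^sup>2) * ennreal (jbr (\<tau> - e1 * norm (\<xi> - y) - e2 * norm y) powr (-(2*b))) \<partial>lborel) = (\<integral>\<^sup>+(y::real^3). 0 \<partial>lborel)"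
        by (rule nn_integral_cong_AE)
      then show ?thesis by simp
    next
      case False
      then have R: "0 < norm \<xi>" by (simp add: R_def)
      have pt: "ennreal ((w (\<xi> - y) y)\<^sup>2) \<le> G (e1 * norm (\<xi> - y) + e2 * norm y) (norm y) * (if norm (\<xi> - y) \<le> 129 * norm \<xi> then 1 else 0)" for y
      proof (cases "?R (\<xi> - y) y")
        case True
        define r a where "r = norm y" and "a = norm (\<xi> - y)"
        have r: "r \<le> a" "r \<le> 128 * R" "0 \<le> r" using True by (auto simp: r_def a_def R_def)
        have aR: "a \<le> 129 * R" "R \<le> 2 * a"
          using r norm_triangle_ineq4[of \<xi> y] norm_triangle_ineq[of "\<xi> - y" y] by (auto simp: r_def a_def R_def)
        define B where "B = cone_gap e1 e2 (\<xi> - y) y"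
        have B: "0 \<le> B" "B \<le> 2 * r" "B = \<bar>\<bar>e1 * a + e2 * r\<bar> - R\<bar>"
          using cone_gap_le[OF e, of "\<xi> - y" y] by (auto simp: B_def r_def a_def R_def cone_gap_def)
        define j J where "j = jbr r" and "J = jbr R"
        have j: "1 \<le> j" "0 < j" "r \<le> j" "1 \<le> J" "0 < J"
          using jbr_ge_1 jbr_pos jbr_ge_abs[of r] r by (auto simp: j_def J_def)
        have jJ: "j \<le> 128 * J" unfolding j_def J_def using r by (intro jbr_le_mult) auto
        have m: "min_freq (\<xi> - y) y powr (\<beta> - \<epsilon>) \<le> j powr (\<beta> - \<epsilon>)"
          using \<beta> jn_pos by (intro powr_mono2) (auto simp: min_freq_def j_def r_def jn_def[of y, symmetric] less_imp_le)
        have sw: "sobolev_weight s0 s1 s2 (\<xi> - y) y \<le> C1 * (J powr (-h) * j powr (-s2))"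
        proof -
          have "jn (\<xi> - y) powr (-s1) \<le> 129 powr \<bar>-s1\<bar> * jn \<xi> powr (-s1)"
            using aR r by (intro jn_powr_comparable) (auto simp: a_def R_def)
          then have 1: "jn (\<xi> - y) powr (-s1) \<le> C1 * J powr (-s1)" by (simp add: C1_def J_def R_def jn_def)
          have "sobolev_weight s0 s1 s2 (\<xi> - y) y = J powr (-s0) * (jn (\<xi> - y) powr (-s1) * j powr (-s2))"
            by (simp add: sobolev_weight_def J_def j_def R_def r_def jn_def)
          also have "\<dots> \<le> J powr (-s0) * ((C1 * J powr (-s1)) * j powr (-s2))"
            using 1 by (intro mult_left_mono mult_right_mono) auto
          also have "\<dots> = C1 * ((J powr (-s0) * J powr (-s1)) * j powr (-s2))" by simp
          also have "J powr (-s0) * J powr (-s1) = J powr (-h)" by (simp add: powr_add[symmetric] h_def algebra_simps)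
          finally show ?thesis .
        qed
        have "w (\<xi> - y) y \<le> (B powr \<beta> + j powr (\<beta> - \<epsilon>)) * (C1 * (J powr (-h) * j powr (-s2)))"
          using True m sw sobolev_weight_nonneg unfolding w_def main_weight_def B_def
          by (auto intro!: mult_mono add_mono add_nonneg_nonneg)
        then have "(w (\<xi> - y) y)\<^sup>2 \<le> ((B powr \<beta> + j powr (\<beta> - \<epsilon>)) * (C1 * (J powr (-h) * j powr (-s2))))\<^sup>2"
          by (rule power_mono) (simp add: w_def main_weight_nonneg)
        also have "\<dots> = (B powr \<beta> + j powr (\<beta> - \<epsilon>))\<^sup>2 * (C1\<^sup>2 * (J powr (-2 * h) * j powr (-2 * s2)))"
        proof -
          have "(J powr (-h))\<^sup>2 = J powr (-2 * h)" "(j powr (-s2))\<^sup>2 = j powr (-2 * s2)"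
            by (simp_all add: power2_eq_square powr_add[symmetric])
          then show ?thesis by (simp only: power_mult_distrib)
        qed
        also have "\<dots> \<le> (2 * (B powr (2 * \<beta>)) + 2 * j powr (2 * \<beta> - 2 * \<epsilon>)) * (C1\<^sup>2 * (J powr (-2 * h) * j powr (-2 * s2)))"
        proof (rule mult_right_mono)
          have "(B powr \<beta> + j powr (\<beta> - \<epsilon>))\<^sup>2 \<le> 2 * (B powr \<beta>)\<^sup>2 + 2 * (j powr (\<beta> - \<epsilon>))\<^sup>2"
            using zero_le_power2[of "B powr \<beta> - j powr (\<beta> - \<epsilon>)"] by (simp add: power2_diff power2_sum)
          moreover have "(B powr \<beta>)\<^sup>2 = B powr (2 * \<beta>)" "(j powr (\<beta> - \<epsilon>))\<^sup>2 = j powr (2 * \<beta> - 2 * \<epsilon>)"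
            by (simp_all add: power2_eq_square powr_add[symmetric])
          ultimately show "(B powr \<beta> + j powr (\<beta> - \<epsilon>))\<^sup>2 \<le> 2 * (B powr (2 * \<beta>)) + 2 * j powr (2 * \<beta> - 2 * \<epsilon>)" by simp
        qed simp
        also have "\<dots> = 2 * C1\<^sup>2 * (B powr (2 * \<beta>) * (J powr (-2 * h) * j powr (-2 * s2)) + j powr (2 * \<beta> - 2 * \<epsilon>) * (J powr (-2 * h) * j powr (-2 * s2)))"
          by (simp add: algebra_simps)
        also have "\<dots> \<le> 2 * C1\<^sup>2 * (2 powr (2 * \<beta>) * bt (e1 * a + e2 * r) r + 128 powr (2 * h) * j powr (-2 - 2 * \<epsilon>))"
        proof (intro mult_left_mono add_mono)
          show "B powr (2 * \<beta>) * (J powr (-2 * h) * j powr (-2 * s2)) \<le> 2 powr (2 * \<beta>) * bt (e1 * a + e2 * r) r"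
          proof (cases "s2 < 1 + \<beta>")
            case True
            have "B powr (2 * \<beta>) \<le> (2 * j) powr (2 * \<beta>)" using B j \<beta> by (intro powr_mono2) auto
            also have "\<dots> = 2 powr (2 * \<beta>) * j powr (2 * \<beta>)" using j by (simp add: powr_mult)
            finally have "B powr (2 * \<beta>) * (J powr (-2 * h) * j powr (-2 * s2)) \<le> (2 powr (2 * \<beta>) * j powr (2 * \<beta>)) * (J powr (-2 * h) * j powr (-2 * s2))"
              by (rule mult_right_mono) simp
            also have "\<dots> = 2 powr (2 * \<beta>) * (J powr (-2 * h) * (j powr (2 * \<beta>) * j powr (-2 * s2)))" by (simp add: mult_ac)
            also have "j powr (2 * \<beta>) * j powr (-2 * s2) = j powr (2 * \<beta> - 2 * s2)" by (simp add: powr_add[symmetric])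
            finally show ?thesis using True r by (simp add: bt_def j_def J_def)
          next
            case False
            have "J powr (-2 * h) \<le> 1" using j h by (intro powr_le_one_le_neg) auto
            moreover have "j powr (-2 * s2) \<le> j powr (-2 - 2 * \<beta>)" using j False by (intro powr_mono) auto
            ultimately have "J powr (-2 * h) * j powr (-2 * s2) \<le> 1 * j powr (-2 - 2 * \<beta>)" by (intro mult_mono) auto
            then have "B powr (2 * \<beta>) * (J powr (-2 * h) * j powr (-2 * s2)) \<le> B powr (2 * \<beta>) * j powr (-2 - 2 * \<beta>)"
              by (intro mult_left_mono) auto
            also have "\<dots> = bt (e1 * a + e2 * r) r" using False B by (simp add: bt_def j_def)
            also have "\<dots> \<le> 2 powr (2 * \<beta>) * bt (e1 * a + e2 * r) r"
              using mult_right_mono[OF ge_one_powr_ge_zero[of 2 "2 * \<beta>"] bt0] \<beta> by simp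
            finally show ?thesis .
          qed
          \<comment> \<open>The decay in the output frequency is handed over to the low frequency,
            which is possible as h \<ge> 0. The total exponent of j is then 2\<beta> - 2\<epsilon> -
            2(s0 + s1 + s2), at most -2 - 2\<epsilon>.\<close>
          have "(128 * J) powr (-2 * h) \<le> j powr (-2 * h)" using j jJ h by (intro powr_mono2') auto
          then have "128 powr (2 * h) * (128 powr (-2 * h) * J powr (-2 * h)) \<le> 128 powr (2 * h) * j powr (-2 * h)"
            using j by (intro mult_left_mono) (auto simp: powr_mult)
          then have "J powr (-2 * h) \<le> 128 powr (2 * h) * j powr (-2 * h)"
            by (simp add: mult.assoc[symmetric] powr_add[symmetric])
          then have "j powr (2 * \<beta> - 2 * \<epsilon>) * (J powr (-2 * h) * j powr (-2 * s2)) \<le> j powr (2 * \<beta> - 2 * \<epsilon>) * ((128 powr (2 * h) * j powr (-2 * h)) * j powr (-2 * s2))"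
            by (intro mult_left_mono mult_right_mono) auto
          also have "\<dots> = 128 powr (2 * h) * j powr (2 * \<beta> - 2 * \<epsilon> + (-2 * h) + (-2 * s2))"
            by (simp only: powr_add mult_ac)
          also have "\<dots> \<le> 128 powr (2 * h) * j powr (-2 - 2 * \<epsilon>)"
            using j s by (intro mult_left_mono powr_mono) (auto simp: h_def)
          finally show "j powr (2 * \<beta> - 2 * \<epsilon>) * (J powr (-2 * h) * j powr (-2 * s2)) \<le> 128 powr (2 * h) * j powr (-2 - 2 * \<epsilon>)" .
        qed (use C1 in simp)
        also have "\<dots> \<le> K0 * (j powr (-2 - 2 * \<epsilon>) + bt (e1 * a + e2 * r) r)"
          unfolding K0_def using bt0[of "e1 * a + e2 * r" r] by (simp add: algebra_simps add_mono mult_left_mono)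
        finally show ?thesis using aR by (auto simp: G_def j_def r_def a_def R_def intro!: ennreal_leI)
      qed (auto simp: w_def)
      have "(\<integral>\<^sup>+y. ennreal ((w (\<xi> - y) y)\<^sup>2) * ennreal (jbr (\<tau> - e1 * norm (\<xi> - y) - e2 * norm y) powr (-(2*b))) \<partial>lborel)
        \<le> (\<integral>\<^sup>+y. G (e1 * norm (\<xi> - y) + e2 * norm y) (norm y) * (if norm (\<xi> - y) \<le> 129 * norm \<xi> then 1 else 0) *
            ennreal (jbr (\<tau> - (e1 * norm (\<xi> - y) + e2 * norm y)) powr (-(2*b))) \<partial>lborel)"
        using pt by (intro nn_integral_mono) (simp add: diff_diff_add mult_right_mono)
      also have "\<dots> \<le> ennreal (129 * pi * jconst (2*b)) * ennreal A"
      proof (rule nn_integral_low_frequency[OF R Gm e(1) b])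
        fix \<psi> :: real
        have "(\<integral>\<^sup>+\<rho>. ennreal (bt \<psi> (sqrt \<rho>)) * indicator {0..} \<rho> \<partial>lborel)
          \<le> ennreal (if s2 < 1 + \<beta> then 128 powr (2 * (1 + \<beta> - s2)) / (1 + \<beta> - s2) else 4 powr \<beta> / \<beta>)"
        proof (cases "s2 < 1 + \<beta>")
          case True
          \<comment> \<open>The integral over \<rho> up to (128 R)^2 grows like R^(2\<delta>). The
            weight pays for it because \<delta> \<le> h, which is the assumption on s0 + s1 +
            s2.\<close>
          define \<delta> where "\<delta> = 1 + \<beta> - s2"
          have \<delta>: "0 < \<delta>" "\<delta> \<le> h" using True s by (auto simp: \<delta>_def h_def)
          have "(\<integral>\<^sup>+\<rho>. ennreal (bt \<psi> (sqrt \<rho>)) * indicator {0..} \<rho> \<partial>lborel)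
             \<le> (\<integral>\<^sup>+\<rho>. ennreal (jbr R powr (-2 * h)) * (ennreal ((1 + \<rho>) powr (\<delta> - 1)) * indicator {0..(128 * R)\<^sup>2} \<rho>) \<partial>lborel)"
          proof (rule nn_integral_mono)
            fix \<rho> :: real
            show "ennreal (bt \<psi> (sqrt \<rho>)) * indicator {0..} \<rho> \<le> ennreal (jbr R powr (-2 * h)) * (ennreal ((1 + \<rho>) powr (\<delta> - 1)) * indicator {0..(128 * R)\<^sup>2} \<rho>)"
            proof (cases "0 \<le> \<rho> \<and> sqrt \<rho> \<le> 128 * R")
              case r: True
              have "jbr (sqrt \<rho>) powr (2 * \<beta> - 2 * s2) = (1 + \<rho>) powr (\<delta> - 1)"
              proof -
                have "(2 * \<beta> - 2 * s2) / 2 = \<delta> - 1" by (simp add: \<delta>_def field_simps)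
                then show ?thesis using r by (simp only: jbr_sqrt_powr)
              qed
              moreover have "\<rho> \<le> (128 * R)\<^sup>2" using r sqrt_le_D by blast
              ultimately show ?thesis using True r by (simp add: bt_def ennreal_mult)
            qed (use True in \<open>auto simp: bt_def indicator_def\<close>)
          qed
          also have "\<dots> \<le> ennreal (jbr R powr (-2 * h)) * ennreal ((1 + (128 * R)\<^sup>2) powr \<delta> / \<delta>)"
            by (subst nn_integral_cmult) (auto intro!: mult_left_mono nn_integral_power_Icc \<delta>)
          also have "\<dots> = ennreal (jbr R powr (-2 * h) * ((1 + (128 * R)\<^sup>2) powr \<delta> / \<delta>))"
            by (rule ennreal_mult[symmetric]) (use \<delta> in auto)
          also have "\<dots> \<le> ennreal (128 powr (2 * \<delta>) / \<delta>)"
          proof (rule ennreal_leI)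
            have "(1 + (128 * R)\<^sup>2) powr \<delta> = jbr (128 * R) powr (2 * \<delta>)"
            proof -
              have "jbr (128 * R) = jbr (sqrt ((128 * R)\<^sup>2))" by (simp only: real_sqrt_abs jbr_abs)
              then show ?thesis using jbr_sqrt_powr[of "(128 * R)\<^sup>2" "2 * \<delta>"] by simp
            qed
            also have "\<dots> \<le> (128 * jbr R) powr (2 * \<delta>)"
              using \<delta> jbr_mult_le[of 128 R] jbr_nonneg by (intro powr_mono2) auto
            also have "\<dots> = 128 powr (2 * \<delta>) * jbr R powr (2 * \<delta>)" using jbr_pos by (simp add: powr_mult)
            finally have "jbr R powr (-2 * h) * (1 + (128 * R)\<^sup>2) powr \<delta> \<le> jbr R powr (-2 * h) * (128 powr (2 * \<delta>) * jbr R powr (2 * \<delta>))"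
              by (rule mult_left_mono) simp
            also have "\<dots> = 128 powr (2 * \<delta>) * jbr R powr (2 * \<delta> - 2 * h)" using jbr_pos[of R] by (simp add: powr_diff powr_minus field_simps)
            also have "\<dots> \<le> 128 powr (2 * \<delta>) * 1"
              using \<delta> jbr_ge_1 by (intro mult_left_mono powr_le_one_le_neg) auto
            finally show "jbr R powr (-2 * h) * ((1 + (128 * R)\<^sup>2) powr \<delta> / \<delta>) \<le> 128 powr (2 * \<delta>) / \<delta>"
              using \<delta> by (simp add: divide_right_mono)
          qed
          finally show ?thesis using True by (simp add: \<delta>_def)
        next
          case False
          \<comment> \<open>At fixed \<psi> the gap is the constant B, and the region starts at
            \<rho> = B^2/4. The tail of (1 + \<rho>)^(-1-\<beta>) from there on compensates
            B^(2\<beta>), without any logarithm.\<close>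
          define B where "B = \<bar>\<bar>\<psi>\<bar> - R\<bar>"
          have B: "0 \<le> B" by (simp add: B_def)
          have "(\<integral>\<^sup>+\<rho>. ennreal (bt \<psi> (sqrt \<rho>)) * indicator {0..} \<rho> \<partial>lborel)
             \<le> (\<integral>\<^sup>+\<rho>. ennreal (B powr (2 * \<beta>)) * (ennreal ((1 + \<rho>) powr (-1 - \<beta>)) * indicator {B\<^sup>2 / 4..} \<rho>) \<partial>lborel)"
          proof (rule nn_integral_mono)
            fix \<rho> :: real
            show "ennreal (bt \<psi> (sqrt \<rho>)) * indicator {0..} \<rho> \<le> ennreal (B powr (2 * \<beta>)) * (ennreal ((1 + \<rho>) powr (-1 - \<beta>)) * indicator {B\<^sup>2 / 4..} \<rho>)"
            proof (cases "0 \<le> \<rho> \<and> B \<le> 2 * sqrt \<rho>")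
              case r: True
              have "jbr (sqrt \<rho>) powr (- 2 - 2 * \<beta>) = (1 + \<rho>) powr (-1 - \<beta>)"
              proof -
                have "(- 2 - 2 * \<beta>) / 2 = -1 - \<beta>" by simp
                then show ?thesis using r by (simp only: jbr_sqrt_powr)
              qed
              moreover have "B\<^sup>2 \<le> (2 * sqrt \<rho>)\<^sup>2" using r B by (intro power_mono) auto
              then have "B\<^sup>2 / 4 \<le> \<rho>" using r by (simp add: power_mult_distrib)
              ultimately show ?thesis using False r by (simp add: bt_def B_def ennreal_mult)
            qed (use False in \<open>auto simp: bt_def B_def indicator_def\<close>)
          qed
          also have "\<dots> = ennreal (B powr (2 * \<beta>)) * ennreal ((1 + B\<^sup>2 / 4) powr (-\<beta>) / \<beta>)"
            using \<beta> by (subst nn_integral_cmult) (auto simp: nn_integral_shifted_power add_pos_nonneg)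
          also have "\<dots> = ennreal (B powr (2 * \<beta>) * ((1 + B\<^sup>2 / 4) powr (-\<beta>) / \<beta>))"
            by (rule ennreal_mult[symmetric]) (use \<beta> in auto)
          also have "\<dots> \<le> ennreal (4 powr \<beta> / \<beta>)"
          proof (rule ennreal_leI)
            have "B powr (2 * \<beta>) = (B powr 2) powr \<beta>" by (simp add: powr_powr)
            also have "B powr 2 = B\<^sup>2" using B by simp
            finally have "B powr (2 * \<beta>) = (B\<^sup>2) powr \<beta>" .
            also have "\<dots> \<le> (4 * (1 + B\<^sup>2 / 4)) powr \<beta>" using \<beta> by (intro powr_mono2) auto
            also have "\<dots> = 4 powr \<beta> * (1 + B\<^sup>2 / 4) powr \<beta>" by (rule powr_mult)
            finally have "B powr (2 * \<beta>) * (1 + B\<^sup>2 / 4) powr (-\<beta>) \<le> 4 powr \<beta> * (1 + B\<^sup>2 / 4) powr \<beta> * (1 + B\<^sup>2 / 4) powr (-\<beta>)"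
              by (rule mult_right_mono) simp
            also have "\<dots> = 4 powr \<beta>"
            proof -
              have "1 + B\<^sup>2 / 4 \<noteq> 0" using zero_le_power2[of B] by (simp add: add_nonneg_eq_0_iff)
              then show ?thesis by (simp add: mult.assoc powr_add[symmetric])
            qed
            finally show "B powr (2 * \<beta>) * ((1 + B\<^sup>2 / 4) powr (-\<beta>) / \<beta>) \<le> 4 powr \<beta> / \<beta>"
              using \<beta> by (simp add: divide_right_mono)
          qed
          finally show ?thesis using False by simp
        qed
        note bt_int = this
        have j_int: "(\<integral>\<^sup>+\<rho>. ennreal (jbr (sqrt \<rho>) powr (-2 - 2 * \<epsilon>)) * indicator {0..} \<rho> \<partial>lborel) \<le> ennreal (1 / \<epsilon>)"
        proof -
          have "(\<integral>\<^sup>+\<rho>. ennreal (jbr (sqrt \<rho>) powr (-2 - 2 * \<epsilon>)) * indicator {0..} \<rho> \<partial>lborel)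
            = (\<integral>\<^sup>+\<rho>. ennreal ((1 + \<rho>) powr (-1 - \<epsilon>)) * indicator {0..} \<rho> \<partial>lborel)"
          proof (rule nn_integral_cong)
            fix \<rho> :: real
            have "jbr (sqrt \<rho>) powr (-2 - 2 * \<epsilon>) = (1 + \<rho>) powr (-1 - \<epsilon>)" if "0 \<le> \<rho>"
            proof -
              have "(-2 - 2 * \<epsilon>) / 2 = -1 - \<epsilon>" by simp
              then show ?thesis using that by (simp only: jbr_sqrt_powr)
            qed
            then show "ennreal (jbr (sqrt \<rho>) powr (-2 - 2 * \<epsilon>)) * indicator {0..} \<rho> = ennreal ((1 + \<rho>) powr (-1 - \<epsilon>)) * indicator {0..} \<rho>"
              by (auto simp: indicator_def)
          qed
          then show ?thesis using nn_integral_shifted_power[of \<epsilon> 1 0] \<beta> by simp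
        qed
        have "(\<integral>\<^sup>+\<rho>. G \<psi> (sqrt \<rho>) * indicator {0..} \<rho> \<partial>lborel)
          = (\<integral>\<^sup>+\<rho>. ennreal K0 * (ennreal (jbr (sqrt \<rho>) powr (-2 - 2 * \<epsilon>)) * indicator {0..} \<rho> + ennreal (bt \<psi> (sqrt \<rho>)) * indicator {0..} \<rho>) \<partial>lborel)"
          using K0 bt0 by (intro nn_integral_cong) (simp add: G_def ennreal_mult distrib_right[symmetric] mult.assoc)
        also have "\<dots> = ennreal K0 * ((\<integral>\<^sup>+\<rho>. ennreal (jbr (sqrt \<rho>) powr (-2 - 2 * \<epsilon>)) * indicator {0..} \<rho> \<partial>lborel) + (\<integral>\<^sup>+\<rho>. ennreal (bt \<psi> (sqrt \<rho>)) * indicator {0..} \<rho> \<partial>lborel))"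
          unfolding bt_def by (simp add: nn_integral_cmult nn_integral_add)
        also have "\<dots> \<le> ennreal K0 * (ennreal (1 / \<epsilon>) + ennreal (if s2 < 1 + \<beta> then 128 powr (2 * (1 + \<beta> - s2)) / (1 + \<beta> - s2) else 4 powr \<beta> / \<beta>))"
          by (intro mult_left_mono add_mono bt_int j_int) simp
        also have "\<dots> = ennreal A"
          unfolding A_def using K0 \<beta> by (subst ennreal_plus[symmetric]) (auto simp: ennreal_mult)
        finally show "(\<integral>\<^sup>+\<rho>. G \<psi> (sqrt \<rho>) * indicator {0..} \<rho> \<partial>lborel) \<le> ennreal A" .
      qed simp
      also have "\<dots> = ennreal (129 * pi * jconst (2 * b) * A)"
        using A0 jconst_nonneg[OF b] by (simp add: ennreal_mult)
      finally show ?thesis .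
    qed
    finally show "(\<integral>\<^sup>+z. ennreal ((w z (\<xi> - z))\<^sup>2) * ennreal (jbr (\<tau> - e1 * norm z - e2 * norm (\<xi> - z)) powr (-(2*b))) \<partial>lborel)
      \<le> ennreal (129 * pi * jconst (2 * b) * A)" .
  qed (rule b)
  then show ?thesis unfolding w_def .
qed

subsection \<open>High-high interactions with opposite signs\<close>

lemma jn_powr: "jn z powr a = (1 + (norm z)\<^sup>2) powr (a / 2)"
  using jbr_sqrt_powr[of "(norm z)\<^sup>2" a] by (simp add: jn_def)

lemma nn_integral_jn_ball:
  assumes s: "0 < s" and T: "0 \<le> T"
  shows "(\<integral>\<^sup>+z. ennreal (if (norm z)\<^sup>2 \<le> T then jn z powr (2 * s - 3) else 0) \<partial>lborel) \<le> ennreal (2 * pi * ((1 + T) powr s / s))"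
proof -
  have "(\<integral>\<^sup>+z. ennreal (if (norm z)\<^sup>2 \<le> T then jn z powr (2 * s - 3) else 0) \<partial>lborel)
      = (\<integral>\<^sup>+\<rho>. ennreal (if \<rho> \<le> T then (1 + \<rho>) powr ((2 * s - 3) / 2) else 0) * (ennreal (2 * pi * sqrt \<rho>) * indicator {0..} \<rho>) \<partial>lborel)"
    unfolding jn_powr by (rule nn_integral_radial3[where F="\<lambda>\<rho>. ennreal (if \<rho> \<le> T then (1 + \<rho>) powr ((2 * s - 3) / 2) else 0)"]) measurable
  also have "\<dots> \<le> (\<integral>\<^sup>+\<rho>. ennreal (2 * pi) * (ennreal ((1 + \<rho>) powr (s - 1)) * indicator {0..T} \<rho>) \<partial>lborel)"
  proof (rule nn_integral_mono)
    fix \<rho> :: real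
    show "ennreal (if \<rho> \<le> T then (1 + \<rho>) powr ((2 * s - 3) / 2) else 0) * (ennreal (2 * pi * sqrt \<rho>) * indicator {0..} \<rho>)
       \<le> ennreal (2 * pi) * (ennreal ((1 + \<rho>) powr (s - 1)) * indicator {0..T} \<rho>)"
    proof (cases "0 \<le> \<rho> \<and> \<rho> \<le> T")
      case True
      have "sqrt \<rho> \<le> (1 + \<rho>) powr (1 / 2)" using True by (simp add: powr_half_sqrt)
      then have "(1 + \<rho>) powr ((2 * s - 3) / 2) * (2 * pi * sqrt \<rho>) \<le> (1 + \<rho>) powr ((2 * s - 3) / 2) * (2 * pi * (1 + \<rho>) powr (1 / 2))"
        by (intro mult_left_mono) auto
      also have "\<dots> = 2 * pi * ((1 + \<rho>) powr ((2 * s - 3) / 2) * (1 + \<rho>) powr (1 / 2))" by simp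
      also have "(1 + \<rho>) powr ((2 * s - 3) / 2) * (1 + \<rho>) powr (1 / 2) = (1 + \<rho>) powr (s - 1)"
        unfolding powr_add[symmetric] by (rule arg_cong[where f="\<lambda>e. (1 + \<rho>) powr e"]) (simp add: field_simps)
      finally show ?thesis using True by (simp add: ennreal_mult[symmetric] ennreal_leI)
    qed (auto simp: indicator_def)
  qed
  also have "\<dots> \<le> ennreal (2 * pi) * ennreal ((1 + T) powr s / s)"
    by (subst nn_integral_cmult) (auto intro!: mult_left_mono nn_integral_power_Icc s T)
  also have "\<dots> = ennreal (2 * pi * ((1 + T) powr s / s))"
    by (rule ennreal_mult[symmetric]) (use s in auto)
  finally show ?thesis .
qed

lemma nn_integral_jn_decay:
  assumes q: "3 < q"
  shows "(\<integral>\<^sup>+z. ennreal (jn z powr (-q)) \<partial>lborel) \<le> ennreal (4 * pi / (q - 3))"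
proof -
  have "(\<integral>\<^sup>+z. ennreal (jn z powr (-q)) \<partial>lborel)
      = (\<integral>\<^sup>+\<rho>. ennreal ((1 + \<rho>) powr (-q / 2)) * (ennreal (2 * pi * sqrt \<rho>) * indicator {0..} \<rho>) \<partial>lborel)"
    unfolding jn_powr by (rule nn_integral_radial3[where F="\<lambda>\<rho>. ennreal ((1 + \<rho>) powr (-q / 2))"]) measurable
  also have "\<dots> \<le> (\<integral>\<^sup>+\<rho>. ennreal (2 * pi) * (ennreal ((1 + \<rho>) powr (-1 - (q - 3) / 2)) * indicator {0..} \<rho>) \<partial>lborel)"
  proof (rule nn_integral_mono)
    fix \<rho> :: real
    show "ennreal ((1 + \<rho>) powr (-q / 2)) * (ennreal (2 * pi * sqrt \<rho>) * indicator {0..} \<rho>)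
       \<le> ennreal (2 * pi) * (ennreal ((1 + \<rho>) powr (-1 - (q - 3) / 2)) * indicator {0..} \<rho>)"
    proof (cases "0 \<le> \<rho>")
      case True
      have "sqrt \<rho> \<le> (1 + \<rho>) powr (1 / 2)" using True by (simp add: powr_half_sqrt)
      then have "(1 + \<rho>) powr (-q / 2) * (2 * pi * sqrt \<rho>) \<le> (1 + \<rho>) powr (-q / 2) * (2 * pi * (1 + \<rho>) powr (1 / 2))"
        by (intro mult_left_mono) auto
      also have "\<dots> = 2 * pi * ((1 + \<rho>) powr (-q / 2) * (1 + \<rho>) powr (1 / 2))" by simp
      also have "(1 + \<rho>) powr (-q / 2) * (1 + \<rho>) powr (1 / 2) = (1 + \<rho>) powr (-1 - (q - 3) / 2)"
        unfolding powr_add[symmetric] by (rule arg_cong[where f="\<lambda>e. (1 + \<rho>) powr e"]) (simp add: field_simps)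
      finally show ?thesis using True by (simp add: ennreal_mult[symmetric] ennreal_leI)
    qed auto
  qed
  also have "\<dots> = ennreal (2 * pi) * ennreal ((1 + 0) powr (- ((q - 3) / 2)) / ((q - 3) / 2))"
    using nn_integral_shifted_power[of "(q - 3) / 2" 1 0] q by (subst nn_integral_cmult) auto
  also have "\<dots> = ennreal (4 * pi / (q - 3))"
    using q by (simp add: ennreal_mult[symmetric])
  finally show ?thesis .
qed

text \<open>Below the scale |z|^2 = |P| the volume of the ball suffices; above it the weight is
  reduced to \<open>gap_weight\<close>, whose layers cost a multiple of |P|. The right-hand side is
  what the Sobolev weights of the two high inputs can pay.\<close>

lemma ellipsoid_weight:
  assumes \<epsilon>: "0 < \<epsilon>" "\<epsilon> \<le> \<beta>" and \<sigma>: "\<beta> \<le> \<sigma>" and hh: "1 + \<beta> \<le> s0 + \<sigma>" and ii: "3/2 + \<beta> \<le> s0 + 2 * \<sigma>" and p: "1 < p"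
  obtains C where "0 \<le> C" "\<And>P Q \<tau>. norm P \<le> norm Q \<Longrightarrow>
    (\<integral>\<^sup>+z. ennreal (if 128 * norm z < norm P then jn z powr (\<beta> - 2 * s0) *
        ((norm z - \<bar>norm (P + z) - norm P\<bar>) powr \<beta> + jn z powr (\<beta> - \<epsilon>)) else 0) *
      ennreal (jbr (\<tau> - (norm (P + z) + norm (Q + z))) powr (-p)) \<partial>lborel) \<le> ennreal (C * jn P powr (2 * \<sigma>))"
proof -
  define \<gamma> where "\<gamma> = 1 + 2 * \<beta> - 2 * s0"
  define C2 where "C2 = 2 powr \<bar>\<gamma>\<bar>"
  define CK where "CK = 2 powr p * jconst p * (pi + 18 powr (1 + \<epsilon>) * (612 powr \<epsilon> + 1) * (128 * pi / \<epsilon>))"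
  define C1 where "C1 = 2 * (2 * pi * (2 powr (2 * \<sigma>) / (2 * \<sigma>)))"
  have \<sigma>0: "0 < \<sigma>" using \<epsilon> \<sigma> by simp
  have C2: "0 \<le> C2" by (simp add: C2_def)
  have C1: "0 \<le> C1" using \<sigma>0 by (simp add: C1_def)
  have CK: "0 \<le> CK" unfolding CK_def using jconst_nonneg[OF p] \<epsilon> by (intro mult_nonneg_nonneg add_nonneg_nonneg) auto
  show thesis
  proof
    show "0 \<le> C1 + C2 * CK" using C1 C2 CK by simp
    fix P Q :: "real^3" and \<tau> assume PQ: "norm P \<le> norm Q"
    define N where "N = norm P"
    define V where "V z = (if 128 * norm z < norm P then jn z powr (\<beta> - 2 * s0) *
        ((norm z - \<bar>norm (P + z) - norm P\<bar>) powr \<beta> + jn z powr (\<beta> - \<epsilon>)) else 0)" for z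
    have [measurable]: "V \<in> borel_measurable borel" unfolding V_def[abs_def] by measurable
    let ?j = "\<lambda>z. ennreal (jbr (\<tau> - (norm (P + z) + norm (Q + z))) powr (-p))"
    have "(\<integral>\<^sup>+z. ennreal (V z) * ?j z \<partial>lborel) \<le> ennreal ((C1 + C2 * CK) * jn P powr (2 * \<sigma>))"
    proof (cases "P = 0")
      case True
      have "V z = 0" for z using norm_ge_zero[of z] by (simp add: V_def True not_less)
      then show ?thesis by simp
    next
      case False
      \<comment> \<open>Chosen so that 1 + T is 2 \<open>jn P\<close>; the ball |z|^2 \<le> T then
        contains both |z| < 1 and |z|^2 < |P|.\<close>
      define T where "T = 2 * jn P - 1"
      have T: "0 \<le> T" using jn_ge_1[of P] by (simp add: T_def)
      have NP: "N \<le> jn P" using norm_le_jn by (simp add: N_def)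
      have pt: "V z \<le> 2 * (if (norm z)\<^sup>2 \<le> T then jn z powr (2 * (2 * \<sigma>) - 3) else 0) + C2 * jn P powr (2 * \<sigma> - 1) * gap_weight \<epsilon> P z" for z
      proof (cases "128 * norm z < norm P")
        case z: True
        define n where "n = norm z"
        define J where "J = jn z"
        define B where "B = norm z - \<bar>norm (P + z) - norm P\<bar>"
        have B: "0 \<le> B" "B \<le> n" using norm_triangle_ineq3[of "P + z" P] by (auto simp: B_def n_def)
        have J: "1 \<le> J" "n \<le> J" "J\<^sup>2 = 1 + n\<^sup>2" using jn_ge_1 norm_le_jn by (auto simp: J_def n_def jn_def jbr_def)
        have V: "V z = J powr (\<beta> - 2 * s0) * (B powr \<beta> + J powr (\<beta> - \<epsilon>))" using z by (simp add: V_def J_def B_def)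
        show ?thesis
        proof (cases "1 \<le> n \<and> N \<le> n\<^sup>2")
          case False
          have "n\<^sup>2 \<le> T"
          proof (cases "1 \<le> n")
            case True
            then show ?thesis using False NP jn_ge_1[of P] by (simp add: T_def)
          next
            case n1: False
            then have "n\<^sup>2 \<le> 1" by (simp add: n_def power_le_one)
            then show ?thesis using jn_ge_1[of P] by (simp add: T_def)
          qed
          \<comment> \<open>The power of J is 2\<beta> - 2 s0, at most 4\<sigma> - 3 by the
            condition on s0 + 2\<sigma>. Integrated over the ball it gives \<open>jn P\<close> to
            the power 2\<sigma>.\<close>
          moreover have "V z \<le> 2 * J powr (2 * (2 * \<sigma>) - 3)"
          proof -
            have "B powr \<beta> \<le> J powr \<beta>" using B J \<epsilon> by (intro powr_mono2) auto
            moreover have "J powr (\<beta> - \<epsilon>) \<le> J powr \<beta>" using J \<epsilon> by (intro powr_mono) auto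
            ultimately have "V z \<le> J powr (\<beta> - 2 * s0) * (2 * J powr \<beta>)" unfolding V by (intro mult_left_mono) auto
            also have "\<dots> = 2 * J powr (\<beta> - 2 * s0 + \<beta>)" by (simp only: powr_add mult_ac)
            also have "\<dots> \<le> 2 * J powr (2 * (2 * \<sigma>) - 3)" using J ii by (intro mult_left_mono powr_mono) auto
            finally show ?thesis .
          qed
          moreover have "0 \<le> C2 * jn P powr (2 * \<sigma> - 1) * gap_weight \<epsilon> P z" using C2 gap_weight_nonneg by simp
          ultimately show ?thesis by (simp add: J_def n_def)
        next
          case True
          have n0: "0 < n" using True by simp
          \<comment> \<open>As B \<le> n and \<epsilon> \<le> \<beta>, the power of the relative gap
            may be lowered to \<epsilon>; both terms then share the factor J^\<beta>, and
            \<open>gap_weight\<close> with \<kappa> = \<epsilon> appears.\<close>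
          have 1: "B powr \<beta> + J powr (\<beta> - \<epsilon>) \<le> J powr \<beta> * ((B / n) powr \<epsilon> + n powr (-\<epsilon>))"
          proof -
            have "B powr \<beta> = n powr \<beta> * (B / n) powr \<beta>" using n0 B by (simp add: powr_divide)
            also have "\<dots> \<le> J powr \<beta> * (B / n) powr \<epsilon>"
              using J n0 B \<epsilon> by (intro mult_mono powr_mono2 powr_mono') auto
            finally have "B powr \<beta> \<le> J powr \<beta> * (B / n) powr \<epsilon>" .
            moreover have "J powr (\<beta> - \<epsilon>) = J powr \<beta> * J powr (-\<epsilon>)" by (simp add: powr_add[symmetric])
            moreover have "J powr \<beta> * J powr (-\<epsilon>) \<le> J powr \<beta> * n powr (-\<epsilon>)"
              using J n0 \<epsilon> by (intro mult_left_mono powr_mono2') auto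
            ultimately show ?thesis by (simp add: distrib_left)
          qed
          \<comment> \<open>The two critical scales: for \<gamma> \<ge> 0 the worst z has the size
            of P and \<gamma> \<le> 2\<sigma> - 1 is needed; for \<gamma> < 0 the worst z has |z|^2
            comparable to |P| and \<gamma>/2 \<le> 2\<sigma> - 1 is needed. These are the conditions
            \<open>hh\<close> and \<open>ii\<close>.\<close>
          have 2: "J powr \<gamma> \<le> C2 * jn P powr (2 * \<sigma> - 1)"
          proof (cases "0 \<le> \<gamma>")
            case g: True
            have "J \<le> jn P" unfolding J_def using jn_le[of z 1 P] z norm_ge_zero[of z] by simp
            then have "J powr \<gamma> \<le> jn P powr \<gamma>" using g J by (intro powr_mono2) auto
            also have "\<dots> \<le> jn P powr (2 * \<sigma> - 1)" using jn_ge_1 hh by (intro powr_mono) (auto simp: \<gamma>_def)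
            also have "\<dots> \<le> C2 * jn P powr (2 * \<sigma> - 1)"
              using mult_right_mono[OF ge_one_powr_ge_zero[of 2 "\<bar>\<gamma>\<bar>"], of "jn P powr (2 * \<sigma> - 1)"] by (simp add: C2_def)
            finally show ?thesis .
          next
            case g: False
            have "jn P \<le> 2 * J\<^sup>2"
            proof -
              have "jn P \<le> 1 + N" using jbr_le[of "norm P"] by (simp add: jn_def N_def)
              also have "1 + N \<le> 1 + n\<^sup>2" using True by simp
              also have "\<dots> \<le> 2 * (1 + n\<^sup>2)" by simp
              finally show ?thesis unfolding J(3) .
            qed
            then have "(2 * J\<^sup>2) powr (\<gamma> / 2) \<le> jn P powr (\<gamma> / 2)" using g jn_pos by (intro powr_mono2') auto
            moreover have "(2 * J\<^sup>2) powr (\<gamma> / 2) = 2 powr (\<gamma> / 2) * J powr \<gamma>"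
            proof -
              have "(J powr 2) powr (\<gamma> / 2) = J powr \<gamma>" by (simp add: powr_powr)
              moreover have "J powr 2 = J\<^sup>2" using J by simp
              moreover have "(2 * J\<^sup>2) powr (\<gamma> / 2) = 2 powr (\<gamma> / 2) * (J\<^sup>2) powr (\<gamma> / 2)" by (rule powr_mult)
              ultimately show ?thesis by (simp only:)
            qed
            ultimately have "2 powr (-\<gamma> / 2) * (2 powr (\<gamma> / 2) * J powr \<gamma>) \<le> 2 powr (-\<gamma> / 2) * jn P powr (\<gamma> / 2)"
              by (intro mult_left_mono) auto
            then have "J powr \<gamma> \<le> 2 powr (-\<gamma> / 2) * jn P powr (\<gamma> / 2)"
              by (simp add: mult.assoc[symmetric] powr_add[symmetric])
            also have "\<dots> \<le> C2 * jn P powr (2 * \<sigma> - 1)"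
              using g jn_ge_1[of P] ii unfolding C2_def by (intro mult_mono powr_mono) (auto simp: \<gamma>_def field_simps)
            finally show ?thesis .
          qed
          have "V z \<le> J powr (\<beta> - 2 * s0) * (J powr \<beta> * ((B / n) powr \<epsilon> + n powr (-\<epsilon>)))"
            unfolding V using 1 by (intro mult_left_mono) auto
          also have "\<dots> = (J powr (\<beta> - 2 * s0) * J powr \<beta>) * ((B / n) powr \<epsilon> + n powr (-\<epsilon>))" by simp
          also have "J powr (\<beta> - 2 * s0) * J powr \<beta> = J powr \<gamma> * J powr (-1)"
            unfolding powr_add[symmetric] by (simp add: \<gamma>_def)
          also have "J powr \<gamma> * J powr (-1) * ((B / n) powr \<epsilon> + n powr (-\<epsilon>)) \<le> (C2 * jn P powr (2 * \<sigma> - 1)) * inverse n * ((B / n) powr \<epsilon> + n powr (-\<epsilon>))"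
          proof (intro mult_right_mono mult_mono 2)
            show "J powr (-1) \<le> inverse n" using J n0 by (simp add: powr_minus le_imp_inverse_le)
          qed (use C2 n0 in auto)
          also have "\<dots> = C2 * jn P powr (2 * \<sigma> - 1) * gap_weight \<epsilon> P z"
            using True z by (simp add: gap_weight_def n_def N_def B_def)
          finally show ?thesis by (auto intro: add_increasing)
        qed
      next
        case False
        then show ?thesis using C2 gap_weight_nonneg[of \<epsilon> P z] by (simp add: V_def)
      qed
      let ?F = "\<lambda>z. ennreal (if (norm z)\<^sup>2 \<le> T then jn z powr (2 * (2 * \<sigma>) - 3) else 0)"
      have "(\<integral>\<^sup>+z. ennreal (V z) * ?j z \<partial>lborel) \<le> (\<integral>\<^sup>+z. ennreal 2 * ?F z + ennreal (C2 * jn P powr (2 * \<sigma> - 1)) * (ennreal (gap_weight \<epsilon> P z) * ?j z) \<partial>lborel)"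
      proof (rule nn_integral_mono)
        fix z :: "real^3"
        have "ennreal (V z) \<le> ennreal 2 * ?F z + ennreal (C2 * jn P powr (2 * \<sigma> - 1)) * ennreal (gap_weight \<epsilon> P z)"
          using pt[of z] C2 gap_weight_nonneg[of \<epsilon> P z]
          by (simp add: ennreal_mult[symmetric] ennreal_plus[symmetric] ennreal_numeral[symmetric] ennreal_leI del: ennreal_plus ennreal_numeral)
        then have "ennreal (V z) * ?j z \<le> (ennreal 2 * ?F z + ennreal (C2 * jn P powr (2 * \<sigma> - 1)) * ennreal (gap_weight \<epsilon> P z)) * ?j z"
          by (rule mult_right_mono) simp
        also have "\<dots> = (ennreal 2 * ?F z) * ?j z + ennreal (C2 * jn P powr (2 * \<sigma> - 1)) * (ennreal (gap_weight \<epsilon> P z) * ?j z)"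
          by (simp add: distrib_right mult.assoc)
        also have "(ennreal 2 * ?F z) * ?j z \<le> (ennreal 2 * ?F z) * 1"
          using p jbr_ge_1 by (intro mult_left_mono) (auto intro!: powr_le_one_le_neg)
        finally show "ennreal (V z) * ?j z \<le> ennreal 2 * ?F z + ennreal (C2 * jn P powr (2 * \<sigma> - 1)) * (ennreal (gap_weight \<epsilon> P z) * ?j z)"
          by (simp add: add_right_mono)
      qed
      also have "\<dots> = ennreal 2 * (\<integral>\<^sup>+z. ?F z \<partial>lborel) + ennreal (C2 * jn P powr (2 * \<sigma> - 1)) * (\<integral>\<^sup>+z. ennreal (gap_weight \<epsilon> P z) * ?j z \<partial>lborel)"
        by (subst nn_integral_add) (auto simp: nn_integral_cmult)
      also have "\<dots> \<le> ennreal 2 * ennreal (2 * pi * ((1 + T) powr (2 * \<sigma>) / (2 * \<sigma>))) + ennreal (C2 * jn P powr (2 * \<sigma> - 1)) * ennreal (CK * norm P)"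
        unfolding CK_def using \<sigma>0 by (intro add_mono mult_left_mono nn_integral_jn_ball gap_weight_layers T False PQ p \<epsilon>) auto
      also have "\<dots> = ennreal (2 * (2 * pi * ((1 + T) powr (2 * \<sigma>) / (2 * \<sigma>))) + C2 * jn P powr (2 * \<sigma> - 1) * (CK * norm P))"
      proof -
        have gen: "ennreal 2 * ennreal X + ennreal Y * ennreal Z = ennreal (2 * X + Y * Z)" if "0 \<le> X" "0 \<le> Y" "0 \<le> Z" for X Y Z
          using that by (simp add: ennreal_mult)
        show ?thesis by (rule gen) (use \<sigma>0 C2 CK in auto)
      qed
      also have "\<dots> \<le> ennreal ((C1 + C2 * CK) * jn P powr (2 * \<sigma>))"
      proof (rule ennreal_leI)
        have "(1 + T) powr (2 * \<sigma>) = 2 powr (2 * \<sigma>) * jn P powr (2 * \<sigma>)" using jn_pos[of P] by (simp add: T_def powr_mult)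
        then have 1: "2 * (2 * pi * ((1 + T) powr (2 * \<sigma>) / (2 * \<sigma>))) = C1 * jn P powr (2 * \<sigma>)" by (simp add: C1_def)
        have "C2 * jn P powr (2 * \<sigma> - 1) * (CK * norm P) \<le> C2 * jn P powr (2 * \<sigma> - 1) * (CK * jn P)"
          using C2 CK norm_le_jn by (intro mult_left_mono) auto
        also have "\<dots> = C2 * CK * (jn P powr (2 * \<sigma> - 1) * jn P powr 1)" using jn_pos[of P] by simp
        also have "\<dots> = C2 * CK * jn P powr (2 * \<sigma>)" unfolding powr_add[symmetric] by simp
        finally show "2 * (2 * pi * ((1 + T) powr (2 * \<sigma>) / (2 * \<sigma>))) + C2 * jn P powr (2 * \<sigma> - 1) * (CK * norm P) \<le> (C1 + C2 * CK) * jn P powr (2 * \<sigma>)"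
          using 1 by (simp add: distrib_right)
      qed
      finally show ?thesis .
    qed
    then show "(\<integral>\<^sup>+z. ennreal (if 128 * norm z < norm P then jn z powr (\<beta> - 2 * s0) *
        ((norm z - \<bar>norm (P + z) - norm P\<bar>) powr \<beta> + jn z powr (\<beta> - \<epsilon>)) else 0) *
      ennreal (jbr (\<tau> - (norm (P + z) + norm (Q + z))) powr (-p)) \<partial>lborel) \<le> ennreal ((C1 + C2 * CK) * jn P powr (2 * \<sigma>))"
      unfolding V_def .
  qed
qed

definition high_high_region :: "real^3 \<Rightarrow> real^3 \<Rightarrow> bool" where
  "high_high_region x y \<longleftrightarrow> 128 * norm (x + y) < norm x \<and> 128 * norm (x + y) < norm y"

lemma high_high_region_measurable [measurable]: "Measurable.pred (borel \<Otimes>\<^sub>M borel) (\<lambda>z. high_high_region (fst z) (snd z))"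
  unfolding high_high_region_def by measurable

lemma high_high_comparable:
  assumes "high_high_region x y"
  shows "jn y powr a \<le> 2 powr \<bar>a\<bar> * jn x powr a" "jn x powr a \<le> 2 powr \<bar>a\<bar> * jn y powr a"
proof -
  have "norm y \<le> norm (x + y) + norm x" "norm x \<le> norm (x + y) + norm y"
    using norm_triangle_ineq4[of "x + y" x] norm_triangle_ineq4[of "x + y" y] by auto
  then have "norm y \<le> 2 * norm x" "norm x \<le> 2 * norm y"
    using assms norm_ge_zero[of "x + y"] unfolding high_high_region_def by linarith+
  then show "jn y powr a \<le> 2 powr \<bar>a\<bar> * jn x powr a" "jn x powr a \<le> 2 powr \<bar>a\<bar> * jn y powr a"
    by (intro jn_powr_comparable; simp)+
qed

lemma high_high_sobolev_weight:
  assumes "high_high_region x y"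
  shows "sobolev_weight s0 s1 s2 x y \<le> 2 powr \<bar>s2\<bar> * (jn (x + y) powr (-s0) * jn x powr (-(s1 + s2)))"
    and "sobolev_weight s0 s1 s2 x y \<le> 2 powr \<bar>s1\<bar> * (jn (x + y) powr (-s0) * jn y powr (-(s1 + s2)))"
proof -
  have "sobolev_weight s0 s1 s2 x y \<le> jn (x + y) powr (-s0) * (jn x powr (-s1) * (2 powr \<bar>-s2\<bar> * jn x powr (-s2)))"
    unfolding sobolev_weight_def using high_high_comparable(1)[OF assms, of "-s2"] by (intro mult_left_mono) auto
  also have "\<dots> = 2 powr \<bar>s2\<bar> * (jn (x + y) powr (-s0) * (jn x powr (-s1) * jn x powr (-s2)))" by simp
  finally show "sobolev_weight s0 s1 s2 x y \<le> 2 powr \<bar>s2\<bar> * (jn (x + y) powr (-s0) * jn x powr (-(s1 + s2)))"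
    by (simp add: powr_add[symmetric])
  have "sobolev_weight s0 s1 s2 x y \<le> jn (x + y) powr (-s0) * ((2 powr \<bar>-s1\<bar> * jn y powr (-s1)) * jn y powr (-s2))"
    unfolding sobolev_weight_def using high_high_comparable(2)[OF assms, of "-s1"] by (intro mult_left_mono mult_right_mono) auto
  also have "\<dots> = 2 powr \<bar>s1\<bar> * (jn (x + y) powr (-s0) * (jn y powr (-s1) * jn y powr (-s2)))" by simp
  finally show "sobolev_weight s0 s1 s2 x y \<le> 2 powr \<bar>s1\<bar> * (jn (x + y) powr (-s0) * jn y powr (-(s1 + s2)))"
    by (simp add: powr_add[symmetric])
qed

text \<open>The region makes the output z small against both inputs, and regrouping integrates over
  z while the inputs \<eta> and \<zeta> are fixed. With P = -\<eta> and Q = -\<zeta> the gaps become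
  |z| minus the variation of |P + z| or |Q + z|, as in \<open>ellipsoid_weight\<close>.\<close>

lemma high_high_opposite:
  assumes \<epsilon>: "0 < \<epsilon>" "\<epsilon> \<le> \<beta>" and \<sigma>: "\<beta> \<le> s1 + s2" and hh: "1 + \<beta> \<le> s0 + s1 + s2" and ii: "3/2 + \<beta> \<le> s0 + 2 * (s1 + s2)"
    and e: "\<bar>e1\<bar> = 1" "e2 = - e1" and b: "1 < 2 * b"
  shows "l2_bounded (\<lambda>X Y. (if high_high_region (snd X) (snd Y) then main_weight s0 s1 s2 \<beta> \<epsilon> e1 e2 (snd X) (snd Y) else 0) * (cone_factor b e1 X * cone_factor b e2 Y))"
proof -
  define \<sigma> where "\<sigma> = s1 + s2"
  define k where "k = 2 powr \<bar>s1\<bar> * 2 powr \<bar>s2\<bar>"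
  have k: "0 \<le> k" by (simp add: k_def)
  have \<sigma>0: "0 \<le> \<sigma>" "\<beta> \<le> \<sigma>" using assms by (auto simp: \<sigma>_def)
  have "1 + \<beta> \<le> s0 + \<sigma>" "3/2 + \<beta> \<le> s0 + 2 * \<sigma>" using hh ii by (auto simp: \<sigma>_def)
  from ellipsoid_weight[OF \<epsilon> \<sigma>0(2) this b]
  obtain C where C: "0 \<le> C" "\<And>P Q \<tau>. norm P \<le> norm Q \<Longrightarrow>
    (\<integral>\<^sup>+z. ennreal (if 128 * norm z < norm P then jn z powr (\<beta> - 2 * s0) *
        ((norm z - \<bar>norm (P + z) - norm P\<bar>) powr \<beta> + jn z powr (\<beta> - \<epsilon>)) else 0) *
      ennreal (jbr (\<tau> - (norm (P + z) + norm (Q + z))) powr (-(2*b))) \<partial>lborel) \<le> ennreal (C * jn P powr (2 * \<sigma>))" by blast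
  define V where "V P z = (if 128 * norm z < norm P then jn z powr (\<beta> - 2 * s0) *
        ((norm z - \<bar>norm (P + z) - norm P\<bar>) powr \<beta> + jn z powr (\<beta> - \<epsilon>)) else 0)" for P z
  have [measurable]: "V P \<in> borel_measurable borel" for P unfolding V_def[abs_def] by measurable
  define w where "w x y = (if high_high_region x y then main_weight s0 s1 s2 \<beta> \<epsilon> e1 e2 x y else 0)" for x y
  have "l2_bounded (\<lambda>X Y. w (snd X) (snd Y) * (cone_factor b e1 X * cone_factor b e2 Y))"
  proof (rule l2_bounded_cone_regroup)
    show "case_prod w \<in> borel_measurable borel"
      unfolding w_def by (rule main_weight_restrict_measurable) measurable
    show "0 \<le> w x y" for x y by (simp add: w_def main_weight_nonneg)
    show "0 \<le> 2 * k * C" using C k by simp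
    fix \<tau> and \<eta> \<zeta> :: "real^3"
    define P Q where "P = - \<eta>" and "Q = - \<zeta>"
    define \<phi> where "\<phi> z = norm (P + z) + norm (Q + z)" for z
    have [measurable]: "\<phi> \<in> borel_measurable borel" unfolding \<phi>_def[abs_def] by measurable
    have zP: "norm (z - \<eta>) = norm (P + z)" "norm (z - \<zeta>) = norm (Q + z)" for z by (simp_all add: P_def Q_def)
    \<comment> \<open>Opposite signs have become a sum of distances; the overall sign is absorbed
      into \<tau>, as the bracket is even.\<close>
    have ph: "jbr (\<tau> - (e2 * norm (z - \<eta>) - e1 * norm (z - \<zeta>))) = jbr (- e1 * \<tau> - \<phi> z)" for z
    proof -
      have "e1 = 1 \<or> e1 = -1" using e by linarith
      then show ?thesis unfolding zP \<phi>_def e(2) jbr_def by (auto simp: power2_eq_square algebra_simps)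
    qed
    define D where "D P z = norm z - \<bar>norm (P + z) - norm P\<bar>" for P z :: "real^3"
    have D: "0 \<le> D P z" "D P z \<le> norm z" for P z
      using norm_triangle_ineq3[of "P + z" P] by (auto simp: D_def)
    define E where "E P z = jn z powr (-s0) * (D P z powr \<beta> + jn z powr (\<beta> - \<epsilon>))" for P z
    have E0: "0 \<le> E P z" for P z by (simp add: E_def)
    have w1: "w \<eta> (z - \<eta>) \<le> (if 128 * norm z < norm P then 2 powr \<bar>s2\<bar> * jn P powr (-\<sigma>) * E P z else 0)" for z
    proof (cases "high_high_region \<eta> (z - \<eta>)")
      case True
      have "cone_gap e1 e2 \<eta> (z - \<eta>) = D P z"
      proof -
        have "e1 = 1 \<or> e1 = -1" using e by linarith
        then have "\<bar>e1 * norm \<eta> + e2 * norm (z - \<eta>)\<bar> = \<bar>norm (P + z) - norm P\<bar>"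
          unfolding zP[symmetric] P_def norm_minus_cancel by (elim disjE) (simp_all add: e(2) abs_minus_commute)
        then show ?thesis using D[of P z] by (simp add: cone_gap_def D_def)
      qed
      moreover have "min_freq \<eta> (z - \<eta>) powr (\<beta> - \<epsilon>) \<le> jn z powr (\<beta> - \<epsilon>)"
        using \<epsilon> jn_pos by (intro powr_mono2) (auto simp: min_freq_def less_imp_le)
      ultimately have "main_weight s0 s1 s2 \<beta> \<epsilon> e1 e2 \<eta> (z - \<eta>) \<le> (D P z powr \<beta> + jn z powr (\<beta> - \<epsilon>)) * (2 powr \<bar>s2\<bar> * (jn z powr (-s0) * jn P powr (-\<sigma>)))"
        unfolding main_weight_def using high_high_sobolev_weight(1)[OF True, of s0 s1 s2] sobolev_weight_nonneg
        by (intro mult_mono add_mono) (auto simp: P_def \<sigma>_def)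
      then show ?thesis using True by (simp add: w_def high_high_region_def P_def E_def mult_ac)
    qed (simp add: w_def E0)
    have w2: "w (z - \<zeta>) \<zeta> \<le> (if 128 * norm z < norm Q then 2 powr \<bar>s1\<bar> * jn Q powr (-\<sigma>) * E Q z else 0)" for z
    proof (cases "high_high_region (z - \<zeta>) \<zeta>")
      case True
      have "cone_gap e1 e2 (z - \<zeta>) \<zeta> = D Q z"
      proof -
        have "e1 = 1 \<or> e1 = -1" using e by linarith
        then have "\<bar>e1 * norm (z - \<zeta>) + e2 * norm \<zeta>\<bar> = \<bar>norm (Q + z) - norm Q\<bar>"
          unfolding zP[symmetric] Q_def norm_minus_cancel by (elim disjE) (simp_all add: e(2) abs_minus_commute)
        then show ?thesis using D[of Q z] by (simp add: cone_gap_def D_def)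
      qed
      moreover have "min_freq (z - \<zeta>) \<zeta> powr (\<beta> - \<epsilon>) \<le> jn z powr (\<beta> - \<epsilon>)"
        using \<epsilon> jn_pos by (intro powr_mono2) (auto simp: min_freq_def less_imp_le)
      ultimately have "main_weight s0 s1 s2 \<beta> \<epsilon> e1 e2 (z - \<zeta>) \<zeta> \<le> (D Q z powr \<beta> + jn z powr (\<beta> - \<epsilon>)) * (2 powr \<bar>s1\<bar> * (jn z powr (-s0) * jn Q powr (-\<sigma>)))"
        unfolding main_weight_def using high_high_sobolev_weight(2)[OF True, of s0 s1 s2] sobolev_weight_nonneg
        by (intro mult_mono add_mono) (auto simp: Q_def \<sigma>_def)
      then show ?thesis using True by (simp add: w_def high_high_region_def Q_def E_def mult_ac)
    qed (simp add: w_def E0)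
    \<comment> \<open>One of the two gaps suffices; the other factor is estimated by size, which
      leaves the exponent \<beta> - 2 s0.\<close>
    have EE: "E P' z * E Q' z \<le> 2 * (jn z powr (\<beta> - 2 * s0) * (D P' z powr \<beta> + jn z powr (\<beta> - \<epsilon>)))" for P' Q' z
    proof -
      have "D Q' z powr \<beta> \<le> jn z powr \<beta>" using D[of Q' z] norm_le_jn[of z] \<epsilon> by (intro powr_mono2) auto
      moreover have "jn z powr (\<beta> - \<epsilon>) \<le> jn z powr \<beta>" using jn_ge_1[of z] \<epsilon> by (intro powr_mono) auto
      ultimately have "E Q' z \<le> jn z powr (-s0) * (2 * jn z powr \<beta>)" unfolding E_def by (intro mult_left_mono) auto
      then have "E P' z * E Q' z \<le> E P' z * (jn z powr (-s0) * (2 * jn z powr \<beta>))" using E0 by (rule mult_left_mono)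
      also have "\<dots> = 2 * ((jn z powr (-s0) * jn z powr (-s0) * jn z powr \<beta>) * (D P' z powr \<beta> + jn z powr (\<beta> - \<epsilon>)))"
        by (simp add: E_def)
      also have "jn z powr (-s0) * jn z powr (-s0) * jn z powr \<beta> = jn z powr (\<beta> - 2 * s0)"
        unfolding powr_add[symmetric] by simp
      finally show ?thesis .
    qed
    have prod: "w \<eta> (z - \<eta>) * w (z - \<zeta>) \<zeta> \<le> 2 * k * (jn P powr (-\<sigma>) * jn Q powr (-\<sigma>)) * V M z"
      if M: "M = P \<or> M = Q" for M z
    proof (cases "128 * norm z < norm P \<and> 128 * norm z < norm Q")
      case True
      have "w \<eta> (z - \<eta>) * w (z - \<zeta>) \<zeta> \<le> (2 powr \<bar>s2\<bar> * jn P powr (-\<sigma>) * E P z) * (2 powr \<bar>s1\<bar> * jn Q powr (-\<sigma>) * E Q z)"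
        using w1[of z] w2[of z] True E0 by (intro mult_mono) (auto simp: w_def main_weight_nonneg)
      also have "\<dots> = k * (jn P powr (-\<sigma>) * jn Q powr (-\<sigma>)) * (E P z * E Q z)" by (simp add: k_def)
      also have "\<dots> \<le> k * (jn P powr (-\<sigma>) * jn Q powr (-\<sigma>)) * (2 * V M z)"
        using EE[of P z Q] EE[of Q z P] M True k by (intro mult_left_mono) (auto simp: V_def D_def mult.commute)
      finally show ?thesis by simp
    next
      case False
      then have "w \<eta> (z - \<eta>) * w (z - \<zeta>) \<zeta> = 0" by (auto simp: w_def high_high_region_def P_def Q_def)
      moreover have "0 \<le> 2 * k * (jn P powr (-\<sigma>) * jn Q powr (-\<sigma>)) * V M z" using k by (simp add: V_def)
      ultimately show ?thesis by linarith
    qed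
    \<comment> \<open>The gap kept is that of the shorter of the two vectors, because the ellipsoid
      estimate is governed by the shorter one. Since \<sigma> \<ge> 0, the decay in both vectors is
      at least that in the shorter, which cancels its power 2\<sigma>.\<close>
    have main: "(\<integral>\<^sup>+z. ennreal (w \<eta> (z - \<eta>) * w (z - \<zeta>) \<zeta>) * ennreal (jbr (- e1 * \<tau> - \<phi> z) powr (-(2*b))) \<partial>lborel) \<le> ennreal (2 * k * C)"
      if M: "M = P \<and> norm P \<le> norm Q \<or> M = Q \<and> norm Q \<le> norm P" for M
    proof -
      let ?c = "2 * k * (jn P powr (-\<sigma>) * jn Q powr (-\<sigma>))"
      have "(\<integral>\<^sup>+z. ennreal (w \<eta> (z - \<eta>) * w (z - \<zeta>) \<zeta>) * ennreal (jbr (- e1 * \<tau> - \<phi> z) powr (-(2*b))) \<partial>lborel)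
         \<le> (\<integral>\<^sup>+z. ennreal ?c * (ennreal (V M z) * ennreal (jbr (- e1 * \<tau> - \<phi> z) powr (-(2*b)))) \<partial>lborel)"
      proof (rule nn_integral_mono)
        fix z
        have "ennreal (w \<eta> (z - \<eta>) * w (z - \<zeta>) \<zeta>) \<le> ennreal ?c * ennreal (V M z)"
          using prod[of M z] M k by (subst ennreal_mult[symmetric]) (auto simp: V_def intro!: ennreal_leI)
        then show "ennreal (w \<eta> (z - \<eta>) * w (z - \<zeta>) \<zeta>) * ennreal (jbr (- e1 * \<tau> - \<phi> z) powr (-(2*b)))
           \<le> ennreal ?c * (ennreal (V M z) * ennreal (jbr (- e1 * \<tau> - \<phi> z) powr (-(2*b))))"
          unfolding mult.assoc[symmetric] by (rule mult_right_mono) simp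
      qed
      also have "\<dots> = ennreal ?c * (\<integral>\<^sup>+z. ennreal (V M z) * ennreal (jbr (- e1 * \<tau> - \<phi> z) powr (-(2*b))) \<partial>lborel)"
        by (rule nn_integral_cmult) measurable
      also have "\<dots> \<le> ennreal ?c * ennreal (C * jn M powr (2 * \<sigma>))"
      proof (rule mult_left_mono)
        show "(\<integral>\<^sup>+z. ennreal (V M z) * ennreal (jbr (- e1 * \<tau> - \<phi> z) powr (-(2*b))) \<partial>lborel) \<le> ennreal (C * jn M powr (2 * \<sigma>))"
          using M
        proof
          assume "M = P \<and> norm P \<le> norm Q"
          then show ?thesis using C(2)[of P Q "- e1 * \<tau>"] by (simp add: V_def \<phi>_def)
        next
          assume "M = Q \<and> norm Q \<le> norm P"
          then show ?thesis using C(2)[of Q P "- e1 * \<tau>"] by (simp add: V_def \<phi>_def add.commute)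
        qed
      qed simp
      also have "\<dots> = ennreal (?c * (C * jn M powr (2 * \<sigma>)))"
        using k C by (simp add: ennreal_mult)
      also have "\<dots> \<le> ennreal (2 * k * C)"
      proof (rule ennreal_leI)
        have M1: "jn M \<le> jn P" "jn M \<le> jn Q" using M jn_le[of P 1 Q] jn_le[of Q 1 P] by auto
        have "jn P powr (-\<sigma>) * jn Q powr (-\<sigma>) \<le> jn M powr (-\<sigma>) * jn M powr (-\<sigma>)"
          using M1 \<sigma>0 jn_pos by (intro mult_mono powr_mono2') auto
        then have "jn P powr (-\<sigma>) * jn Q powr (-\<sigma>) * jn M powr (2 * \<sigma>) \<le> jn M powr (-\<sigma>) * jn M powr (-\<sigma>) * jn M powr (2 * \<sigma>)"
          by (rule mult_right_mono) simp
        also have "\<dots> = 1" unfolding powr_add[symmetric] using jn_pos[of M] by simp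
        finally have "(2 * k * C) * (jn P powr (-\<sigma>) * jn Q powr (-\<sigma>) * jn M powr (2 * \<sigma>)) \<le> (2 * k * C) * 1"
          using k C by (intro mult_left_mono) auto
        then show "?c * (C * jn M powr (2 * \<sigma>)) \<le> 2 * k * C" by (simp add: mult_ac)
      qed
      finally show ?thesis .
    qed
    show "(\<integral>\<^sup>+z. ennreal (w \<eta> (z - \<eta>) * w (z - \<zeta>) \<zeta>) * ennreal (jbr (\<tau> - (e2 * norm (z - \<eta>) - e1 * norm (z - \<zeta>))) powr (-(2*b))) \<partial>lborel) \<le> ennreal (2 * k * C)"
      unfolding ph using main[of P] main[of Q] by (cases "norm P \<le> norm Q") auto
  qed (rule b)
  then show ?thesis by (simp add: w_def)
qed

subsection \<open>High-high interactions with equal signs\<close>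

text \<open>After integration along the gradient only the distance s \<le> |z| to an axis is
  available. For \<nu> \<le> 1 the bound 2(\<nu> - 1) on the exponent is not positive, and |z| may
  be replaced by s; for \<nu> > 1 the power is replaced by its maximum on the ball. At \<nu> = 0 the
  exponent -2 would give a logarithm in the plane, and s0 > 1 removes it.\<close>

lemma disc_weight:
  assumes \<nu>: "0 \<le> \<nu>" "1 - \<nu> \<le> s0" "\<nu> = 0 \<Longrightarrow> 1 < s0"
  obtains C where "0 \<le> C" "\<And>N. 0 \<le> N \<Longrightarrow> \<exists>g\<in>borel_measurable borel.
    (\<forall>z s. 0 \<le> s \<and> s \<le> norm z \<and> 128 * norm z < N \<longrightarrow> ennreal (jn z powr (-2 * s0)) \<le> g s) \<and>
    (\<integral>\<^sup>+y. g (norm (y::real\<times>real)) \<partial>lborel) \<le> ennreal (C * jbr N powr (2 * \<nu>))"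
proof -
  have rad: "(\<integral>\<^sup>+y. F ((norm (y::real\<times>real))\<^sup>2) \<partial>lborel) \<le> ennreal pi * (\<integral>\<^sup>+w. F w * indicator {0..} w \<partial>lborel)"
    if [measurable]: "F \<in> borel_measurable borel" for F
  proof -
    have "(\<integral>\<^sup>+y. F ((norm (y::real\<times>real))\<^sup>2) \<partial>lborel) = (\<integral>\<^sup>+w. ennreal pi * (F w * indicator {0..} w) \<partial>lborel)"
      by (subst nn_integral_radial2) (auto simp: mult_ac)
    then show ?thesis by (simp add: nn_integral_cmult)
  qed
  have jr: "jbr r powr a = (1 + r\<^sup>2) powr (a / 2)" if "0 \<le> r" for r a
    using jbr_sqrt_powr[of "r\<^sup>2" a] that by simp
  consider "\<nu> = 0" | "0 < \<nu>" "\<nu> \<le> 1" | "1 < \<nu>" using \<nu> by linarith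
  then show thesis
  proof cases
    case 1
    then have s0: "1 < s0" using \<nu> by simp
    show thesis
    proof (rule that[of "pi / (s0 - 1)"])
      show "0 \<le> pi / (s0 - 1)" using s0 by simp
      fix N :: real
      define g where "g s = ennreal ((1 + s\<^sup>2) powr (-1 - (s0 - 1)))" for s
      show "\<exists>g\<in>borel_measurable borel. (\<forall>z s. 0 \<le> s \<and> s \<le> norm z \<and> 128 * norm z < N \<longrightarrow> ennreal (jn z powr (-2 * s0)) \<le> g s) \<and>
        (\<integral>\<^sup>+y. g (norm (y::real\<times>real)) \<partial>lborel) \<le> ennreal (pi / (s0 - 1) * jbr N powr (2 * \<nu>))"
      proof (intro bexI[of _ g] conjI allI impI)
        fix z :: "real^3" and s assume s: "0 \<le> s \<and> s \<le> norm z \<and> 128 * norm z < N"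
        have "jn z powr (-2 * s0) \<le> (1 + s\<^sup>2) powr (-1 - (s0 - 1))"
          unfolding jn_powr using s s0 by (auto intro!: powr_mono2' add_left_mono power_mono simp: add_pos_nonneg)
        then show "ennreal (jn z powr (-2 * s0)) \<le> g s" by (simp add: g_def ennreal_leI)
      next
        have "(\<integral>\<^sup>+y. g (norm (y::real\<times>real)) \<partial>lborel) \<le> ennreal pi * (\<integral>\<^sup>+w. ennreal ((1 + w) powr (-1 - (s0 - 1))) * indicator {0..} w \<partial>lborel)"
          unfolding g_def by (rule rad) measurable
        also have "\<dots> = ennreal (pi / (s0 - 1))"
          using nn_integral_shifted_power[of "s0 - 1" 1 0] s0 by (simp add: ennreal_mult[symmetric])
        finally show "(\<integral>\<^sup>+y. g (norm (y::real\<times>real)) \<partial>lborel) \<le> ennreal (pi / (s0 - 1) * jbr N powr (2 * \<nu>))"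
          using 1 jbr_pos[of N] by simp
        show "g \<in> borel_measurable borel" unfolding g_def[abs_def] by measurable
      qed
    qed
  next
    case 2
    show thesis
    proof (rule that[of "pi / \<nu>"])
      show "0 \<le> pi / \<nu>" using 2 by simp
      fix N :: real assume N: "0 \<le> N"
      define F where "F w = ennreal ((1 + w) powr (\<nu> - 1)) * indicator {..N\<^sup>2} w" for w :: real
      have [measurable]: "F \<in> borel_measurable borel" unfolding F_def[abs_def] by measurable
      show "\<exists>g\<in>borel_measurable borel. (\<forall>z s. 0 \<le> s \<and> s \<le> norm z \<and> 128 * norm z < N \<longrightarrow> ennreal (jn z powr (-2 * s0)) \<le> g s) \<and>
        (\<integral>\<^sup>+y. g (norm (y::real\<times>real)) \<partial>lborel) \<le> ennreal (pi / \<nu> * jbr N powr (2 * \<nu>))"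
      proof (intro bexI[of _ "\<lambda>s. F (s\<^sup>2)"] conjI allI impI)
        fix z :: "real^3" and s assume s: "0 \<le> s \<and> s \<le> norm z \<and> 128 * norm z < N"
        have "s \<le> N" using s norm_ge_zero[of z] by linarith
        then have "s\<^sup>2 \<le> N\<^sup>2" using s by (intro power_mono) auto
        have "jn z powr (-2 * s0) \<le> jn z powr (2 * (\<nu> - 1))" using jn_ge_1[of z] \<nu> by (intro powr_mono) auto
        also have "\<dots> = (1 + (norm z)\<^sup>2) powr (\<nu> - 1)"
        proof -
          have "2 * (\<nu> - 1) / 2 = \<nu> - 1" by (rule nonzero_mult_div_cancel_left) simp
          then show ?thesis by (simp only: jn_powr)
        qed
        also have "\<dots> \<le> (1 + s\<^sup>2) powr (\<nu> - 1)"
        proof (rule powr_mono2')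
          show "1 + s\<^sup>2 \<le> 1 + (norm z)\<^sup>2" using s by (intro add_left_mono power_mono) auto
          show "0 < 1 + s\<^sup>2" by (simp add: add_pos_nonneg)
        qed (use 2 in simp)
        finally show "ennreal (jn z powr (-2 * s0)) \<le> F (s\<^sup>2)" using \<open>s\<^sup>2 \<le> N\<^sup>2\<close> by (simp add: F_def ennreal_leI)
      next
        have "(\<integral>\<^sup>+y. F ((norm (y::real\<times>real))\<^sup>2) \<partial>lborel) \<le> ennreal pi * (\<integral>\<^sup>+w. F w * indicator {0..} w \<partial>lborel)"
          by (rule rad) measurable
        also have "(\<integral>\<^sup>+w. F w * indicator {0..} w \<partial>lborel) = (\<integral>\<^sup>+w. ennreal ((1 + w) powr (\<nu> - 1)) * indicator {0..N\<^sup>2} w \<partial>lborel)"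
          by (intro nn_integral_cong) (auto simp: F_def indicator_def)
        also have "\<dots> \<le> ennreal ((1 + N\<^sup>2) powr \<nu> / \<nu>)"
          using 2 by (intro nn_integral_power_Icc) auto
        finally have "(\<integral>\<^sup>+y. F ((norm (y::real\<times>real))\<^sup>2) \<partial>lborel) \<le> ennreal pi * ennreal ((1 + N\<^sup>2) powr \<nu> / \<nu>)"
          by (simp add: mult_left_mono)
        also have "\<dots> = ennreal (pi / \<nu> * jbr N powr (2 * \<nu>))"
          using 2 N by (simp add: ennreal_mult[symmetric] jr)
        finally show "(\<integral>\<^sup>+y. F ((norm (y::real\<times>real))\<^sup>2) \<partial>lborel) \<le> ennreal (pi / \<nu> * jbr N powr (2 * \<nu>))" .
      qed measurable
    qed
  next
    case 3
    show thesis
    proof (rule that[of pi])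
      show "0 \<le> pi" by simp
      fix N :: real assume N: "0 \<le> N"
      define c where "c = jbr N powr (2 * \<nu> - 2)"
      define F where "F w = ennreal c * indicator {..N\<^sup>2} w" for w :: real
      have [measurable]: "F \<in> borel_measurable borel" unfolding F_def[abs_def] by measurable
      show "\<exists>g\<in>borel_measurable borel. (\<forall>z s. 0 \<le> s \<and> s \<le> norm z \<and> 128 * norm z < N \<longrightarrow> ennreal (jn z powr (-2 * s0)) \<le> g s) \<and>
        (\<integral>\<^sup>+y. g (norm (y::real\<times>real)) \<partial>lborel) \<le> ennreal (pi * jbr N powr (2 * \<nu>))"
      proof (intro bexI[of _ "\<lambda>s. F (s\<^sup>2)"] conjI allI impI)
        fix z :: "real^3" and s assume s: "0 \<le> s \<and> s \<le> norm z \<and> 128 * norm z < N"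
        have zN: "s \<le> N" "norm z \<le> N" using s norm_ge_zero[of z] by linarith+
        then have "s\<^sup>2 \<le> N\<^sup>2" using s by (intro power_mono) auto
        have "jn z powr (-2 * s0) \<le> jn z powr (2 * \<nu> - 2)" using jn_ge_1[of z] \<nu> by (intro powr_mono) auto
        also have "\<dots> \<le> c" unfolding c_def jn_def using 3 zN N jbr_nonneg by (intro powr_mono2 jbr_mono) auto
        finally show "ennreal (jn z powr (-2 * s0)) \<le> F (s\<^sup>2)" using \<open>s\<^sup>2 \<le> N\<^sup>2\<close> by (simp add: F_def ennreal_leI)
      next
        have "(\<integral>\<^sup>+y. F ((norm (y::real\<times>real))\<^sup>2) \<partial>lborel) \<le> ennreal pi * (\<integral>\<^sup>+w. F w * indicator {0..} w \<partial>lborel)"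
          by (rule rad) measurable
        also have "(\<integral>\<^sup>+w. F w * indicator {0..} w \<partial>lborel) = (\<integral>\<^sup>+w. ennreal c * indicator {0..N\<^sup>2} w \<partial>lborel)"
          by (intro nn_integral_cong) (auto simp: F_def indicator_def)
        also have "\<dots> = ennreal c * ennreal (N\<^sup>2)" by (simp add: nn_integral_cmult_indicator)
        also have "ennreal pi * (ennreal c * ennreal (N\<^sup>2)) = ennreal (pi * (c * N\<^sup>2))"
          by (simp add: ennreal_mult c_def)
        also have "\<dots> \<le> ennreal (pi * jbr N powr (2 * \<nu>))"
        proof (intro ennreal_leI mult_left_mono)
          have "N\<^sup>2 \<le> (jbr N)\<^sup>2" using jbr_ge_abs[of N] N by (intro power_mono) auto
          then have "c * N\<^sup>2 \<le> c * jbr N powr 2" using jbr_pos[of N] by (intro mult_left_mono) (auto simp: c_def)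
          also have "\<dots> = jbr N powr (2 * \<nu>)" unfolding c_def powr_add[symmetric] by simp
          finally show "c * N\<^sup>2 \<le> jbr N powr (2 * \<nu>)" .
        qed simp
        finally show "(\<integral>\<^sup>+y. F ((norm (y::real\<times>real))\<^sup>2) \<partial>lborel) \<le> ennreal (pi * jbr N powr (2 * \<nu>))" .
      qed measurable
    qed
  qed
qed

text \<open>The angle condition keeps the directions of P and Q apart, so the gradient of the phase
  has length at least 1 at the origin; as |z| is below |P|/128 and |Q|/128,
  \<open>norm_sum_transversal\<close> applies on the whole support. Layers then have bounded
  thickness, and a plane integral remains.\<close>

lemma hyperboloid_weight:
  assumes \<nu>: "0 \<le> \<nu>" "1 - \<nu> \<le> s0" "\<nu> = 0 \<Longrightarrow> 1 < s0" and p: "1 < p"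
  obtains C where "0 \<le> C" "\<And>P Q \<tau>. 128 * (P \<bullet> Q) \<le> norm P * norm Q \<Longrightarrow>
    (\<integral>\<^sup>+z. ennreal (if 128 * norm z < norm P \<and> 128 * norm z < norm Q then jn z powr (-2 * s0) else 0) *
      ennreal (jbr (\<tau> - (norm (P + z) - norm (Q + z))) powr (-p)) \<partial>lborel) \<le> ennreal (C * (jn P powr \<nu> * jn Q powr \<nu>))"
proof -
  obtain C where C: "0 \<le> C" "\<And>N. 0 \<le> N \<Longrightarrow> \<exists>g\<in>borel_measurable borel.
    (\<forall>z s. 0 \<le> s \<and> s \<le> norm z \<and> 128 * norm z < N \<longrightarrow> ennreal (jn z powr (-2 * s0)) \<le> g s) \<and>
    (\<integral>\<^sup>+y. g (norm (y::real\<times>real)) \<partial>lborel) \<le> ennreal (C * jbr N powr (2 * \<nu>))"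
    using disc_weight[OF \<nu>] by blast
  show thesis
  proof
    show "0 \<le> 2 powr p * jconst p * (4 * C)" using C jconst_nonneg[OF p] by simp
    fix P Q :: "real^3" and \<tau> assume PQ: "128 * (P \<bullet> Q) \<le> norm P * norm Q"
    define W where "W z = ennreal (if 128 * norm z < norm P \<and> 128 * norm z < norm Q then jn z powr (-2 * s0) else 0)" for z
    define \<phi> where "\<phi> z = norm (P + z) - norm (Q + z)" for z
    have [measurable]: "W \<in> borel_measurable borel" "\<phi> \<in> borel_measurable borel"
      unfolding W_def[abs_def] \<phi>_def[abs_def] by measurable
    have "(\<integral>\<^sup>+z. W z * ennreal (jbr (\<tau> - \<phi> z) powr (-p)) \<partial>lborel) \<le> ennreal (2 powr p * jconst p * (4 * C) * (jn P powr \<nu> * jn Q powr \<nu>))"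
    proof (cases "P = 0 \<or> Q = 0")
      case True
      then have "W z = 0" for z using norm_ge_zero[of z] by (auto simp: W_def not_less)
      then show ?thesis by simp
    next
      case False
      define N where "N = min (norm P) (norm Q)"
      have N: "0 \<le> N" by (simp add: N_def)
      define d where "d = P /\<^sub>R norm P + (-1) *\<^sub>R (Q /\<^sub>R norm Q)"
      \<comment> \<open>The square of |d| is 2 minus twice the cosine of the angle between P and Q,
        and the cosine is at most 1/128.\<close>
      have d1: "1 \<le> norm d"
      proof -
        define a b where "a = P /\<^sub>R norm P" and "b = Q /\<^sub>R norm Q"
        have "norm a = 1" "norm b = 1" using False by (auto simp: a_def b_def)
        then have ab: "a \<bullet> a = 1" "b \<bullet> b = 1" by (simp_all only: norm_eq_1)
        have "a \<bullet> b = (P \<bullet> Q) / (norm P * norm Q)" using False by (simp add: a_def b_def field_simps)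
        also have "\<dots> \<le> 1 / 128" using PQ False by (simp add: field_simps)
        finally have "a \<bullet> b \<le> 1 / 128" .
        moreover have "(norm d)\<^sup>2 = 2 - 2 * (a \<bullet> b)"
          unfolding d_def a_def[symmetric] b_def[symmetric] power2_norm_eq_inner
          by (simp add: inner_diff_left inner_diff_right ab inner_commute)
        ultimately have "1\<^sup>2 \<le> (norm d)\<^sup>2" by simp
        then show ?thesis by (rule power2_le_imp_le) simp
      qed
      then have d0: "d \<noteq> 0" by auto
      define n where "n = d /\<^sub>R norm d"
      have n: "norm n = 1" using d0 by (simp add: n_def)
      obtain g where g[measurable]: "g \<in> borel_measurable borel"
        and gW: "\<And>z s. 0 \<le> s \<Longrightarrow> s \<le> norm z \<Longrightarrow> 128 * norm z < N \<Longrightarrow> ennreal (jn z powr (-2 * s0)) \<le> g s"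
        and gi: "(\<integral>\<^sup>+y. g (norm (y::real\<times>real)) \<partial>lborel) \<le> ennreal (C * jbr N powr (2 * \<nu>))"
        using C(2)[OF N] by blast
      have layer: "(\<integral>\<^sup>+z. W z * indicator {t..t+1} (\<phi> z) \<partial>lborel) \<le> ennreal (4 * (C * jbr N powr (2 * \<nu>)))" for t
      proof -
        have "(\<integral>\<^sup>+z. W z * indicator {t..t+1} (\<phi> z) \<partial>lborel) \<le> ennreal (2 / (norm d / 2)) * (\<integral>\<^sup>+y. g (norm (y::real\<times>real)) \<partial>lborel)"
        proof (rule nn_integral_transversal_layer[OF n])
          fix z :: "real^3"
          have "norm (z - (z \<bullet> n) *\<^sub>R n) \<le> norm z"
          proof -
            have "(norm (z - (z \<bullet> n) *\<^sub>R n))\<^sup>2 = (norm z)\<^sup>2 - (z \<bullet> n)\<^sup>2"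
              using n unfolding power2_norm_eq_inner
              by (simp add: inner_diff_left inner_diff_right inner_commute norm_eq_1 power2_eq_square)
            then have "(norm (z - (z \<bullet> n) *\<^sub>R n))\<^sup>2 \<le> (norm z)\<^sup>2" by simp
            then show ?thesis by (rule power2_le_imp_le) simp
          qed
          then show "W z \<le> g (norm (z - (z \<bullet> n) *\<^sub>R n))"
            using gW[of "norm (z - (z \<bullet> n) *\<^sub>R n)" z] by (auto simp: W_def N_def)
        next
          fix z :: "real^3" and s assume "W z \<noteq> 0" "W (z + s *\<^sub>R n) \<noteq> 0"
          then have z: "norm z \<le> N / 128" "norm (z + s *\<^sub>R n) \<le> N / 128" by (auto simp: W_def N_def split: if_splits)
          have "norm P \<le> norm d * norm P" "norm Q \<le> norm d * norm Q" "N \<le> norm P" "N \<le> norm Q"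
            using mult_right_mono[OF d1, of "norm P"] mult_right_mono[OF d1, of "norm Q"] by (auto simp: N_def)
          then have r: "16 * (N / 128) \<le> norm d * norm P" "16 * (N / 128) \<le> norm d * norm Q"
            using N by linarith+
          have "norm d / 2 * \<bar>s\<bar> \<le> \<bar>(norm (P + (z + s *\<^sub>R (d /\<^sub>R norm d))) + (-1) * norm (Q + (z + s *\<^sub>R (d /\<^sub>R norm d))))
              - (norm (P + z) + (-1) * norm (Q + z))\<bar>"
            unfolding d_def
            by (rule norm_sum_transversal[where r="N / 128"]) (use False d0 r z in \<open>auto simp: d_def n_def\<close>)
          then show "norm d / 2 * \<bar>s\<bar> \<le> \<bar>\<phi> (z + s *\<^sub>R n) - \<phi> z\<bar>"
            by (simp add: \<phi>_def n_def)
        qed (use d0 in auto)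
        also have "\<dots> \<le> ennreal 4 * ennreal (C * jbr N powr (2 * \<nu>))"
        proof (intro mult_mono ennreal_leI gi)
          have "4 / norm d \<le> 4 / 1" using d1 by (intro divide_left_mono) auto
          then show "2 / (norm d / 2) \<le> 4" by simp
        qed auto
        also have "\<dots> = ennreal (4 * (C * jbr N powr (2 * \<nu>)))" by (rule ennreal_mult[symmetric]) (use C in auto)
        finally show ?thesis .
      qed
      have "(\<integral>\<^sup>+z. W z * ennreal (jbr (\<tau> - \<phi> z) powr (-p)) \<partial>lborel) \<le> ennreal (2 powr p * jconst p) * ennreal (4 * (C * jbr N powr (2 * \<nu>)))"
        by (intro nn_integral_layers p layer) auto
      also have "\<dots> = ennreal (2 powr p * jconst p * (4 * (C * jbr N powr (2 * \<nu>))))"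
        by (rule ennreal_mult[symmetric]) (use C jconst_nonneg[OF p] in auto)
      also have "\<dots> \<le> ennreal (2 powr p * jconst p * (4 * C) * (jn P powr \<nu> * jn Q powr \<nu>))"
      proof (rule ennreal_leI)
        have "jbr N powr (2 * \<nu>) = jbr N powr \<nu> * jbr N powr \<nu>" unfolding powr_add[symmetric] by simp
        also have "\<dots> \<le> jn P powr \<nu> * jn Q powr \<nu>"
          unfolding jn_def using \<nu> N by (intro mult_mono powr_mono2 jbr_mono jbr_nonneg) (auto simp: N_def)
        finally have "2 powr p * jconst p * (4 * C) * jbr N powr (2 * \<nu>) \<le> 2 powr p * jconst p * (4 * C) * (jn P powr \<nu> * jn Q powr \<nu>)"
          using C jconst_nonneg[OF p] by (intro mult_left_mono) auto
        then show "2 powr p * jconst p * (4 * (C * jbr N powr (2 * \<nu>))) \<le> 2 powr p * jconst p * (4 * C) * (jn P powr \<nu> * jn Q powr \<nu>)"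
          by (simp add: mult.assoc)
      qed
      finally show ?thesis .
    qed
    then show "(\<integral>\<^sup>+z. ennreal (if 128 * norm z < norm P \<and> 128 * norm z < norm Q then jn z powr (-2 * s0) else 0) *
      ennreal (jbr (\<tau> - (norm (P + z) - norm (Q + z))) powr (-p)) \<partial>lborel) \<le> ennreal (2 powr p * jconst p * (4 * C) * (jn P powr \<nu> * jn Q powr \<nu>))"
      by (simp add: W_def \<phi>_def)
  qed
qed

text \<open>Encoded by the set of non-negative coordinates: \<open>3 \<Rightarrow> bool\<close> is a
  finite type, so the sum over all octants is a sum over \<open>UNIV\<close>.\<close>

definition octant :: "real^3 \<Rightarrow> 3 \<Rightarrow> bool" where
  "octant x = (\<lambda>i. 0 \<le> x $ i)"

lemma octant_inner: "octant x = octant y \<Longrightarrow> 0 \<le> x \<bullet> y"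
  unfolding octant_def fun_eq_iff inner_vec_def inner_real_def
  by (intro sum_nonneg) (metis linear mult_nonneg_nonneg mult_nonpos_nonpos)

text \<open>Regrouping leads to |P + z| - |Q + z|, which is flat when P and Q are parallel. Only the
  first input is restricted to an octant, but regrouping compares two first inputs, \<eta> and z -
  \<zeta>; as z is small, this keeps \<zeta> from pointing along \<eta>.\<close>

lemma high_high_same:
  assumes \<epsilon>: "0 < \<epsilon>" "\<epsilon> \<le> \<beta>" and \<sigma>: "\<beta> \<le> s1 + s2" and hh: "1 + \<beta> \<le> s0 + s1 + s2" and jj: "s1 + s2 = \<beta> \<Longrightarrow> 1 + \<beta> < s0 + s1 + s2"
    and e: "\<bar>e\<bar> = 1" and b: "1 < 2 * b"
  shows "l2_bounded (\<lambda>X Y. (if high_high_region (snd X) (snd Y) then main_weight s0 s1 s2 \<beta> \<epsilon> e e (snd X) (snd Y) else 0) * (cone_factor b e X * cone_factor b e Y))"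
proof -
  define \<sigma> \<nu> where "\<sigma> = s1 + s2" and "\<nu> = \<sigma> - \<beta>"
  define k where "k = (2 powr \<beta> + 1)\<^sup>2 * (2 powr \<bar>s1\<bar> * 2 powr \<bar>s2\<bar>)"
  have k: "0 \<le> k" by (simp add: k_def)
  have \<nu>: "0 \<le> \<nu>" "1 - \<nu> \<le> s0" "\<nu> = 0 \<Longrightarrow> 1 < s0" using assms by (auto simp: \<sigma>_def \<nu>_def)
  obtain C where C: "0 \<le> C" "\<And>P Q \<tau>. 128 * (P \<bullet> Q) \<le> norm P * norm Q \<Longrightarrow>
    (\<integral>\<^sup>+z. ennreal (if 128 * norm z < norm P \<and> 128 * norm z < norm Q then jn z powr (-2 * s0) else 0) *
      ennreal (jbr (\<tau> - (norm (P + z) - norm (Q + z))) powr (-(2*b))) \<partial>lborel) \<le> ennreal (C * (jn P powr \<nu> * jn Q powr \<nu>))"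
    using hyperboloid_weight[OF \<nu> b] by blast
  define w where "w o' x y = (if high_high_region x y \<and> octant x = o' then main_weight s0 s1 s2 \<beta> \<epsilon> e e x y else 0)" for o' x y
  have wm: "case_prod (w o') \<in> borel_measurable borel" for o'
  proof -
    have "Measurable.pred (borel \<Otimes>\<^sub>M borel) (\<lambda>z. high_high_region (fst z) (snd z) \<and> octant (fst z) = o')"
      unfolding octant_def fun_eq_iff forall_3 by measurable
    then show ?thesis unfolding w_def by (rule main_weight_restrict_measurable)
  qed
  have w0: "0 \<le> w o' x y" for o' x y by (simp add: w_def main_weight_nonneg)
  have bd: "l2_bounded (\<lambda>X Y. w o' (snd X) (snd Y) * (cone_factor b e X * cone_factor b e Y))" for o'
  proof (rule l2_bounded_cone_regroup[OF wm w0 b])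
    show "0 \<le> k * C" using C k by simp
    fix \<tau> and \<eta> \<zeta> :: "real^3"
    define P Q where "P = - \<eta>" and "Q = - \<zeta>"
    have nP: "norm (z - \<eta>) = norm (P + z)" "norm (z - \<zeta>) = norm (Q + z)" for z by (simp_all add: P_def Q_def)
    have ph: "jbr (\<tau> - (e * norm (z - \<eta>) - e * norm (z - \<zeta>))) = jbr (e * \<tau> - (norm (P + z) - norm (Q + z)))" for z
    proof -
      have "e = 1 \<or> e = -1" using e by linarith
      then show ?thesis unfolding nP jbr_def by (elim disjE) (simp_all add: power2_eq_square algebra_simps)
    qed
    define V where "V z = (if 128 * norm z < norm P \<and> 128 * norm z < norm Q then jn z powr (-2 * s0) else 0)" for z
    have [measurable]: "V \<in> borel_measurable borel" unfolding V_def[abs_def] by measurable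
    \<comment> \<open>For equal signs nothing is gained from the gap: it is bounded by either input
      frequency, whichever is convenient.\<close>
    have fac: "cone_gap e e x y powr \<beta> + min_freq x y powr (\<beta> - \<epsilon>) \<le> (2 powr \<beta> + 1) * jn v powr \<beta>"
      if v: "v = x \<or> v = y" for x y v :: "real^3"
    proof -
      have "cone_gap e e x y \<le> 2 * norm v"
        using v cone_gap_le[OF e e, of x y] cone_gap_le[OF e e, of y x] by (auto simp: cone_gap_def add.commute)
      then have "cone_gap e e x y \<le> 2 * jn v" using norm_le_jn[of v] by linarith
      then have "cone_gap e e x y powr \<beta> \<le> (2 * jn v) powr \<beta>" using \<epsilon> by (intro powr_mono2) (auto simp: cone_gap_def)
      also have "\<dots> = 2 powr \<beta> * jn v powr \<beta>" by (rule powr_mult)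
      finally have 1: "cone_gap e e x y powr \<beta> \<le> 2 powr \<beta> * jn v powr \<beta>" .
      have "min_freq x y powr (\<beta> - \<epsilon>) \<le> jn v powr (\<beta> - \<epsilon>)"
        using \<epsilon> v jn_pos by (intro powr_mono2) (auto simp: min_freq_def less_imp_le)
      also have "\<dots> \<le> jn v powr \<beta>" using \<epsilon> jn_ge_1[of v] by (intro powr_mono) auto
      finally show ?thesis using 1 by (simp add: distrib_right)
    qed
    \<comment> \<open>The angle condition is proved only where the product does not vanish. If it
      fails for the given P and Q, the whole integrand is 0.\<close>
    have prod: "w o' \<eta> (z - \<eta>) * w o' (z - \<zeta>) \<zeta> \<le> k * (jn P powr (-\<nu>) * jn Q powr (-\<nu>)) * V z \<and>
        (w o' \<eta> (z - \<eta>) * w o' (z - \<zeta>) \<zeta> \<noteq> 0 \<longrightarrow> 128 * (P \<bullet> Q) \<le> norm P * norm Q)" for z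
    proof (cases "w o' \<eta> (z - \<eta>) * w o' (z - \<zeta>) \<zeta> = 0")
      case True
      have "0 \<le> k * (jn P powr (-\<nu>) * jn Q powr (-\<nu>)) * V z" using k by (simp add: V_def)
      then show ?thesis using True by linarith
    next
      case False
      then have r: "high_high_region \<eta> (z - \<eta>)" "high_high_region (z - \<zeta>) \<zeta>" and o: "octant \<eta> = octant (z - \<zeta>)"
        by (auto simp: w_def split: if_splits)
      have z: "128 * norm z < norm P" "128 * norm z < norm Q" using r by (auto simp: high_high_region_def P_def Q_def)
      have jP: "jn P = jn \<eta>" "jn Q = jn \<zeta>" by (simp_all add: P_def Q_def)
      have "w o' \<eta> (z - \<eta>) \<le> ((2 powr \<beta> + 1) * jn \<eta> powr \<beta>) * (2 powr \<bar>s2\<bar> * (jn z powr (-s0) * jn \<eta> powr (-\<sigma>)))"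
        using fac[of \<eta> \<eta> "z - \<eta>"] high_high_sobolev_weight(1)[OF r(1), of s0 s1 s2] sobolev_weight_nonneg
        unfolding w_def main_weight_def \<sigma>_def by (auto intro!: mult_mono)
      also have "\<dots> = (2 powr \<beta> + 1) * 2 powr \<bar>s2\<bar> * (jn z powr (-s0) * (jn \<eta> powr \<beta> * jn \<eta> powr (-\<sigma>)))" by (simp only: mult_ac)
      also have "jn \<eta> powr \<beta> * jn \<eta> powr (-\<sigma>) = jn P powr (-\<nu>)" unfolding powr_add[symmetric] jP by (simp add: \<nu>_def)
      finally have 1: "w o' \<eta> (z - \<eta>) \<le> (2 powr \<beta> + 1) * 2 powr \<bar>s2\<bar> * (jn z powr (-s0) * jn P powr (-\<nu>))" .
      have "w o' (z - \<zeta>) \<zeta> \<le> ((2 powr \<beta> + 1) * jn \<zeta> powr \<beta>) * (2 powr \<bar>s1\<bar> * (jn z powr (-s0) * jn \<zeta> powr (-\<sigma>)))"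
        using fac[of \<zeta> "z - \<zeta>" \<zeta>] high_high_sobolev_weight(2)[OF r(2), of s0 s1 s2] sobolev_weight_nonneg
        unfolding w_def main_weight_def \<sigma>_def by (auto intro!: mult_mono)
      also have "\<dots> = (2 powr \<beta> + 1) * 2 powr \<bar>s1\<bar> * (jn z powr (-s0) * (jn \<zeta> powr \<beta> * jn \<zeta> powr (-\<sigma>)))" by (simp only: mult_ac)
      also have "jn \<zeta> powr \<beta> * jn \<zeta> powr (-\<sigma>) = jn Q powr (-\<nu>)" unfolding powr_add[symmetric] jP by (simp add: \<nu>_def)
      finally have 2: "w o' (z - \<zeta>) \<zeta> \<le> (2 powr \<beta> + 1) * 2 powr \<bar>s1\<bar> * (jn z powr (-s0) * jn Q powr (-\<nu>))" .
      have "w o' \<eta> (z - \<eta>) * w o' (z - \<zeta>) \<zeta> \<le> ((2 powr \<beta> + 1) * 2 powr \<bar>s2\<bar> * (jn z powr (-s0) * jn P powr (-\<nu>))) * ((2 powr \<beta> + 1) * 2 powr \<bar>s1\<bar> * (jn z powr (-s0) * jn Q powr (-\<nu>)))"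
        by (intro mult_mono 1 2 w0) auto
      also have "\<dots> = k * (jn P powr (-\<nu>) * jn Q powr (-\<nu>)) * (jn z powr (-s0) * jn z powr (-s0))"
        by (simp add: k_def power2_eq_square mult_ac)
      also have "jn z powr (-s0) * jn z powr (-s0) = V z" unfolding powr_add[symmetric] using z by (simp add: V_def)
      finally have "w o' \<eta> (z - \<eta>) * w o' (z - \<zeta>) \<zeta> \<le> k * (jn P powr (-\<nu>) * jn Q powr (-\<nu>)) * V z" .
      moreover have "128 * (P \<bullet> Q) \<le> norm P * norm Q"
      proof -
        \<comment> \<open>In one octant the inner product of \<eta> and z - \<zeta> is non-negative,
          so P . Q is at most \<eta> . z, which is below |P| |Q| / 128 in this region.\<close>
        have "P \<bullet> Q = \<eta> \<bullet> z - \<eta> \<bullet> (z - \<zeta>)" by (simp add: P_def Q_def inner_diff_right)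
        also have "\<dots> \<le> \<eta> \<bullet> z" using octant_inner[OF o] by simp
        also have "\<dots> \<le> norm P * norm z" using norm_cauchy_schwarz[of \<eta> z] by (simp add: P_def)
        finally have "128 * (P \<bullet> Q) \<le> norm P * (128 * norm z)" by simp
        also have "\<dots> \<le> norm P * norm Q" using z by (intro mult_left_mono) auto
        finally show ?thesis .
      qed
      ultimately show ?thesis by blast
    qed
    have "(\<integral>\<^sup>+z. ennreal (w o' \<eta> (z - \<eta>) * w o' (z - \<zeta>) \<zeta>) * ennreal (jbr (e * \<tau> - (norm (P + z) - norm (Q + z))) powr (-(2*b))) \<partial>lborel) \<le> ennreal (k * C)"
    proof (cases "128 * (P \<bullet> Q) \<le> norm P * norm Q")
      case False
      then have "w o' \<eta> (z - \<eta>) * w o' (z - \<zeta>) \<zeta> = 0" for z using prod by blast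
      then show ?thesis by (simp only: nn_integral_const) simp
    next
      case True
      let ?c = "k * (jn P powr (-\<nu>) * jn Q powr (-\<nu>))"
      let ?j = "\<lambda>z. ennreal (jbr (e * \<tau> - (norm (P + z) - norm (Q + z))) powr (-(2*b)))"
      have "(\<integral>\<^sup>+z. ennreal (w o' \<eta> (z - \<eta>) * w o' (z - \<zeta>) \<zeta>) * ?j z \<partial>lborel) \<le> (\<integral>\<^sup>+z. ennreal ?c * (ennreal (V z) * ?j z) \<partial>lborel)"
      proof (rule nn_integral_mono)
        fix z
        have "ennreal (w o' \<eta> (z - \<eta>) * w o' (z - \<zeta>) \<zeta>) \<le> ennreal ?c * ennreal (V z)"
          using prod[of z] k by (subst ennreal_mult[symmetric]) (auto simp: V_def intro!: ennreal_leI)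
        then show "ennreal (w o' \<eta> (z - \<eta>) * w o' (z - \<zeta>) \<zeta>) * ?j z \<le> ennreal ?c * (ennreal (V z) * ?j z)"
          unfolding mult.assoc[symmetric] by (rule mult_right_mono) simp
      qed
      also have "\<dots> = ennreal ?c * (\<integral>\<^sup>+z. ennreal (V z) * ?j z \<partial>lborel)"
        by (rule nn_integral_cmult) measurable
      also have "\<dots> \<le> ennreal ?c * ennreal (C * (jn P powr \<nu> * jn Q powr \<nu>))"
        using C(2)[OF True, of "e * \<tau>"] by (intro mult_left_mono) (auto simp: V_def)
      also have "\<dots> = ennreal (?c * (C * (jn P powr \<nu> * jn Q powr \<nu>)))"
        by (rule ennreal_mult[symmetric]) (use k C in auto)
      also have "?c * (C * (jn P powr \<nu> * jn Q powr \<nu>)) = k * C * ((jn P powr (-\<nu>) * jn P powr \<nu>) * (jn Q powr (-\<nu>) * jn Q powr \<nu>))"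
        by (simp only: mult_ac)
      also have "\<dots> = k * C" unfolding powr_add[symmetric] using jn_pos[of P] jn_pos[of Q] by simp
      finally show ?thesis .
    qed
    then show "(\<integral>\<^sup>+z. ennreal (w o' \<eta> (z - \<eta>) * w o' (z - \<zeta>) \<zeta>) * ennreal (jbr (\<tau> - (e * norm (z - \<eta>) - e * norm (z - \<zeta>))) powr (-(2*b))) \<partial>lborel) \<le> ennreal (k * C)"
      unfolding ph .
  qed
  have meas: "(\<lambda>(X, Y). w o' (snd X) (snd Y) * (cone_factor b e X * cone_factor b e Y)) \<in> borel_measurable borel" for o'
    unfolding case_prod_beta'
    by (intro borel_measurable_times measurable_curried[OF wm] measurable_compose[OF _ cone_factor_measurable])
       (auto intro!: borel_measurable_continuous_onI continuous_intros)
  have "l2_bounded (\<lambda>X Y. \<Sum>o'\<in>UNIV. w o' (snd X) (snd Y) * (cone_factor b e X * cone_factor b e Y))"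
    by (intro l2_bounded_sum bd meas) (auto intro!: mult_nonneg_nonneg w0 cone_factor_nonneg)
  moreover have "(\<Sum>o'\<in>UNIV. w o' x y * c) = (if high_high_region x y then main_weight s0 s1 s2 \<beta> \<epsilon> e e x y else 0) * c" for x y c
  proof -
    have "(\<Sum>o'\<in>UNIV. w o' x y * c) = (\<Sum>o'\<in>UNIV. if o' = octant x then (if high_high_region x y then main_weight s0 s1 s2 \<beta> \<epsilon> e e x y else 0) * c else 0)"
      by (intro sum.cong) (auto simp: w_def)
    then show ?thesis by simp
  qed
  ultimately show ?thesis by simp
qed

subsection \<open>Modulation weights\<close>

lemma jn_le_norm: "jn x \<le> jn y \<longleftrightarrow> norm x \<le> norm y"
  by (simp add: jn_def jbr_def)

definition modulation :: "real \<Rightarrow> spacetime \<Rightarrow> real" where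
  "modulation b X = jbr (\<bar>fst X\<bar> - norm (snd X)) powr (-b)"

lemma modulation_measurable [measurable]: "modulation b \<in> borel_measurable borel"
  unfolding modulation_def[abs_def] by (simp add: borel_prod[symmetric])

lemma modulation_nonneg: "0 \<le> modulation b X"
  by (simp add: modulation_def)

text \<open>For each sign of t the modulation is the distance to one of the two sheets; both are
  added.\<close>

lemma nn_integral_modulation:
  assumes b: "1 < 2 * b"
  shows "(\<integral>\<^sup>+t. ennreal ((modulation b (t, x))\<^sup>2) \<partial>lborel) \<le> ennreal (2 * jconst (2 * b))"
proof -
  have "(\<integral>\<^sup>+t. ennreal ((modulation b (t, x))\<^sup>2) \<partial>lborel)
    \<le> (\<integral>\<^sup>+t. ennreal (jbr (t - norm x) powr (-(2*b))) + ennreal (jbr (t - (- norm x)) powr (-(2*b))) \<partial>lborel)"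
  proof (rule nn_integral_mono)
    fix t :: real
    have sq: "(modulation b (t, x))\<^sup>2 = jbr (\<bar>t\<bar> - norm x) powr (-(2*b))"
      unfolding modulation_def by (simp add: power2_eq_square powr_add[symmetric])
    have "jbr (\<bar>t\<bar> - norm x) = jbr (t - norm x) \<or> jbr (\<bar>t\<bar> - norm x) = jbr (t - (- norm x))"
      using jbr_abs[of "t + norm x"] by (cases "0 \<le> t") (auto simp: jbr_def power2_eq_square algebra_simps)
    then show "ennreal ((modulation b (t, x))\<^sup>2) \<le> ennreal (jbr (t - norm x) powr (-(2*b))) + ennreal (jbr (t - (- norm x)) powr (-(2*b)))"
      unfolding sq by auto
  qed
  also have "\<dots> = (\<integral>\<^sup>+t. ennreal (jbr (t - norm x) powr (-(2*b))) \<partial>lborel) + (\<integral>\<^sup>+t. ennreal (jbr (t - (- norm x)) powr (-(2*b))) \<partial>lborel)"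
    by (rule nn_integral_add) auto
  also have "\<dots> \<le> ennreal (jconst (2 * b)) + ennreal (jconst (2 * b))"
    by (intro add_mono nn_integral_jbr b)
  also have "\<dots> = ennreal (2 * jconst (2 * b))"
    using jconst_nonneg[OF b] by (simp add: ennreal_plus[symmetric] del: ennreal_plus)
  finally show ?thesis .
qed

lemma nn_integral_weight_modulation:
  fixes a :: "real^3 \<Rightarrow> real"
  assumes b: "1 < 2 * b" and [measurable]: "a \<in> borel_measurable borel"
    and A: "(\<integral>\<^sup>+x. ennreal ((a x)\<^sup>2) \<partial>lborel) \<le> ennreal A" "0 \<le> A"
    and a0: "\<And>x. 0 \<le> a x"
  shows "(\<integral>\<^sup>+X. (ennreal (a (\<xi> - snd X) * modulation b X))\<^sup>2 \<partial>lborel) \<le> ennreal (2 * jconst (2 * b) * A)"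
proof -
  have "(\<integral>\<^sup>+X. (ennreal (a (\<xi> - snd X) * modulation b X))\<^sup>2 \<partial>lborel)
     = (\<integral>\<^sup>+x. \<integral>\<^sup>+t. ennreal ((a (\<xi> - x))\<^sup>2) * ennreal ((modulation b (t, x))\<^sup>2) \<partial>lborel \<partial>lborel)"
    using a0 modulation_nonneg[of b] unfolding modulation_def
    by (subst nn_integral_spacetime) (simp_all add: borel_prod[symmetric] ennreal_power power_mult_distrib ennreal_mult)
  also have "\<dots> = (\<integral>\<^sup>+x. ennreal ((a (\<xi> - x))\<^sup>2) * (\<integral>\<^sup>+t. ennreal ((modulation b (t, x))\<^sup>2) \<partial>lborel) \<partial>lborel)"
    unfolding modulation_def by (intro nn_integral_cong nn_integral_cmult) simp
  also have "\<dots> \<le> (\<integral>\<^sup>+x. ennreal ((a (\<xi> - x))\<^sup>2) * ennreal (2 * jconst (2 * b)) \<partial>lborel)"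
    by (intro nn_integral_mono mult_left_mono nn_integral_modulation b) simp
  also have "\<dots> = (\<integral>\<^sup>+x. ennreal ((a (\<xi> - x))\<^sup>2) \<partial>lborel) * ennreal (2 * jconst (2 * b))"
    by (rule nn_integral_multc) measurable
  also have "(\<integral>\<^sup>+x. ennreal ((a (\<xi> - x))\<^sup>2) \<partial>lborel) = (\<integral>\<^sup>+x. ennreal ((a x)\<^sup>2) \<partial>lborel)"
    by (rule nn_integral_reflect[of "\<lambda>x. ennreal ((a x)\<^sup>2)"]) measurable
  also have "\<dots> * ennreal (2 * jconst (2 * b)) \<le> ennreal A * ennreal (2 * jconst (2 * b))"
    by (intro mult_right_mono A) simp
  also have "\<dots> = ennreal (2 * jconst (2 * b) * A)"
    using A(2) jconst_nonneg[OF b] by (simp add: ennreal_mult[symmetric] mult.commute)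
  finally show ?thesis .
qed

text \<open>Covers an input modulation so large that its own weight absorbs it and only the other
  modulation remains. Whichever frequency is smallest, its power is square integrable in space since
  2q > 3, and the modulation is square integrable in time.\<close>

lemma l2_bounded_low_min:
  assumes b: "1 < 2 * b" and q: "3 < 2 * q"
  shows "l2_bounded (\<lambda>X Y. min_freq (snd X) (snd Y) powr (-q) * modulation b Y)"
proof -
  define A where "A = 4 * pi / (2 * q - 3)"
  have A: "0 \<le> A" using q by (simp add: A_def)
  define a where "a x = jn x powr (-q)" for x
  have [measurable]: "a \<in> borel_measurable borel" unfolding a_def[abs_def] by measurable
  have a0: "0 \<le> a x" for x by (simp add: a_def)
  have "(a x)\<^sup>2 = jn x powr (-(2*q))" for x by (simp add: a_def power2_eq_square powr_add[symmetric])
  then have ai: "(\<integral>\<^sup>+x. ennreal ((a x)\<^sup>2) \<partial>lborel) \<le> ennreal A"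
    using nn_integral_jn_decay[of "2 * q"] q by (simp add: A_def)
  have C: "0 \<le> 2 * jconst (2 * b) * A" using A jconst_nonneg[OF b] by simp
  note bound = nn_integral_weight_modulation[OF b _ ai A a0]
  have m: "(\<lambda>(X, Y). a (f X Y) * modulation b Y) \<in> borel_measurable borel"
    if f: "continuous_on UNIV (\<lambda>(X, Y). f X Y)" for f
  proof -
    have "(\<lambda>Z. a (case_prod f Z)) \<in> borel_measurable borel"
      by (rule measurable_compose[OF borel_measurable_continuous_onI[OF f]]) measurable
    then show ?thesis unfolding case_prod_beta'
      by (intro borel_measurable_times measurable_compose[OF _ modulation_measurable])
         (auto intro!: borel_measurable_continuous_onI continuous_intros)
  qed
  \<comment> \<open>If the first input is the lowest, the kernel is integrated at a fixed output; in
    the other two cases the first input is held fixed.\<close>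
  have 1: "l2_bounded (\<lambda>X Y. a (snd X) * modulation b Y)"
  proof (rule l2_bounded_output[OF m C])
    show "continuous_on UNIV (\<lambda>(X::spacetime, Y::spacetime). snd X)" by (auto simp: case_prod_beta' intro!: continuous_intros)
    fix X :: spacetime
    have "(\<integral>\<^sup>+Y. (ennreal (a (snd Y) * modulation b (X - Y)))\<^sup>2 \<partial>lborel) = (\<integral>\<^sup>+Y. (\<lambda>Z. (ennreal (a (snd X - snd Z) * modulation b Z))\<^sup>2) (X - Y) \<partial>lborel)"
      by simp
    also have "\<dots> = (\<integral>\<^sup>+Z. (ennreal (a (snd X - snd Z) * modulation b Z))\<^sup>2 \<partial>lborel)"
      unfolding modulation_def by (rule nn_integral_reflect) (simp add: borel_prod[symmetric])
    also have "\<dots> \<le> ennreal (2 * jconst (2 * b) * A)" by (rule bound) measurable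
    finally show "(\<integral>\<^sup>+Y. (ennreal (a (snd Y) * modulation b (X - Y)))\<^sup>2 \<partial>lborel) \<le> ennreal (2 * jconst (2 * b) * A)" .
  qed
  have 2: "l2_bounded (\<lambda>X Y. a (snd Y) * modulation b Y)"
  proof (rule l2_bounded_input[OF m C])
    show "continuous_on UNIV (\<lambda>(X::spacetime, Y::spacetime). snd Y)" by (auto simp: case_prod_beta' intro!: continuous_intros)
    fix Y :: spacetime
    have "a (0 - x) = a x" for x by (simp add: a_def)
    then show "(\<integral>\<^sup>+X. (ennreal (a (snd X) * modulation b X))\<^sup>2 \<partial>lborel) \<le> ennreal (2 * jconst (2 * b) * A)"
      using bound[of 0] by simp
  qed
  have 3: "l2_bounded (\<lambda>X Y. a (snd X + snd Y) * modulation b Y)"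
  proof (rule l2_bounded_input[OF m C])
    show "continuous_on UNIV (\<lambda>(X::spacetime, Y::spacetime). snd X + snd Y)" by (auto simp: case_prod_beta' intro!: continuous_intros)
    fix Y :: spacetime
    have "a (- snd Y - x) = a (snd Y + x)" for x unfolding a_def by (metis jn_minus minus_add_distrib diff_conv_add_uminus)
    then show "(\<integral>\<^sup>+X. (ennreal (a (snd Y + snd X) * modulation b X))\<^sup>2 \<partial>lborel) \<le> ennreal (2 * jconst (2 * b) * A)"
      using bound[of "- snd Y"] by simp
  qed
  have m1: "(\<lambda>(X::spacetime, Y). a (snd X) * modulation b Y) \<in> borel_measurable borel"
    by (rule m) (auto simp: case_prod_beta' intro!: continuous_intros)
  have m2: "(\<lambda>(X::spacetime, Y). a (snd Y) * modulation b Y) \<in> borel_measurable borel"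
    by (rule m) (auto simp: case_prod_beta' intro!: continuous_intros)
  have m3: "(\<lambda>(X::spacetime, Y). a (snd X + snd Y) * modulation b Y) \<in> borel_measurable borel"
    by (rule m) (auto simp: case_prod_beta' intro!: continuous_intros)
  have nn: "0 \<le> a x * modulation b Y" for x Y by (simp add: a0 modulation_nonneg)
  have m12: "(\<lambda>(X::spacetime, Y). a (snd X) * modulation b Y + a (snd Y) * modulation b Y) \<in> borel_measurable borel"
    using borel_measurable_add[OF m1 m2] by (simp add: case_prod_beta')
  have m123: "(\<lambda>(X::spacetime, Y). (a (snd X) * modulation b Y + a (snd Y) * modulation b Y) + a (snd X + snd Y) * modulation b Y) \<in> borel_measurable borel"
    using borel_measurable_add[OF m12 m3] by (simp add: case_prod_beta')
  have sum: "l2_bounded (\<lambda>X Y. (a (snd X) * modulation b Y + a (snd Y) * modulation b Y) + a (snd X + snd Y) * modulation b Y)"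
    by (rule l2_bounded_add[OF l2_bounded_add[OF 1 2 nn nn m1 m2] 3 _ nn m12 m3]) (auto intro!: add_nonneg_nonneg nn)
  show ?thesis
  proof (rule l2_bounded_mono[OF sum, of 1])
    fix X Y :: spacetime
    have "min_freq (snd X) (snd Y) powr (-q) \<le> (a (snd X) + a (snd Y)) + a (snd X + snd Y)"
      using a0[of "snd X"] a0[of "snd Y"] a0[of "snd X + snd Y"] unfolding min_freq_def a_def by (auto simp: min_def)
    then have "min_freq (snd X) (snd Y) powr (-q) * modulation b Y \<le> ((a (snd X) + a (snd Y)) + a (snd X + snd Y)) * modulation b Y"
      by (rule mult_right_mono) (rule modulation_nonneg)
    then show "min_freq (snd X) (snd Y) powr (-q) * modulation b Y \<le> 1 * ((a (snd X) * modulation b Y + a (snd Y) * modulation b Y) + a (snd X + snd Y) * modulation b Y)"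
      by (simp add: distrib_right)
  qed (use nn m123 in \<open>auto intro!: add_nonneg_nonneg\<close>)
qed

text \<open>The two frequencies other than the smallest are comparable by the triangle inequality,
  and the sum of their exponents is non-negative. Replacing both by the smallest therefore only
  enlarges the weight.\<close>

lemma sobolev_weight_le_min_freq:
  assumes s: "0 \<le> s1 + s2" "0 \<le> s0 + s2" "0 \<le> s0 + s1"
  shows "sobolev_weight s0 s1 s2 x y \<le> 2 powr (\<bar>s1\<bar> + \<bar>s2\<bar>) * min_freq x y powr (-(s0 + s1 + s2))"
proof -
  have tri: "norm x \<le> norm (x + y) + norm y" "norm y \<le> norm (x + y) + norm x" "norm (x + y) \<le> norm x + norm y"
    using norm_triangle_ineq4[of "x + y" y] norm_triangle_ineq4[of "x + y" x] norm_triangle_ineq[of x y] by auto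
  define m where "m = min_freq x y"
  have m: "0 < m" using jn_pos by (simp add: m_def min_freq_def)
  have gen: "K * (h powr (-(p + r)) * l powr (-t)) \<le> 2 powr (\<bar>s1\<bar> + \<bar>s2\<bar>) * m powr (-(s0 + s1 + s2))"
    if "0 \<le> p + r" "m \<le> h" "l = m" "p + r + t = s0 + s1 + s2" "0 \<le> K" "K \<le> 2 powr (\<bar>s1\<bar> + \<bar>s2\<bar>)" for K h l p r t
  proof -
    have "h powr (-(p + r)) \<le> m powr (-(p + r))" using that m by (intro powr_mono2') auto
    then have "K * (h powr (-(p + r)) * l powr (-t)) \<le> 2 powr (\<bar>s1\<bar> + \<bar>s2\<bar>) * (m powr (-(p + r)) * m powr (-t))"
      using that by (intro mult_mono) auto
    also have "m powr (-(p + r)) * m powr (-t) = m powr (-(s0 + s1 + s2))"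
      unfolding powr_add[symmetric] that(4)[symmetric] by simp
    finally show ?thesis .
  qed
  have K: "2 powr \<bar>s1\<bar> \<le> 2 powr (\<bar>s1\<bar> + \<bar>s2\<bar>)" "2 powr \<bar>s2\<bar> \<le> 2 powr (\<bar>s1\<bar> + \<bar>s2\<bar>)" by (intro powr_mono; simp)+
  consider "m = jn y" "m \<le> jn x" "m \<le> jn (x + y)" | "m = jn x" "m \<le> jn y" "m \<le> jn (x + y)"
    | "m = jn (x + y)" "m \<le> jn x" "m \<le> jn y"
  proof -
    have "m = jn y \<or> m = jn x \<or> m = jn (x + y)" "m \<le> jn x" "m \<le> jn y" "m \<le> jn (x + y)"
      unfolding m_def min_freq_def by (auto simp: min_def)
    then show ?thesis using that by blast
  qed
  then show ?thesis
  proof cases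
    case 1
    then have "norm x \<le> 2 * norm (x + y)" "norm (x + y) \<le> 2 * norm x" using tri by (auto simp: jn_le_norm)
    then have "jn x powr (-s1) \<le> 2 powr \<bar>-s1\<bar> * jn (x + y) powr (-s1)" by (rule jn_powr_comparable) simp
    then have "sobolev_weight s0 s1 s2 x y \<le> jn (x + y) powr (-s0) * ((2 powr \<bar>-s1\<bar> * jn (x + y) powr (-s1)) * jn y powr (-s2))"
      unfolding sobolev_weight_def by (intro mult_left_mono mult_right_mono) auto
    also have "\<dots> = 2 powr \<bar>s1\<bar> * ((jn (x + y) powr (-s0) * jn (x + y) powr (-s1)) * jn y powr (-s2))" by simp
    also have "jn (x + y) powr (-s0) * jn (x + y) powr (-s1) = jn (x + y) powr (-(s0 + s1))" by (simp add: powr_add[symmetric])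
    also have "2 powr \<bar>s1\<bar> * (jn (x + y) powr (-(s0 + s1)) * jn y powr (-s2)) \<le> 2 powr (\<bar>s1\<bar> + \<bar>s2\<bar>) * m powr (-(s0 + s1 + s2))"
      using 1 s K by (intro gen) auto
    finally show ?thesis by (simp add: m_def)
  next
    case 2
    then have "norm y \<le> 2 * norm (x + y)" "norm (x + y) \<le> 2 * norm y" using tri by (auto simp: jn_le_norm)
    then have "jn y powr (-s2) \<le> 2 powr \<bar>-s2\<bar> * jn (x + y) powr (-s2)" by (rule jn_powr_comparable) simp
    then have "sobolev_weight s0 s1 s2 x y \<le> jn (x + y) powr (-s0) * (jn x powr (-s1) * (2 powr \<bar>-s2\<bar> * jn (x + y) powr (-s2)))"
      unfolding sobolev_weight_def by (intro mult_left_mono) auto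
    also have "\<dots> = 2 powr \<bar>s2\<bar> * ((jn (x + y) powr (-s0) * jn (x + y) powr (-s2)) * jn x powr (-s1))" by simp
    also have "jn (x + y) powr (-s0) * jn (x + y) powr (-s2) = jn (x + y) powr (-(s0 + s2))" by (simp add: powr_add[symmetric])
    also have "2 powr \<bar>s2\<bar> * (jn (x + y) powr (-(s0 + s2)) * jn x powr (-s1)) \<le> 2 powr (\<bar>s1\<bar> + \<bar>s2\<bar>) * m powr (-(s0 + s1 + s2))"
      using 2 s K by (intro gen) auto
    finally show ?thesis by (simp add: m_def)
  next
    case 3
    then have "norm y \<le> 2 * norm x" "norm x \<le> 2 * norm y" using tri by (auto simp: jn_le_norm)
    then have "jn y powr (-s2) \<le> 2 powr \<bar>-s2\<bar> * jn x powr (-s2)" by (rule jn_powr_comparable) simp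
    then have "sobolev_weight s0 s1 s2 x y \<le> jn (x + y) powr (-s0) * (jn x powr (-s1) * (2 powr \<bar>-s2\<bar> * jn x powr (-s2)))"
      unfolding sobolev_weight_def by (intro mult_left_mono) auto
    also have "\<dots> = 2 powr \<bar>s2\<bar> * ((jn x powr (-s1) * jn x powr (-s2)) * jn (x + y) powr (-s0))" by simp
    also have "jn x powr (-s1) * jn x powr (-s2) = jn x powr (-(s1 + s2))" by (simp add: powr_add[symmetric])
    also have "2 powr \<bar>s2\<bar> * (jn x powr (-(s1 + s2)) * jn (x + y) powr (-s0)) \<le> 2 powr (\<bar>s1\<bar> + \<bar>s2\<bar>) * m powr (-(s0 + s1 + s2))"
      using 3 s K by (intro gen) auto
    finally show ?thesis by (simp add: m_def)
  qed
qed

lemma main_kernel_measurable: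
  "(\<lambda>(X, Y). main_weight s0 s1 s2 \<beta> \<epsilon> e1 e2 (snd X) (snd Y) * (cone_factor b e1 X * cone_factor b e2 Y)) \<in> borel_measurable borel"
  unfolding case_prod_beta'
  by (intro borel_measurable_times measurable_curried[OF main_weight_measurable] measurable_compose[OF _ cone_factor_measurable])
     (auto intro!: borel_measurable_continuous_onI continuous_intros)

text \<open>Two low-input regions and the low-output region, which may overlap; the second is the
  first with the roles of the inputs, of s1 and s2, and of the signs exchanged.\<close>

lemma l2_bounded_main:
  assumes \<epsilon>: "0 < \<epsilon>" "\<epsilon> \<le> \<beta>" and s: "0 \<le> s0 + s1" "0 \<le> s0 + s2" "\<beta> \<le> s1 + s2" "1 + \<beta> \<le> s0 + s1 + s2"
      "3/2 + \<beta> \<le> s0 + 2 * (s1 + s2)" "s1 + s2 = \<beta> \<Longrightarrow> 1 + \<beta> < s0 + s1 + s2"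
    and e: "\<bar>e1\<bar> = 1" "\<bar>e2\<bar> = 1" and b: "1 < 2 * b"
  shows "l2_bounded (\<lambda>X Y. main_weight s0 s1 s2 \<beta> \<epsilon> e1 e2 (snd X) (snd Y) * (cone_factor b e1 X * cone_factor b e2 Y))"
proof -
  define R where "R i x y = (if i = (0::nat) then norm y \<le> norm x \<and> norm y \<le> 128 * norm (x + y)
    else if i = 1 then norm x \<le> norm y \<and> norm x \<le> 128 * norm (x + y) else high_high_region x y)" for i and x y :: "real^3"
  define K where "K i X Y = (if R i (snd X) (snd Y) then main_weight s0 s1 s2 \<beta> \<epsilon> e1 e2 (snd X) (snd Y) else 0) * (cone_factor b e1 X * cone_factor b e2 Y)" for i X Y
  have Rm: "Measurable.pred (borel \<Otimes>\<^sub>M borel) (\<lambda>z. R i (fst z) (snd z))" for i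
    unfolding R_def high_high_region_def by measurable
  have Km: "case_prod (K i) \<in> borel_measurable borel" for i
    unfolding K_def case_prod_beta'
    by (intro borel_measurable_times measurable_compose[OF _ cone_factor_measurable]
          measurable_curried[OF main_weight_restrict_measurable[OF Rm]])
       (auto intro!: borel_measurable_continuous_onI continuous_intros)
  have K0: "0 \<le> K i X Y" for i X Y
    unfolding K_def using main_weight_nonneg cone_factor_nonneg by (intro mult_nonneg_nonneg) auto
  have "l2_bounded (K i)" if "i \<in> {0, 1, 2}" for i
  proof -
    consider "i = 0" | "i = 1" | "i = 2" using \<open>i \<in> {0, 1, 2}\<close> by blast
    then show ?thesis
    proof cases
      case 1
      then show ?thesis using low_high[OF \<epsilon> s(1,4) e b] by (simp add: K_def[abs_def] R_def)
    next
      case 2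
      have "1 + \<beta> \<le> s0 + s2 + s1" using s(4) by simp
      note lh = low_high[OF \<epsilon> s(2) this e(2,1) b]
      have m: "(\<lambda>(X, Y). (if norm (snd Y) \<le> norm (snd X) \<and> norm (snd Y) \<le> 128 * norm (snd X + snd Y)
          then main_weight s0 s2 s1 \<beta> \<epsilon> e2 e1 (snd X) (snd Y) else 0) * (cone_factor b e2 X * cone_factor b e1 Y)) \<in> borel_measurable borel"
      proof -
        have "Measurable.pred (borel \<Otimes>\<^sub>M borel) (\<lambda>z. norm (snd z :: real^3) \<le> norm (fst z :: real^3) \<and> norm (snd z) \<le> 128 * norm (fst z + snd z))" by measurable
        note mm = main_weight_restrict_measurable[OF this]
        show ?thesis unfolding case_prod_beta'
          by (intro borel_measurable_times measurable_compose[OF _ cone_factor_measurable] measurable_curried[OF mm])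
             (auto intro!: borel_measurable_continuous_onI continuous_intros)
      qed
      have "K 1 = (\<lambda>X Y. (if norm (snd X) \<le> norm (snd Y) \<and> norm (snd X) \<le> 128 * norm (snd Y + snd X)
          then main_weight s0 s2 s1 \<beta> \<epsilon> e2 e1 (snd Y) (snd X) else 0) * (cone_factor b e2 Y * cone_factor b e1 X))"
        by (intro ext) (simp add: K_def R_def main_weight_swap[of s0 s1 s2] add.commute mult.commute)
      then show ?thesis using l2_bounded_swap[OF lh m] 2 by simp
    next
      case 3
      have "e2 = e1 \<or> e2 = - e1" using e by linarith
      then show ?thesis
      proof
        assume "e2 = e1"
        then show ?thesis using high_high_same[OF \<epsilon> s(3,4,6) e(1) b] 3 by (simp add: K_def[abs_def] R_def cong del: if_weak_cong)
      next
        assume "e2 = - e1"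
        then show ?thesis using high_high_opposite[OF \<epsilon> s(3,4,5) e(1) _ b] 3 by (simp add: K_def[abs_def] R_def cong del: if_weak_cong)
      qed
    qed
  qed
  then have S: "l2_bounded (\<lambda>X Y. \<Sum>i\<in>{0, 1, 2}. K i X Y)"
    by (intro l2_bounded_sum Km K0) auto
  show ?thesis
  proof (rule l2_bounded_mono[OF S, of 1])
    fix X Y :: spacetime
    \<comment> \<open>Outside the third region one input is at most 128 |x + y|, and then so is the
      smaller one.\<close>
    have "R 0 (snd X) (snd Y) \<or> R 1 (snd X) (snd Y) \<or> R 2 (snd X) (snd Y)"
      unfolding R_def high_high_region_def by simp linarith
    then obtain i where i: "i \<in> {0, 1, 2}" "R i (snd X) (snd Y)" by blast
    then have "main_weight s0 s1 s2 \<beta> \<epsilon> e1 e2 (snd X) (snd Y) * (cone_factor b e1 X * cone_factor b e2 Y) = K i X Y" by (simp add: K_def)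
    also have "\<dots> \<le> (\<Sum>i\<in>{0, 1, 2}. K i X Y)" using i(1) K0 by (intro member_le_sum) auto
    finally show "main_weight s0 s1 s2 \<beta> \<epsilon> e1 e2 (snd X) (snd Y) * (cone_factor b e1 X * cone_factor b e2 Y) \<le> 1 * (\<Sum>i\<in>{0, 1, 2}. K i X Y)" by simp
  next
    show "0 \<le> (\<Sum>i\<in>{0, 1, 2}. K i X Y)" for X Y by (intro sum_nonneg K0)
    have "(\<lambda>Z. \<Sum>i\<in>{0, 1, 2}. case_prod (K i) Z) \<in> borel_measurable borel" by (intro borel_measurable_sum Km)
    then show "(\<lambda>(X, Y). \<Sum>i\<in>{0, 1, 2}. K i X Y) \<in> borel_measurable borel" by (simp add: case_prod_beta')
  qed simp
qed

section \<open>Assembling the full kernel\<close>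

text \<open>The ratio of the output weight to the two input weights on the Fourier side. Since b0 is
  negative, the output modulation enters with the positive power \<beta> = -b0 and has to be
  distributed.\<close>

definition full_kernel :: "real \<Rightarrow> real \<Rightarrow> real \<Rightarrow> real \<Rightarrow> real \<Rightarrow> real \<Rightarrow> spacetime \<Rightarrow> spacetime \<Rightarrow> real" where
  "full_kernel s0 s1 s2 \<beta> b1 b2 X Y = jbr (\<bar>fst X + fst Y\<bar> - norm (snd X + snd Y)) powr \<beta> *
     sobolev_weight s0 s1 s2 (snd X) (snd Y) * (modulation b1 X * modulation b2 Y)"

text \<open>The two terms come from \<open>M1 \<le> m\<close> and \<open>M1 > m\<close>, where \<open>m\<close> will be the smallest frequency.\<close>

lemma modulation_trade:
  fixes M1 M2 m :: real
  assumes M: "1 \<le> M1" "1 \<le> M2" "1 \<le> m" and b: "b + \<epsilon> \<le> b1" "b \<le> b2" "\<beta> \<le> b1" and \<epsilon>: "\<epsilon> \<le> \<beta>"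
  shows "M1 powr \<beta> * (M1 powr (-b1) * M2 powr (-b2)) \<le> m powr (\<beta> - \<epsilon>) * (M1 powr (-b) * M2 powr (-b)) + m powr (\<beta> - b1) * M2 powr (-b2)"
proof -
  have eq: "M1 powr \<beta> * (M1 powr (-b1) * M2 powr (-b2)) = M1 powr (\<beta> - b1) * M2 powr (-b2)"
    by (simp add: mult.assoc[symmetric] powr_add[symmetric])
  show ?thesis
  proof (cases "M1 \<le> m")
    case True
    have "M1 powr (\<beta> - b1) = M1 powr (\<beta> - b1 + b) * M1 powr (-b)" by (simp add: powr_add[symmetric])
    also have "\<dots> \<le> m powr (\<beta> - \<epsilon>) * M1 powr (-b)"
    proof (rule mult_right_mono)
      have "M1 powr (\<beta> - b1 + b) \<le> M1 powr (\<beta> - \<epsilon>)" using M b by (intro powr_mono) auto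
      also have "\<dots> \<le> m powr (\<beta> - \<epsilon>)" using M True \<epsilon> by (intro powr_mono2) auto
      finally show "M1 powr (\<beta> - b1 + b) \<le> m powr (\<beta> - \<epsilon>)" .
    qed simp
    finally have "M1 powr (\<beta> - b1) * M2 powr (-b2) \<le> (m powr (\<beta> - \<epsilon>) * M1 powr (-b)) * M2 powr (-b)"
      using M b by (intro mult_mono powr_mono) auto
    then show ?thesis unfolding eq by (simp add: mult.assoc add_increasing2)
  next
    case False
    have "M1 powr (\<beta> - b1) \<le> m powr (\<beta> - b1)" using M False b by (intro powr_mono2') auto
    then have "M1 powr (\<beta> - b1) * M2 powr (-b2) \<le> m powr (\<beta> - b1) * M2 powr (-b2)" by (rule mult_right_mono) simp
    then show ?thesis unfolding eq by (simp add: add_increasing)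
  qed
qed

lemma powr_sum3_le:
  fixes a b c p :: real
  assumes "0 \<le> a" "0 \<le> b" "0 \<le> c" "0 \<le> p"
  shows "(a + b + c) powr p \<le> 3 powr p * (a powr p + b powr p + c powr p)"
proof -
  define M where "M = max a (max b c)"
  have M: "0 \<le> M" "a + b + c \<le> 3 * M" using assms by (auto simp: M_def)
  have "(a + b + c) powr p \<le> (3 * M) powr p" using assms M by (intro powr_mono2) auto
  also have "\<dots> = 3 powr p * M powr p" by (rule powr_mult)
  also have "M powr p \<le> a powr p + b powr p + c powr p"
    unfolding M_def max_def by auto
  finally show ?thesis by (simp add: mult_left_mono)
qed

lemma l2_bounded_full_kernel:
  assumes \<beta>: "0 < \<beta>" "\<beta> \<le> b1" "\<beta> \<le> b2" and b12: "1/2 < b1" "1/2 < b2"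
    and s: "0 \<le> s0 + s1" "0 \<le> s0 + s2" "\<beta> \<le> s1 + s2" "1 + \<beta> \<le> s0 + s1 + s2"
      "3/2 + \<beta> \<le> s0 + 2 * (s1 + s2)" "s1 + s2 = \<beta> \<Longrightarrow> 1 + \<beta> < s0 + s1 + s2"
  shows "l2_bounded (full_kernel s0 s1 s2 \<beta> b1 b2)"
proof -
  \<comment> \<open>Half of the smaller excess over 1/2 raises b above 1/2 and the other half is the
    gain of \<open>modulation_trade\<close>, as b + \<epsilon> = 1/2 + 2\<epsilon>; also \<epsilon>
    \<le> \<beta>.\<close>
  define \<epsilon> where "\<epsilon> = min \<beta> (min ((b1 - 1/2) / 2) ((b2 - 1/2) / 2))"
  define b where "b = 1/2 + \<epsilon>"
  define q where "q = 3/2 + \<epsilon>"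
  have \<epsilon>: "0 < \<epsilon>" "\<epsilon> \<le> \<beta>" "b + \<epsilon> \<le> b1" "b + \<epsilon> \<le> b2" using \<beta> b12 by (auto simp: \<epsilon>_def b_def min_def field_simps)
  have b: "1 < 2 * b" using \<epsilon> by (simp add: b_def)
  have q: "3 < 2 * q" using \<epsilon> by (simp add: q_def)
  define S where "S = s0 + s1 + s2"
  define c where "c = 2 powr (\<bar>s1\<bar> + \<bar>s2\<bar>)"
  have c: "1 \<le> c" unfolding c_def by (rule ge_one_powr_ge_zero) auto
  define G where "G e X Y = main_weight s0 s1 s2 \<beta> \<epsilon> (fst e) (snd e) (snd X) (snd Y) * (cone_factor b (fst e) X * cone_factor b (snd e) Y)" for e X Y
  define H1 H2 where "H1 X Y = min_freq (snd X) (snd Y) powr (-q) * modulation b2 Y"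
    and "H2 X Y = min_freq (snd Y) (snd X) powr (-q) * modulation b1 X" for X Y :: spacetime
  let ?E = "{1, -1} \<times> {1, -1 :: real}"
  have G0: "0 \<le> G e X Y" for e X Y unfolding G_def using main_weight_nonneg cone_factor_nonneg by (intro mult_nonneg_nonneg)
  have Gm: "case_prod (G e) \<in> borel_measurable borel" for e unfolding G_def by (rule main_kernel_measurable)
  have Gb: "l2_bounded (G e)" if "e \<in> ?E" for e
    unfolding G_def[abs_def] using that by (intro l2_bounded_main \<epsilon> s b) auto
  have H0: "0 \<le> H1 X Y" "0 \<le> H2 X Y" for X Y by (simp_all add: H1_def H2_def modulation_nonneg)
  have mm: "(\<lambda>(X::spacetime, Y). min_freq (snd X) (snd Y) powr (-q) * modulation b' Y) \<in> borel_measurable borel" for b'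
  proof -
    have "case_prod min_freq \<in> borel_measurable borel"
      unfolding min_freq_def case_prod_beta' by (simp add: borel_prod[symmetric])
    then have [measurable]: "(\<lambda>Z::spacetime \<times> spacetime. min_freq (snd (fst Z)) (snd (snd Z))) \<in> borel_measurable borel"
      by (intro measurable_curried[of min_freq]) (auto intro!: borel_measurable_continuous_onI continuous_intros)
    have [measurable]: "(\<lambda>Z::spacetime \<times> spacetime. modulation b' (snd Z)) \<in> borel_measurable borel"
      by (intro measurable_compose[OF _ modulation_measurable]) (auto intro!: borel_measurable_continuous_onI continuous_intros)
    show ?thesis unfolding case_prod_beta' by measurable
  qed
  have H1m: "case_prod H1 \<in> borel_measurable borel" unfolding H1_def by (rule mm)
  have H2m: "case_prod H2 \<in> borel_measurable borel"
  proof -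
    have "(\<lambda>z. (snd z, fst z)) \<in> borel_measurable (borel :: (spacetime \<times> spacetime) measure)"
      by (auto intro!: borel_measurable_continuous_onI continuous_intros)
    from measurable_compose[OF this mm[of b1]] show ?thesis by (simp add: H2_def case_prod_beta')
  qed
  have H1b: "l2_bounded H1" unfolding H1_def[abs_def] using b12 q by (intro l2_bounded_low_min) auto
  have "l2_bounded (\<lambda>X Y. min_freq (snd X) (snd Y) powr (-q) * modulation b1 Y)" using b12 q by (intro l2_bounded_low_min) auto
  from l2_bounded_swap[OF this mm] have H2b: "l2_bounded H2" unfolding H2_def[abs_def] .
  have Sm: "(\<lambda>(X, Y). \<Sum>e\<in>?E. G e X Y) \<in> borel_measurable borel"
  proof -
    have "(\<lambda>Z. \<Sum>e\<in>?E. case_prod (G e) Z) \<in> borel_measurable borel" by (intro borel_measurable_sum Gm)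
    then show ?thesis by (simp only: case_prod_beta')
  qed
  have Sb: "l2_bounded (\<lambda>X Y. \<Sum>e\<in>?E. G e X Y)" by (rule l2_bounded_sum[OF _ Gb G0 Gm]) auto
  have S0: "0 \<le> (\<Sum>e\<in>?E. G e X Y)" for X Y by (intro sum_nonneg G0)
  have SHm: "(\<lambda>(X, Y). (\<Sum>e\<in>?E. G e X Y) + H1 X Y) \<in> borel_measurable borel"
    using borel_measurable_add[OF Sm H1m] by (simp only: case_prod_beta')
  have total: "l2_bounded (\<lambda>X Y. ((\<Sum>e\<in>?E. G e X Y) + H1 X Y) + H2 X Y)"
    by (rule l2_bounded_add[OF l2_bounded_add[OF Sb H1b S0 H0(1) Sm H1m] H2b _ H0(2) SHm H2m]) (intro add_nonneg_nonneg S0 H0)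
  have totalm: "(\<lambda>(X, Y). ((\<Sum>e\<in>?E. G e X Y) + H1 X Y) + H2 X Y) \<in> borel_measurable borel"
    using borel_measurable_add[OF SHm H2m] by (simp only: case_prod_beta')
  show ?thesis
  proof (rule l2_bounded_mono[OF total _ _ _ totalm, of "6 powr \<beta> * (3 * c)"])
    fix X Y :: spacetime
    show "0 \<le> ((\<Sum>e\<in>?E. G e X Y) + H1 X Y) + H2 X Y" by (intro add_nonneg_nonneg S0 H0)
    obtain t x r y where X: "X = (t, x)" and Y: "Y = (r, y)" by (cases X, cases Y)
    \<comment> \<open>The signs of the time frequencies select the sheets, so that each modulation
      is exactly the distance to the selected sheet.\<close>
    define e where "e = ((if 0 \<le> t then 1 else -1 :: real), (if 0 \<le> r then 1 else -1 :: real))"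
    have e: "e \<in> ?E" by (auto simp: e_def)
    have et: "\<bar>t\<bar> = fst e * t" "\<bar>r\<bar> = snd e * r" by (auto simp: e_def)
    define M1 M2 B m where "M1 = jbr (\<bar>t\<bar> - norm x)" and "M2 = jbr (\<bar>r\<bar> - norm y)"
      and "B = cone_gap (fst e) (snd e) x y" and "m = min_freq x y"
    define W where "W = sobolev_weight s0 s1 s2 x y"
    have M: "1 \<le> M1" "1 \<le> M2" "1 \<le> m" "0 \<le> B" by (auto simp: M1_def M2_def m_def B_def jbr_ge_1 min_freq_def jn_ge_1 cone_gap_def)
    have W0: "0 \<le> W" by (simp add: W_def sobolev_weight_nonneg)
    have Wm: "W \<le> c * m powr (-S)"
      unfolding W_def c_def m_def S_def using s \<beta> by (intro sobolev_weight_le_min_freq) auto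
    have jmd: "M1 powr (-b) = cone_factor b (fst e) X" "M2 powr (-b) = cone_factor b (snd e) Y"
      by (auto simp: M1_def M2_def cone_factor_def X Y e_def jbr_def power2_eq_square algebra_simps)
    have Gval: "G e X Y = (B powr \<beta> + m powr (\<beta> - \<epsilon>)) * W * (M1 powr (-b) * M2 powr (-b))"
      by (simp add: G_def main_weight_def jmd X Y B_def m_def W_def)
    have H1val: "H1 X Y = m powr (-q) * M2 powr (-b2)" by (simp add: H1_def modulation_def X Y m_def M2_def)
    have H2val: "H2 X Y = m powr (-q) * M1 powr (-b1)"
      by (simp add: H2_def modulation_def X Y m_def M1_def min_freq_def add.commute min.commute)
    \<comment> \<open>The output modulation is at most the gap plus both input modulations. The
      factor 6 is 2 * 3: the additive 1 of the bracket is absorbed by M1 \<ge> 1, and the power is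
      spread over three terms.\<close>
    have D: "jbr (\<bar>t + r\<bar> - norm (x + y)) powr \<beta> \<le> 6 powr \<beta> * (B powr \<beta> + M1 powr \<beta> + M2 powr \<beta>)"
    proof -
      have "\<bar>\<bar>t + r\<bar> - \<bar>fst e * norm x + snd e * norm y\<bar>\<bar> \<le> \<bar>\<bar>t\<bar> - norm x\<bar> + \<bar>\<bar>r\<bar> - norm y\<bar>"
      proof -
        have "\<bar>t - fst e * norm x\<bar> = \<bar>\<bar>t\<bar> - norm x\<bar>" "\<bar>r - snd e * norm y\<bar> = \<bar>\<bar>r\<bar> - norm y\<bar>"
          by (auto simp: e_def abs_real_def)
        then show ?thesis
          using abs_triangle_ineq3[of "t + r" "fst e * norm x + snd e * norm y"] by linarith
      qed
      then have "\<bar>\<bar>t + r\<bar> - norm (x + y)\<bar> \<le> B + M1 + M2"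
      proof -
        assume "\<bar>\<bar>t + r\<bar> - \<bar>fst e * norm x + snd e * norm y\<bar>\<bar> \<le> \<bar>\<bar>t\<bar> - norm x\<bar> + \<bar>\<bar>r\<bar> - norm y\<bar>"
        also have "\<dots> \<le> M1 + M2" unfolding M1_def M2_def by (intro add_mono jbr_ge_abs)
        finally have "\<bar>p - d\<bar> \<le> \<bar>z - d\<bar> + M1 + M2"
          if "\<bar>t + r\<bar> = p" "\<bar>fst e * norm x + snd e * norm y\<bar> = z" for p z d :: real
          unfolding that by (auto simp: abs_real_def split: if_splits)
        then show ?thesis unfolding B_def cone_gap_def by blast
      qed
      then have "jbr (\<bar>t + r\<bar> - norm (x + y)) \<le> 1 + (B + M1 + M2)"
        using jbr_le[of "\<bar>t + r\<bar> - norm (x + y)"] by linarith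
      also have "\<dots> \<le> 2 * (B + M1 + M2)" using M by simp
      finally have "jbr (\<bar>t + r\<bar> - norm (x + y)) powr \<beta> \<le> (2 * (B + M1 + M2)) powr \<beta>"
        using \<beta> jbr_nonneg by (intro powr_mono2) auto
      also have "\<dots> = 2 powr \<beta> * (B + M1 + M2) powr \<beta>" by (rule powr_mult)
      also have "\<dots> \<le> 2 powr \<beta> * (3 powr \<beta> * (B powr \<beta> + M1 powr \<beta> + M2 powr \<beta>))"
        using M \<beta> by (intro mult_left_mono powr_sum3_le) auto
      also have "\<dots> = 6 powr \<beta> * (B powr \<beta> + M1 powr \<beta> + M2 powr \<beta>)"
        using powr_mult[of 2 3 \<beta>] by simp
      finally show ?thesis .
    qed
    define N where "N = M1 powr (-b1) * M2 powr (-b2)"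
    have N0: "0 \<le> N" by (simp add: N_def)
    have tB: "B powr \<beta> * W * N \<le> G e X Y"
    proof -
      have "N \<le> M1 powr (-b) * M2 powr (-b)"
        unfolding N_def using M \<epsilon> by (intro mult_mono powr_mono) auto
      then have "B powr \<beta> * W * N \<le> (B powr \<beta> + m powr (\<beta> - \<epsilon>)) * W * (M1 powr (-b) * M2 powr (-b))"
        using W0 N0 by (intro mult_mono mult_right_mono) auto
      then show ?thesis by (simp add: Gval)
    qed
    \<comment> \<open>The total exponent \<beta> - b' - S is at most -1 - b', hence at most -q: the
      bound on S together with b' > 1/2 yields more than the decay 3/2 needed in space.\<close>
    have low: "m powr (\<beta> - b') * W \<le> c * m powr (-q)" if "b + \<epsilon> \<le> b'" for b'
    proof -
      have "m powr (\<beta> - b') * W \<le> m powr (\<beta> - b') * (c * m powr (-S))" using Wm by (rule mult_left_mono) simp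
      also have "\<dots> = c * m powr (\<beta> - b' + (-S))" by (simp only: powr_add mult_ac)
      also have "\<dots> \<le> c * m powr (-q)"
        using c M that s(4) \<epsilon> by (intro mult_left_mono powr_mono) (auto simp: S_def q_def b_def)
      finally show ?thesis .
    qed
    have small: "m powr (\<beta> - \<epsilon>) * (M1 powr (-b) * M2 powr (-b)) * W \<le> G e X Y"
    proof -
      have "(m powr (\<beta> - \<epsilon>)) * (W * (M1 powr (-b) * M2 powr (-b))) \<le> (B powr \<beta> + m powr (\<beta> - \<epsilon>)) * (W * (M1 powr (-b) * M2 powr (-b)))"
        using W0 by (intro mult_right_mono) auto
      then show ?thesis by (simp add: Gval mult_ac)
    qed
    have t1: "M1 powr \<beta> * W * N \<le> G e X Y + c * H1 X Y"
    proof -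
      have "M1 powr \<beta> * N \<le> m powr (\<beta> - \<epsilon>) * (M1 powr (-b) * M2 powr (-b)) + m powr (\<beta> - b1) * M2 powr (-b2)"
        unfolding N_def using M \<epsilon> \<beta> by (intro modulation_trade) auto
      then have "M1 powr \<beta> * N * W \<le> (m powr (\<beta> - \<epsilon>) * (M1 powr (-b) * M2 powr (-b)) + m powr (\<beta> - b1) * M2 powr (-b2)) * W"
        using W0 by (rule mult_right_mono)
      also have "\<dots> = m powr (\<beta> - \<epsilon>) * (M1 powr (-b) * M2 powr (-b)) * W + (m powr (\<beta> - b1) * W) * M2 powr (-b2)"
        by (simp only: distrib_left distrib_right mult_ac)
      also have "\<dots> \<le> G e X Y + (c * m powr (-q)) * M2 powr (-b2)"
        using small low[OF \<epsilon>(3)] by (intro add_mono mult_right_mono) auto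
      finally show ?thesis by (simp add: H1val mult_ac)
    qed
    have t2: "M2 powr \<beta> * W * N \<le> G e X Y + c * H2 X Y"
    proof -
      have "M2 powr \<beta> * (M2 powr (-b2) * M1 powr (-b1)) \<le> m powr (\<beta> - \<epsilon>) * (M2 powr (-b) * M1 powr (-b)) + m powr (\<beta> - b2) * M1 powr (-b1)"
        using M \<epsilon> \<beta> by (intro modulation_trade) auto
      then have "M2 powr \<beta> * (M2 powr (-b2) * M1 powr (-b1)) * W \<le> (m powr (\<beta> - \<epsilon>) * (M2 powr (-b) * M1 powr (-b)) + m powr (\<beta> - b2) * M1 powr (-b1)) * W"
        using W0 by (rule mult_right_mono)
      also have "\<dots> = m powr (\<beta> - \<epsilon>) * (M1 powr (-b) * M2 powr (-b)) * W + (m powr (\<beta> - b2) * W) * M1 powr (-b1)"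
        by (simp only: distrib_left distrib_right mult_ac)
      also have "\<dots> \<le> G e X Y + (c * m powr (-q)) * M1 powr (-b1)"
        using small low[OF \<epsilon>(4)] by (intro add_mono mult_right_mono) auto
      finally show ?thesis by (simp add: H2val N_def mult_ac)
    qed
    have "full_kernel s0 s1 s2 \<beta> b1 b2 X Y = jbr (\<bar>t + r\<bar> - norm (x + y)) powr \<beta> * (W * N)"
      by (simp add: full_kernel_def modulation_def X Y W_def N_def M1_def M2_def mult.assoc)
    also have "\<dots> \<le> 6 powr \<beta> * (B powr \<beta> + M1 powr \<beta> + M2 powr \<beta>) * (W * N)"
      using D W0 N0 by (intro mult_right_mono) auto
    also have "\<dots> = 6 powr \<beta> * (B powr \<beta> * W * N + M1 powr \<beta> * W * N + M2 powr \<beta> * W * N)"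
      by (simp add: algebra_simps)
    \<comment> \<open>The term of the selected signs is used three times, for the gap and for each
      input modulation; this is the factor 3.\<close>
    also have "\<dots> \<le> 6 powr \<beta> * (3 * c * (((\<Sum>e\<in>?E. G e X Y) + H1 X Y) + H2 X Y))"
    proof (rule mult_left_mono)
      have "G e X Y \<le> (\<Sum>e\<in>?E. G e X Y)" using e G0 by (intro member_le_sum) auto
      moreover have "(\<Sum>e\<in>?E. G e X Y) \<le> c * (\<Sum>e\<in>?E. G e X Y)" using mult_right_mono[OF c S0[of X Y]] by simp
      moreover have "0 \<le> c * H1 X Y" "0 \<le> c * H2 X Y" using c H0 by auto
      ultimately show "B powr \<beta> * W * N + M1 powr \<beta> * W * N + M2 powr \<beta> * W * N \<le> 3 * c * (((\<Sum>e\<in>?E. G e X Y) + H1 X Y) + H2 X Y)"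
        using tB t1 t2 by (simp only: distrib_left mult.assoc)
    qed simp
    finally show "full_kernel s0 s1 s2 \<beta> b1 b2 X Y \<le> 6 powr \<beta> * (3 * c) * (((\<Sum>e\<in>?E. G e X Y) + H1 X Y) + H2 X Y)"
      by (simp only: mult.assoc)
  qed (use c in simp)
qed

section \<open>Return to the Sobolev norms\<close>

text \<open>Applied to the weighted transforms of u and v, the kernel cancels both input weights and
  leaves the output weight times the convolution of the absolute values, which dominates the
  transform of the product by \<open>norm_ft_mult_le\<close>.\<close>

lemma is_product3_if_l2_bounded:
  assumes K: "l2_bounded (full_kernel s0 s1 s2 \<beta> b1 b2)"
  shows "is_product3 s0 s1 s2 (-\<beta>) b1 b2"
proof -
  obtain C where C: "0 \<le> C" "\<And>f g. f \<in> borel_measurable borel \<Longrightarrow> g \<in> borel_measurable borel \<Longrightarrow>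
     (\<integral>\<^sup>+X. (bilin (full_kernel s0 s1 s2 \<beta> b1 b2) f g X)\<^sup>2 \<partial>lborel) \<le> ennreal C * ((\<integral>\<^sup>+X. (f X)\<^sup>2 \<partial>lborel) * (\<integral>\<^sup>+X. (g X)\<^sup>2 \<partial>lborel))"
    using K unfolding l2_bounded_def by blast
  have "hsb_norm_sq (-s0) \<beta> (\<lambda>z. u z * v z) \<le> ennreal C * hsb_norm_sq s1 b1 u * hsb_norm_sq s2 b2 v"
    if u: "schwartz u" and v: "schwartz v" for u v
  proof -
    obtain M where M: "\<And>z. norm (u z) \<le> M" using schwartz_imp(2)[OF u] by blast
    note iu = schwartz_imp(3)[OF u] and iv = schwartz_imp(3)[OF v]
    note [measurable] = ft_measurable[OF iu] ft_measurable[OF iv]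
    define f where "f s b w X = ennreal (jbr (norm (snd X)) powr s * jbr (\<bar>fst X\<bar> - norm (snd X)) powr b * cmod (ft w X))" for s b w and X :: spacetime
    have fm: "f s b w \<in> borel_measurable borel" if [measurable]: "ft w \<in> borel_measurable borel" for s b w
    proof -
      have "(\<lambda>X::spacetime. jbr (norm (snd X)) powr s * jbr (\<bar>fst X\<bar> - norm (snd X)) powr b) \<in> borel_measurable borel"
        by (simp add: borel_prod[symmetric])
      then show ?thesis unfolding f_def[abs_def] by measurable
    qed
    have hsb: "hsb_norm_sq s b w = (\<integral>\<^sup>+X. (f s b w X)\<^sup>2 \<partial>lborel)" for s b w
      unfolding hsb_norm_sq_def f_def fourier_st_eq_ft by (intro nn_integral_cong) (simp add: ennreal_power)
    have pt: "f (-s0) \<beta> (\<lambda>z. u z * v z) X \<le> bilin (full_kernel s0 s1 s2 \<beta> b1 b2) (f s1 b1 u) (f s2 b2 v) X" for X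
    proof -
      let ?w = "jbr (norm (snd X)) powr (-s0) * jbr (\<bar>fst X\<bar> - norm (snd X)) powr \<beta>"
      have "f (-s0) \<beta> (\<lambda>z. u z * v z) X = ennreal ?w * ennreal (norm (ft (\<lambda>z. u z * v z) X))"
        unfolding f_def by (rule ennreal_mult) auto
      also have "\<dots> \<le> ennreal ?w * (\<integral>\<^sup>+Y. ennreal (norm (ft u Y)) * ennreal (norm (ft v (X - Y))) \<partial>lborel)"
        by (intro mult_left_mono norm_ft_mult_le[OF schwartz_imp(1)[OF u] M iu iv]) simp
      also have "\<dots> = (\<integral>\<^sup>+Y. ennreal ?w * (ennreal (norm (ft u Y)) * ennreal (norm (ft v (X - Y)))) \<partial>lborel)"
        by (rule nn_integral_cmult[symmetric]) measurable
      also have "\<dots> = bilin (full_kernel s0 s1 s2 \<beta> b1 b2) (f s1 b1 u) (f s2 b2 v) X"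
        unfolding bilin_def
      proof (rule nn_integral_cong)
        fix Y
        have can: "p powr a * p powr (-a) = 1" if "1 \<le> p" for p a :: real using that by (simp add: powr_add[symmetric])
        define j1 j2 d1 d2 where "j1 = jbr (norm (snd Y))" and "j2 = jbr (norm (snd (X - Y)))"
          and "d1 = jbr (\<bar>fst Y\<bar> - norm (snd Y))" and "d2 = jbr (\<bar>fst (X - Y)\<bar> - norm (snd (X - Y)))"
        have j: "1 \<le> j1" "1 \<le> j2" "1 \<le> d1" "1 \<le> d2" by (simp_all add: j1_def j2_def d1_def d2_def jbr_ge_1)
        have K: "full_kernel s0 s1 s2 \<beta> b1 b2 Y (X - Y) = ?w * (j1 powr (-s1) * j2 powr (-s2) * (d1 powr (-b1) * d2 powr (-b2)))"
          by (simp add: full_kernel_def sobolev_weight_def modulation_def jn_def j1_def j2_def d1_def d2_def mult_ac)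
        have "(j1 powr s1 * d1 powr b1 * cmod (ft u Y)) * (j2 powr s2 * d2 powr b2 * cmod (ft v (X - Y))) * full_kernel s0 s1 s2 \<beta> b1 b2 Y (X - Y)
          = ?w * (cmod (ft u Y) * cmod (ft v (X - Y))) * ((j1 powr s1 * j1 powr (-s1)) * (j2 powr s2 * j2 powr (-s2)) * (d1 powr b1 * d1 powr (-b1)) * (d2 powr b2 * d2 powr (-b2)))"
          unfolding K by (simp only: mult_ac)
        also have "\<dots> = ?w * (cmod (ft u Y) * cmod (ft v (X - Y)))" by (simp only: can[OF j(1)] can[OF j(2)] can[OF j(3)] can[OF j(4)] mult_1_right)
        finally have eq: "(j1 powr s1 * d1 powr b1 * cmod (ft u Y)) * (j2 powr s2 * d2 powr b2 * cmod (ft v (X - Y))) * full_kernel s0 s1 s2 \<beta> b1 b2 Y (X - Y)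
          = ?w * (cmod (ft u Y) * cmod (ft v (X - Y)))" .
        have "0 \<le> full_kernel s0 s1 s2 \<beta> b1 b2 Y (X - Y)" unfolding K by simp
        then have "f s1 b1 u Y * f s2 b2 v (X - Y) * ennreal (full_kernel s0 s1 s2 \<beta> b1 b2 Y (X - Y))
          = ennreal ((j1 powr s1 * d1 powr b1 * cmod (ft u Y)) * (j2 powr s2 * d2 powr b2 * cmod (ft v (X - Y))) * full_kernel s0 s1 s2 \<beta> b1 b2 Y (X - Y))"
          by (simp add: f_def j1_def j2_def d1_def d2_def ennreal_mult)
        also have "\<dots> = ennreal ?w * (ennreal (norm (ft u Y)) * ennreal (norm (ft v (X - Y))))"
          unfolding eq by (simp add: ennreal_mult)
        finally show "ennreal ?w * (ennreal (norm (ft u Y)) * ennreal (norm (ft v (X - Y))))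
          = f s1 b1 u Y * f s2 b2 v (X - Y) * ennreal (full_kernel s0 s1 s2 \<beta> b1 b2 Y (X - Y))" by simp
      qed
      finally show ?thesis .
    qed
    have "hsb_norm_sq (-s0) \<beta> (\<lambda>z. u z * v z) \<le> (\<integral>\<^sup>+X. (bilin (full_kernel s0 s1 s2 \<beta> b1 b2) (f s1 b1 u) (f s2 b2 v) X)\<^sup>2 \<partial>lborel)"
      unfolding hsb by (intro nn_integral_mono power_mono pt) simp
    also have "\<dots> \<le> ennreal C * (hsb_norm_sq s1 b1 u * hsb_norm_sq s2 b2 v)"
      unfolding hsb by (intro C fm) measurable
    finally show ?thesis by (simp add: mult.assoc)
  qed
  then show ?thesis unfolding is_product3_def by auto
qed

theorem theoremP:
  fixes s0 s1 s2 b0 b1 b2 :: real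
  defines "S \<equiv> s0 + s1 + s2"
  assumes hb0: "b0 < 0"
    and hb1: "b1 > 1/2" and hb2: "b2 > 1/2"
    and b: "b0 + b1 + b2 \<ge> 1/2"
    and c: "b0 + b1 \<ge> 0"
    and d: "b0 + b2 \<ge> 0"
    and e: "S \<ge> 2 - (b0 + b1 + b2)"
    and f: "S \<ge> 3/2 - (b0 + b1)"
    and g: "S \<ge> 3/2 - (b0 + b2)"
    and h: "S \<ge> 1 - b0"
    and i: "s0 + 2 * (s1 + s2) + b0 \<ge> 3/2"
    and j: "s1 + s2 \<ge> - b0"
    and k: "s0 + s2 \<ge> 0"
    and l: "s0 + s1 \<ge> 0"
    and ex1: "b1 = 1/2 \<Longrightarrow> S > 2 - (b0 + b1 + b2) \<and> S > 3/2 - (b0 + b1)"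
    and ex2: "b2 = 1/2 \<Longrightarrow> S > 2 - (b0 + b1 + b2) \<and> S > 3/2 - (b0 + b2)"
    and ex3: "b1 + b2 = 1 \<Longrightarrow> S > 2 - (b0 + b1 + b2)"
    and ex4: "b0 + b1 + b2 = 1/2 \<Longrightarrow> b0 + b1 > 0 \<and> b0 + b2 > 0"
    and ex5: "S = 1 - b0 \<Longrightarrow> s1 + s2 > - b0"
  shows "is_product3 s0 s1 s2 b0 b1 b2"
proof -
  have "l2_bounded (full_kernel s0 s1 s2 (- b0) b1 b2)"
  proof (rule l2_bounded_full_kernel)
    \<comment> \<open>Equality in (j) excludes equality in (h), by the last exception. This is the
      case \<nu> = 0 of \<open>disc_weight\<close>, where strictness prevents a logarithm.\<close>
    show "1 + - b0 < s0 + s1 + s2" if "s1 + s2 = - b0"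
      using that h ex5 unfolding S_def by linarith
  qed (use hb0 hb1 hb2 c d h i j k l in \<open>auto simp: S_def\<close>)
  from is_product3_if_l2_bounded[OF this] show ?thesis by simp
qed

end
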